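(* Let $K$ be an algebraically closed field and let $\Lambda = KQ/I$ be an indecomposable basic finite-dimensional symmetric $K$-algebra, where $Q$ is the Gabriel quiver of $\Lambda$ and $I$ is an admissible ideal of $KQ$. Assume that every indecomposable non-projective $\Lambda$-module $M$ has $\Omega$-period dividing $4$, that is, $\Omega^4(M)\cong M$. Then the following are equivalent: (a) There is a simple $\Lambda$-module $S$ such that $\Omega^2(S)$ is simple. (b) There is a vertex $i$ of $Q$ with $|P_i| = |P_i^{+}| = |P_i^{-}|$. (c) The quiver $Q$ either consists of one vertex with exactly one loop, or it consists of exactly two vertices $1,2$ and exactly two arrows $\alpha\colon 1\to 2$ and $\beta\colon 2\to 1$. (d) The quiver $Q$ has an arrow $\alpha\colon i\to j$ such that $i^+ = \{\alpha\} = j^-$. Moreover, if these equivalent conditions hold, then $\Lambda$ has finite representation type.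
   Context: Modules are finite-dimensional right modules. The syzygy $\Omega(M)$ of a module $M$ is the kernel of a minimal projective cover of $M$. A module $M$ is periodic if $\Omega^n(M)\cong M$ for some $n\ge 1$, and then the minimal such $n$ is its ($\Omega$-)period. For a vertex $i$ of $Q$, $i^+$ denotes the set of arrows starting at $i$ and $i^-$ denotes the set of arrows ending at $i$. The indecomposable projective module corresponding to vertex $i$ is $P_i$. Put $P_i^+ = \bigoplus_{\alpha\colon i\to j} P_j$ (sum over all arrows $\alpha\in i^+$, with $j$ the end vertex of $\alpha$) and $P_i^- = \bigoplus_{\gamma\colon k\to i} P_k$ (sum over all arrows $\gamma\in i^-$, with $k$ the start vertex of $\gamma$). For a module $M$, $|M|$ denotes its $K$-dimension. Paths are composed from left to right. An algebra has finite (representation) type if it has only finitely many indecomposable modules up to isomorphism. *)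

theory Defs
  imports
    "Graph_Theory.Arc_Walk"
    "Jordan_Normal_Form.VS_Connect"
    "HOL-Algebra.Ideal_Product"
    "HOL-Algebra.QuotRing"
begin

section \<open>Right modules over a K-algebra\<close>

text \<open>
  A \<open>K\<close>-algebra is given by a record of type \<^typ>\<open>('k, 'a) module\<close>: its ring part is the (not
  necessarily commutative) multiplication of the algebra, and \<^const>\<open>smult\<close> is the action of the
  field, which is a type of class \<^class>\<open>field\<close>.  In a module record, the unused ring operations
  \<^const>\<open>mult\<close> and \<^const>\<open>one\<close> carry no meaning.
\<close>

record ('k, 'm, 'a) right_module = "('k, 'm) module" +
  act :: "'m \<Rightarrow> 'a \<Rightarrow> 'm" (infixl \<open>\<lhd>\<index>\<close> 70)

locale right_module = vectorspace "class_ring :: 'k ring" M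
  for \<Lambda> :: "('k::field, 'a) module" and M :: "('k, 'm, 'a) right_module" +
  assumes act_closed: "\<lbrakk>x \<in> carrier M; a \<in> carrier \<Lambda>\<rbrakk> \<Longrightarrow> x \<lhd>\<^bsub>M\<^esub> a \<in> carrier M"
    and act_add_left: "\<lbrakk>x \<in> carrier M; y \<in> carrier M; a \<in> carrier \<Lambda>\<rbrakk>
          \<Longrightarrow> (x \<oplus>\<^bsub>M\<^esub> y) \<lhd>\<^bsub>M\<^esub> a = x \<lhd>\<^bsub>M\<^esub> a \<oplus>\<^bsub>M\<^esub> y \<lhd>\<^bsub>M\<^esub> a"
    and act_add_right: "\<lbrakk>x \<in> carrier M; a \<in> carrier \<Lambda>; b \<in> carrier \<Lambda>\<rbrakk>
          \<Longrightarrow> x \<lhd>\<^bsub>M\<^esub> (a \<oplus>\<^bsub>\<Lambda>\<^esub> b) = x \<lhd>\<^bsub>M\<^esub> a \<oplus>\<^bsub>M\<^esub> x \<lhd>\<^bsub>M\<^esub> b"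
    and act_smult_left: "\<lbrakk>x \<in> carrier M; a \<in> carrier \<Lambda>\<rbrakk>
          \<Longrightarrow> (c \<odot>\<^bsub>M\<^esub> x) \<lhd>\<^bsub>M\<^esub> a = c \<odot>\<^bsub>M\<^esub> (x \<lhd>\<^bsub>M\<^esub> a)"
    and act_smult_right: "\<lbrakk>x \<in> carrier M; a \<in> carrier \<Lambda>\<rbrakk>
          \<Longrightarrow> x \<lhd>\<^bsub>M\<^esub> (c \<odot>\<^bsub>\<Lambda>\<^esub> a) = c \<odot>\<^bsub>M\<^esub> (x \<lhd>\<^bsub>M\<^esub> a)"
    and act_assoc: "\<lbrakk>x \<in> carrier M; a \<in> carrier \<Lambda>; b \<in> carrier \<Lambda>\<rbrakk>
          \<Longrightarrow> (x \<lhd>\<^bsub>M\<^esub> a) \<lhd>\<^bsub>M\<^esub> b = x \<lhd>\<^bsub>M\<^esub> (a \<otimes>\<^bsub>\<Lambda>\<^esub> b)"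
    and act_one: "x \<in> carrier M \<Longrightarrow> x \<lhd>\<^bsub>M\<^esub> \<one>\<^bsub>\<Lambda>\<^esub> = x"

locale fd_right_module = right_module +
  assumes finite_dimensional: "fin_dim"

text \<open>
  Statements quantifying over all finite-dimensional modules need a fixed carrier type.  Every
  finite-dimensional \<open>K\<close>-space is isomorphic to a subspace of \<^typ>\<open>nat \<Rightarrow> 'k\<close>, so by transport of
  structure every finite-dimensional module is isomorphic to one of the following type.
\<close>

type_synonym ('k, 'a) fdmod = "('k, nat \<Rightarrow> 'k, 'a) right_module"

abbreviation mdim :: "('k::field, 'm, 'z) module_scheme \<Rightarrow> nat" where
  "mdim M \<equiv> vectorspace.dim (class_ring :: 'k ring) M"

definition rsubmodule ::
  "('k::field, 'a) module \<Rightarrow> 'm set \<Rightarrow> ('k, 'm, 'a) right_module \<Rightarrow> bool" where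
  "rsubmodule \<Lambda> N M \<longleftrightarrow>
     subspace class_ring N M \<and> (\<forall>x\<in>N. \<forall>a\<in>carrier \<Lambda>. x \<lhd>\<^bsub>M\<^esub> a \<in> N)"

definition rmodule_hom ::
  "('k::field, 'a) module \<Rightarrow> ('k, 'm, 'a) right_module \<Rightarrow> ('k, 'n, 'a) right_module
     \<Rightarrow> ('m \<Rightarrow> 'n) set" where
  "rmodule_hom \<Lambda> M N = {f \<in> module_hom class_ring M N.
     \<forall>x\<in>carrier M. \<forall>a\<in>carrier \<Lambda>. f (x \<lhd>\<^bsub>M\<^esub> a) = f x \<lhd>\<^bsub>N\<^esub> a}"

definition rmodule_iso ::
  "('k::field, 'a) module \<Rightarrow> ('k, 'm, 'a) right_module \<Rightarrow> ('k, 'n, 'a) right_module \<Rightarrow> bool" where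
  "rmodule_iso \<Lambda> M N \<longleftrightarrow> (\<exists>f\<in>rmodule_hom \<Lambda> M N. bij_betw f (carrier M) (carrier N))"

definition simple_module ::
  "('k::field, 'a) module \<Rightarrow> ('k, 'm, 'a) right_module \<Rightarrow> bool" where
  "simple_module \<Lambda> M \<longleftrightarrow> fd_right_module \<Lambda> M \<and> carrier M \<noteq> {\<zero>\<^bsub>M\<^esub>} \<and>
     (\<forall>N. rsubmodule \<Lambda> N M \<longrightarrow> N = {\<zero>\<^bsub>M\<^esub>} \<or> N = carrier M)"

definition indecomposable_module ::
  "('k::field, 'a) module \<Rightarrow> ('k, 'm, 'a) right_module \<Rightarrow> bool" where
  "indecomposable_module \<Lambda> M \<longleftrightarrow> fd_right_module \<Lambda> M \<and> carrier M \<noteq> {\<zero>\<^bsub>M\<^esub>} \<and>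
     (\<forall>N L. rsubmodule \<Lambda> N M \<and> rsubmodule \<Lambda> L M \<and>
        N <+>\<^bsub>M\<^esub> L = carrier M \<and> N \<inter> L = {\<zero>\<^bsub>M\<^esub>} \<longrightarrow> N = {\<zero>\<^bsub>M\<^esub>} \<or> L = {\<zero>\<^bsub>M\<^esub>})"

definition projective_module ::
  "('k::field, 'a) module \<Rightarrow> ('k, 'm, 'a) right_module \<Rightarrow> bool" where
  "projective_module \<Lambda> P \<longleftrightarrow> fd_right_module \<Lambda> P \<and>
     (\<forall>(N :: ('k, 'a) fdmod) (L :: ('k, 'a) fdmod) g f.
        fd_right_module \<Lambda> N \<and> fd_right_module \<Lambda> L \<and>
        g \<in> rmodule_hom \<Lambda> N L \<and> g ` carrier N = carrier L \<and> f \<in> rmodule_hom \<Lambda> P L \<longrightarrow>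
        (\<exists>h\<in>rmodule_hom \<Lambda> P N. \<forall>x\<in>carrier P. g (h x) = f x))"

definition hom_kernel ::
  "('k::field, 'm, 'a) right_module \<Rightarrow> ('k, 'n, 'a) right_module \<Rightarrow> ('m \<Rightarrow> 'n) \<Rightarrow> 'm set" where
  "hom_kernel M N f = {x \<in> carrier M. f x = \<zero>\<^bsub>N\<^esub>}"

text \<open>The last condition says that the kernel is superfluous, i.e. that the cover is minimal.\<close>

definition projective_cover ::
  "('k::field, 'a) module \<Rightarrow> ('k, 'm, 'a) right_module \<Rightarrow> ('m \<Rightarrow> 'n)
     \<Rightarrow> ('k, 'n, 'a) right_module \<Rightarrow> bool" where
  "projective_cover \<Lambda> P f M \<longleftrightarrow> projective_module \<Lambda> P \<and>
     f \<in> rmodule_hom \<Lambda> P M \<and> f ` carrier P = carrier M \<and>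
     (\<forall>N. rsubmodule \<Lambda> N P \<and> N <+>\<^bsub>P\<^esub> hom_kernel P M f = carrier P \<longrightarrow> N = carrier P)"

text \<open>
  The syzygy is only determined up to isomorphism; the Hilbert choice fixes some projective cover
  of each module and takes its kernel.
\<close>

definition syzygy :: "('k::field, 'a) module \<Rightarrow> ('k, 'a) fdmod \<Rightarrow> ('k, 'a) fdmod" where
  "syzygy \<Lambda> M = (SOME \<Omega>. \<exists>P f. projective_cover \<Lambda> P f M \<and>
     \<Omega> = P\<lparr>carrier := hom_kernel P M f\<rparr>)"

definition direct_sum_module ::
  "'i set \<Rightarrow> ('i \<Rightarrow> ('k::field, 'm, 'a) right_module) \<Rightarrow> ('k, 'i \<Rightarrow> 'm, 'a) right_module" where
  "direct_sum_module J M = \<lparr>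
     carrier = (\<Pi>\<^sub>E j\<in>J. carrier (M j)),
     mult = undefined, one = undefined,
     zero = (\<lambda>j\<in>J. \<zero>\<^bsub>M j\<^esub>),
     add = (\<lambda>x y. \<lambda>j\<in>J. x j \<oplus>\<^bsub>M j\<^esub> y j),
     smult = (\<lambda>c x. \<lambda>j\<in>J. c \<odot>\<^bsub>M j\<^esub> x j),
     act = (\<lambda>x a. \<lambda>j\<in>J. x j \<lhd>\<^bsub>M j\<^esub> a)\<rparr>"

definition regular_module :: "('k::field, 'a) module \<Rightarrow> ('k, 'a, 'a) right_module" where
  "regular_module \<Lambda> = \<lparr>
     carrier = carrier \<Lambda>, mult = mult \<Lambda>, one = one \<Lambda>, zero = zero \<Lambda>, add = add \<Lambda>,
     smult = smult \<Lambda>, act = mult \<Lambda>\<rparr>"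

definition finite_representation_type :: "('k::field, 'a) module \<Rightarrow> bool" where
  "finite_representation_type \<Lambda> \<longleftrightarrow>
     (\<exists>\<M> :: ('k, 'a) fdmod set. finite \<M> \<and> (\<forall>N\<in>\<M>. indecomposable_module \<Lambda> N) \<and>
        (\<forall>M :: ('k, 'a) fdmod. indecomposable_module \<Lambda> M \<longrightarrow> (\<exists>N\<in>\<M>. rmodule_iso \<Lambda> M N)))"


section \<open>Indecomposable and symmetric algebras\<close>

definition indecomposable_algebra :: "('k::field, 'a) module \<Rightarrow> bool" where
  "indecomposable_algebra \<Lambda> \<longleftrightarrow> carrier \<Lambda> \<noteq> {\<zero>\<^bsub>\<Lambda>\<^esub>} \<and>
     (\<forall>A B. ideal A \<Lambda> \<and> ideal B \<Lambda> \<and> A <+>\<^bsub>\<Lambda>\<^esub> B = carrier \<Lambda> \<and> A \<inter> B = {\<zero>\<^bsub>\<Lambda>\<^esub>} \<longrightarrow>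
        A = {\<zero>\<^bsub>\<Lambda>\<^esub>} \<or> B = {\<zero>\<^bsub>\<Lambda>\<^esub>})"

text \<open>
  A symmetric algebra carries an associative, symmetric, non-degenerate bilinear form.  By symmetry,
  linearity and non-degeneracy in one argument give both.
\<close>

definition symmetric_algebra :: "('k::field, 'a) module \<Rightarrow> bool" where
  "symmetric_algebra \<Lambda> \<longleftrightarrow> (\<exists>B :: 'a \<Rightarrow> 'a \<Rightarrow> 'k.
     (\<forall>x\<in>carrier \<Lambda>. \<forall>y\<in>carrier \<Lambda>. \<forall>z\<in>carrier \<Lambda>. B (x \<oplus>\<^bsub>\<Lambda>\<^esub> y) z = B x z + B y z) \<and>
     (\<forall>c. \<forall>x\<in>carrier \<Lambda>. \<forall>y\<in>carrier \<Lambda>. B (c \<odot>\<^bsub>\<Lambda>\<^esub> x) y = c * B x y) \<and>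
     (\<forall>x\<in>carrier \<Lambda>. \<forall>y\<in>carrier \<Lambda>. \<forall>z\<in>carrier \<Lambda>. B (x \<otimes>\<^bsub>\<Lambda>\<^esub> y) z = B x (y \<otimes>\<^bsub>\<Lambda>\<^esub> z)) \<and>
     (\<forall>x\<in>carrier \<Lambda>. \<forall>y\<in>carrier \<Lambda>. B x y = B y x) \<and>
     (\<forall>x\<in>carrier \<Lambda>. (\<forall>y\<in>carrier \<Lambda>. B x y = 0) \<longrightarrow> x = \<zero>\<^bsub>\<Lambda>\<^esub>))"


section \<open>Path algebras and their admissible quotients\<close>

text \<open>
  A quiver is a directed multigraph \<open>Q\<close> with loops allowed.  A path is encoded as its start vertex
  together with its list of arrows, read from left to right; \<open>(u, [])\<close> is the trivial path at \<open>u\<close>.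
\<close>

type_synonym ('v, 'e) path = "'v \<times> 'e list"

definition paths :: "('v, 'e) pre_digraph \<Rightarrow> ('v, 'e) path set" where
  "paths Q = {(u, p). \<exists>v. pre_digraph.awalk Q u p v}"

definition path_end :: "('v, 'e) pre_digraph \<Rightarrow> 'v \<Rightarrow> 'e list \<Rightarrow> 'v" where
  "path_end Q u p = last (pre_digraph.awalk_verts Q u p)"

definition path_elem :: "('v, 'e) path \<Rightarrow> ('v, 'e) path \<Rightarrow> 'k::field" where
  "path_elem p = (\<lambda>q. if q = p then 1 else 0)"

text \<open>
  Elements of \<open>KQ\<close> are finitely supported coefficient functions on paths.  The coefficient of a
  product at a path is the sum over all ways of cutting this path into two.  The unit is the sum of
  the trivial paths, for which \<open>Q\<close> has to have finitely many vertices.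
\<close>

definition path_algebra :: "('v, 'e) pre_digraph \<Rightarrow> ('k::field, ('v, 'e) path \<Rightarrow> 'k) module" where
  "path_algebra Q = \<lparr>
     carrier = {f. finite {p. f p \<noteq> 0} \<and> {p. f p \<noteq> 0} \<subseteq> paths Q},
     mult = (\<lambda>f g (u, p).
       \<Sum>n\<le>length p. f (u, take n p) * g (path_end Q u (take n p), drop n p)),
     one = (\<lambda>(u, p). if u \<in> verts Q \<and> p = [] then 1 else 0),
     zero = (\<lambda>p. 0),
     add = (\<lambda>f g p. f p + g p),
     smult = (\<lambda>c f p. c * f p)\<rparr>"

definition arrow_ideal :: "('v, 'e) pre_digraph \<Rightarrow> (('v, 'e) path \<Rightarrow> 'k::field) set" where
  "arrow_ideal Q = Idl\<^bsub>path_algebra Q\<^esub> ((\<lambda>\<alpha>. path_elem (tail Q \<alpha>, [\<alpha>])) ` arcs Q)"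

primrec arrow_ideal_power ::
  "('v, 'e) pre_digraph \<Rightarrow> nat \<Rightarrow> (('v, 'e) path \<Rightarrow> 'k::field) set" where
  "arrow_ideal_power Q 0 = carrier (path_algebra Q)"
| "arrow_ideal_power Q (Suc n) =
     ideal_prod (path_algebra Q) (arrow_ideal_power Q n) (arrow_ideal Q)"

definition admissible_ideal ::
  "('v, 'e) pre_digraph \<Rightarrow> (('v, 'e) path \<Rightarrow> 'k::field) set \<Rightarrow> bool" where
  "admissible_ideal Q I \<longleftrightarrow> ideal I (path_algebra Q) \<and>
     I \<subseteq> arrow_ideal_power Q 2 \<and> (\<exists>m\<ge>2. arrow_ideal_power Q m \<subseteq> I)"

definition quotient_algebra :: "('k::field, 'a) module \<Rightarrow> 'a set \<Rightarrow> ('k, 'a set) module" where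
  "quotient_algebra A I = \<lparr>
     carrier = carrier (A Quot I), mult = mult (A Quot I), one = one (A Quot I),
     zero = zero (A Quot I), add = add (A Quot I),
     smult = (\<lambda>c X. \<Union>x\<in>X. I +>\<^bsub>A\<^esub> (c \<odot>\<^bsub>A\<^esub> x))\<rparr>"

text \<open>
  For a finite quiver \<open>Q\<close> and an admissible ideal \<open>I\<close>, the algebra \<open>KQ/I\<close> is automatically
  finite-dimensional and basic, and \<open>Q\<close> is its Gabriel quiver.
\<close>

definition bound_quiver_algebra ::
  "('v, 'e) pre_digraph \<Rightarrow> (('v, 'e) path \<Rightarrow> 'k::field) set
     \<Rightarrow> ('k, (('v, 'e) path \<Rightarrow> 'k) set) module" where
  "bound_quiver_algebra Q I = quotient_algebra (path_algebra Q) I"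

definition vertex_idempotent ::
  "('v, 'e) pre_digraph \<Rightarrow> (('v, 'e) path \<Rightarrow> 'k::field) set \<Rightarrow> 'v
     \<Rightarrow> (('v, 'e) path \<Rightarrow> 'k) set" where
  "vertex_idempotent Q I i = I +>\<^bsub>path_algebra Q\<^esub> path_elem (i, [])"

text \<open>
  \<open>P\<^sub>i = e\<^sub>i \<Lambda>\<close>, spanned by the residue classes of the paths starting at \<open>i\<close>.
\<close>

definition proj_at ::
  "('v, 'e) pre_digraph \<Rightarrow> (('v, 'e) path \<Rightarrow> 'k::field) set \<Rightarrow> 'v
     \<Rightarrow> ('k, (('v, 'e) path \<Rightarrow> 'k) set, (('v, 'e) path \<Rightarrow> 'k) set) right_module" where
  "proj_at Q I i = (regular_module (bound_quiver_algebra Q I))\<lparr>carrier :=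
     (\<lambda>x. vertex_idempotent Q I i \<otimes>\<^bsub>bound_quiver_algebra Q I\<^esub> x) `
       carrier (bound_quiver_algebra Q I)\<rparr>"

definition proj_plus ::
  "('v, 'e) pre_digraph \<Rightarrow> (('v, 'e) path \<Rightarrow> 'k::field) set \<Rightarrow> 'v
     \<Rightarrow> ('k, 'e \<Rightarrow> (('v, 'e) path \<Rightarrow> 'k) set, (('v, 'e) path \<Rightarrow> 'k) set) right_module" where
  "proj_plus Q I i = direct_sum_module (out_arcs Q i) (\<lambda>\<alpha>. proj_at Q I (head Q \<alpha>))"

definition proj_minus ::
  "('v, 'e) pre_digraph \<Rightarrow> (('v, 'e) path \<Rightarrow> 'k::field) set \<Rightarrow> 'v
     \<Rightarrow> ('k, 'e \<Rightarrow> (('v, 'e) path \<Rightarrow> 'k) set, (('v, 'e) path \<Rightarrow> 'k) set) right_module" where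
  "proj_minus Q I i = direct_sum_module (in_arcs Q i) (\<lambda>\<gamma>. proj_at Q I (tail Q \<gamma>))"

end

theory Submission imports Defs begin

text \<open>
  The second syzygy of the simple module at a vertex \<open>i\<close> is the kernel \<open>K\<^sub>i\<close> of \<open>P\<^sub>i\<^sup>+ \<rightarrow> rad P\<^sub>i\<close>, \<open>(x\<^sub>\<alpha>) \<mapsto> \<Sum> \<alpha> x\<^sub>\<alpha>\<close>,
  and \<open>|P\<^sub>i\<^sup>+| - |P\<^sub>i| = |K\<^sub>i| - 1\<close>; thus (b) forces a simple \<open>K\<^sub>i\<close>.  As \<open>\<Lambda>\<close> is symmetric, \<open>K\<^sub>i\<close> contains the socles
  of all \<open>P\<^sub>j\<close> with an arrow \<open>i \<rightarrow> j\<close>, and these socles are simple.  So a simple \<open>K\<^sub>i\<close> leaves a single arrow \<open>\<alpha>: i \<rightarrow> j\<close>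
  starting at \<open>i\<close>.  A second arrow \<open>\<gamma>\<close> ending at \<open>j\<close> is excluded by pairing with the form: some \<open>y\<close> represents
  the coefficient functional of \<open>\<gamma>\<close>, whence \<open>\<alpha> y = 0\<close> but \<open>\<gamma> y \<noteq> 0\<close>, although the \<open>y\<close> in \<open>K\<^sub>i\<close> are annihilated by all
  arrows.  Conversely (d) makes \<open>K\<^sub>i\<close> the simple module at \<open>j\<close>.  Since \<open>\<Omega>\<^sup>4\<close> fixes the simple modules, \<open>\<Omega>\<^sup>2\<close> of the
  simple module at \<open>j\<close> is the one at \<open>i\<close>, and the same argument yields a single arrow \<open>j \<rightarrow> i\<close>; as \<open>\<Lambda>\<close> is
  indecomposable, there are no other vertices.  Such an algebra is a Nakayama algebra, whose indecomposable
  modules are cyclic, determined by a vertex and a length.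
\<close>

section \<open>Modules and homomorphisms\<close>

text \<open>Two obstacles shape the formalization. Syzygies are picked by Hilbert choice among
  modules on one fixed carrier type, whereas P_i, P_i^+ and K_i live on the type of the algebra and
  on functions into it. So modules are compared up to isomorphism only, and the kernel of any
  minimal projective cover, on any type, has to be recognized as the chosen syzygy. Second, elements
  of KQ/I are cosets. The module theory therefore takes place in a locale that knows only
  idempotents, arrows, coefficient functionals, spanning by words in the arrows and the vanishing of
  words of length \<open>m\<close>; KQ/I becomes an instance at the very end. Radicals and socles
  are never built as intersections or sums of submodules: the radical of P_i is the kernel of a
  functional, the socle is annihilation by arrows. Minimality of covers is then Nakayama's lemma, an
  induction on word length up to \<open>m\<close>, and the form makes left and right annihilation by
  arrows coincide. For finite type the key is a splitting: a cyclic submodule along which paths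
  survive longest has a complement cut out by a single linear functional.\<close>

lemma right_moduleI:
  fixes \<Lambda> :: "('k::field, 'a) module" and M :: "('k, 'm, 'a) right_module"
  assumes zero: "\<zero>\<^bsub>M\<^esub> \<in> carrier M"
    and add: "\<And>x y. \<lbrakk>x \<in> carrier M; y \<in> carrier M\<rbrakk> \<Longrightarrow> x \<oplus>\<^bsub>M\<^esub> y \<in> carrier M"
    and neg: "\<And>x. x \<in> carrier M \<Longrightarrow> \<exists>y\<in>carrier M. x \<oplus>\<^bsub>M\<^esub> y = \<zero>\<^bsub>M\<^esub>"
    and smult: "\<And>c x. x \<in> carrier M \<Longrightarrow> c \<odot>\<^bsub>M\<^esub> x \<in> carrier M"
    and comm: "\<And>x y. \<lbrakk>x \<in> carrier M; y \<in> carrier M\<rbrakk> \<Longrightarrow> x \<oplus>\<^bsub>M\<^esub> y = y \<oplus>\<^bsub>M\<^esub> x"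
    and assoc: "\<And>x y z. \<lbrakk>x \<in> carrier M; y \<in> carrier M; z \<in> carrier M\<rbrakk>
      \<Longrightarrow> x \<oplus>\<^bsub>M\<^esub> y \<oplus>\<^bsub>M\<^esub> z = x \<oplus>\<^bsub>M\<^esub> (y \<oplus>\<^bsub>M\<^esub> z)"
    and add_zero: "\<And>x. x \<in> carrier M \<Longrightarrow> x \<oplus>\<^bsub>M\<^esub> \<zero>\<^bsub>M\<^esub> = x"
    and smult_assoc: "\<And>a b x. x \<in> carrier M \<Longrightarrow> (a * b) \<odot>\<^bsub>M\<^esub> x = a \<odot>\<^bsub>M\<^esub> (b \<odot>\<^bsub>M\<^esub> x)"
    and smult_one: "\<And>x. x \<in> carrier M \<Longrightarrow> 1 \<odot>\<^bsub>M\<^esub> x = x"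
    and smult_l: "\<And>a b x. x \<in> carrier M \<Longrightarrow> (a + b) \<odot>\<^bsub>M\<^esub> x = a \<odot>\<^bsub>M\<^esub> x \<oplus>\<^bsub>M\<^esub> b \<odot>\<^bsub>M\<^esub> x"
    and smult_r: "\<And>a x y. \<lbrakk>x \<in> carrier M; y \<in> carrier M\<rbrakk>
      \<Longrightarrow> a \<odot>\<^bsub>M\<^esub> (x \<oplus>\<^bsub>M\<^esub> y) = a \<odot>\<^bsub>M\<^esub> x \<oplus>\<^bsub>M\<^esub> a \<odot>\<^bsub>M\<^esub> y"
    and "\<And>x a. \<lbrakk>x \<in> carrier M; a \<in> carrier \<Lambda>\<rbrakk> \<Longrightarrow> x \<lhd>\<^bsub>M\<^esub> a \<in> carrier M"
    and "\<And>x y a. \<lbrakk>x \<in> carrier M; y \<in> carrier M; a \<in> carrier \<Lambda>\<rbrakk>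
          \<Longrightarrow> (x \<oplus>\<^bsub>M\<^esub> y) \<lhd>\<^bsub>M\<^esub> a = x \<lhd>\<^bsub>M\<^esub> a \<oplus>\<^bsub>M\<^esub> y \<lhd>\<^bsub>M\<^esub> a"
    and "\<And>x a b. \<lbrakk>x \<in> carrier M; a \<in> carrier \<Lambda>; b \<in> carrier \<Lambda>\<rbrakk>
          \<Longrightarrow> x \<lhd>\<^bsub>M\<^esub> (a \<oplus>\<^bsub>\<Lambda>\<^esub> b) = x \<lhd>\<^bsub>M\<^esub> a \<oplus>\<^bsub>M\<^esub> x \<lhd>\<^bsub>M\<^esub> b"
    and "\<And>c x a. \<lbrakk>x \<in> carrier M; a \<in> carrier \<Lambda>\<rbrakk>
          \<Longrightarrow> (c \<odot>\<^bsub>M\<^esub> x) \<lhd>\<^bsub>M\<^esub> a = c \<odot>\<^bsub>M\<^esub> (x \<lhd>\<^bsub>M\<^esub> a)"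
    and "\<And>c x a. \<lbrakk>x \<in> carrier M; a \<in> carrier \<Lambda>\<rbrakk>
          \<Longrightarrow> x \<lhd>\<^bsub>M\<^esub> (c \<odot>\<^bsub>\<Lambda>\<^esub> a) = c \<odot>\<^bsub>M\<^esub> (x \<lhd>\<^bsub>M\<^esub> a)"
    and "\<And>x a b. \<lbrakk>x \<in> carrier M; a \<in> carrier \<Lambda>; b \<in> carrier \<Lambda>\<rbrakk>
          \<Longrightarrow> (x \<lhd>\<^bsub>M\<^esub> a) \<lhd>\<^bsub>M\<^esub> b = x \<lhd>\<^bsub>M\<^esub> (a \<otimes>\<^bsub>\<Lambda>\<^esub> b)"
    and "\<And>x. x \<in> carrier M \<Longrightarrow> x \<lhd>\<^bsub>M\<^esub> \<one>\<^bsub>\<Lambda>\<^esub> = x"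
  shows "right_module \<Lambda> M"
proof -
  have "vectorspace (class_ring :: 'k ring) M"
    by (rule vs_criteria[OF class_field]) (use assms in auto)
  then show ?thesis
    using assms by (auto simp: right_module_def right_module_axioms_def)
qed

context right_module
begin

lemmas M_zero [simp] = module.M.zero_closed
  and M_add [simp] = module.M.a_closed
  and M_neg [simp] = module.M.a_inv_closed

lemma M_smult [simp]: "x \<in> carrier M \<Longrightarrow> c \<odot>\<^bsub>M\<^esub> x \<in> carrier M"
  using smult_closed by simp

lemma M_smult_assoc: "x \<in> carrier M \<Longrightarrow> (a * b) \<odot>\<^bsub>M\<^esub> x = a \<odot>\<^bsub>M\<^esub> (b \<odot>\<^bsub>M\<^esub> x)"
  using smult_assoc1[of a b x] by simp

lemma M_smult_one [simp]: "x \<in> carrier M \<Longrightarrow> 1 \<odot>\<^bsub>M\<^esub> x = x"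
  using smult_one[of x] by simp

lemma M_smult_l: "x \<in> carrier M \<Longrightarrow> (a + b) \<odot>\<^bsub>M\<^esub> x = a \<odot>\<^bsub>M\<^esub> x \<oplus>\<^bsub>M\<^esub> b \<odot>\<^bsub>M\<^esub> x"
  using smult_l_distr[of a b x] by simp

lemma M_smult_r: "\<lbrakk>x \<in> carrier M; y \<in> carrier M\<rbrakk> \<Longrightarrow> c \<odot>\<^bsub>M\<^esub> (x \<oplus>\<^bsub>M\<^esub> y) = c \<odot>\<^bsub>M\<^esub> x \<oplus>\<^bsub>M\<^esub> c \<odot>\<^bsub>M\<^esub> y"
  using smult_r_distr[of c x y] by simp

lemma M_smult_0 [simp]: "x \<in> carrier M \<Longrightarrow> 0 \<odot>\<^bsub>M\<^esub> x = \<zero>\<^bsub>M\<^esub>"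
  using module.lmult_0[of x] by simp

lemma M_smult_zero [simp]: "c \<odot>\<^bsub>M\<^esub> \<zero>\<^bsub>M\<^esub> = \<zero>\<^bsub>M\<^esub>"
  using module.rmult_0[of c] by simp

lemma M_smult_minus: "x \<in> carrier M \<Longrightarrow> (- 1) \<odot>\<^bsub>M\<^esub> x = \<ominus>\<^bsub>M\<^esub> x"
  by (metis M_smult M_smult_0 M_smult_l M_smult_one add.left_inverse module.M.minus_equality)

lemmas act_closed' [simp] = act_closed

lemma act_zero_left [simp]: "a \<in> carrier \<Lambda> \<Longrightarrow> \<zero>\<^bsub>M\<^esub> \<lhd>\<^bsub>M\<^esub> a = \<zero>\<^bsub>M\<^esub>"
  by (metis M_smult_0 M_zero act_closed act_smult_left)

text \<open>Applied to S = \<open>span B\<close>. Stating generation through closed subsets avoids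
  linear combinations in every later spanning argument.\<close>

lemma fin_dimI:
  assumes "finite B" "B \<subseteq> carrier M"
    and gen: "\<And>S. \<lbrakk>S \<subseteq> carrier M; \<zero>\<^bsub>M\<^esub> \<in> S; \<And>x y. \<lbrakk>x \<in> S; y \<in> S\<rbrakk> \<Longrightarrow> x \<oplus>\<^bsub>M\<^esub> y \<in> S;
      \<And>c x. x \<in> S \<Longrightarrow> c \<odot>\<^bsub>M\<^esub> x \<in> S; B \<subseteq> S\<rbrakk> \<Longrightarrow> carrier M \<subseteq> S"
  shows "fin_dim"
proof -
  have sub: "LinearCombinations.submodule class_ring (span B) M"
    using assms(2) by (rule span_is_submodule)
  have "carrier M \<subseteq> span B"
    by (rule gen) (use sub in_own_span[OF assms(2)] in \<open>auto simp: LinearCombinations.submodule_def\<close>)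
  then have "span B = carrier M"
    using sub by (auto simp: LinearCombinations.submodule_def)
  then show ?thesis
    using assms unfolding fin_dim_def by blast
qed

text \<open>A set that is independent in \<open>W\<close> is independent in \<open>M\<close>, so its
  size is at most \<open>dim\<close>; hence a maximal independent set of \<open>W\<close> exists,
  and it is a basis of \<open>W\<close>.\<close>

lemma subspace_fin_dim:
  assumes fd: "fin_dim" and sub: "VectorSpace.subspace class_ring W M"
  shows "vectorspace.fin_dim class_ring (M\<lparr>carrier := W\<rparr>)"
proof -
  interpret W: vectorspace class_ring "M\<lparr>carrier := W\<rparr>"
    using sub by (rule subspace_is_vs)
  have sm: "LinearCombinations.submodule class_ring W M"
    using sub by (simp add: VectorSpace.subspace_def)
  then have WM: "W \<subseteq> carrier M"
    by (simp add: LinearCombinations.submodule_def)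
  define P where "P = (\<lambda>S. S \<subseteq> carrier (M\<lparr>carrier := W\<rparr>) \<and> W.lin_indpt S)"
  have "P {}"
    by (auto simp: P_def W.lin_dep_def)
  moreover have "finite A \<and> card A \<le> dim" if "P A" for A
  proof -
    have "A \<subseteq> W" "W.lin_indpt A"
      using that by (auto simp: P_def)
    then have "lin_indpt A"
      using span_li_not_depend(2)[OF _ sm] by blast
    then show ?thesis
      using li_le_dim[OF fd, of A] \<open>A \<subseteq> W\<close> WM by auto
  qed
  ultimately obtain A where "finite A" "maximal A P"
    using maximal_exists[of P dim "{}"] by blast
  then have "W.basis A"
    using W.max_li_is_basis by (simp add: P_def)
  then show ?thesis
    using \<open>finite A\<close> unfolding W.fin_dim_def W.basis_def by blast
qed

end

text \<open>Only additivity between two abelian monoids is assumed, so that one lemma serves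
  homomorphisms, both arguments of the action, scalars, coordinate projections and the inclusion of
  a submodule (with \<open>f\<close> the identity).\<close>

lemma finsum_additive:
  assumes G: "abelian_monoid G" and H: "abelian_monoid H"
    and closed: "\<And>x. x \<in> carrier G \<Longrightarrow> f x \<in> carrier H"
    and zero: "f \<zero>\<^bsub>G\<^esub> = \<zero>\<^bsub>H\<^esub>"
    and add: "\<And>x y. \<lbrakk>x \<in> carrier G; y \<in> carrier G\<rbrakk> \<Longrightarrow> f (x \<oplus>\<^bsub>G\<^esub> y) = f x \<oplus>\<^bsub>H\<^esub> f y"
    and J: "finite J" "\<And>j. j \<in> J \<Longrightarrow> g j \<in> carrier G"
  shows "f (finsum G g J) = finsum H (\<lambda>j. f (g j)) J"
  using J
proof (induction J rule: finite_induct)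
  case empty
  show ?case
    by (simp add: zero abelian_monoid.finsum_empty[OF G] abelian_monoid.finsum_empty[OF H])
next
  case (insert j J)
  then have "g \<in> J \<rightarrow> carrier G" "(\<lambda>j. f (g j)) \<in> J \<rightarrow> carrier H"
    using closed by auto
  with insert closed add show ?case
    by (simp add: abelian_monoid.finsum_insert[OF G] abelian_monoid.finsum_insert[OF H]
        abelian_monoid.finsum_closed[OF G])
qed

section \<open>Submodules, homomorphisms and isomorphisms\<close>

context right_module
begin

lemma rsubmodule_iff:
  "rsubmodule \<Lambda> N M \<longleftrightarrow> N \<subseteq> carrier M \<and> \<zero>\<^bsub>M\<^esub> \<in> N \<and> (\<forall>x\<in>N. \<forall>y\<in>N. x \<oplus>\<^bsub>M\<^esub> y \<in> N) \<and>
    (\<forall>c. \<forall>x\<in>N. c \<odot>\<^bsub>M\<^esub> x \<in> N) \<and> (\<forall>x\<in>N. \<forall>a\<in>carrier \<Lambda>. x \<lhd>\<^bsub>M\<^esub> a \<in> N)"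
  using module_axioms vectorspace_axioms
  by (auto simp: rsubmodule_def VectorSpace.subspace_def LinearCombinations.submodule_def)

lemma rsubmoduleI:
  assumes "N \<subseteq> carrier M" "\<zero>\<^bsub>M\<^esub> \<in> N" "\<And>x y. \<lbrakk>x \<in> N; y \<in> N\<rbrakk> \<Longrightarrow> x \<oplus>\<^bsub>M\<^esub> y \<in> N"
    "\<And>c x. x \<in> N \<Longrightarrow> c \<odot>\<^bsub>M\<^esub> x \<in> N" "\<And>x a. \<lbrakk>x \<in> N; a \<in> carrier \<Lambda>\<rbrakk> \<Longrightarrow> x \<lhd>\<^bsub>M\<^esub> a \<in> N"
  shows "rsubmodule \<Lambda> N M"
  using assms by (simp add: rsubmodule_iff)

lemma submodule_right_module:
  assumes "rsubmodule \<Lambda> N M"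
  shows "right_module \<Lambda> (M\<lparr>carrier := N\<rparr>)"
proof (rule right_moduleI, goal_cases)
  \<comment> \<open>Case 3 asks for a negative: \<open>(- 1) \<odot> x\<close> is one, and it stays
    in \<open>N\<close> because \<open>N\<close> is closed under scalars.\<close>
  case (3 x)
  then have x: "x \<in> N" "x \<in> carrier M"
    using assms by (auto simp: rsubmodule_iff)
  then have "(- 1) \<odot>\<^bsub>M\<^esub> x \<in> N"
    using assms by (auto simp: rsubmodule_iff)
  then show ?case
    using x by (auto simp: M_smult_minus module.M.r_neg intro!: bexI[of _ "(- 1) \<odot>\<^bsub>M\<^esub> x"])
qed (use assms in \<open>auto simp: rsubmodule_iff subset_iff M_smult_assoc M_smult_l M_smult_r module.M.a_ac
    act_add_left act_add_right act_smult_left act_smult_right act_assoc act_one\<close>)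

lemma rsubmodule_carrier: "rsubmodule \<Lambda> (carrier M) M"
  by (rule rsubmoduleI) auto

end

lemma (in fd_right_module) submodule_fd:
  assumes "rsubmodule \<Lambda> N M"
  shows "fd_right_module \<Lambda> (M\<lparr>carrier := N\<rparr>)"
  using submodule_right_module[OF assms] subspace_fin_dim[OF finite_dimensional, of N] assms
  by (simp add: fd_right_module_def fd_right_module_axioms_def rsubmodule_def)

lemma fd_right_module_imp [intro]: "fd_right_module \<Lambda> M \<Longrightarrow> right_module \<Lambda> M"
  by (simp add: fd_right_module_def)

lemma rmodule_hom_iff:
  "f \<in> rmodule_hom \<Lambda> M N \<longleftrightarrow> (\<forall>x\<in>carrier M. f x \<in> carrier N) \<and>
    (\<forall>x\<in>carrier M. \<forall>y\<in>carrier M. f (x \<oplus>\<^bsub>M\<^esub> y) = f x \<oplus>\<^bsub>N\<^esub> f y) \<and>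
    (\<forall>c. \<forall>x\<in>carrier M. f (c \<odot>\<^bsub>M\<^esub> x) = c \<odot>\<^bsub>N\<^esub> f x) \<and>
    (\<forall>x\<in>carrier M. \<forall>a\<in>carrier \<Lambda>. f (x \<lhd>\<^bsub>M\<^esub> a) = f x \<lhd>\<^bsub>N\<^esub> a)"
  by (auto simp: rmodule_hom_def module_hom_def)

lemma rmodule_homD:
  assumes "f \<in> rmodule_hom \<Lambda> M N" "x \<in> carrier M"
  shows "f x \<in> carrier N" "y \<in> carrier M \<Longrightarrow> f (x \<oplus>\<^bsub>M\<^esub> y) = f x \<oplus>\<^bsub>N\<^esub> f y"
    "f (c \<odot>\<^bsub>M\<^esub> x) = c \<odot>\<^bsub>N\<^esub> f x" "a \<in> carrier \<Lambda> \<Longrightarrow> f (x \<lhd>\<^bsub>M\<^esub> a) = f x \<lhd>\<^bsub>N\<^esub> a"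
  using assms by (auto simp: rmodule_hom_iff)

lemma rmodule_hom_zero:
  assumes "right_module \<Lambda> M" "right_module \<Lambda> N" "f \<in> rmodule_hom \<Lambda> M N"
  shows "f \<zero>\<^bsub>M\<^esub> = \<zero>\<^bsub>N\<^esub>"
  using rmodule_homD(3)[OF assms(3) right_module.M_zero[OF assms(1)], of 0]
    rmodule_homD(1)[OF assms(3) right_module.M_zero[OF assms(1)]]
  by (simp add: right_module.M_smult_0[OF assms(1)] right_module.M_zero[OF assms(1)]
      right_module.M_smult_0[OF assms(2)])

lemma rmodule_hom_minus:
  assumes "right_module \<Lambda> M" "right_module \<Lambda> N" "f \<in> rmodule_hom \<Lambda> M N" "x \<in> carrier M"
  shows "f (\<ominus>\<^bsub>M\<^esub> x) = \<ominus>\<^bsub>N\<^esub> f x"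
  using rmodule_homD(1)[OF assms(3,4)] rmodule_homD(3)[OF assms(3,4), of "- 1"] assms(4)
  by (simp add: right_module.M_smult_minus[OF assms(1)] right_module.M_smult_minus[OF assms(2)])

lemma rmodule_hom_id: "(\<lambda>x. x) \<in> rmodule_hom \<Lambda> M M"
  by (simp add: rmodule_hom_iff)

lemma rmodule_hom_comp:
  assumes "f \<in> rmodule_hom \<Lambda> M N" "g \<in> rmodule_hom \<Lambda> N L"
  shows "(\<lambda>x. g (f x)) \<in> rmodule_hom \<Lambda> M L"
  using assms by (simp add: rmodule_hom_iff)

lemma rmodule_hom_finsum:
  assumes M: "right_module \<Lambda> M" and N: "right_module \<Lambda> N" and f: "f \<in> rmodule_hom \<Lambda> M N"
    and J: "finite J" "\<And>j. j \<in> J \<Longrightarrow> g j \<in> carrier M"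
  shows "f (finsum M g J) = finsum N (\<lambda>j. f (g j)) J"
proof -
  interpret M: right_module \<Lambda> M by fact
  interpret N: right_module \<Lambda> N by fact
  show ?thesis
    by (rule finsum_additive)
      (use f J M.module.M.abelian_monoid_axioms N.module.M.abelian_monoid_axioms
        in \<open>auto simp: rmodule_homD rmodule_hom_zero[OF M N f]\<close>)
qed

lemma hom_kernel_rsubmodule:
  assumes M: "right_module \<Lambda> M" and N: "right_module \<Lambda> N" and f: "f \<in> rmodule_hom \<Lambda> M N"
  shows "rsubmodule \<Lambda> (hom_kernel M N f) M"
proof -
  interpret M: right_module \<Lambda> M by fact
  interpret N: right_module \<Lambda> N by fact
  show ?thesis
    by (rule M.rsubmoduleI) (auto simp: hom_kernel_def rmodule_homD[OF f] rmodule_hom_zero[OF M N f])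
qed

lemma image_rsubmodule:
  assumes M: "right_module \<Lambda> M" and N: "right_module \<Lambda> N" and f: "f \<in> rmodule_hom \<Lambda> M N"
    and S: "rsubmodule \<Lambda> S M"
  shows "rsubmodule \<Lambda> (f ` S) N"
proof -
  interpret M: right_module \<Lambda> M by fact
  interpret N: right_module \<Lambda> N by fact
  have S': "S \<subseteq> carrier M" "\<zero>\<^bsub>M\<^esub> \<in> S" "\<And>x y. \<lbrakk>x \<in> S; y \<in> S\<rbrakk> \<Longrightarrow> x \<oplus>\<^bsub>M\<^esub> y \<in> S"
    "\<And>c x. x \<in> S \<Longrightarrow> c \<odot>\<^bsub>M\<^esub> x \<in> S" "\<And>x a. \<lbrakk>x \<in> S; a \<in> carrier \<Lambda>\<rbrakk> \<Longrightarrow> x \<lhd>\<^bsub>M\<^esub> a \<in> S"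
    using S by (auto simp: M.rsubmodule_iff)
  show ?thesis
  proof (rule N.rsubmoduleI)
    show "f ` S \<subseteq> carrier N"
      using S'(1) rmodule_homD(1)[OF f] by auto
    show "\<zero>\<^bsub>N\<^esub> \<in> f ` S"
      using S'(2) rmodule_hom_zero[OF M N f] by (metis imageI)
  next
    fix x y assume "x \<in> f ` S" "y \<in> f ` S"
    then obtain x' y' where "x' \<in> S" "x = f x'" "y' \<in> S" "y = f y'" by auto
    then show "x \<oplus>\<^bsub>N\<^esub> y \<in> f ` S"
      using S' rmodule_homD(2)[OF f, of x' y'] by (metis imageI subsetD)
  next
    fix c x assume "x \<in> f ` S"
    then obtain x' where "x' \<in> S" "x = f x'" by auto
    then show "c \<odot>\<^bsub>N\<^esub> x \<in> f ` S"
      using S' rmodule_homD(3)[OF f, of x'] by (metis imageI subsetD)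
  next
    fix x a assume "x \<in> f ` S" and a: "a \<in> carrier \<Lambda>"
    then obtain x' where "x' \<in> S" "x = f x'" by auto
    then show "x \<lhd>\<^bsub>N\<^esub> a \<in> f ` S"
      using S' a rmodule_homD(4)[OF f, of x' a] by (metis imageI subsetD)
  qed
qed

lemma rmodule_hom_inv_into:
  assumes "right_module \<Lambda> M" and f: "f \<in> rmodule_hom \<Lambda> M N" and bij: "bij_betw f (carrier M) (carrier N)"
  shows "inv_into (carrier M) f \<in> rmodule_hom \<Lambda> N M"
proof -
  interpret M: right_module \<Lambda> M by fact
  let ?g = "inv_into (carrier M) f"
  have g: "?g y \<in> carrier M" "f (?g y) = y" if "y \<in> carrier N" for y
    using bij that by (auto simp: bij_betw_def inv_into_into f_inv_into_f)
  have gf: "?g y = x" if "x \<in> carrier M" "y = f x" for x y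
    using bij that by (auto simp: bij_betw_def)
  show ?thesis
    unfolding rmodule_hom_iff
    by (auto intro!: gf simp: g rmodule_homD[OF f])
qed

lemma rmodule_iso_sym:
  assumes "right_module \<Lambda> M" "rmodule_iso \<Lambda> M N"
  shows "rmodule_iso \<Lambda> N M"
  using assms rmodule_hom_inv_into[of \<Lambda> M] unfolding rmodule_iso_def
  by (meson bij_betw_inv_into)

lemma rmodule_iso_trans:
  assumes "rmodule_iso \<Lambda> M N" "rmodule_iso \<Lambda> N L"
  shows "rmodule_iso \<Lambda> M L"
proof -
  obtain f g where "f \<in> rmodule_hom \<Lambda> M N" "bij_betw f (carrier M) (carrier N)"
    "g \<in> rmodule_hom \<Lambda> N L" "bij_betw g (carrier N) (carrier L)"
    using assms unfolding rmodule_iso_def by blast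
  then show ?thesis
    unfolding rmodule_iso_def
    using rmodule_hom_comp[of f \<Lambda> M N g L] bij_betw_trans[of f "carrier M" "carrier N" g "carrier L"]
    by (auto simp: comp_def)
qed

text \<open>Requiring the regular module to be a right module packs the vector space axioms and the
  bilinearity of the product into one assumption; the laws for \<Lambda> are then read off from
  those for modules.\<close>

locale k_algebra = ring \<Lambda> for \<Lambda> :: "('k::field, 'a) module" (structure) +
  assumes regular: "right_module \<Lambda> (regular_module \<Lambda>)"
begin

sublocale reg: right_module \<Lambda> "regular_module \<Lambda>"
  by (rule regular)

lemma regular_simps [simp]:
  "carrier (regular_module \<Lambda>) = carrier \<Lambda>" "zero (regular_module \<Lambda>) = \<zero>"
  "add (regular_module \<Lambda>) = add \<Lambda>" "smult (regular_module \<Lambda>) = smult \<Lambda>" "act (regular_module \<Lambda>) = mult \<Lambda>"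
  by (simp_all add: regular_module_def)

lemmas smult_closed [simp] = reg.M_smult[simplified]
  and smult_add = reg.M_smult_r[simplified]
  and add_smult = reg.M_smult_l[simplified]
  and smult_one [simp] = reg.M_smult_one[simplified]
  and zero_smult [simp] = reg.M_smult_0[simplified]
  and smult_zero [simp] = reg.M_smult_zero[simplified]
  and smult_smult = reg.M_smult_assoc[simplified]
  and smult_mult_left = reg.act_smult_left[simplified]
  and smult_mult_right = reg.act_smult_right[simplified]

end

text \<open>Each module law holds in \<open>N\<close> because it is the \<open>f\<close>-image of
  the law in \<open>M\<close>. As \<open>N\<close> is not yet known to be a module, preservation of
  zero cannot be derived and is assumed.\<close>

lemma (in k_algebra) transport_right_module:
  fixes M :: "('k, 'm, 'a) right_module" and N :: "('k, 'n, 'a) right_module"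
  assumes M: "right_module \<Lambda> M" and f: "f \<in> rmodule_hom \<Lambda> M N"
    and bij: "bij_betw f (carrier M) (carrier N)" and zero: "f \<zero>\<^bsub>M\<^esub> = \<zero>\<^bsub>N\<^esub>"
  shows "right_module \<Lambda> N"
proof -
  interpret M: right_module \<Lambda> M by fact
  have [simp]: "carrier N = f ` carrier M"
    using bij by (simp add: bij_betw_def)
  note h = rmodule_homD(2-)[OF f, symmetric]
  show ?thesis
  proof (rule right_moduleI, goal_cases)
    case (3 x)
    then obtain x' where "x' \<in> carrier M" "x = f x'" by auto
    then show ?case
      using h(1)[of x' "\<ominus>\<^bsub>M\<^esub> x'"] by (auto simp: zero M.module.M.r_neg intro!: bexI[of _ "\<ominus>\<^bsub>M\<^esub> x'"])
  qed (auto simp: zero[symmetric] h M.M_smult_assoc M.M_smult_l M.M_smult_r M.module.M.a_ac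
      M.act_add_left M.act_add_right M.act_smult_left M.act_smult_right M.act_assoc M.act_one)
qed

lemma hom_linear_map:
  fixes M :: "('k::field, 'm, 'a) right_module"
  assumes "right_module \<Lambda> M" "right_module \<Lambda> N" "f \<in> rmodule_hom \<Lambda> M N"
  shows "linear_map (class_ring :: 'k ring) M N f"
  using assms by (auto simp: linear_map_def mod_hom_def right_module_def vectorspace_def mod_hom_axioms_def
      rmodule_hom_def)

lemma transport_fd_right_module:
  assumes M: "fd_right_module \<Lambda> M" and N: "right_module \<Lambda> N" and f: "f \<in> rmodule_hom \<Lambda> M N"
    and surj: "f ` carrier M = carrier N"
  shows "fd_right_module \<Lambda> N"
  using linear_map.surj_fin_dim[OF hom_linear_map[OF _ N f] _ surj] M N
  by (auto simp: fd_right_module_def fd_right_module_axioms_def)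

text \<open>The inverse isomorphism carries a submodule of \<open>N\<close> to one of
  \<open>S\<close>, and, being injective, it reflects the two trivial submodules.\<close>

lemma iso_simple_module:
  assumes S: "simple_module \<Lambda> S" and N: "right_module \<Lambda> N" and iso: "rmodule_iso \<Lambda> S N"
  shows "simple_module \<Lambda> N"
proof -
  obtain f where f: "f \<in> rmodule_hom \<Lambda> S N" and bij: "bij_betw f (carrier S) (carrier N)"
    using iso unfolding rmodule_iso_def by blast
  have S': "fd_right_module \<Lambda> S" "right_module \<Lambda> S"
    using S by (auto simp: simple_module_def)
  let ?g = "inv_into (carrier S) f"
  have g: "?g \<in> rmodule_hom \<Lambda> N S"
    using rmodule_hom_inv_into[OF S'(2) f bij] .
  have gbij: "bij_betw ?g (carrier N) (carrier S)"
    using bij by (rule bij_betw_inv_into)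
  have g0: "?g \<zero>\<^bsub>N\<^esub> = \<zero>\<^bsub>S\<^esub>"
    using rmodule_hom_zero[OF N S'(2) g] .
  have im: "A = B" if "?g ` A = ?g ` B" "A \<subseteq> carrier N" "B \<subseteq> carrier N" for A B
    using that gbij by (meson bij_betw_imp_inj_on inj_on_image_eq_iff)
  interpret N: right_module \<Lambda> N by fact
  show ?thesis
    unfolding simple_module_def
  proof (intro conjI allI impI)
    show "fd_right_module \<Lambda> N"
      using transport_fd_right_module[OF S'(1) N f] bij by (simp add: bij_betw_def)
    show "carrier N \<noteq> {\<zero>\<^bsub>N\<^esub>}"
      using S gbij g0 by (auto simp: simple_module_def bij_betw_def)
  next
    fix L assume L: "rsubmodule \<Lambda> L N"
    then have LN: "L \<subseteq> carrier N" by (simp add: N.rsubmodule_iff)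
    from S image_rsubmodule[OF N S'(2) g L]
    consider "?g ` L = {\<zero>\<^bsub>S\<^esub>}" | "?g ` L = carrier S"
      unfolding simple_module_def by blast
    then show "L = {\<zero>\<^bsub>N\<^esub>} \<or> L = carrier N"
    proof cases
      case 1
      then have "L = {\<zero>\<^bsub>N\<^esub>}" using im[of L "{\<zero>\<^bsub>N\<^esub>}"] LN g0 by simp
      then show ?thesis ..
    next
      case 2
      then have "L = carrier N" using im[of L "carrier N"] LN gbij by (simp add: bij_betw_def)
      then show ?thesis ..
    qed
  qed
qed

text \<open>Coordinates with respect to a numbered finite basis, padded by 0. They give copies of
  modules on functions from \<open>nat\<close> to the field, and later a linear functional that does
  not vanish at a prescribed vector.\<close>

lemma coordinates_exist:
  fixes M :: "('k::field, 'm, 'a) right_module"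
  assumes "fd_right_module \<Lambda> M"
  obtains \<phi> :: "'m \<Rightarrow> nat \<Rightarrow> 'k" where "inj_on \<phi> (carrier M)"
    "\<And>x y k. \<lbrakk>x \<in> carrier M; y \<in> carrier M\<rbrakk> \<Longrightarrow> \<phi> (x \<oplus>\<^bsub>M\<^esub> y) k = \<phi> x k + \<phi> y k"
    "\<And>c x k. x \<in> carrier M \<Longrightarrow> \<phi> (c \<odot>\<^bsub>M\<^esub> x) k = c * \<phi> x k"
proof -
  interpret fd_right_module \<Lambda> M by fact
  obtain \<beta> where \<beta>: "finite \<beta>" "basis \<beta>"
    using finite_basis_exists finite_dimensional by blast
  have \<beta>M: "\<beta> \<subseteq> carrier M"
    using \<beta> by (simp add: basis_def)
  have ex: "\<exists>!a. a \<in> \<beta> \<rightarrow>\<^sub>E UNIV \<and> lincomb a \<beta> = v" if "v \<in> carrier M" for v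
    using basis_criterion[OF \<beta>(1) \<beta>M] \<beta>(2) that by simp
  define co where "co v = (THE a. a \<in> \<beta> \<rightarrow>\<^sub>E UNIV \<and> lincomb a \<beta> = v)" for v
  have co: "co v \<in> \<beta> \<rightarrow>\<^sub>E UNIV" "lincomb (co v) \<beta> = v" if "v \<in> carrier M" for v
    using theI'[OF ex[OF that]] by (auto simp: co_def)
  \<comment> \<open>Coefficient functions are unique only as extensional functions on
    \<open>\<beta>\<close>, hence the restriction before the comparison.\<close>
  have uniq: "a x = co v x" if "lincomb a \<beta> = v" "v \<in> carrier M" "x \<in> \<beta>" for a v x
  proof -
    have "lincomb (restrict a \<beta>) \<beta> = v"
      using that \<beta>M by (subst lincomb_cong[of \<beta> \<beta> _ a]) auto
    then have "restrict a \<beta> = co v"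
      using ex[of v] co[of v] that by (metis UNIV_I restrict_PiE_iff)
    then show ?thesis
      using that by (metis restrict_apply')
  qed
  obtain b :: "nat \<Rightarrow> 'm" where b: "bij_betw b {..<card \<beta>} \<beta>"
    using ex_bij_betw_nat_finite[OF \<beta>(1)] by (auto simp: atLeast0LessThan)
  define \<phi> where "\<phi> v k = (if k < card \<beta> then co v (b k) else 0)" for v k
  have b\<beta>: "b k \<in> \<beta>" if "k < card \<beta>" for k
    using b that by (auto simp: bij_betw_def)
  show ?thesis
  proof (rule that)
    show "inj_on \<phi> (carrier M)"
    proof (rule inj_onI)
      fix x y assume xy: "x \<in> carrier M" "y \<in> carrier M" "\<phi> x = \<phi> y"
      have "co x z = co y z" if "z \<in> \<beta>" for z
      proof -
        obtain k where "k < card \<beta>" "z = b k"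
          using b \<open>z \<in> \<beta>\<close> by (auto simp: bij_betw_def)
        then show ?thesis
          using xy(3) by (metis \<phi>_def)
      qed
      then have "co x = co y"
        using co(1)[OF xy(1)] co(1)[OF xy(2)] by (metis PiE_ext)
      then show "x = y"
        using co(2) xy by metis
    qed
  next
    fix x y k assume xy: "x \<in> carrier M" "y \<in> carrier M"
    have "lincomb (\<lambda>v. co x v + co y v) \<beta> = x \<oplus>\<^bsub>M\<^esub> y"
      using lincomb_sum[OF \<beta>(1) \<beta>M, of "co x" "co y"] co(2)[OF xy(1)] co(2)[OF xy(2)] by simp
    then have "co x z + co y z = co (x \<oplus>\<^bsub>M\<^esub> y) z" if "z \<in> \<beta>" for z
      using uniq xy that by (metis (no_types, lifting) M_add)
    then show "\<phi> (x \<oplus>\<^bsub>M\<^esub> y) k = \<phi> x k + \<phi> y k"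
      by (simp add: \<phi>_def b\<beta>)
  next
    fix c x k assume x: "x \<in> carrier M"
    have "lincomb (\<lambda>v. c * co x v) \<beta> = c \<odot>\<^bsub>M\<^esub> x"
      using lincomb_distrib[OF \<beta>M, of "co x" c] co(2)[OF x] by simp
    then have "c * co x z = co (c \<odot>\<^bsub>M\<^esub> x) z" if "z \<in> \<beta>" for z
      using uniq x that by (metis (no_types, lifting) M_smult)
    then show "\<phi> (c \<odot>\<^bsub>M\<^esub> x) k = c * \<phi> x k"
      by (simp add: \<phi>_def b\<beta>)
  qed
qed

text \<open>Syzygies and the periodicity hypothesis speak of modules of type \<open>fdmod\<close>,
  while P_i and its relatives live on other types; this is the bridge, built by carrying the
  structure along an injective coordinate map.\<close>

lemma (in k_algebra) fdmod_copy:
  fixes M :: "('k, 'm, 'a) right_module"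
  assumes "fd_right_module \<Lambda> M"
  obtains M' :: "('k, 'a) fdmod" and f where "fd_right_module \<Lambda> M'" "f \<in> rmodule_hom \<Lambda> M M'"
    "bij_betw f (carrier M) (carrier M')"
proof -
  interpret M: fd_right_module \<Lambda> M by fact
  obtain \<phi> :: "'m \<Rightarrow> nat \<Rightarrow> 'k" where \<phi>: "inj_on \<phi> (carrier M)"
    using coordinates_exist[OF assms] by metis
  let ?g = "inv_into (carrier M) \<phi>"
  \<comment> \<open>Every operation decodes by \<open>inv_into\<close>, computes in \<open>M\<close>
    and encodes by \<open>\<phi>\<close>.\<close>
  define M' :: "('k, 'a) fdmod" where "M' = \<lparr>carrier = \<phi> ` carrier M, mult = undefined, one = undefined,
    zero = \<phi> \<zero>\<^bsub>M\<^esub>, add = (\<lambda>x y. \<phi> (?g x \<oplus>\<^bsub>M\<^esub> ?g y)), smult = (\<lambda>c x. \<phi> (c \<odot>\<^bsub>M\<^esub> ?g x)),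
    act = (\<lambda>x a. \<phi> (?g x \<lhd>\<^bsub>M\<^esub> a))\<rparr>"
  have hom: "\<phi> \<in> rmodule_hom \<Lambda> M M'"
    using \<phi> by (simp add: rmodule_hom_iff M'_def)
  have bij: "bij_betw \<phi> (carrier M) (carrier M')"
    using \<phi> by (simp add: bij_betw_def M'_def)
  have rm: "right_module \<Lambda> M'"
    by (rule transport_right_module[OF M.right_module_axioms hom bij]) (simp add: M'_def)
  have "fd_right_module \<Lambda> M'"
    using transport_fd_right_module[OF assms rm hom] bij by (simp add: bij_betw_def)
  then show ?thesis
    using that hom bij by blast
qed

section \<open>Projective covers and syzygies\<close>

lemma (in right_module) M_diff_zero:
  assumes "x \<in> carrier M" "y \<in> carrier M" "x \<oplus>\<^bsub>M\<^esub> \<ominus>\<^bsub>M\<^esub> y = \<zero>\<^bsub>M\<^esub>"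
  shows "x = y"
proof -
  have "\<ominus>\<^bsub>M\<^esub> (\<ominus>\<^bsub>M\<^esub> y) = x"
    using assms by (intro module.M.minus_equality) auto
  then show ?thesis
    using module.M.minus_minus[OF assms(2)] by (rule trans[OF sym])
qed

lemma mem_set_add: "x \<in> A <+>\<^bsub>G\<^esub> B \<longleftrightarrow> (\<exists>a\<in>A. \<exists>b\<in>B. x = a \<oplus>\<^bsub>G\<^esub> b)"
  by (auto simp: set_add_def set_mult_def)

text \<open>A submodule complements the kernel of \<^term>\<open>f\<close> iff it still surjects onto the target.\<close>

lemma projective_cover_iff:
  assumes P: "right_module \<Lambda> P" and M: "right_module \<Lambda> M"
  shows "projective_cover \<Lambda> P f M \<longleftrightarrow> projective_module \<Lambda> P \<and> f \<in> rmodule_hom \<Lambda> P M \<and>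
    f ` carrier P = carrier M \<and> (\<forall>N. rsubmodule \<Lambda> N P \<and> f ` N = carrier M \<longrightarrow> N = carrier P)"
proof -
  interpret P: right_module \<Lambda> P by fact
  interpret M: right_module \<Lambda> M by fact
  have eqv: "N <+>\<^bsub>P\<^esub> hom_kernel P M f = carrier P \<longleftrightarrow> f ` N = carrier M"
    if f: "f \<in> rmodule_hom \<Lambda> P M" "f ` carrier P = carrier M" and N: "rsubmodule \<Lambda> N P" for N
  proof -
    have NP: "N \<subseteq> carrier P" using N by (simp add: P.rsubmodule_iff)
    note fD = rmodule_homD[OF f(1)]
    show ?thesis
    proof
      assume sum: "N <+>\<^bsub>P\<^esub> hom_kernel P M f = carrier P"
      have "y \<in> f ` N" if y: "y \<in> carrier M" for y
      proof -
        obtain x where x: "x \<in> carrier P" "y = f x" using y f(2) by auto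
        then obtain n k where nk: "n \<in> N" "k \<in> carrier P" "f k = \<zero>\<^bsub>M\<^esub>" "x = n \<oplus>\<^bsub>P\<^esub> k"
          using sum mem_set_add[of x P N "hom_kernel P M f"] by (auto simp: hom_kernel_def)
        then have "n \<in> carrier P" using NP by auto
        then have "f x = f n" using nk fD(1)[of n] by (simp add: fD(2) M.module.M.r_zero)
        then show ?thesis using nk x by auto
      qed
      then show "f ` N = carrier M" using NP fD(1) by auto
    next
      assume im: "f ` N = carrier M"
      have "x \<in> N <+>\<^bsub>P\<^esub> hom_kernel P M f" if x: "x \<in> carrier P" for x
      proof -
        have "f x \<in> f ` N" using im fD(1)[OF x] by simp
        then obtain n where n: "n \<in> N" "f x = f n" by (rule imageE)
        then have nP: "n \<in> carrier P" using NP by auto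
        let ?k = "\<ominus>\<^bsub>P\<^esub> n \<oplus>\<^bsub>P\<^esub> x"
        have "f ?k = \<zero>\<^bsub>M\<^esub>"
          using x nP fD(1)[OF nP] by (simp add: n(2) fD(2) rmodule_hom_minus[OF P M f(1)] M.module.M.l_neg)
        moreover have "x = n \<oplus>\<^bsub>P\<^esub> ?k" using nP x by (simp add: P.module.M.r_neg2)
        ultimately show ?thesis
          using n(1) nP x unfolding mem_set_add
          by (intro bexI[of _ n] bexI[of _ ?k]) (auto simp: hom_kernel_def)
      qed
      moreover have "N <+>\<^bsub>P\<^esub> hom_kernel P M f \<subseteq> carrier P"
      proof
        fix x assume "x \<in> N <+>\<^bsub>P\<^esub> hom_kernel P M f"
        then obtain n k where "n \<in> N" "k \<in> carrier P" "x = n \<oplus>\<^bsub>P\<^esub> k"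
          unfolding mem_set_add hom_kernel_def by blast
        then show "x \<in> carrier P" using NP P.M_add[of n k] by blast
      qed
      ultimately show "N <+>\<^bsub>P\<^esub> hom_kernel P M f = carrier P" by auto
    qed
  qed
  show ?thesis
  proof
    assume c: "projective_cover \<Lambda> P f M"
    then have f: "f \<in> rmodule_hom \<Lambda> P M" "f ` carrier P = carrier M"
      by (auto simp: projective_cover_def)
    have min: "N = carrier P" if "rsubmodule \<Lambda> N P" "N <+>\<^bsub>P\<^esub> hom_kernel P M f = carrier P" for N
      using c that by (simp add: projective_cover_def)
    have "N = carrier P" if N: "rsubmodule \<Lambda> N P" "f ` N = carrier M" for N
      using min[OF N(1)] N(2) by (simp add: eqv[OF f N(1)])
    then show "projective_module \<Lambda> P \<and> f \<in> rmodule_hom \<Lambda> P M \<and> f ` carrier P = carrier M \<and>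
      (\<forall>N. rsubmodule \<Lambda> N P \<and> f ` N = carrier M \<longrightarrow> N = carrier P)"
      using c f by (simp add: projective_cover_def)
  next
    assume c: "projective_module \<Lambda> P \<and> f \<in> rmodule_hom \<Lambda> P M \<and> f ` carrier P = carrier M \<and>
      (\<forall>N. rsubmodule \<Lambda> N P \<and> f ` N = carrier M \<longrightarrow> N = carrier P)"
    then have f: "f \<in> rmodule_hom \<Lambda> P M" "f ` carrier P = carrier M"
      by auto
    have "N = carrier P" if N: "rsubmodule \<Lambda> N P" "N <+>\<^bsub>P\<^esub> hom_kernel P M f = carrier P" for N
      using c N by (simp add: eqv[OF f N(1)])
    then show "projective_cover \<Lambda> P f M"
      using c by (simp add: projective_cover_def)
  qed
qed

lemma projective_coverI:
  assumes "projective_module \<Lambda> P" "right_module \<Lambda> M" "f \<in> rmodule_hom \<Lambda> P M" "f ` carrier P = carrier M"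
    "\<And>N. \<lbrakk>rsubmodule \<Lambda> N P; f ` N = carrier M\<rbrakk> \<Longrightarrow> N = carrier P"
  shows "projective_cover \<Lambda> P f M"
proof -
  have "right_module \<Lambda> P" using assms(1) by (auto simp: projective_module_def)
  then show ?thesis using assms by (simp add: projective_cover_iff)
qed

lemma projective_cover_min:
  assumes "projective_cover \<Lambda> P f M" "right_module \<Lambda> M" "rsubmodule \<Lambda> N P" "f ` N = carrier M"
  shows "N = carrier P"
proof -
  have "right_module \<Lambda> P" using assms(1) by (auto simp: projective_cover_def projective_module_def)
  then show ?thesis using assms by (simp add: projective_cover_iff)
qed

lemma projective_module_fd: "projective_module \<Lambda> P \<Longrightarrow> fd_right_module \<Lambda> P"
  by (simp add: projective_module_def)

lemma projective_lift:
  fixes N L :: "('k::field, 'a) fdmod"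
  assumes "projective_module \<Lambda> P" "fd_right_module \<Lambda> N" "fd_right_module \<Lambda> L"
    "g \<in> rmodule_hom \<Lambda> N L" "g ` carrier N = carrier L" "f \<in> rmodule_hom \<Lambda> P L"
  obtains h where "h \<in> rmodule_hom \<Lambda> P N" "\<And>x. x \<in> carrier P \<Longrightarrow> g (h x) = f x"
  using assms(1)[unfolded projective_module_def, THEN conjunct2, rule_format, of N L g f] assms(2-) that
  by auto

text \<open>A lifting problem on \<open>P'\<close> becomes one on \<open>P\<close> by composing with
  \<open>\<phi>\<close>; its solution is pulled back along the inverse.\<close>

lemma projective_module_iso:
  fixes P :: "('k::field, 'm, 'a) right_module" and P' :: "('k, 'n, 'a) right_module"
  assumes P: "projective_module \<Lambda> P" and P': "fd_right_module \<Lambda> P'"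
    and \<phi>: "\<phi> \<in> rmodule_hom \<Lambda> P P'" "bij_betw \<phi> (carrier P) (carrier P')"
  shows "projective_module \<Lambda> P'"
  unfolding projective_module_def
proof (intro conjI allI impI P')
  let ?\<psi> = "inv_into (carrier P) \<phi>"
  have \<psi>: "?\<psi> \<in> rmodule_hom \<Lambda> P' P"
    using rmodule_hom_inv_into[OF _ \<phi>] P by (auto simp: projective_module_def)
  fix N L :: "('k, 'a) fdmod" and g f
  assume *: "fd_right_module \<Lambda> N \<and> fd_right_module \<Lambda> L \<and>
        g \<in> rmodule_hom \<Lambda> N L \<and> g ` carrier N = carrier L \<and> f \<in> rmodule_hom \<Lambda> P' L"
  then have "(\<lambda>x. f (\<phi> x)) \<in> rmodule_hom \<Lambda> P L"
    using rmodule_hom_comp[OF \<phi>(1), of f L] by simp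
  then obtain h where h: "h \<in> rmodule_hom \<Lambda> P N" "\<And>x. x \<in> carrier P \<Longrightarrow> g (h x) = f (\<phi> x)"
    using projective_lift[OF P, of N L g "\<lambda>x. f (\<phi> x)"] * by auto
  have "g (h (?\<psi> x)) = f x" if "x \<in> carrier P'" for x
    using h(2)[of "?\<psi> x"] \<phi>(2) that by (simp add: bij_betw_def f_inv_into_f inv_into_into)
  then show "\<exists>h\<in>rmodule_hom \<Lambda> P' N. \<forall>x\<in>carrier P'. g (h x) = f x"
    by (intro bexI[OF _ rmodule_hom_comp[OF \<psi> h(1)]]) simp
qed

lemma projective_cover_hom:
  assumes "projective_cover \<Lambda> P f M"
  shows "f \<in> rmodule_hom \<Lambda> P M" "f ` carrier P = carrier M" "projective_module \<Lambda> P" "fd_right_module \<Lambda> P"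
  using assms by (auto simp: projective_cover_def projective_module_def)

text \<open>A chosen syzygy is known only up to isomorphism. This moves a cover of a concrete model
  to it, with the same kernel because \<open>\<theta>\<close> is injective.\<close>

lemma projective_cover_iso_target:
  assumes cov: "projective_cover \<Lambda> P f M" and M: "right_module \<Lambda> M" and N: "right_module \<Lambda> N"
    and \<theta>: "\<theta> \<in> rmodule_hom \<Lambda> M N" "bij_betw \<theta> (carrier M) (carrier N)"
  shows "projective_cover \<Lambda> P (\<lambda>x. \<theta> (f x)) N"
    and "hom_kernel P N (\<lambda>x. \<theta> (f x)) = hom_kernel P M f"
proof -
  note P = projective_cover_hom[OF cov]
  have rP: "right_module \<Lambda> P" using P(4) by auto
  have \<theta>0: "\<theta> \<zero>\<^bsub>M\<^esub> = \<zero>\<^bsub>N\<^esub>" by (rule rmodule_hom_zero[OF M N \<theta>(1)])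
  have inj: "inj_on \<theta> (carrier M)" and surj: "\<theta> ` carrier M = carrier N"
    using \<theta>(2) by (auto simp: bij_betw_def)
  have im: "\<theta> ` (f ` A) = carrier N \<longleftrightarrow> f ` A = carrier M" if "A \<subseteq> carrier P" for A
  proof -
    have "f ` A \<subseteq> carrier M" using that rmodule_homD(1)[OF P(1)] by auto
    then have "\<theta> ` (f ` A) = \<theta> ` carrier M \<longleftrightarrow> f ` A = carrier M"
      by (rule inj_on_image_eq_iff[OF inj _ order_refl])
    then show ?thesis using surj by simp
  qed
  have eq: "(\<lambda>x. \<theta> (f x)) ` A = \<theta> ` (f ` A)" for A by auto
  have rsub: "A \<subseteq> carrier P" if "rsubmodule \<Lambda> A P" for A
    using that by (simp add: right_module.rsubmodule_iff[OF rP])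
  show "projective_cover \<Lambda> P (\<lambda>x. \<theta> (f x)) N"
  proof (rule projective_coverI[OF P(3) N rmodule_hom_comp[OF P(1) \<theta>(1)]])
    show "(\<lambda>x. \<theta> (f x)) ` carrier P = carrier N"
      using im[of "carrier P"] P(2) by (simp add: eq)
    show "A = carrier P" if "rsubmodule \<Lambda> A P" "(\<lambda>x. \<theta> (f x)) ` A = carrier N" for A
      using projective_cover_min[OF cov M that(1)] im[OF rsub[OF that(1)]] that(2) by (simp add: eq)
  qed
  have "\<theta> (f x) = \<zero>\<^bsub>N\<^esub> \<longleftrightarrow> f x = \<zero>\<^bsub>M\<^esub>" if "x \<in> carrier P" for x
    using inj_onD[OF inj, of "f x" "\<zero>\<^bsub>M\<^esub>"] \<theta>0 rmodule_homD(1)[OF P(1) that] right_module.M_zero[OF M]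
    by auto
  then show "hom_kernel P N (\<lambda>x. \<theta> (f x)) = hom_kernel P M f"
    by (auto simp: hom_kernel_def)
qed

lemma rmodule_hom_restrict:
  assumes "h \<in> rmodule_hom \<Lambda> P P'" "K \<subseteq> carrier P" "h ` K \<subseteq> K'"
  shows "h \<in> rmodule_hom \<Lambda> (P\<lparr>carrier := K\<rparr>) (P'\<lparr>carrier := K'\<rparr>)"
  using assms by (auto simp: rmodule_hom_iff subset_iff)

lemma cover_kernel_iso_source:
  assumes P: "right_module \<Lambda> P" and \<phi>: "\<phi> \<in> rmodule_hom \<Lambda> P P'" "bij_betw \<phi> (carrier P) (carrier P')"
    and eq: "\<And>x. x \<in> carrier P \<Longrightarrow> f' (\<phi> x) = f x"
  shows "rmodule_iso \<Lambda> (P\<lparr>carrier := hom_kernel P M f\<rparr>) (P'\<lparr>carrier := hom_kernel P' M f'\<rparr>)"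
proof -
  have *: "\<phi> ` hom_kernel P M f = hom_kernel P' M f'"
  proof (intro equalityI subsetI)
    fix y assume "y \<in> hom_kernel P' M f'"
    then have y: "y \<in> carrier P'" "f' y = \<zero>\<^bsub>M\<^esub>" by (auto simp: hom_kernel_def)
    then obtain x where "x \<in> carrier P" "y = \<phi> x" using \<phi>(2) by (auto simp: bij_betw_def)
    then show "y \<in> \<phi> ` hom_kernel P M f" using y eq by (auto simp: hom_kernel_def)
  qed (auto simp: hom_kernel_def eq rmodule_homD(1)[OF \<phi>(1)])
  have sub: "hom_kernel P M f \<subseteq> carrier P" by (auto simp: hom_kernel_def)
  have "\<phi> \<in> rmodule_hom \<Lambda> (P\<lparr>carrier := hom_kernel P M f\<rparr>) (P'\<lparr>carrier := hom_kernel P' M f'\<rparr>)"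
    using \<phi> sub * by (intro rmodule_hom_restrict) auto
  moreover have "bij_betw \<phi> (hom_kernel P M f) (hom_kernel P' M f')"
    by (rule bij_betw_subset[OF \<phi>(2) sub *])
  ultimately show ?thesis unfolding rmodule_iso_def by (intro bexI[of _ \<phi>]) auto
qed

text \<open>Lifting \<open>f\<close> through \<open>f'\<close> gives \<open>h\<close>. Minimality of
  the second cover makes \<open>h\<close> onto, projectivity of \<open>P'\<close> splits it by
  \<open>s\<close>, and minimality of the first cover makes \<open>s\<close> onto, so
  \<open>h\<close> is injective as well.\<close>

lemma cover_kernel_unique:
  fixes P P' M :: "('k::field, 'a) fdmod"
  assumes M: "fd_right_module \<Lambda> M" and cov: "projective_cover \<Lambda> P f M" and cov': "projective_cover \<Lambda> P' f' M"
  shows "rmodule_iso \<Lambda> (P\<lparr>carrier := hom_kernel P M f\<rparr>) (P'\<lparr>carrier := hom_kernel P' M f'\<rparr>)"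
proof -
  note P = projective_cover_hom[OF cov] and P' = projective_cover_hom[OF cov']
  have rP: "right_module \<Lambda> P" and rP': "right_module \<Lambda> P'" and rM: "right_module \<Lambda> M"
    using P P' M by auto
  interpret P: right_module \<Lambda> P by (fact rP)
  interpret P': right_module \<Lambda> P' by (fact rP')
  note min = projective_cover_min[OF cov rM] and min' = projective_cover_min[OF cov' rM]
  obtain h where h: "h \<in> rmodule_hom \<Lambda> P P'" "\<And>x. x \<in> carrier P \<Longrightarrow> f' (h x) = f x"
    by (rule projective_lift[OF P(3) P'(4) M P'(1,2) P(1)]) (rule that, auto)
  have surj: "h ` carrier P = carrier P'"
  proof (rule min')
    show "rsubmodule \<Lambda> (h ` carrier P) P'"
      by (rule image_rsubmodule[OF rP rP' h(1) P.rsubmodule_carrier])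
    show "f' ` h ` carrier P = carrier M"
      using h(2) P(2) by (simp add: image_image)
  qed
  obtain s where s: "s \<in> rmodule_hom \<Lambda> P' P" "\<And>y. y \<in> carrier P' \<Longrightarrow> h (s y) = y"
    by (rule projective_lift[OF P'(3) P(4) P'(4) h(1) surj rmodule_hom_id]) (rule that, auto)
  have im_s: "s ` carrier P' = carrier P"
  proof (rule min)
    show "rsubmodule \<Lambda> (s ` carrier P') P"
      by (rule image_rsubmodule[OF rP' rP s(1) P'.rsubmodule_carrier])
    have "f (s y) = f' y" if "y \<in> carrier P'" for y
      using h(2)[of "s y"] s that rmodule_homD(1)[OF s(1)] by simp
    then show "f ` s ` carrier P' = carrier M"
      using P'(2) by (simp add: image_image)
  qed
  have "inj_on h (carrier P)"
  proof (intro inj_onI)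
    fix x y assume "x \<in> carrier P" "y \<in> carrier P" and xy: "h x = h y"
    then have "x \<in> s ` carrier P'" "y \<in> s ` carrier P'"
      using im_s by auto
    then obtain x' y' where "x' \<in> carrier P'" "y' \<in> carrier P'" "x = s x'" "y = s y'"
      by (elim imageE) auto
    then show "x = y" using xy s(2)[of x'] s(2)[of y'] by simp
  qed
  then have "bij_betw h (carrier P) (carrier P')"
    using surj by (simp add: bij_betw_def)
  then show ?thesis
    using cover_kernel_iso_source[OF rP h(1), of f' f M] h(2) by simp
qed

text \<open>Makes the Hilbert choice computable from any cover, on any carrier type: the copy of the
  cover of type \<open>fdmod\<close> shows that the choice has a witness, and uniqueness of the
  kernel does the rest.\<close>

lemma (in k_algebra) syzygy_iso:
  fixes P :: "('k, 'm, 'a) right_module" and M :: "('k, 'a) fdmod"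
  assumes M: "fd_right_module \<Lambda> M" and cov: "projective_cover \<Lambda> P f M"
  shows "rmodule_iso \<Lambda> (P\<lparr>carrier := hom_kernel P M f\<rparr>) (syzygy \<Lambda> M)"
    and "fd_right_module \<Lambda> (syzygy \<Lambda> M)"
proof -
  note P = projective_cover_hom[OF cov]
  have rM: "right_module \<Lambda> M" and rP: "right_module \<Lambda> P"
    using M P by auto
  obtain P' :: "('k, 'a) fdmod" and \<phi> where P': "fd_right_module \<Lambda> P'" "\<phi> \<in> rmodule_hom \<Lambda> P P'"
    "bij_betw \<phi> (carrier P) (carrier P')"
    using fdmod_copy[OF P(4)] by blast
  have rP': "right_module \<Lambda> P'" using P' by auto
  interpret P: right_module \<Lambda> P by (fact rP)
  let ?\<psi> = "inv_into (carrier P) \<phi>"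
  have \<psi>: "?\<psi> \<in> rmodule_hom \<Lambda> P' P" "?\<psi> ` carrier P' = carrier P"
    using rmodule_hom_inv_into[OF rP P'(2,3)] bij_betw_inv_into[OF P'(3)] by (auto simp: bij_betw_def)
  define f' where "f' = (\<lambda>x. f (?\<psi> x))"
  have eq: "f' (\<phi> x) = f x" if "x \<in> carrier P" for x
    using P'(3) that by (simp add: f'_def bij_betw_def)
  have im: "f' ` A = f ` ?\<psi> ` A" for A
    by (simp add: f'_def image_image)
  have cov': "projective_cover \<Lambda> P' f' M"
  proof (rule projective_coverI[OF projective_module_iso[OF P(3) P'] rM])
    show "f' \<in> rmodule_hom \<Lambda> P' M" unfolding f'_def by (rule rmodule_hom_comp[OF \<psi>(1) P(1)])
    show "f' ` carrier P' = carrier M" using \<psi>(2) P(2) im[of "carrier P'"] by simp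
    fix N assume N: "rsubmodule \<Lambda> N P'" "f' ` N = carrier M"
    have "?\<psi> ` N = carrier P"
      by (rule projective_cover_min[OF cov rM image_rsubmodule[OF rP' rP \<psi>(1) N(1)]])
        (simp add: im[symmetric] N(2))
    then have "?\<psi> ` N = ?\<psi> ` carrier P'" using \<psi>(2) by simp
    moreover have "N \<subseteq> carrier P'" using N(1) by (simp add: right_module.rsubmodule_iff[OF rP'])
    ultimately show "N = carrier P'"
      using inj_on_image_eq_iff[OF bij_betw_imp_inj_on[OF bij_betw_inv_into[OF P'(3)]], of N "carrier P'"]
      by simp
  qed
  \<comment> \<open>Without such a witness nothing could be said about the record that
    \<open>syzygy\<close> selects.\<close>
  have "\<exists>(\<Omega> :: ('k, 'a) fdmod) P f. projective_cover \<Lambda> P f M \<and> \<Omega> = P\<lparr>carrier := hom_kernel P M f\<rparr>"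
    using cov' by (intro exI conjI) (assumption, rule refl)
  then have "\<exists>P f. projective_cover \<Lambda> P f M \<and> syzygy \<Lambda> M = P\<lparr>carrier := hom_kernel P M f\<rparr>"
    unfolding syzygy_def by (rule someI_ex)
  then obtain P0 :: "('k, 'a) fdmod" and f0 where
    c0: "projective_cover \<Lambda> P0 f0 M" "syzygy \<Lambda> M = P0\<lparr>carrier := hom_kernel P0 M f0\<rparr>"
    by blast
  have "rmodule_iso \<Lambda> (P\<lparr>carrier := hom_kernel P M f\<rparr>) (P'\<lparr>carrier := hom_kernel P' M f'\<rparr>)"
    using cover_kernel_iso_source[OF rP P'(2,3), of f' f M] eq by simp
  moreover have "rmodule_iso \<Lambda> (P'\<lparr>carrier := hom_kernel P' M f'\<rparr>) (syzygy \<Lambda> M)"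
    using cover_kernel_unique[OF M cov' c0(1)] c0(2) by simp
  ultimately show "rmodule_iso \<Lambda> (P\<lparr>carrier := hom_kernel P M f\<rparr>) (syzygy \<Lambda> M)"
    by (rule rmodule_iso_trans)
  note P0 = projective_cover_hom[OF c0(1)]
  show "fd_right_module \<Lambda> (syzygy \<Lambda> M)"
    using fd_right_module.submodule_fd[OF P0(4) hom_kernel_rsubmodule[OF _ rM P0(1)]] P0(4) c0(2) by auto
qed

section \<open>Algebras with a Gabriel quiver\<close>

lemma (in abelian_monoid) finsum_single:
  assumes "finite A" "i \<in> A" "x \<in> carrier G" "\<And>j. \<lbrakk>j \<in> A; j \<noteq> i\<rbrakk> \<Longrightarrow> f j = \<zero>" "f i = x"
  shows "finsum G f A = x"
proof -
  have "finsum G f A = (\<Oplus>j\<in>A. if i = j then x else \<zero>)"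
    using assms by (intro finsum_cong') auto
  then show ?thesis
    using add.finprod_singleton[of i A "\<lambda>_. x"] assms by simp
qed

text \<open>
  Think of \<open>e u\<close> and \<open>g \<gamma>\<close> as the classes of the trivial paths and of the arrows in \<open>KQ/I\<close>.  The functionals
  \<open>eps u\<close> and \<open>dl \<gamma>\<close> read off their coefficients; they descend to the quotient because an admissible
  ideal lies in the square of the arrow ideal.
\<close>

locale bound_quiver = k_algebra \<Lambda> for \<Lambda> :: "('k::field, 'a) module" (structure) +
  fixes Q :: "('v, 'e) pre_digraph" and e :: "'v \<Rightarrow> 'a" and g :: "'e \<Rightarrow> 'a"
    and eps :: "'v \<Rightarrow> 'a \<Rightarrow> 'k" and dl :: "'e \<Rightarrow> 'a \<Rightarrow> 'k" and m :: nat
  assumes Q: "fin_digraph Q"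
    and e_closed [simp]: "u \<in> verts Q \<Longrightarrow> e u \<in> carrier \<Lambda>"
    and g_closed [simp]: "\<gamma> \<in> arcs Q \<Longrightarrow> g \<gamma> \<in> carrier \<Lambda>"
    and e_e: "\<lbrakk>u \<in> verts Q; v \<in> verts Q\<rbrakk> \<Longrightarrow> e u \<otimes> e v = (if u = v then e u else \<zero>)"
    and one_e: "\<one> = (\<Oplus>u\<in>verts Q. e u)"
    and e_g: "\<lbrakk>u \<in> verts Q; \<gamma> \<in> arcs Q\<rbrakk> \<Longrightarrow> e u \<otimes> g \<gamma> = (if u = tail Q \<gamma> then g \<gamma> else \<zero>)"
    and g_e: "\<lbrakk>u \<in> verts Q; \<gamma> \<in> arcs Q\<rbrakk> \<Longrightarrow> g \<gamma> \<otimes> e u = (if u = head Q \<gamma> then g \<gamma> else \<zero>)"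
    and eps_add: "\<lbrakk>u \<in> verts Q; a \<in> carrier \<Lambda>; b \<in> carrier \<Lambda>\<rbrakk> \<Longrightarrow> eps u (a \<oplus> b) = eps u a + eps u b"
    and eps_smult: "\<lbrakk>u \<in> verts Q; a \<in> carrier \<Lambda>\<rbrakk> \<Longrightarrow> eps u (c \<odot> a) = c * eps u a"
    and eps_mult: "\<lbrakk>u \<in> verts Q; a \<in> carrier \<Lambda>; b \<in> carrier \<Lambda>\<rbrakk> \<Longrightarrow> eps u (a \<otimes> b) = eps u a * eps u b"
    and eps_e: "\<lbrakk>u \<in> verts Q; v \<in> verts Q\<rbrakk> \<Longrightarrow> eps u (e v) = (if u = v then 1 else 0)"
    and eps_g: "\<lbrakk>u \<in> verts Q; \<gamma> \<in> arcs Q\<rbrakk> \<Longrightarrow> eps u (g \<gamma>) = 0"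
    and dl_add: "\<lbrakk>\<gamma> \<in> arcs Q; a \<in> carrier \<Lambda>; b \<in> carrier \<Lambda>\<rbrakk> \<Longrightarrow> dl \<gamma> (a \<oplus> b) = dl \<gamma> a + dl \<gamma> b"
    and dl_smult: "\<lbrakk>\<gamma> \<in> arcs Q; a \<in> carrier \<Lambda>\<rbrakk> \<Longrightarrow> dl \<gamma> (c \<odot> a) = c * dl \<gamma> a"
    and dl_mult: "\<lbrakk>\<gamma> \<in> arcs Q; a \<in> carrier \<Lambda>; b \<in> carrier \<Lambda>\<rbrakk> \<Longrightarrow>
      dl \<gamma> (a \<otimes> b) = eps (tail Q \<gamma>) a * dl \<gamma> b + dl \<gamma> a * eps (head Q \<gamma>) b"
    and dl_g: "\<lbrakk>\<gamma> \<in> arcs Q; \<delta> \<in> arcs Q\<rbrakk> \<Longrightarrow> dl \<gamma> (g \<delta>) = (if \<gamma> = \<delta> then 1 else 0)"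
    and path_induct: "\<lbrakk>a \<in> carrier \<Lambda>; R \<zero>;
      \<And>x y. \<lbrakk>x \<in> carrier \<Lambda>; y \<in> carrier \<Lambda>; R x; R y\<rbrakk> \<Longrightarrow> R (x \<oplus> y);
      \<And>c u p. \<lbrakk>u \<in> verts Q; set p \<subseteq> arcs Q\<rbrakk> \<Longrightarrow> R (c \<odot> (e u \<otimes> foldr (\<lambda>\<gamma> b. g \<gamma> \<otimes> b) p \<one>))\<rbrakk> \<Longrightarrow> R a"
    and nilpotent: "\<lbrakk>set p \<subseteq> arcs Q; length p = m\<rbrakk> \<Longrightarrow> foldr (\<lambda>\<gamma> b. g \<gamma> \<otimes> b) p \<one> = \<zero>"
begin

section \<open>Words in the arrows, and the splitting of the algebra into vertex part and
  radical\<close>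

lemma finite_Q [simp]: "finite (verts Q)" "finite (arcs Q)"
  and ends_Q [simp]: "\<gamma> \<in> arcs Q \<Longrightarrow> tail Q \<gamma> \<in> verts Q" "\<gamma> \<in> arcs Q \<Longrightarrow> head Q \<gamma> \<in> verts Q"
  using Q by (auto simp: fin_digraph_def fin_digraph_axioms_def wf_digraph_def)

text \<open>Arbitrary lists are allowed: a list that is not a path has product zero, because
  \<open>g \<gamma> = g \<gamma> \<otimes> e (head Q \<gamma>)\<close> and this idempotent kills
  every arrow that starts elsewhere. Inductions can thus range over all pairs of a vertex and a list
  of arrows.\<close>

definition w :: "'e list \<Rightarrow> 'a" where
  "w p = foldr (\<lambda>\<gamma> b. g \<gamma> \<otimes> b) p \<one>"

lemma w_Nil [simp]: "w [] = \<one>" and w_Cons: "w (\<gamma> # p) = g \<gamma> \<otimes> w p"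
  by (simp_all add: w_def)

lemma w_closed [simp]: "set p \<subseteq> arcs Q \<Longrightarrow> w p \<in> carrier \<Lambda>"
  by (induction p) (auto simp: w_Cons)

lemma w_append: "\<lbrakk>set p \<subseteq> arcs Q; set q \<subseteq> arcs Q\<rbrakk> \<Longrightarrow> w (p @ q) = w p \<otimes> w q"
  by (induction p) (auto simp: w_Cons m_assoc)

lemma w_snoc: "\<lbrakk>set p \<subseteq> arcs Q; \<gamma> \<in> arcs Q\<rbrakk> \<Longrightarrow> w (p @ [\<gamma>]) = w p \<otimes> g \<gamma>"
  by (simp add: w_append w_Cons)

lemma w_long:
  assumes "set p \<subseteq> arcs Q" "m \<le> length p"
  shows "w p = \<zero>"
proof -
  have s: "set (take m p) \<subseteq> arcs Q" "set (drop m p) \<subseteq> arcs Q"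
    using assms(1) set_take_subset[of m p] set_drop_subset[of m p] by auto
  have "w (take m p) = \<zero>"
    using nilpotent[OF s(1)] assms(2) by (simp add: w_def)
  then show ?thesis
    using w_append[OF s] s by simp
qed

lemma path_induct' [consumes 1, case_names zero add path]:
  assumes "a \<in> carrier \<Lambda>" "R \<zero>"
    "\<And>x y. \<lbrakk>x \<in> carrier \<Lambda>; y \<in> carrier \<Lambda>; R x; R y\<rbrakk> \<Longrightarrow> R (x \<oplus> y)"
    "\<And>c u p. \<lbrakk>u \<in> verts Q; set p \<subseteq> arcs Q\<rbrakk> \<Longrightarrow> R (c \<odot> (e u \<otimes> w p))"
  shows "R a"
  using path_induct[of a R] assms unfolding w_def by blast

lemma eps_zero [simp]: "u \<in> verts Q \<Longrightarrow> eps u \<zero> = 0"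
  using eps_smult[of u \<zero> 0] by simp

lemma dl_zero [simp]: "\<gamma> \<in> arcs Q \<Longrightarrow> dl \<gamma> \<zero> = 0"
  using dl_smult[of \<gamma> \<zero> 0] by simp

lemma eps_one: "u \<in> verts Q \<Longrightarrow> eps u \<one> = 1"
  using eps_mult[of u "e u" \<one>] by (simp add: eps_e)

lemma e_nonzero: "u \<in> verts Q \<Longrightarrow> e u \<noteq> \<zero>"
  using eps_e[of u u] by auto

lemma g_nonzero: "\<gamma> \<in> arcs Q \<Longrightarrow> g \<gamma> \<noteq> \<zero>"
  using dl_g[of \<gamma> \<gamma>] by auto

text \<open>The semisimple part of \<open>a\<close>: its class modulo the radical, lifted to the
  span of the \<open>e u\<close>.\<close>

definition vpart :: "'a \<Rightarrow> 'a" where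
  "vpart a = (\<Oplus>u\<in>verts Q. eps u a \<odot> e u)"

lemma vpart_closed [simp]: "vpart a \<in> carrier \<Lambda>"
  unfolding vpart_def by (auto intro!: finsum_closed)

lemma vpart_add:
  assumes "a \<in> carrier \<Lambda>" "b \<in> carrier \<Lambda>"
  shows "vpart (a \<oplus> b) = vpart a \<oplus> vpart b"
proof -
  have "vpart (a \<oplus> b) = (\<Oplus>u\<in>verts Q. eps u a \<odot> e u \<oplus> eps u b \<odot> e u)"
    unfolding vpart_def using assms by (intro finsum_cong') (auto simp: eps_add add_smult)
  also have "\<dots> = vpart a \<oplus> vpart b"
    unfolding vpart_def by (intro finsum_addf) auto
  finally show ?thesis .
qed

lemma vpart_eq_zero:
  assumes "\<And>u. u \<in> verts Q \<Longrightarrow> eps u a = 0"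
  shows "vpart a = \<zero>"
proof -
  have "vpart a = (\<Oplus>u\<in>verts Q. \<zero>)"
    unfolding vpart_def using assms by (intro finsum_cong') auto
  then show ?thesis by simp
qed

lemma vpart_e:
  assumes "u \<in> verts Q"
  shows "vpart (c \<odot> e u) = c \<odot> e u"
  unfolding vpart_def
  by (rule finsum_single[where i = u]) (use assms in \<open>auto simp: eps_smult eps_e\<close>)

lemma eps_path:
  assumes "set p \<subseteq> arcs Q" "p \<noteq> []" "u \<in> verts Q"
  shows "eps u (w p) = 0"
  using assms by (cases p) (auto simp: w_Cons eps_mult eps_g)

lemma vpart_path:
  assumes "set p \<subseteq> arcs Q" "p \<noteq> []" "u \<in> verts Q"
  shows "vpart (c \<odot> (e u \<otimes> w p)) = \<zero>"
  using assms by (intro vpart_eq_zero) (simp add: eps_smult eps_mult eps_path)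

text \<open>Every nonempty word begins with an arrow, so the radical is the sum of the right ideals
  generated by the arrows. The left form is what \<open>pi\<close> and \<open>socle_act\<close>
  need; the mirror form below splits off the last arrow and fits Nakayama's lemma.\<close>

lemma left_decomposition:
  assumes "a \<in> carrier \<Lambda>"
  obtains l where "\<And>\<gamma>. \<gamma> \<in> arcs Q \<Longrightarrow> l \<gamma> \<in> carrier \<Lambda>" "a = vpart a \<oplus> (\<Oplus>\<gamma>\<in>arcs Q. g \<gamma> \<otimes> l \<gamma>)"
proof -
  have "\<exists>l. (\<forall>\<gamma>\<in>arcs Q. l \<gamma> \<in> carrier \<Lambda>) \<and> a = vpart a \<oplus> (\<Oplus>\<gamma>\<in>arcs Q. g \<gamma> \<otimes> l \<gamma>)"
    using assms
  proof (induction rule: path_induct')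
    case zero
    show ?case
      by (rule exI[of _ "\<lambda>_. \<zero>"]) (simp add: vpart_eq_zero)
  next
    case (add x y)
    then obtain l l' where l: "\<forall>\<gamma>\<in>arcs Q. l \<gamma> \<in> carrier \<Lambda>" "x = vpart x \<oplus> (\<Oplus>\<gamma>\<in>arcs Q. g \<gamma> \<otimes> l \<gamma>)"
      "\<forall>\<gamma>\<in>arcs Q. l' \<gamma> \<in> carrier \<Lambda>" "y = vpart y \<oplus> (\<Oplus>\<gamma>\<in>arcs Q. g \<gamma> \<otimes> l' \<gamma>)"
      by blast
    have "(\<Oplus>\<gamma>\<in>arcs Q. g \<gamma> \<otimes> (l \<gamma> \<oplus> l' \<gamma>)) = (\<Oplus>\<gamma>\<in>arcs Q. (g \<gamma> \<otimes> l \<gamma>) \<oplus> (g \<gamma> \<otimes> l' \<gamma>))"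
      using l by (intro finsum_cong') (auto simp: r_distr)
    also have "\<dots> = (\<Oplus>\<gamma>\<in>arcs Q. g \<gamma> \<otimes> l \<gamma>) \<oplus> (\<Oplus>\<gamma>\<in>arcs Q. g \<gamma> \<otimes> l' \<gamma>)"
      using l by (intro finsum_addf) auto
    finally have s: "(\<Oplus>\<gamma>\<in>arcs Q. g \<gamma> \<otimes> (l \<gamma> \<oplus> l' \<gamma>)) = (\<Oplus>\<gamma>\<in>arcs Q. g \<gamma> \<otimes> l \<gamma>) \<oplus> (\<Oplus>\<gamma>\<in>arcs Q. g \<gamma> \<otimes> l' \<gamma>)" .
    have c: "(\<Oplus>\<gamma>\<in>arcs Q. g \<gamma> \<otimes> l \<gamma>) \<in> carrier \<Lambda>" "(\<Oplus>\<gamma>\<in>arcs Q. g \<gamma> \<otimes> l' \<gamma>) \<in> carrier \<Lambda>"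
      using l by (auto intro!: finsum_closed)
    have "x \<oplus> y = (vpart x \<oplus> (\<Oplus>\<gamma>\<in>arcs Q. g \<gamma> \<otimes> l \<gamma>)) \<oplus> (vpart y \<oplus> (\<Oplus>\<gamma>\<in>arcs Q. g \<gamma> \<otimes> l' \<gamma>))"
      using l(2,4) by simp
    also have "\<dots> = vpart (x \<oplus> y) \<oplus> (\<Oplus>\<gamma>\<in>arcs Q. g \<gamma> \<otimes> (l \<gamma> \<oplus> l' \<gamma>))"
      using add(1,2) c by (simp add: s vpart_add a_ac)
    finally show ?case
      using l by (intro exI[of _ "\<lambda>\<gamma>. l \<gamma> \<oplus> l' \<gamma>"]) auto
  next
    case (path c u p)
    show ?case
    proof (cases p)
      case Nil
      then show ?thesis
        using path by (intro exI[of _ "\<lambda>_. \<zero>"]) (simp add: vpart_e)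
    next
      case (Cons \<delta> q)
      then have \<delta>: "\<delta> \<in> arcs Q" "set q \<subseteq> arcs Q" using path by auto
      \<comment> \<open>If \<open>u\<close> is not the tail of the first arrow, then
        \<open>e u\<close> kills the word and all coefficients are 0.\<close>
      let ?l = "\<lambda>\<gamma>. if \<gamma> = \<delta> \<and> u = tail Q \<delta> then c \<odot> w q else \<zero>"
      have "(\<Oplus>\<gamma>\<in>arcs Q. g \<gamma> \<otimes> ?l \<gamma>) = c \<odot> (e u \<otimes> w p)"
        using \<delta> path(1) by (intro finsum_single[where i = \<delta>])
          (auto simp: Cons w_Cons e_g smult_mult_right m_assoc[symmetric])
      then show ?thesis
        using path \<delta> by (intro exI[of _ ?l]) (auto simp: vpart_path Cons)
    qed
  qed
  then show ?thesis using that by blast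
qed

lemma right_decomposition:
  assumes "a \<in> carrier \<Lambda>"
  obtains r where "\<And>\<gamma>. \<gamma> \<in> arcs Q \<Longrightarrow> r \<gamma> \<in> carrier \<Lambda>" "a = vpart a \<oplus> (\<Oplus>\<gamma>\<in>arcs Q. r \<gamma> \<otimes> g \<gamma>)"
proof -
  have "\<exists>l. (\<forall>\<gamma>\<in>arcs Q. l \<gamma> \<in> carrier \<Lambda>) \<and> a = vpart a \<oplus> (\<Oplus>\<gamma>\<in>arcs Q. l \<gamma> \<otimes> g \<gamma>)"
    using assms
  proof (induction rule: path_induct')
    case zero
    show ?case
      by (rule exI[of _ "\<lambda>_. \<zero>"]) (simp add: vpart_eq_zero)
  next
    case (add x y)
    then obtain l l' where l: "\<forall>\<gamma>\<in>arcs Q. l \<gamma> \<in> carrier \<Lambda>" "x = vpart x \<oplus> (\<Oplus>\<gamma>\<in>arcs Q. l \<gamma> \<otimes> g \<gamma>)"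
      "\<forall>\<gamma>\<in>arcs Q. l' \<gamma> \<in> carrier \<Lambda>" "y = vpart y \<oplus> (\<Oplus>\<gamma>\<in>arcs Q. l' \<gamma> \<otimes> g \<gamma>)"
      by blast
    have "(\<Oplus>\<gamma>\<in>arcs Q. (l \<gamma> \<oplus> l' \<gamma>) \<otimes> g \<gamma>) = (\<Oplus>\<gamma>\<in>arcs Q. (l \<gamma> \<otimes> g \<gamma>) \<oplus> (l' \<gamma> \<otimes> g \<gamma>))"
      using l by (intro finsum_cong') (auto simp: l_distr)
    also have "\<dots> = (\<Oplus>\<gamma>\<in>arcs Q. l \<gamma> \<otimes> g \<gamma>) \<oplus> (\<Oplus>\<gamma>\<in>arcs Q. l' \<gamma> \<otimes> g \<gamma>)"
      using l by (intro finsum_addf) auto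
    finally have s: "(\<Oplus>\<gamma>\<in>arcs Q. (l \<gamma> \<oplus> l' \<gamma>) \<otimes> g \<gamma>) = (\<Oplus>\<gamma>\<in>arcs Q. l \<gamma> \<otimes> g \<gamma>) \<oplus> (\<Oplus>\<gamma>\<in>arcs Q. l' \<gamma> \<otimes> g \<gamma>)" .
    have c: "(\<Oplus>\<gamma>\<in>arcs Q. l \<gamma> \<otimes> g \<gamma>) \<in> carrier \<Lambda>" "(\<Oplus>\<gamma>\<in>arcs Q. l' \<gamma> \<otimes> g \<gamma>) \<in> carrier \<Lambda>"
      using l by (auto intro!: finsum_closed)
    have "x \<oplus> y = (vpart x \<oplus> (\<Oplus>\<gamma>\<in>arcs Q. l \<gamma> \<otimes> g \<gamma>)) \<oplus> (vpart y \<oplus> (\<Oplus>\<gamma>\<in>arcs Q. l' \<gamma> \<otimes> g \<gamma>))"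
      using l(2,4) by simp
    also have "\<dots> = vpart (x \<oplus> y) \<oplus> (\<Oplus>\<gamma>\<in>arcs Q. (l \<gamma> \<oplus> l' \<gamma>) \<otimes> g \<gamma>)"
      using add(1,2) c by (simp add: s vpart_add a_ac)
    finally show ?case
      using l by (intro exI[of _ "\<lambda>\<gamma>. l \<gamma> \<oplus> l' \<gamma>"]) auto
  next
    case (path c u p)
    show ?case
    proof (cases p rule: rev_cases)
      case Nil
      then show ?thesis
        using path by (intro exI[of _ "\<lambda>_. \<zero>"]) (simp add: vpart_e)
    next
      case (snoc q \<delta>)
      then have \<delta>: "\<delta> \<in> arcs Q" "set q \<subseteq> arcs Q" using path by auto
      \<comment> \<open>Here \<open>e u\<close> is absorbed by the coefficient, so no case
        distinction on \<open>u\<close> arises.\<close>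
      let ?l = "\<lambda>\<gamma>. if \<gamma> = \<delta> then c \<odot> (e u \<otimes> w q) else \<zero>"
      have "(\<Oplus>\<gamma>\<in>arcs Q. ?l \<gamma> \<otimes> g \<gamma>) = c \<odot> (e u \<otimes> w p)"
        using \<delta> path(1) by (intro finsum_single[where i = \<delta>])
          (auto simp: snoc w_snoc smult_mult_left m_assoc)
      then show ?thesis
        using path \<delta> by (intro exI[of _ ?l]) (auto simp: vpart_path snoc)
    qed
  qed
  then show ?thesis using that by blast
qed

text \<open>The finitely many \<open>e u \<otimes> w p\<close> with \<open>p\<close> of length at
  most \<open>m\<close> span, because longer words vanish.\<close>

lemma fd_regular: "fd_right_module \<Lambda> (regular_module \<Lambda>)"
proof -
  let ?B = "(\<lambda>(u, p). e u \<otimes> w p) ` (verts Q \<times> {p. set p \<subseteq> arcs Q \<and> length p \<le> m})"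
  have "vectorspace.fin_dim class_ring (regular_module \<Lambda>)"
  proof (rule reg.fin_dimI[where B = ?B])
    show "finite ?B"
      using finite_lists_length_le[of "arcs Q" m] by (intro finite_imageI finite_cartesian_product) auto
    show "?B \<subseteq> carrier (regular_module \<Lambda>)" by auto
    fix S assume S: "\<zero>\<^bsub>regular_module \<Lambda>\<^esub> \<in> S" "\<And>x y. \<lbrakk>x \<in> S; y \<in> S\<rbrakk> \<Longrightarrow> x \<oplus>\<^bsub>regular_module \<Lambda>\<^esub> y \<in> S"
      "\<And>c x. x \<in> S \<Longrightarrow> c \<odot>\<^bsub>regular_module \<Lambda>\<^esub> x \<in> S" "?B \<subseteq> S"
    show "carrier (regular_module \<Lambda>) \<subseteq> S"
    proof
      fix a assume "a \<in> carrier (regular_module \<Lambda>)"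
      then have "a \<in> carrier \<Lambda>" by simp
      then show "a \<in> S"
      proof (induction rule: path_induct')
        case (path c u p)
        show ?case
        proof (cases "length p \<le> m")
          case True
          then have "e u \<otimes> w p \<in> S" using path S(4) by auto
          then show ?thesis using S(3) by simp
        next
          case False
          then show ?thesis using path S(1) w_long[of p] by simp
        qed
      qed (use S in auto)
    qed
  qed
  then show ?thesis
    using regular by (simp add: fd_right_module_def fd_right_module_axioms_def)
qed

text \<open>As no arrow joins \<open>W\<close> to its complement, the sum \<open>f\<close> of the
  \<open>e u\<close> over \<open>W\<close> is a central idempotent, and the ideals generated by
  \<open>f\<close> and \<open>1 - f\<close> decompose the algebra. If \<open>W\<close> were a proper
  subset, each of them would contain some nonzero \<open>e u\<close>.\<close>

lemma full_vertex_set: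
  assumes ind: "indecomposable_algebra \<Lambda>" and W: "W \<subseteq> verts Q" "W \<noteq> {}"
    and arcs: "\<And>\<gamma>. \<gamma> \<in> arcs Q \<Longrightarrow> tail Q \<gamma> \<in> W \<longleftrightarrow> head Q \<gamma> \<in> W"
  shows "W = verts Q"
proof (rule ccontr)
  assume "W \<noteq> verts Q"
  then obtain k where k: "k \<in> verts Q" "k \<notin> W" using W by auto
  obtain i where i: "i \<in> W" "i \<in> verts Q" using W by auto
  define f where "f = (\<Oplus>u\<in>W. e u)"
  have fW: "finite W" using finite_subset[OF W(1)] by simp
  have f [simp]: "f \<in> carrier \<Lambda>" unfolding f_def using W by (intro finsum_closed) auto
  have fe: "f \<otimes> e u = (if u \<in> W then e u else \<zero>)" if u: "u \<in> verts Q" for u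
  proof -
    have "f \<otimes> e u = (\<Oplus>v\<in>W. e v \<otimes> e u)"
      unfolding f_def using W fW u by (subst finsum_ldistr) auto
    also have "\<dots> = (if u \<in> W then e u else \<zero>)"
    proof (cases "u \<in> W")
      case True
      then show ?thesis using W fW u by (auto intro!: finsum_single[where i = u] simp: e_e subset_iff)
    next
      case False
      then have "(\<Oplus>v\<in>W. e v \<otimes> e u) = (\<Oplus>v\<in>W. \<zero>)"
        using W u by (intro finsum_cong') (auto simp: e_e subset_iff)
      then show ?thesis using False by simp
    qed
    finally show ?thesis .
  qed
  have ef: "e u \<otimes> f = (if u \<in> W then e u else \<zero>)" if u: "u \<in> verts Q" for u
  proof -
    have "e u \<otimes> f = (\<Oplus>v\<in>W. e u \<otimes> e v)"
      unfolding f_def using W fW u by (subst finsum_rdistr) auto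
    also have "\<dots> = (if u \<in> W then e u else \<zero>)"
    proof (cases "u \<in> W")
      case True
      then show ?thesis using W fW u by (auto intro!: finsum_single[where i = u] simp: e_e subset_iff)
    next
      case False
      then have "(\<Oplus>v\<in>W. e u \<otimes> e v) = (\<Oplus>v\<in>W. \<zero>)"
        using W u by (intro finsum_cong') (auto simp: e_e subset_iff)
      then show ?thesis using False by simp
    qed
    finally show ?thesis .
  qed
  have fg: "f \<otimes> g \<gamma> = (if tail Q \<gamma> \<in> W then g \<gamma> else \<zero>)" if "\<gamma> \<in> arcs Q" for \<gamma>
  proof -
    have "f \<otimes> g \<gamma> = f \<otimes> (e (tail Q \<gamma>) \<otimes> g \<gamma>)" using that by (simp add: e_g)
    also have "\<dots> = (f \<otimes> e (tail Q \<gamma>)) \<otimes> g \<gamma>" using that by (simp add: m_assoc)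
    finally show ?thesis using that by (simp add: fe e_g)
  qed
  \<comment> \<open>By the hypothesis on \<open>W\<close>, an arrow absorbs \<open>f\<close> on the
    right exactly if it does so on the left.\<close>
  have gf: "g \<gamma> \<otimes> f = (if tail Q \<gamma> \<in> W then g \<gamma> else \<zero>)" if "\<gamma> \<in> arcs Q" for \<gamma>
  proof -
    have "g \<gamma> \<otimes> f = (g \<gamma> \<otimes> e (head Q \<gamma>)) \<otimes> f" using that by (simp add: g_e)
    also have "\<dots> = g \<gamma> \<otimes> (e (head Q \<gamma>) \<otimes> f)" using that by (simp add: m_assoc)
    finally show ?thesis using that arcs by (simp add: ef g_e)
  qed
  have fw: "f \<otimes> w p = w p \<otimes> f" if "set p \<subseteq> arcs Q" for p
    using that
  proof (induction p)
    case (Cons \<gamma> p)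
    then have c: "\<gamma> \<in> arcs Q" "set p \<subseteq> arcs Q" and IH: "f \<otimes> w p = w p \<otimes> f" by auto
    have "f \<otimes> w (\<gamma> # p) = (f \<otimes> g \<gamma>) \<otimes> w p" using c by (simp add: w_Cons m_assoc)
    also have "\<dots> = g \<gamma> \<otimes> (f \<otimes> w p)" using c by (simp add: fg gf m_assoc[symmetric])
    also have "\<dots> = w (\<gamma> # p) \<otimes> f" using c by (simp add: IH w_Cons m_assoc)
    finally show ?case .
  qed simp
  have central: "f \<otimes> a = a \<otimes> f" if "a \<in> carrier \<Lambda>" for a
    using that
  proof (induction rule: path_induct')
    case (path c u p)
    have "f \<otimes> (e u \<otimes> w p) = (f \<otimes> e u) \<otimes> w p" using path by (simp add: m_assoc)
    also have "\<dots> = e u \<otimes> (f \<otimes> w p)" using path by (simp add: fe ef m_assoc[symmetric])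
    also have "\<dots> = (e u \<otimes> w p) \<otimes> f" using path by (simp add: fw m_assoc)
    finally show ?case using path by (simp add: smult_mult_left smult_mult_right)
  qed (simp_all add: l_distr r_distr)
  have ff: "f \<otimes> f = f"
  proof -
    have "f \<otimes> f = (\<Oplus>v\<in>W. f \<otimes> e v)"
      unfolding f_def using W fW by (subst finsum_rdistr) (auto simp: f_def[symmetric])
    also have "\<dots> = (\<Oplus>v\<in>W. e v)" using W by (intro finsum_cong') (auto simp: fe subset_iff)
    finally show ?thesis by (simp add: f_def)
  qed
  \<comment> \<open>With \<open>h\<close> the identity this is the ideal generated by
    \<open>f\<close>, with \<open>h\<close> zero it is the complement, so one argument covers
    both.\<close>
  have idl: "ideal {a \<in> carrier \<Lambda>. f \<otimes> a = h a} \<Lambda>" if h: "h = (\<lambda>a. a) \<or> h = (\<lambda>a. \<zero>)" for h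
  proof (rule idealI)
    show "ring \<Lambda>" by (rule ring_axioms)
    show "subgroup {a \<in> carrier \<Lambda>. f \<otimes> a = h a} (add_monoid \<Lambda>)"
      using h by (intro add.subgroupI) (auto simp: r_distr r_minus simp flip: a_inv_def intro!: exI[of _ \<zero>])
  next
    fix a x assume a: "a \<in> {a \<in> carrier \<Lambda>. f \<otimes> a = h a}" and x: "x \<in> carrier \<Lambda>"
    have "f \<otimes> (x \<otimes> a) = (f \<otimes> x) \<otimes> a" using a x by (simp add: m_assoc)
    also have "\<dots> = x \<otimes> (f \<otimes> a)" using a x by (simp add: central[OF x] m_assoc)
    finally have "f \<otimes> (x \<otimes> a) = x \<otimes> (f \<otimes> a)" .
    then show "x \<otimes> a \<in> {a \<in> carrier \<Lambda>. f \<otimes> a = h a}" using a x h by auto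
    have "f \<otimes> (a \<otimes> x) = (f \<otimes> a) \<otimes> x" using a x m_assoc[of f a x] by simp
    then show "a \<otimes> x \<in> {a \<in> carrier \<Lambda>. f \<otimes> a = h a}" using a x h by auto
  qed
  define A where "A = {a \<in> carrier \<Lambda>. f \<otimes> a = a}"
  define B where "B = {a \<in> carrier \<Lambda>. f \<otimes> a = \<zero>}"
  have "ideal A \<Lambda>" "ideal B \<Lambda>" unfolding A_def B_def by (rule idl; simp)+
  moreover have "A <+>\<^bsub>\<Lambda>\<^esub> B = carrier \<Lambda>"
  proof
    show "A <+>\<^bsub>\<Lambda>\<^esub> B \<subseteq> carrier \<Lambda>" by (auto simp: mem_set_add A_def B_def)
    show "carrier \<Lambda> \<subseteq> A <+>\<^bsub>\<Lambda>\<^esub> B"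
    proof
      fix a assume a: "a \<in> carrier \<Lambda>"
      have "f \<otimes> a \<in> A" using a ff by (simp add: A_def m_assoc[symmetric])
      moreover have "\<ominus> (f \<otimes> a) \<oplus> a \<in> B"
        using a ff by (simp add: B_def r_distr r_minus m_assoc[symmetric] l_neg)
      moreover have "a = f \<otimes> a \<oplus> (\<ominus> (f \<otimes> a) \<oplus> a)" using a by (simp add: r_neg2)
      ultimately show "a \<in> A <+>\<^bsub>\<Lambda>\<^esub> B" unfolding mem_set_add by blast
    qed
  qed
  moreover have "A \<inter> B = {\<zero>}" by (auto simp: A_def B_def)
  moreover have "e i \<in> A" "e k \<in> B" using i k by (auto simp: A_def B_def fe)
  ultimately show False
    using ind e_nonzero[OF i(2)] e_nonzero[OF k(1)] unfolding indecomposable_algebra_def by blast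
qed

end

section \<open>Socle vectors, Nakayama's lemma and simple modules\<close>

context right_module
begin

lemma rsubmodule_finsum:
  assumes N: "rsubmodule \<Lambda> N M" and J: "finite J" "\<And>j. j \<in> J \<Longrightarrow> f j \<in> N"
  shows "finsum M f J \<in> N"
  using J
proof (induction J rule: finite_induct)
  case empty
  then show ?case using N by (simp add: rsubmodule_iff module.M.finsum_empty)
next
  case (insert j J)
  have NM: "N \<subseteq> carrier M" using N by (simp add: rsubmodule_iff)
  have "finsum M f (insert j J) = f j \<oplus>\<^bsub>M\<^esub> finsum M f J"
    using insert NM by (intro module.M.finsum_insert) auto
  then show ?case using N insert by (simp add: rsubmodule_iff)
qed

lemma act_finsum_left:
  assumes a: "a \<in> carrier \<Lambda>" and J: "finite J" "\<And>j. j \<in> J \<Longrightarrow> f j \<in> carrier M"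
  shows "finsum M f J \<lhd>\<^bsub>M\<^esub> a = finsum M (\<lambda>j. f j \<lhd>\<^bsub>M\<^esub> a) J"
  by (rule finsum_additive[where f = "\<lambda>x. x \<lhd>\<^bsub>M\<^esub> a"])
    (use a J in \<open>auto simp: act_add_left module.M.abelian_monoid_axioms\<close>)

end

context bound_quiver
begin

context
  fixes M :: "('k, 'm, 'a) right_module"
  assumes M: "right_module \<Lambda> M"
begin

interpretation M: right_module \<Lambda> M by (rule M)

lemma act_zero_right: "x \<in> carrier M \<Longrightarrow> x \<lhd>\<^bsub>M\<^esub> \<zero> = \<zero>\<^bsub>M\<^esub>"
  using M.act_smult_right[of x \<zero> 0] by simp

lemma act_finsum_right:
  assumes x: "x \<in> carrier M" and J: "finite J" "\<And>j. j \<in> J \<Longrightarrow> f j \<in> carrier \<Lambda>"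
  shows "x \<lhd>\<^bsub>M\<^esub> finsum \<Lambda> f J = finsum M (\<lambda>j. x \<lhd>\<^bsub>M\<^esub> f j) J"
  by (rule finsum_additive[where f = "\<lambda>a. x \<lhd>\<^bsub>M\<^esub> a"])
    (use x J in \<open>auto simp: M.act_add_right act_zero_right M.module.M.abelian_monoid_axioms abelian_monoid_axioms\<close>)

lemma vertex_sum: "x \<in> carrier M \<Longrightarrow> x = finsum M (\<lambda>u. x \<lhd>\<^bsub>M\<^esub> e u) (verts Q)"
  using act_finsum_right[of x "verts Q" e] M.act_one[of x] by (simp flip: one_e)

text \<open>The radical part of \<open>b\<close> starts with arrows and kills \<open>x\<close>; of
  the vertex part only the term at \<open>i\<close> survives. So the algebra acts on
  \<open>x\<close> through the character \<open>eps i\<close>.\<close>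

lemma socle_act:
  assumes x: "x \<in> carrier M" and i: "i \<in> verts Q" "x \<lhd>\<^bsub>M\<^esub> e i = x"
    and kill: "\<And>\<gamma>. \<gamma> \<in> arcs Q \<Longrightarrow> x \<lhd>\<^bsub>M\<^esub> g \<gamma> = \<zero>\<^bsub>M\<^esub>" and b: "b \<in> carrier \<Lambda>"
  shows "x \<lhd>\<^bsub>M\<^esub> b = eps i b \<odot>\<^bsub>M\<^esub> x"
proof -
  obtain l where l: "\<And>\<gamma>. \<gamma> \<in> arcs Q \<Longrightarrow> l \<gamma> \<in> carrier \<Lambda>" "b = vpart b \<oplus> (\<Oplus>\<gamma>\<in>arcs Q. g \<gamma> \<otimes> l \<gamma>)"
    using left_decomposition[OF b] by blast
  let ?L = "\<Oplus>\<gamma>\<in>arcs Q. g \<gamma> \<otimes> l \<gamma>"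
  have L: "?L \<in> carrier \<Lambda>" using l by (auto intro!: finsum_closed)
  have "x \<lhd>\<^bsub>M\<^esub> ?L = finsum M (\<lambda>\<gamma>. x \<lhd>\<^bsub>M\<^esub> (g \<gamma> \<otimes> l \<gamma>)) (arcs Q)"
    using x l by (intro act_finsum_right) auto
  also have "\<dots> = finsum M (\<lambda>\<gamma>. \<zero>\<^bsub>M\<^esub>) (arcs Q)"
    using x l(1) by (intro M.module.M.finsum_cong') (auto simp: M.act_assoc[symmetric] kill)
  finally have 0: "x \<lhd>\<^bsub>M\<^esub> ?L = \<zero>\<^bsub>M\<^esub>" by (simp add: M.module.M.finsum_zero)
  have xe: "x \<lhd>\<^bsub>M\<^esub> e u = (if u = i then x else \<zero>\<^bsub>M\<^esub>)" if u: "u \<in> verts Q" for u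
  proof -
    have "x \<lhd>\<^bsub>M\<^esub> e u = (x \<lhd>\<^bsub>M\<^esub> e i) \<lhd>\<^bsub>M\<^esub> e u" using i by simp
    also have "\<dots> = x \<lhd>\<^bsub>M\<^esub> (e i \<otimes> e u)" using i(1) u by (intro M.act_assoc[OF x]) auto
    finally show ?thesis using x i u by (simp add: e_e act_zero_right)
  qed
  have "x \<lhd>\<^bsub>M\<^esub> vpart b = finsum M (\<lambda>u. x \<lhd>\<^bsub>M\<^esub> (eps u b \<odot> e u)) (verts Q)"
    unfolding vpart_def using x by (intro act_finsum_right) auto
  also have "\<dots> = eps i b \<odot>\<^bsub>M\<^esub> x"
    using x i by (intro M.module.M.finsum_single[where i = i]) (auto simp: M.act_smult_right xe)
  finally have 1: "x \<lhd>\<^bsub>M\<^esub> vpart b = eps i b \<odot>\<^bsub>M\<^esub> x" .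
  have "x \<lhd>\<^bsub>M\<^esub> b = x \<lhd>\<^bsub>M\<^esub> (vpart b \<oplus> ?L)" using l(2) by simp
  also have "\<dots> = x \<lhd>\<^bsub>M\<^esub> vpart b \<oplus>\<^bsub>M\<^esub> x \<lhd>\<^bsub>M\<^esub> ?L" using x L by (intro M.act_add_right) auto
  finally show ?thesis using x by (simp add: 0 1 M.module.M.r_zero)
qed

text \<open>Follow \<open>x\<close> along a longest word that does not kill it; lengths are bounded
  by \<open>m\<close>, and every further arrow kills the result. Some vertex component of it is
  nonzero and is still killed by all arrows.\<close>

lemma socle_vector:
  assumes x: "x \<in> carrier M" "x \<noteq> \<zero>\<^bsub>M\<^esub>"
  obtains a i where "a \<in> carrier \<Lambda>" "i \<in> verts Q" "x \<lhd>\<^bsub>M\<^esub> a \<noteq> \<zero>\<^bsub>M\<^esub>" "x \<lhd>\<^bsub>M\<^esub> a \<lhd>\<^bsub>M\<^esub> e i = x \<lhd>\<^bsub>M\<^esub> a"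
    "\<And>\<gamma>. \<gamma> \<in> arcs Q \<Longrightarrow> x \<lhd>\<^bsub>M\<^esub> a \<lhd>\<^bsub>M\<^esub> g \<gamma> = \<zero>\<^bsub>M\<^esub>"
proof -
  define R where "R p \<longleftrightarrow> set p \<subseteq> arcs Q \<and> x \<lhd>\<^bsub>M\<^esub> w p \<noteq> \<zero>\<^bsub>M\<^esub>" for p
  have "R []" using x by (simp add: R_def M.act_one)
  moreover have "length p \<le> m" if "R p" for p
    using that w_long[of p] act_zero_right[OF x(1)] by (cases "length p \<le> m") (auto simp: R_def)
  ultimately obtain p where p: "R p" and max: "\<And>q. R q \<Longrightarrow> length q \<le> length p"
    using ex_has_greatest_nat[of R "[]" length "Suc m"] by (auto simp: less_Suc_eq_le)
  have pa: "set p \<subseteq> arcs Q" using p by (simp add: R_def)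
  let ?y = "x \<lhd>\<^bsub>M\<^esub> w p"
  have y: "?y \<in> carrier M" "?y \<noteq> \<zero>\<^bsub>M\<^esub>" using p x by (auto simp: R_def)
  have kill: "?y \<lhd>\<^bsub>M\<^esub> g \<gamma> = \<zero>\<^bsub>M\<^esub>" if \<gamma>: "\<gamma> \<in> arcs Q" for \<gamma>
  proof (rule ccontr)
    assume "?y \<lhd>\<^bsub>M\<^esub> g \<gamma> \<noteq> \<zero>\<^bsub>M\<^esub>"
    then have "R (p @ [\<gamma>])" using \<gamma> pa x by (simp add: R_def w_snoc M.act_assoc)
    then show False using max[of "p @ [\<gamma>]"] by simp
  qed
  have "\<exists>i\<in>verts Q. ?y \<lhd>\<^bsub>M\<^esub> e i \<noteq> \<zero>\<^bsub>M\<^esub>"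
  proof (rule ccontr)
    assume "\<not> ?thesis"
    then have "finsum M (\<lambda>u. ?y \<lhd>\<^bsub>M\<^esub> e u) (verts Q) = finsum M (\<lambda>u. \<zero>\<^bsub>M\<^esub>) (verts Q)"
      by (intro M.module.M.finsum_cong') auto
    then show False using vertex_sum[OF y(1)] y(2) by (simp add: M.module.M.finsum_zero)
  qed
  then obtain i where i: "i \<in> verts Q" "?y \<lhd>\<^bsub>M\<^esub> e i \<noteq> \<zero>\<^bsub>M\<^esub>" by blast
  have eq: "x \<lhd>\<^bsub>M\<^esub> (w p \<otimes> e i) = ?y \<lhd>\<^bsub>M\<^esub> e i" using x i pa by (simp add: M.act_assoc)
  show ?thesis
  proof (rule that)
    show "w p \<otimes> e i \<in> carrier \<Lambda>" "i \<in> verts Q" "x \<lhd>\<^bsub>M\<^esub> (w p \<otimes> e i) \<noteq> \<zero>\<^bsub>M\<^esub>" using i pa eq by auto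
    show "x \<lhd>\<^bsub>M\<^esub> (w p \<otimes> e i) \<lhd>\<^bsub>M\<^esub> e i = x \<lhd>\<^bsub>M\<^esub> (w p \<otimes> e i)"
      using i y by (simp add: eq M.act_assoc e_e)
    show "x \<lhd>\<^bsub>M\<^esub> (w p \<otimes> e i) \<lhd>\<^bsub>M\<^esub> g \<gamma> = \<zero>\<^bsub>M\<^esub>" if "\<gamma> \<in> arcs Q" for \<gamma>
      using i y that kill[OF that] by (simp add: eq M.act_assoc e_g act_zero_right)
  qed
qed

text \<open>With \<open>J\<close> the radical, \<open>gen\<close> says \<open>M = N + M J\<close>.
  Substituting this into itself pushes the remainder into ever higher powers of \<open>J\<close>,
  which vanish from \<open>m\<close> on.\<close>

lemma nakayama:
  assumes N: "rsubmodule \<Lambda> N M"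
    and gen: "\<And>x. x \<in> carrier M \<Longrightarrow>
      \<exists>n\<in>N. \<exists>y. (\<forall>\<gamma>\<in>arcs Q. y \<gamma> \<in> carrier M) \<and> x = n \<oplus>\<^bsub>M\<^esub> finsum M (\<lambda>\<gamma>. y \<gamma> \<lhd>\<^bsub>M\<^esub> g \<gamma>) (arcs Q)"
  shows "N = carrier M"
proof -
  have NM: "N \<subseteq> carrier M" using N by (simp add: M.rsubmodule_iff)
  \<comment> \<open>\<open>k\<close> bounds how many arrows \<open>p\<close> lacks to reach length
    \<open>m\<close>; the induction goes from long words, which act as zero, down to the empty
    word.\<close>
  have "\<lbrakk>set p \<subseteq> arcs Q; m \<le> length p + k; x \<in> carrier M\<rbrakk> \<Longrightarrow> x \<lhd>\<^bsub>M\<^esub> w p \<in> N" for k p x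
  proof (induction k arbitrary: p x)
    case 0
    then show ?case using N by (simp add: w_long act_zero_right M.rsubmodule_iff)
  next
    case (Suc k)
    obtain n y where n: "n \<in> N" and y: "\<forall>\<gamma>\<in>arcs Q. y \<gamma> \<in> carrier M"
      and x: "x = n \<oplus>\<^bsub>M\<^esub> finsum M (\<lambda>\<gamma>. y \<gamma> \<lhd>\<^bsub>M\<^esub> g \<gamma>) (arcs Q)"
      using gen[OF Suc.prems(3)] by blast
    let ?s = "finsum M (\<lambda>\<gamma>. y \<gamma> \<lhd>\<^bsub>M\<^esub> g \<gamma>) (arcs Q)"
    have s: "?s \<in> carrier M" using y by (intro M.module.M.finsum_closed) auto
    have "?s \<lhd>\<^bsub>M\<^esub> w p = finsum M (\<lambda>\<gamma>. y \<gamma> \<lhd>\<^bsub>M\<^esub> g \<gamma> \<lhd>\<^bsub>M\<^esub> w p) (arcs Q)"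
      using y Suc.prems by (intro M.act_finsum_left) auto
    also have "\<dots> \<in> N"
    proof (rule M.rsubmodule_finsum[OF N])
      fix \<gamma> assume \<gamma>: "\<gamma> \<in> arcs Q"
      then have "y \<gamma> \<lhd>\<^bsub>M\<^esub> w (\<gamma> # p) \<in> N" using Suc y by auto
      then show "y \<gamma> \<lhd>\<^bsub>M\<^esub> g \<gamma> \<lhd>\<^bsub>M\<^esub> w p \<in> N" using \<gamma> y Suc.prems by (simp add: w_Cons M.act_assoc)
    qed simp
    finally have "?s \<lhd>\<^bsub>M\<^esub> w p \<in> N" .
    moreover have "n \<lhd>\<^bsub>M\<^esub> w p \<in> N" using n N Suc.prems by (simp add: M.rsubmodule_iff)
    moreover have "x \<lhd>\<^bsub>M\<^esub> w p = n \<lhd>\<^bsub>M\<^esub> w p \<oplus>\<^bsub>M\<^esub> ?s \<lhd>\<^bsub>M\<^esub> w p"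
      unfolding x using n NM s Suc.prems by (intro M.act_add_left) auto
    ultimately show ?case using N by (simp add: M.rsubmodule_iff)
  qed
  from this[of "[]" m] show ?thesis using NM by (auto simp: M.act_one)
qed

end

text \<open>A socle vector spans a submodule, which must be all of \<open>S\<close>. So a simple
  module is one-dimensional, and its vertex is the one of that vector.\<close>

lemma simple_structure:
  assumes S: "simple_module \<Lambda> S"
  obtains i x where "i \<in> verts Q" "x \<in> carrier S" "x \<noteq> \<zero>\<^bsub>S\<^esub>" "carrier S = range (\<lambda>c. c \<odot>\<^bsub>S\<^esub> x)"
    "x \<lhd>\<^bsub>S\<^esub> e i = x" "\<And>b. b \<in> carrier \<Lambda> \<Longrightarrow> x \<lhd>\<^bsub>S\<^esub> b = eps i b \<odot>\<^bsub>S\<^esub> x"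
proof -
  have rS: "right_module \<Lambda> S" using S by (auto simp: simple_module_def)
  interpret S: right_module \<Lambda> S by (rule rS)
  obtain x0 where x0: "x0 \<in> carrier S" "x0 \<noteq> \<zero>\<^bsub>S\<^esub>"
    using S S.M_zero unfolding simple_module_def by blast
  obtain a i where ai: "a \<in> carrier \<Lambda>" "i \<in> verts Q" "x0 \<lhd>\<^bsub>S\<^esub> a \<noteq> \<zero>\<^bsub>S\<^esub>"
    "x0 \<lhd>\<^bsub>S\<^esub> a \<lhd>\<^bsub>S\<^esub> e i = x0 \<lhd>\<^bsub>S\<^esub> a" "\<And>\<gamma>. \<gamma> \<in> arcs Q \<Longrightarrow> x0 \<lhd>\<^bsub>S\<^esub> a \<lhd>\<^bsub>S\<^esub> g \<gamma> = \<zero>\<^bsub>S\<^esub>"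
    using socle_vector[OF rS x0] by blast
  define x where "x = x0 \<lhd>\<^bsub>S\<^esub> a"
  have x: "x \<in> carrier S" using x0 ai by (simp add: x_def)
  have act: "x \<lhd>\<^bsub>S\<^esub> b = eps i b \<odot>\<^bsub>S\<^esub> x" if "b \<in> carrier \<Lambda>" for b
    using socle_act[OF rS x ai(2)] ai that by (simp add: x_def)
  have sub: "rsubmodule \<Lambda> (range (\<lambda>c. c \<odot>\<^bsub>S\<^esub> x)) S"
  proof (rule S.rsubmoduleI)
    show "\<zero>\<^bsub>S\<^esub> \<in> range (\<lambda>c. c \<odot>\<^bsub>S\<^esub> x)" using x by (auto intro!: image_eqI[of _ _ 0])
  qed (use x in \<open>auto simp: act S.act_smult_left S.M_smult_l[symmetric] S.M_smult_assoc[symmetric]\<close>)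
  have "x \<in> range (\<lambda>c. c \<odot>\<^bsub>S\<^esub> x)" using x by (auto intro!: image_eqI[of _ _ 1])
  then have "carrier S = range (\<lambda>c. c \<odot>\<^bsub>S\<^esub> x)"
    using S sub ai(3) unfolding simple_module_def x_def[symmetric] by auto
  then show ?thesis using that[of i x] ai x act by (simp add: x_def)
qed

lemma simple_moduleI:
  assumes S: "fd_right_module \<Lambda> S" and x: "x \<in> carrier S" "x \<noteq> \<zero>\<^bsub>S\<^esub>"
    and gen: "\<And>y. y \<in> carrier S \<Longrightarrow> \<exists>c. y = c \<odot>\<^bsub>S\<^esub> x"
  shows "simple_module \<Lambda> S"
proof -
  interpret S: right_module \<Lambda> S using S by auto
  show ?thesis
    unfolding simple_module_def
  proof (intro conjI allI impI S)
    show "carrier S \<noteq> {\<zero>\<^bsub>S\<^esub>}" using x by auto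
    fix N assume N: "rsubmodule \<Lambda> N S"
    show "N = {\<zero>\<^bsub>S\<^esub>} \<or> N = carrier S"
    proof (cases "N = {\<zero>\<^bsub>S\<^esub>}")
      case False
      then obtain y where y: "y \<in> N" "y \<noteq> \<zero>\<^bsub>S\<^esub>" using N by (auto simp: S.rsubmodule_iff)
      then obtain c where c: "y = c \<odot>\<^bsub>S\<^esub> x" using gen N by (auto simp: S.rsubmodule_iff)
      then have "c \<noteq> 0" using y x by auto
      then have "inverse c \<odot>\<^bsub>S\<^esub> y = x" using c x by (simp add: S.M_smult_assoc[symmetric])
      then have "x \<in> N" using y N by (auto simp: S.rsubmodule_iff)
      then have "c \<odot>\<^bsub>S\<^esub> x \<in> N" for c using N by (simp add: S.rsubmodule_iff)
      then have "carrier S \<subseteq> N" using gen by auto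
      then show ?thesis using N by (auto simp: S.rsubmodule_iff)
    qed simp
  qed
qed

end

section \<open>Direct sums\<close>

lemma (in right_module) span_carrier_subset:
  assumes "span B = carrier M" "S \<subseteq> carrier M" "\<zero>\<^bsub>M\<^esub> \<in> S" "\<And>x y. \<lbrakk>x \<in> S; y \<in> S\<rbrakk> \<Longrightarrow> x \<oplus>\<^bsub>M\<^esub> y \<in> S"
    "\<And>c x. x \<in> S \<Longrightarrow> c \<odot>\<^bsub>M\<^esub> x \<in> S" "B \<subseteq> S"
  shows "carrier M \<subseteq> S"
proof -
  have "LinearCombinations.submodule class_ring S M"
    using assms module_axioms by (auto simp: LinearCombinations.submodule_def)
  then show ?thesis
    using span_is_subset[of B S] assms by auto
qed

lemma right_module_group: "right_module \<Lambda> N \<Longrightarrow> abelian_group N"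
  by (simp add: right_module_def vectorspace_def module_def)

lemma right_module_monoid: "right_module \<Lambda> N \<Longrightarrow> abelian_monoid N"
  by (simp add: right_module_group abelian_group.axioms(1))

lemma direct_sum_simps [simp]:
  "carrier (direct_sum_module J M) = (\<Pi>\<^sub>E j\<in>J. carrier (M j))"
  "zero (direct_sum_module J M) = (\<lambda>j\<in>J. \<zero>\<^bsub>M j\<^esub>)"
  "add (direct_sum_module J M) = (\<lambda>x y. \<lambda>j\<in>J. x j \<oplus>\<^bsub>M j\<^esub> y j)"
  "smult (direct_sum_module J M) = (\<lambda>c x. \<lambda>j\<in>J. c \<odot>\<^bsub>M j\<^esub> x j)"
  "act (direct_sum_module J M) = (\<lambda>x a. \<lambda>j\<in>J. x j \<lhd>\<^bsub>M j\<^esub> a)"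
  by (simp_all add: direct_sum_module_def)

lemma PiE_eqI: "\<lbrakk>x \<in> Pi\<^sub>E J A; y \<in> Pi\<^sub>E J B; \<And>j. j \<in> J \<Longrightarrow> x j = y j\<rbrakk> \<Longrightarrow> x = y"
  by (rule ext) (metis PiE_E)

lemma direct_sum_right_module:
  fixes M :: "'i \<Rightarrow> ('k::field, 'm, 'a) right_module"
  assumes M: "\<And>j. j \<in> J \<Longrightarrow> right_module \<Lambda> (M j)"
  shows "right_module \<Lambda> (direct_sum_module J M)"
proof -
  note f = right_module.M_zero[OF M] right_module.M_add[OF M] right_module.M_smult[OF M]
    right_module.act_closed[OF M] right_module.M_smult_assoc[OF M] right_module.M_smult_l[OF M]
    right_module.M_smult_r[OF M] right_module.M_smult_one[OF M] right_module.act_add_left[OF M]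
    right_module.act_add_right[OF M] right_module.act_smult_left[OF M]
    right_module.act_smult_right[OF M] right_module.act_assoc[OF M] right_module.act_one[OF M]
  have ag: "abelian_group (M j)" if "j \<in> J" for j
    using M[OF that] by (simp add: right_module_def vectorspace_def module_def)
  note g = abelian_monoid.a_comm[OF abelian_group.axioms(1)[OF ag]]
    abelian_monoid.a_assoc[OF abelian_group.axioms(1)[OF ag]]
    abelian_monoid.r_zero[OF abelian_group.axioms(1)[OF ag]]
    abelian_group.r_neg[OF ag] abelian_group.a_inv_closed[OF ag]
  show ?thesis
  proof (rule right_moduleI, goal_cases)
    case (3 x)
    then have "(\<lambda>j\<in>J. \<ominus>\<^bsub>M j\<^esub> x j) \<in> carrier (direct_sum_module J M)" by (auto simp: PiE_iff g(5))
    moreover have "x \<oplus>\<^bsub>direct_sum_module J M\<^esub> (\<lambda>j\<in>J. \<ominus>\<^bsub>M j\<^esub> x j) = \<zero>\<^bsub>direct_sum_module J M\<^esub>"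
      using 3 by (auto simp: fun_eq_iff restrict_def PiE_iff g(4))
    ultimately show ?case by blast
  next
    case 5 then show ?case by (auto simp: fun_eq_iff restrict_def PiE_iff g(1))
  next
    case 6 then show ?case by (auto simp: fun_eq_iff restrict_def PiE_iff f g(2))
  qed (auto simp: fun_eq_iff restrict_def PiE_iff extensional_def f g(3))
qed

definition inc :: "'i set \<Rightarrow> ('i \<Rightarrow> ('k::field, 'm, 'a) right_module) \<Rightarrow> 'i \<Rightarrow> 'm \<Rightarrow> 'i \<Rightarrow> 'm" where
  "inc J M i x = (\<lambda>j\<in>J. if j = i then x else \<zero>\<^bsub>M j\<^esub>)"

lemma mod_zero_add: "right_module \<Lambda> N \<Longrightarrow> \<zero>\<^bsub>N\<^esub> \<oplus>\<^bsub>N\<^esub> \<zero>\<^bsub>N\<^esub> = \<zero>\<^bsub>N\<^esub>"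
  by (simp add: right_module_def vectorspace_def module_def abelian_group_def abelian_monoid.r_zero
      abelian_monoid.zero_closed)

lemma inc_hom:
  assumes M: "\<And>j. j \<in> J \<Longrightarrow> right_module \<Lambda> (M j)" and i: "i \<in> J"
  shows "inc J M i \<in> rmodule_hom \<Lambda> (M i) (direct_sum_module J M)"
  unfolding rmodule_hom_iff
proof (intro conjI ballI allI)
  note z = right_module.M_zero[OF M] right_module.M_smult_zero[OF M] right_module.act_zero_left[OF M]
    mod_zero_add[OF M]
  show "inc J M i x \<in> carrier (direct_sum_module J M)" if "x \<in> carrier (M i)" for x
    using that by (auto simp: inc_def z)
  show "inc J M i (x \<oplus>\<^bsub>M i\<^esub> y) = inc J M i x \<oplus>\<^bsub>direct_sum_module J M\<^esub> inc J M i y" for x y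
    by (auto simp: inc_def z fun_eq_iff restrict_def)
  show "inc J M i (c \<odot>\<^bsub>M i\<^esub> x) = c \<odot>\<^bsub>direct_sum_module J M\<^esub> inc J M i x" for c x
    by (auto simp: inc_def z fun_eq_iff restrict_def)
  show "inc J M i (x \<lhd>\<^bsub>M i\<^esub> a) = inc J M i x \<lhd>\<^bsub>direct_sum_module J M\<^esub> a" if "a \<in> carrier \<Lambda>" for x a
    using that by (auto simp: inc_def z fun_eq_iff restrict_def)
qed

lemma finsum_direct_sum:
  assumes M: "\<And>j. j \<in> J \<Longrightarrow> right_module \<Lambda> (M j)" and A: "finite A"
    "\<And>a. a \<in> A \<Longrightarrow> f a \<in> carrier (direct_sum_module J M)" and j: "j \<in> J"
  shows "finsum (direct_sum_module J M) f A j = finsum (M j) (\<lambda>a. f a j) A"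
proof -
  show ?thesis
    by (rule finsum_additive[where f = "\<lambda>x. x j", OF right_module_monoid[OF direct_sum_right_module[of J \<Lambda> M, OF M]] right_module_monoid[OF M[OF j]]])
      (use A j in auto)
qed

lemma direct_sum_decomp:
  assumes M: "\<And>j. j \<in> J \<Longrightarrow> right_module \<Lambda> (M j)" and J: "finite J"
    and x: "x \<in> carrier (direct_sum_module J M)"
  shows "x = finsum (direct_sum_module J M) (\<lambda>i. inc J M i (x i)) J"
proof -
  have D: "right_module \<Lambda> (direct_sum_module J M)" by (rule direct_sum_right_module[of J \<Lambda> M, OF M])
  have c: "inc J M i (x i) \<in> carrier (direct_sum_module J M)" if "i \<in> J" for i
    using rmodule_homD(1)[OF inc_hom[of J \<Lambda> M, OF M that]] x that by (auto simp: PiE_mem)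
  show ?thesis
  proof (rule PiE_eqI[of _ J])
    show "x \<in> (\<Pi>\<^sub>E j\<in>J. carrier (M j))" using x by simp
    show "finsum (direct_sum_module J M) (\<lambda>i. inc J M i (x i)) J \<in> (\<Pi>\<^sub>E j\<in>J. carrier (M j))"
      using abelian_monoid.finsum_closed[OF right_module_monoid[OF D], of "\<lambda>i. inc J M i (x i)" J] c by auto
    fix j assume j: "j \<in> J"
    have "finsum (M j) (\<lambda>i. inc J M i (x i) j) J = x j"
      using J j x right_module.M_zero[OF M[OF j]]
      by (intro abelian_monoid.finsum_single[OF right_module_monoid[OF M[OF j]], where i = j]) (auto simp: inc_def PiE_mem)
    then show "x j = finsum (direct_sum_module J M) (\<lambda>i. inc J M i (x i)) J j"
      using finsum_direct_sum[of J \<Lambda> M, OF M J c j] by simp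
  qed
qed

text \<open>The union of the images of finite spanning sets of the summands spans, since every
  vector is the sum of its included components.\<close>

lemma direct_sum_fd:
  fixes M :: "'i \<Rightarrow> ('k::field, 'm, 'a) right_module"
  assumes M: "\<And>j. j \<in> J \<Longrightarrow> fd_right_module \<Lambda> (M j)" and J: "finite J"
  shows "fd_right_module \<Lambda> (direct_sum_module J M)"
proof -
  let ?D = "direct_sum_module J M"
  have rM: "right_module \<Lambda> (M j)" if "j \<in> J" for j using M[OF that] by auto
  have D: "right_module \<Lambda> ?D" by (rule direct_sum_right_module[of J \<Lambda> M, OF rM])
  interpret D: right_module \<Lambda> ?D by (rule D)
  have "\<forall>j\<in>J. \<exists>B. finite B \<and> B \<subseteq> carrier (M j) \<and> LinearCombinations.module.span class_ring (M j) B = carrier (M j)"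
  proof
    fix j assume j: "j \<in> J"
    interpret Mj: fd_right_module \<Lambda> "M j" using M[OF j] .
    show "\<exists>B. finite B \<and> B \<subseteq> carrier (M j) \<and> Mj.span B = carrier (M j)"
      using Mj.finite_dimensional unfolding Mj.fin_dim_def by auto
  qed
  then obtain B where B: "\<And>j. j \<in> J \<Longrightarrow> finite (B j)" "\<And>j. j \<in> J \<Longrightarrow> B j \<subseteq> carrier (M j)"
    "\<And>j. j \<in> J \<Longrightarrow> LinearCombinations.module.span class_ring (M j) (B j) = carrier (M j)"
    unfolding bchoice_iff by auto
  have "vectorspace.fin_dim class_ring ?D"
  proof (rule D.fin_dimI[where B = "\<Union>j\<in>J. inc J M j ` B j"])
    show "finite (\<Union>j\<in>J. inc J M j ` B j)" using B J by auto
    show "(\<Union>j\<in>J. inc J M j ` B j) \<subseteq> carrier ?D"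
      using B(2) rmodule_homD(1)[OF inc_hom[of J \<Lambda> M, OF rM]] by blast
    fix S assume S: "S \<subseteq> carrier ?D" "\<zero>\<^bsub>?D\<^esub> \<in> S" "\<And>x y. \<lbrakk>x \<in> S; y \<in> S\<rbrakk> \<Longrightarrow> x \<oplus>\<^bsub>?D\<^esub> y \<in> S"
      "\<And>c x. x \<in> S \<Longrightarrow> c \<odot>\<^bsub>?D\<^esub> x \<in> S" "(\<Union>j\<in>J. inc J M j ` B j) \<subseteq> S"
    have inc: "inc J M j x \<in> S" if j: "j \<in> J" and x: "x \<in> carrier (M j)" for j x
    proof -
      note h = rmodule_homD[OF inc_hom[of J \<Lambda> M, OF rM j]]
      have z: "inc J M j \<zero>\<^bsub>M j\<^esub> = \<zero>\<^bsub>?D\<^esub>" by (auto simp: inc_def intro!: restrict_ext)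
      have "carrier (M j) \<subseteq> {x \<in> carrier (M j). inc J M j x \<in> S}"
      proof (rule right_module.span_carrier_subset[OF rM[OF j] B(3)[OF j]])
        show "B j \<subseteq> {x \<in> carrier (M j). inc J M j x \<in> S}" using B(2)[OF j] S(5) j by auto
        show "\<zero>\<^bsub>M j\<^esub> \<in> {x \<in> carrier (M j). inc J M j x \<in> S}"
          using S(2)[folded z] right_module.M_zero[OF rM[OF j]] by (rule_tac CollectI) auto
      next
        fix x y assume "x \<in> {x \<in> carrier (M j). inc J M j x \<in> S}" "y \<in> {x \<in> carrier (M j). inc J M j x \<in> S}"
        then show "x \<oplus>\<^bsub>M j\<^esub> y \<in> {x \<in> carrier (M j). inc J M j x \<in> S}"
          using S(3) h(2) right_module.M_add[OF rM[OF j]] by simp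
      next
        fix c x assume "x \<in> {x \<in> carrier (M j). inc J M j x \<in> S}"
        then show "c \<odot>\<^bsub>M j\<^esub> x \<in> {x \<in> carrier (M j). inc J M j x \<in> S}"
          using S(4) h(3) right_module.M_smult[OF rM[OF j]] by simp
      qed auto
      then show ?thesis using x by auto
    qed
    show "carrier ?D \<subseteq> S"
    proof
      fix x assume x: "x \<in> carrier ?D"
      have xS: "inc J M i (x i) \<in> S" if "i \<in> J" for i
        using inc[OF that] x that by (auto simp: PiE_iff)
      have "finsum ?D (\<lambda>i. inc J M i (x i)) A \<in> S" if "finite A" "A \<subseteq> J" for A
        using that
      proof (induction A rule: finite_induct)
        case empty
        show ?case unfolding D.module.M.finsum_empty by (rule S(2))
      next
        case (insert j A)
        have "finsum ?D (\<lambda>i. inc J M i (x i)) (insert j A) =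
          inc J M j (x j) \<oplus>\<^bsub>?D\<^esub> finsum ?D (\<lambda>i. inc J M i (x i)) A"
          by (rule D.module.M.finsum_insert) (use insert xS S(1) in blast)+
        moreover have "\<dots> \<in> S" using insert by (intro S(3) xS) auto
        ultimately show ?case by (simp only:)
      qed
      from this[OF J order_refl] show "x \<in> S" by (simp only: direct_sum_decomp[of J \<Lambda> M, OF rM J x, symmetric])
    qed
  qed
  then show ?thesis using D by (simp add: fd_right_module_def fd_right_module_axioms_def)
qed

text \<open>The restrictions to the summands are lifted one by one, and \<open>H\<close> adds up the
  lifts of the components.\<close>

lemma direct_sum_projective:
  fixes M :: "'i \<Rightarrow> ('k::field, 'm, 'a) right_module"
  assumes M: "\<And>j. j \<in> J \<Longrightarrow> projective_module \<Lambda> (M j)" and J: "finite J"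
  shows "projective_module \<Lambda> (direct_sum_module J M)"
proof -
  let ?D = "direct_sum_module J M"
  have fM: "fd_right_module \<Lambda> (M j)" if "j \<in> J" for j using M[OF that] by (rule projective_module_fd)
  have rM: "right_module \<Lambda> (M j)" if "j \<in> J" for j using fM[OF that] by auto
  have D: "right_module \<Lambda> ?D" by (rule direct_sum_right_module[of J \<Lambda> M, OF rM])
  have "\<exists>h\<in>rmodule_hom \<Lambda> ?D N. \<forall>x\<in>carrier ?D. g (h x) = f x"
    if N: "fd_right_module \<Lambda> N" and L: "fd_right_module \<Lambda> L" and g: "g \<in> rmodule_hom \<Lambda> N L"
      "g ` carrier N = carrier L" and f: "f \<in> rmodule_hom \<Lambda> ?D L"
    for N L :: "('k, 'a) fdmod" and g f
  proof -
    have rN: "right_module \<Lambda> N" and rL: "right_module \<Lambda> L" using N L by auto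
    interpret N: right_module \<Lambda> N by (rule rN)
    have "\<forall>j\<in>J. \<exists>h. h \<in> rmodule_hom \<Lambda> (M j) N \<and> (\<forall>x\<in>carrier (M j). g (h x) = f (inc J M j x))"
    proof
      fix j assume j: "j \<in> J"
      have "(\<lambda>x. f (inc J M j x)) \<in> rmodule_hom \<Lambda> (M j) L"
        by (rule rmodule_hom_comp[OF inc_hom[of J \<Lambda> M, OF rM j] f])
      then obtain h where "h \<in> rmodule_hom \<Lambda> (M j) N" "\<And>x. x \<in> carrier (M j) \<Longrightarrow> g (h x) = f (inc J M j x)"
        by (rule projective_lift[OF M[OF j] N L g]) (rule that, auto)
      then show "\<exists>h. h \<in> rmodule_hom \<Lambda> (M j) N \<and> (\<forall>x\<in>carrier (M j). g (h x) = f (inc J M j x))" by auto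
    qed
    then obtain h where h: "\<And>j. j \<in> J \<Longrightarrow> h j \<in> rmodule_hom \<Lambda> (M j) N"
      "\<And>j x. \<lbrakk>j \<in> J; x \<in> carrier (M j)\<rbrakk> \<Longrightarrow> g (h j x) = f (inc J M j x)"
      unfolding bchoice_iff by auto
    note hD = rmodule_homD[OF h(1)]
    define H where "H x = finsum N (\<lambda>j. h j (x j)) J" for x
    have c: "h j (x j) \<in> carrier N" if "x \<in> carrier ?D" "j \<in> J" for x j
      using hD(1)[OF that(2)] that by (simp add: PiE_iff)
    have "H \<in> rmodule_hom \<Lambda> ?D N"
      unfolding rmodule_hom_iff
    proof (intro conjI ballI allI)
      fix x assume x: "x \<in> carrier ?D"
      show "H x \<in> carrier N" unfolding H_def using c[OF x] by (intro N.module.M.finsum_closed) auto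
      { fix y assume y: "y \<in> carrier ?D"
        have "H (x \<oplus>\<^bsub>?D\<^esub> y) = finsum N (\<lambda>j. h j (x j) \<oplus>\<^bsub>N\<^esub> h j (y j)) J"
          unfolding H_def using x y c by (intro N.module.M.finsum_cong') (auto simp: hD PiE_iff)
        also have "\<dots> = H x \<oplus>\<^bsub>N\<^esub> H y"
          unfolding H_def using c[OF x] c[OF y] by (intro N.module.M.finsum_addf) auto
        finally show "H (x \<oplus>\<^bsub>?D\<^esub> y) = H x \<oplus>\<^bsub>N\<^esub> H y" . }
      { fix k
        have "H (k \<odot>\<^bsub>?D\<^esub> x) = finsum N (\<lambda>j. k \<odot>\<^bsub>N\<^esub> h j (x j)) J"
          unfolding H_def using x c[OF x] by (intro N.module.M.finsum_cong') (auto simp: hD PiE_iff)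
        also have "\<dots> = k \<odot>\<^bsub>N\<^esub> H x"
          unfolding H_def using c[OF x] J
          by (intro finsum_additive[where f = "\<lambda>y. k \<odot>\<^bsub>N\<^esub> y", symmetric])
            (auto simp: N.module.M.abelian_monoid_axioms N.M_smult_r)
        finally show "H (k \<odot>\<^bsub>?D\<^esub> x) = k \<odot>\<^bsub>N\<^esub> H x" . }
      { fix a assume a: "a \<in> carrier \<Lambda>"
        have "H (x \<lhd>\<^bsub>?D\<^esub> a) = finsum N (\<lambda>j. h j (x j) \<lhd>\<^bsub>N\<^esub> a) J"
          unfolding H_def using x a c[OF x] by (intro N.module.M.finsum_cong') (auto simp: hD PiE_iff)
        also have "\<dots> = H x \<lhd>\<^bsub>N\<^esub> a"
          unfolding H_def using c[OF x] J a by (intro N.act_finsum_left[symmetric]) auto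
        finally show "H (x \<lhd>\<^bsub>?D\<^esub> a) = H x \<lhd>\<^bsub>N\<^esub> a" . }
    qed
    moreover have "g (H x) = f x" if x: "x \<in> carrier ?D" for x
    proof -
      interpret L: right_module \<Lambda> L by (rule rL)
      have ic: "inc J M j (x j) \<in> carrier ?D" if "j \<in> J" for j
        using rmodule_homD(1)[OF inc_hom[of J \<Lambda> M, OF rM that]] x that by (auto simp: PiE_mem)
      have "g (H x) = finsum L (\<lambda>j. g (h j (x j))) J"
        unfolding H_def by (rule rmodule_hom_finsum[OF rN rL g(1) J c[OF x]])
      also have "\<dots> = finsum L (\<lambda>j. f (inc J M j (x j))) J"
        using x h(2) rmodule_homD(1)[OF f ic] by (intro L.module.M.finsum_cong') (auto simp: PiE_mem)
      also have "\<dots> = f (finsum ?D (\<lambda>j. inc J M j (x j)) J)"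
        by (rule rmodule_hom_finsum[OF D rL f J ic, symmetric])
      finally show ?thesis using direct_sum_decomp[of J \<Lambda> M, OF rM J x] by simp
    qed
    ultimately show ?thesis by blast
  qed
  then show ?thesis using direct_sum_fd[of J \<Lambda> M, OF fM J] unfolding projective_module_def by blast
qed

section \<open>The first two syzygies of a simple module\<close>

context bound_quiver
begin

text \<open>
  \<open>Pm i\<close> is \<open>P\<^sub>i\<close>, with radical \<open>RadM i\<close>, and \<open>Dm i\<close> is \<open>P\<^sub>i\<^sup>+\<close>.  Left multiplication by the arrows maps \<open>Dm i\<close>
  onto \<open>RadM i\<close>, and its kernel \<open>KM i\<close> is the second syzygy of the simple module at \<open>i\<close>.
\<close>

definition Pm :: "'v \<Rightarrow> ('k, 'a, 'a) right_module" where
  "Pm i = (regular_module \<Lambda>)\<lparr>carrier := (\<lambda>x. e i \<otimes> x) ` carrier \<Lambda>\<rparr>"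

lemma Pm_simps [simp]:
  "zero (Pm i) = \<zero>" "add (Pm i) = add \<Lambda>" "smult (Pm i) = smult \<Lambda>" "act (Pm i) = mult \<Lambda>"
  by (simp_all add: Pm_def)

lemma Pm_carrier:
  assumes i: "i \<in> verts Q"
  shows "carrier (Pm i) = {a \<in> carrier \<Lambda>. e i \<otimes> a = a}"
proof -
  have "e i \<otimes> (e i \<otimes> x) = e i \<otimes> x" if "x \<in> carrier \<Lambda>" for x
    using i that by (simp add: m_assoc[symmetric] e_e)
  then show ?thesis using i by (force simp: Pm_def)
qed

lemma Pm_memD: "\<lbrakk>i \<in> verts Q; a \<in> carrier (Pm i)\<rbrakk> \<Longrightarrow> a \<in> carrier \<Lambda> \<and> e i \<otimes> a = a"
  by (simp add: Pm_carrier)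

lemma Pm_mult_e: "\<lbrakk>i \<in> verts Q; a \<in> carrier \<Lambda>\<rbrakk> \<Longrightarrow> e i \<otimes> a \<in> carrier (Pm i)"
  by (simp add: Pm_def)

lemma Pm_e [simp]: "i \<in> verts Q \<Longrightarrow> e i \<in> carrier (Pm i)"
  by (simp add: Pm_carrier e_e)

lemma Pm_rsubmodule:
  assumes i: "i \<in> verts Q"
  shows "rsubmodule \<Lambda> (carrier (Pm i)) (regular_module \<Lambda>)"
  using i by (intro reg.rsubmoduleI)
    (auto simp: Pm_carrier r_distr smult_mult_right m_assoc[symmetric])

lemma Pm_fd: "i \<in> verts Q \<Longrightarrow> fd_right_module \<Lambda> (Pm i)"
  using fd_right_module.submodule_fd[OF fd_regular Pm_rsubmodule, of i] by (simp add: Pm_def)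

lemma Pm_right_module: "i \<in> verts Q \<Longrightarrow> right_module \<Lambda> (Pm i)"
  using Pm_fd by auto

lemma act_hom:
  assumes M: "right_module \<Lambda> M" and i: "i \<in> verts Q" and x: "x \<in> carrier M"
  shows "(\<lambda>a. x \<lhd>\<^bsub>M\<^esub> a) \<in> rmodule_hom \<Lambda> (Pm i) M"
proof -
  interpret M: right_module \<Lambda> M by (rule M)
  show ?thesis
    using i x by (auto simp: rmodule_hom_iff Pm_carrier M.act_add_right M.act_smult_right M.act_assoc)
qed

text \<open>A homomorphism out of \<open>Pm i\<close> is determined by the image of
  \<open>e i\<close>; a preimage \<open>n\<close> of this image under \<open>k\<close> defines the
  lift, sending \<open>a\<close> to \<open>n\<close> acted on by \<open>a\<close>.\<close>

lemma Pm_projective: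
  assumes i: "i \<in> verts Q"
  shows "projective_module \<Lambda> (Pm i)"
proof -
  have "\<exists>h\<in>rmodule_hom \<Lambda> (Pm i) N. \<forall>x\<in>carrier (Pm i). k (h x) = f x"
    if N: "fd_right_module \<Lambda> N" and k: "k \<in> rmodule_hom \<Lambda> N L" "k ` carrier N = carrier L"
      and f: "f \<in> rmodule_hom \<Lambda> (Pm i) L"
    for N L :: "('k, 'a) fdmod" and k f
  proof -
    have "f (e i) \<in> carrier L" using rmodule_homD(1)[OF f] i by simp
    then have "f (e i) \<in> k ` carrier N" using k(2) by simp
    then obtain n where n: "n \<in> carrier N" "k n = f (e i)" by auto
    have "k (n \<lhd>\<^bsub>N\<^esub> a) = f a" if a: "a \<in> carrier (Pm i)" for a
    proof -
      have a': "a \<in> carrier \<Lambda>" "e i \<otimes> a = a" using Pm_memD[OF i a] by auto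
      have "k (n \<lhd>\<^bsub>N\<^esub> a) = f (e i) \<lhd>\<^bsub>L\<^esub> a" using rmodule_homD(4)[OF k(1) n(1) a'(1)] n(2) by simp
      also have "\<dots> = f (e i \<otimes> a)" using rmodule_homD(4)[OF f _ a'(1), of "e i"] i by simp
      finally show ?thesis using a' by simp
    qed
    then show ?thesis using act_hom[OF fd_right_module_imp[OF N] i n(1)] by (intro bexI) auto
  qed
  then show ?thesis using Pm_fd[OF i] unfolding projective_module_def by auto
qed

text \<open>The radical of P_i: on \<open>e i \<Lambda>\<close> the functionals \<open>eps u\<close>
  at the other vertices vanish anyway, so \<open>eps i\<close> alone decides.\<close>

definition Rad :: "'v \<Rightarrow> 'a set" where
  "Rad i = {a \<in> carrier (Pm i). eps i a = 0}"

definition RadM :: "'v \<Rightarrow> ('k, 'a, 'a) right_module" where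
  "RadM i = (Pm i)\<lparr>carrier := Rad i\<rparr>"

lemma RadM_simps [simp]:
  "carrier (RadM i) = Rad i"
  "zero (RadM i) = \<zero>" "add (RadM i) = add \<Lambda>" "smult (RadM i) = smult \<Lambda>" "act (RadM i) = mult \<Lambda>"
  by (simp_all add: RadM_def)

lemma Rad_mem: "i \<in> verts Q \<Longrightarrow> a \<in> Rad i \<longleftrightarrow> a \<in> carrier \<Lambda> \<and> e i \<otimes> a = a \<and> eps i a = 0"
  by (auto simp: Rad_def Pm_carrier)

lemma Rad_rsubmodule:
  assumes i: "i \<in> verts Q"
  shows "rsubmodule \<Lambda> (Rad i) (Pm i)"
  using i by (intro right_module.rsubmoduleI[OF Pm_right_module])
    (auto simp: Rad_def Pm_carrier r_distr smult_mult_right m_assoc[symmetric] eps_add eps_smult eps_mult)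

lemma RadM_fd: "i \<in> verts Q \<Longrightarrow> fd_right_module \<Lambda> (RadM i)"
  unfolding RadM_def by (intro fd_right_module.submodule_fd Pm_fd Rad_rsubmodule)

lemma RadM_right_module: "i \<in> verts Q \<Longrightarrow> right_module \<Lambda> (RadM i)"
  using RadM_fd by auto

lemma eps_Pm:
  assumes "i \<in> verts Q" "u \<in> verts Q" "a \<in> carrier \<Lambda>" "e i \<otimes> a = a"
  shows "eps u a = (if u = i then eps i a else 0)"
  using eps_mult[of u "e i" a] assms by (simp add: eps_e split: if_splits)

lemma eps_minus:
  assumes "u \<in> verts Q" "a \<in> carrier \<Lambda>"
  shows "eps u (\<ominus> a) = - eps u a"
  using eps_add[of u a "\<ominus> a"] assms by (simp add: r_neg add_eq_0_iff)

lemma mult_finsum_right: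
  assumes "a \<in> carrier \<Lambda>" "finite A" "\<And>j. j \<in> A \<Longrightarrow> f j \<in> carrier \<Lambda>"
  shows "a \<otimes> (\<Oplus>j\<in>A. f j) = (\<Oplus>j\<in>A. a \<otimes> f j)"
  using assms by (intro finsum_rdistr) auto

text \<open>The radical in the form \<open>P_i J\<close> that Nakayama's lemma asks for: the right
  decomposition of \<open>d\<close>, with coefficients brought into P_i by multiplying with
  \<open>e i\<close> from the left.\<close>

lemma Rad_generated:
  assumes i: "i \<in> verts Q" and d: "d \<in> Rad i"
  obtains y where "\<And>\<gamma>. \<gamma> \<in> arcs Q \<Longrightarrow> y \<gamma> \<in> carrier (Pm i)" "d = (\<Oplus>\<gamma>\<in>arcs Q. y \<gamma> \<otimes> g \<gamma>)"
proof -
  have d': "d \<in> carrier \<Lambda>" "e i \<otimes> d = d" "eps i d = 0" using d i by (auto simp: Rad_mem)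
  obtain r where r: "\<And>\<gamma>. \<gamma> \<in> arcs Q \<Longrightarrow> r \<gamma> \<in> carrier \<Lambda>" "d = vpart d \<oplus> (\<Oplus>\<gamma>\<in>arcs Q. r \<gamma> \<otimes> g \<gamma>)"
    using right_decomposition[OF d'(1)] by blast
  have "vpart d = \<zero>"
  proof (rule vpart_eq_zero)
    show "eps u d = 0" if "u \<in> verts Q" for u
      using eps_Pm[OF i that d'(1,2)] d'(3) by (cases "u = i") auto
  qed
  moreover have c: "(\<Oplus>\<gamma>\<in>arcs Q. r \<gamma> \<otimes> g \<gamma>) \<in> carrier \<Lambda>" using r(1) by (intro finsum_closed) auto
  ultimately have d2: "d = (\<Oplus>\<gamma>\<in>arcs Q. r \<gamma> \<otimes> g \<gamma>)" using r(2) by simp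
  have "d = e i \<otimes> (\<Oplus>\<gamma>\<in>arcs Q. r \<gamma> \<otimes> g \<gamma>)" using d'(2) d2 by simp
  also have "\<dots> = (\<Oplus>\<gamma>\<in>arcs Q. e i \<otimes> (r \<gamma> \<otimes> g \<gamma>))" using i r(1) by (intro mult_finsum_right) auto
  also have "\<dots> = (\<Oplus>\<gamma>\<in>arcs Q. (e i \<otimes> r \<gamma>) \<otimes> g \<gamma>)"
    using i r(1) by (intro finsum_cong') (auto simp: m_assoc)
  finally have "d = (\<Oplus>\<gamma>\<in>arcs Q. (e i \<otimes> r \<gamma>) \<otimes> g \<gamma>)" .
  then show ?thesis
    by (rule that[rotated]) (use i r(1) Pm_mult_e in auto)
qed

text \<open>For minimality: an element \<open>a\<close> has the same image as some \<open>n\<close>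
  in \<open>N\<close>, hence the same \<open>eps i\<close>; so the two differ by an element of the
  radical and Nakayama's lemma applies.\<close>

lemma simple_cover:
  fixes S :: "('k, 'm, 'a) right_module"
  assumes S: "right_module \<Lambda> S" and i: "i \<in> verts Q" and x: "x \<in> carrier S"
    and gen: "carrier S = range (\<lambda>c. c \<odot>\<^bsub>S\<^esub> x)" and nz: "x \<noteq> \<zero>\<^bsub>S\<^esub>"
    and act: "\<And>b. b \<in> carrier \<Lambda> \<Longrightarrow> x \<lhd>\<^bsub>S\<^esub> b = eps i b \<odot>\<^bsub>S\<^esub> x"
  shows "projective_cover \<Lambda> (Pm i) (\<lambda>a. x \<lhd>\<^bsub>S\<^esub> a) S"
    and "hom_kernel (Pm i) S (\<lambda>a. x \<lhd>\<^bsub>S\<^esub> a) = Rad i"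
proof -
  interpret S: right_module \<Lambda> S by (rule S)
  \<comment> \<open>As \<open>x\<close> is nonzero, a scalar can be read off from its multiple of
    \<open>x\<close>; this turns equal images into equal values of \<open>eps i\<close>.\<close>
  have inj: "c = d" if "c \<odot>\<^bsub>S\<^esub> x = d \<odot>\<^bsub>S\<^esub> x" for c d
  proof (rule ccontr)
    assume "c \<noteq> d"
    have "(c - d) \<odot>\<^bsub>S\<^esub> x = d \<odot>\<^bsub>S\<^esub> x \<oplus>\<^bsub>S\<^esub> (- d) \<odot>\<^bsub>S\<^esub> x"
      using S.M_smult_l[of x c "- d"] x that by simp
    also have "\<dots> = \<zero>\<^bsub>S\<^esub>" using S.M_smult_l[of x d "- d"] x by simp
    finally have "(c - d) \<odot>\<^bsub>S\<^esub> x = \<zero>\<^bsub>S\<^esub>" .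
    then have "inverse (c - d) \<odot>\<^bsub>S\<^esub> ((c - d) \<odot>\<^bsub>S\<^esub> x) = \<zero>\<^bsub>S\<^esub>" by simp
    then show False using x nz \<open>c \<noteq> d\<close> by (simp add: S.M_smult_assoc[symmetric])
  qed
  show "projective_cover \<Lambda> (Pm i) (\<lambda>a. x \<lhd>\<^bsub>S\<^esub> a) S"
  proof (rule projective_coverI[OF Pm_projective[OF i] S act_hom[OF S i x]])
    have "c \<odot>\<^bsub>S\<^esub> x \<in> (\<lambda>a. x \<lhd>\<^bsub>S\<^esub> a) ` carrier (Pm i)" for c
    proof (rule image_eqI)
      show "c \<odot>\<^bsub>S\<^esub> x = x \<lhd>\<^bsub>S\<^esub> (c \<odot> e i)" using i by (simp add: act eps_smult eps_e)
      show "c \<odot> e i \<in> carrier (Pm i)" using i by (simp add: Pm_carrier smult_mult_right e_e)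
    qed
    then show "(\<lambda>a. x \<lhd>\<^bsub>S\<^esub> a) ` carrier (Pm i) = carrier S"
      unfolding gen using i by (auto simp: Pm_carrier act)
    fix N assume N: "rsubmodule \<Lambda> N (Pm i)" "(\<lambda>a. x \<lhd>\<^bsub>S\<^esub> a) ` N = carrier S"
    interpret P: right_module \<Lambda> "Pm i" by (rule Pm_right_module[OF i])
    have NP: "N \<subseteq> carrier (Pm i)" using N(1) by (simp add: P.rsubmodule_iff)
    show "N = carrier (Pm i)"
    proof (rule nakayama[OF P.right_module_axioms N(1)])
      fix a assume a: "a \<in> carrier (Pm i)"
      then have a': "a \<in> carrier \<Lambda>" "e i \<otimes> a = a" using Pm_memD[OF i] by auto
      have "x \<lhd>\<^bsub>S\<^esub> a \<in> (\<lambda>a. x \<lhd>\<^bsub>S\<^esub> a) ` N" unfolding N(2) using x a'(1) by (rule S.act_closed)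
      then obtain n where n: "n \<in> N" "x \<lhd>\<^bsub>S\<^esub> a = x \<lhd>\<^bsub>S\<^esub> n" by (rule imageE)
      have n': "n \<in> carrier \<Lambda>" "e i \<otimes> n = n" using n(1) NP Pm_memD[OF i] by auto
      have "eps i a = eps i n" using n(2) a' n' inj[of "eps i a" "eps i n"] by (simp add: act)
      then have "\<ominus> n \<oplus> a \<in> Rad i"
        using a' n' i by (simp add: Rad_mem r_distr r_minus eps_add eps_minus)
      obtain y where y: "\<And>\<gamma>. \<gamma> \<in> arcs Q \<Longrightarrow> y \<gamma> \<in> carrier (Pm i)" "\<ominus> n \<oplus> a = (\<Oplus>\<gamma>\<in>arcs Q. y \<gamma> \<otimes> g \<gamma>)"
        by (rule Rad_generated[OF i \<open>\<ominus> n \<oplus> a \<in> Rad i\<close>]) (rule that, auto)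
      \<comment> \<open>Sums in \<open>Pm i\<close> and in \<Lambda> are formed over different
        carriers, so their agreement needs the additivity of the inclusion.\<close>
      have "finsum (Pm i) (\<lambda>\<gamma>. y \<gamma> \<otimes> g \<gamma>) (arcs Q) = (\<Oplus>\<gamma>\<in>arcs Q. y \<gamma> \<otimes> g \<gamma>)"
        using y(1) i by (intro finsum_additive[where f = "\<lambda>x. x"])
          (auto simp: P.module.M.abelian_monoid_axioms abelian_monoid_axioms Pm_carrier m_assoc[symmetric])
      moreover have "a = n \<oplus> (\<ominus> n \<oplus> a)"
        using a' n' by (simp add: r_neg2)
      ultimately have "a = n \<oplus> finsum (Pm i) (\<lambda>\<gamma>. y \<gamma> \<otimes> g \<gamma>) (arcs Q)"
        by (simp only: y(2))
      then show "\<exists>n\<in>N. \<exists>y. (\<forall>\<gamma>\<in>arcs Q. y \<gamma> \<in> carrier (Pm i)) \<and>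
          a = n \<oplus>\<^bsub>Pm i\<^esub> finsum (Pm i) (\<lambda>\<gamma>. y \<gamma> \<lhd>\<^bsub>Pm i\<^esub> g \<gamma>) (arcs Q)"
        using n(1) y(1) by (intro bexI[of _ n] exI[of _ y]) auto
    qed
  qed
  show "hom_kernel (Pm i) S (\<lambda>a. x \<lhd>\<^bsub>S\<^esub> a) = Rad i"
  proof -
    have "c \<odot>\<^bsub>S\<^esub> x = \<zero>\<^bsub>S\<^esub> \<longleftrightarrow> c = 0" for c using inj[of c 0] x by auto
    then have "x \<lhd>\<^bsub>S\<^esub> a = \<zero>\<^bsub>S\<^esub> \<longleftrightarrow> eps i a = 0" if "a \<in> carrier \<Lambda>" for a
      using act[OF that] by simp
    then show ?thesis
      unfolding hom_kernel_def Rad_def Pm_carrier[OF i] by (intro Collect_cong conj_cong refl) simp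
  qed
qed

definition Dm :: "'v \<Rightarrow> ('k, 'e \<Rightarrow> 'a, 'a) right_module" where
  "Dm i = direct_sum_module (out_arcs Q i) (\<lambda>\<alpha>. Pm (head Q \<alpha>))"

definition pi :: "'v \<Rightarrow> ('e \<Rightarrow> 'a) \<Rightarrow> 'a" where
  "pi i x = (\<Oplus>\<alpha>\<in>out_arcs Q i. g \<alpha> \<otimes> x \<alpha>)"

lemma out_arcs_simps [simp]: "finite (out_arcs Q i)" "\<alpha> \<in> out_arcs Q i \<longleftrightarrow> \<alpha> \<in> arcs Q \<and> tail Q \<alpha> = i"
  by (auto simp: out_arcs_def)

lemma Dm_simps [simp]:
  "zero (Dm i) = (\<lambda>j\<in>out_arcs Q i. \<zero>)"
  "add (Dm i) = (\<lambda>x y. \<lambda>j\<in>out_arcs Q i. x j \<oplus> y j)"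
  "smult (Dm i) = (\<lambda>c x. \<lambda>j\<in>out_arcs Q i. c \<odot> x j)"
  "act (Dm i) = (\<lambda>x a. \<lambda>j\<in>out_arcs Q i. x j \<otimes> a)"
  by (simp_all add: Dm_def)

lemma Dm_carrier: "carrier (Dm i) = (\<Pi>\<^sub>E \<alpha>\<in>out_arcs Q i. carrier (Pm (head Q \<alpha>)))"
  by (simp add: Dm_def)

lemma Dm_mem:
  assumes "x \<in> carrier (Dm i)" "\<alpha> \<in> arcs Q" "tail Q \<alpha> = i"
  shows "x \<alpha> \<in> carrier \<Lambda>" "e (head Q \<alpha>) \<otimes> x \<alpha> = x \<alpha>"
  using assms Pm_memD[of "head Q \<alpha>" "x \<alpha>"] by (auto simp: Dm_carrier PiE_iff)

lemma Dm_fd: "fd_right_module \<Lambda> (Dm i)"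
  unfolding Dm_def by (intro direct_sum_fd Pm_fd) auto

lemma Dm_right_module: "right_module \<Lambda> (Dm i)"
  using Dm_fd by auto

lemma Dm_projective: "projective_module \<Lambda> (Dm i)"
  unfolding Dm_def by (intro direct_sum_projective Pm_projective) auto

lemma pi_closed: "x \<in> carrier (Dm i) \<Longrightarrow> pi i x \<in> carrier \<Lambda>"
  unfolding pi_def by (intro finsum_closed) (auto simp: Dm_mem)

lemma pi_hom:
  assumes i: "i \<in> verts Q"
  shows "pi i \<in> rmodule_hom \<Lambda> (Dm i) (RadM i)"
  unfolding rmodule_hom_iff
proof (intro conjI ballI allI)
  fix x assume x: "x \<in> carrier (Dm i)"
  have "e i \<otimes> pi i x = (\<Oplus>\<alpha>\<in>out_arcs Q i. e i \<otimes> (g \<alpha> \<otimes> x \<alpha>))"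
    unfolding pi_def using i x by (intro mult_finsum_right) (auto simp: Dm_mem)
  also have "\<dots> = pi i x"
    unfolding pi_def using i x by (intro finsum_cong') (auto simp: Dm_mem e_g m_assoc[symmetric])
  finally have 1: "e i \<otimes> pi i x = pi i x" .
  have "eps i (finsum \<Lambda> (\<lambda>\<alpha>. g \<alpha> \<otimes> x \<alpha>) A) = 0" if "finite A" "A \<subseteq> out_arcs Q i" for A
    using that
  proof (induction A rule: finite_induct)
    case (insert \<alpha> A)
    then have "finsum \<Lambda> (\<lambda>\<alpha>. g \<alpha> \<otimes> x \<alpha>) (insert \<alpha> A) = g \<alpha> \<otimes> x \<alpha> \<oplus> finsum \<Lambda> (\<lambda>\<alpha>. g \<alpha> \<otimes> x \<alpha>) A"
      using x by (intro finsum_insert) (auto simp: Dm_mem subset_iff)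
    moreover have "finsum \<Lambda> (\<lambda>\<alpha>. g \<alpha> \<otimes> x \<alpha>) A \<in> carrier \<Lambda>"
      using insert x by (intro finsum_closed) (auto simp: Dm_mem subset_iff)
    ultimately show ?case
      using insert x i Dm_mem[OF x, of \<alpha>] by (simp add: eps_add eps_mult eps_g)
  qed (simp add: i)
  from this[of "out_arcs Q i"] have "eps i (pi i x) = 0" by (simp add: pi_def)
  with 1 show "pi i x \<in> carrier (RadM i)" using i x by (simp add: Rad_mem pi_closed)
  { fix y assume y: "y \<in> carrier (Dm i)"
    have "pi i (x \<oplus>\<^bsub>Dm i\<^esub> y) = (\<Oplus>\<alpha>\<in>out_arcs Q i. g \<alpha> \<otimes> x \<alpha> \<oplus> g \<alpha> \<otimes> y \<alpha>)"
      unfolding pi_def using x y by (intro finsum_cong') (auto simp: Dm_mem r_distr)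
    also have "\<dots> = pi i x \<oplus> pi i y"
      unfolding pi_def using x y by (intro finsum_addf) (auto simp: Dm_mem)
    finally show "pi i (x \<oplus>\<^bsub>Dm i\<^esub> y) = pi i x \<oplus>\<^bsub>RadM i\<^esub> pi i y" by simp }
  { fix c
    have "pi i (c \<odot>\<^bsub>Dm i\<^esub> x) = (\<Oplus>\<alpha>\<in>out_arcs Q i. c \<odot> (g \<alpha> \<otimes> x \<alpha>))"
      unfolding pi_def using x by (intro finsum_cong') (auto simp: Dm_mem smult_mult_right)
    also have "\<dots> = c \<odot> pi i x"
      unfolding pi_def using x by (intro finsum_additive[where f = "\<lambda>y. c \<odot> y", symmetric])
        (auto simp: Dm_mem abelian_monoid_axioms smult_add)
    finally show "pi i (c \<odot>\<^bsub>Dm i\<^esub> x) = c \<odot>\<^bsub>RadM i\<^esub> pi i x" by simp }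
  { fix a assume a: "a \<in> carrier \<Lambda>"
    have "pi i (x \<lhd>\<^bsub>Dm i\<^esub> a) = (\<Oplus>\<alpha>\<in>out_arcs Q i. (g \<alpha> \<otimes> x \<alpha>) \<otimes> a)"
      unfolding pi_def using x a by (intro finsum_cong') (auto simp: Dm_mem m_assoc)
    also have "\<dots> = pi i x \<otimes> a"
      unfolding pi_def using x a by (intro finsum_ldistr[symmetric]) (auto simp: Dm_mem)
    finally show "pi i (x \<lhd>\<^bsub>Dm i\<^esub> a) = pi i x \<lhd>\<^bsub>RadM i\<^esub> a" by simp }
qed

text \<open>In the left decomposition of a radical element of P_i, multiplying by \<open>e i\<close>
  keeps exactly the arrows that start at \<open>i\<close>.\<close>

lemma pi_surj:
  assumes i: "i \<in> verts Q"
  shows "pi i ` carrier (Dm i) = Rad i"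
proof
  show "pi i ` carrier (Dm i) \<subseteq> Rad i" using rmodule_homD(1)[OF pi_hom[OF i]] by auto
  show "Rad i \<subseteq> pi i ` carrier (Dm i)"
  proof
    fix d assume "d \<in> Rad i"
    then have d': "d \<in> carrier \<Lambda>" "e i \<otimes> d = d" "eps i d = 0" using i by (auto simp: Rad_mem)
    obtain r where r: "\<And>\<gamma>. \<gamma> \<in> arcs Q \<Longrightarrow> r \<gamma> \<in> carrier \<Lambda>" "d = vpart d \<oplus> (\<Oplus>\<gamma>\<in>arcs Q. g \<gamma> \<otimes> r \<gamma>)"
      using left_decomposition[OF d'(1)] by blast
    have "vpart d = \<zero>"
    proof (rule vpart_eq_zero)
      show "eps u d = 0" if "u \<in> verts Q" for u
        using eps_Pm[OF i that d'(1,2)] d'(3) by (cases "u = i") auto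
    qed
    moreover have c: "(\<Oplus>\<gamma>\<in>arcs Q. g \<gamma> \<otimes> r \<gamma>) \<in> carrier \<Lambda>" using r(1) by (intro finsum_closed) auto
    ultimately have d2: "d = (\<Oplus>\<gamma>\<in>arcs Q. g \<gamma> \<otimes> r \<gamma>)" using r(2) by simp
    \<comment> \<open>The factor \<open>e (head Q \<alpha>)\<close> moves the coefficient into the
      summand at the head of the arrow without changing its product with the arrow.\<close>
    define x where "x = (\<lambda>\<alpha>\<in>out_arcs Q i. e (head Q \<alpha>) \<otimes> r \<alpha>)"
    have x: "x \<in> carrier (Dm i)" using r(1) by (auto simp: x_def Dm_carrier intro!: Pm_mult_e)
    have t: "e i \<otimes> (g \<gamma> \<otimes> r \<gamma>) = (if tail Q \<gamma> = i then g \<gamma> \<otimes> r \<gamma> else \<zero>)" if "\<gamma> \<in> arcs Q" for \<gamma>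
      using that i r(1) e_g[of i \<gamma>] by (auto simp: m_assoc[symmetric])
    have "d = e i \<otimes> (\<Oplus>\<gamma>\<in>arcs Q. g \<gamma> \<otimes> r \<gamma>)" using d'(2) d2 by simp
    also have "\<dots> = (\<Oplus>\<gamma>\<in>arcs Q. e i \<otimes> (g \<gamma> \<otimes> r \<gamma>))" using i r(1) by (intro mult_finsum_right) auto
    also have "\<dots> = (\<Oplus>\<gamma>\<in>arcs Q. if tail Q \<gamma> = i then g \<gamma> \<otimes> r \<gamma> else \<zero>)"
      using r(1) by (intro finsum_cong') (auto simp: t)
    also have "\<dots> = (\<Oplus>\<gamma>\<in>out_arcs Q i. if tail Q \<gamma> = i then g \<gamma> \<otimes> r \<gamma> else \<zero>)"
      using r(1) by (intro add.finprod_mono_neutral_cong_right) (auto simp: out_arcs_def)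
    also have "\<dots> = pi i x"
      unfolding pi_def x_def using r(1) g_e
      by (intro finsum_cong') (auto simp: m_assoc[symmetric])
    finally show "d \<in> pi i ` carrier (Dm i)" using x by (rule image_eqI)
  qed
qed

text \<open>The functionals \<^term>\<open>dl \<alpha>\<close> detect the components outside the radical.\<close>

lemma pi_kernel_Rad:
  assumes d: "d \<in> carrier (Dm i)" "pi i d = \<zero>" and \<alpha>: "\<alpha> \<in> arcs Q" "tail Q \<alpha> = i"
  shows "d \<alpha> \<in> Rad (head Q \<alpha>)"
proof -
  have "dl \<alpha> (finsum \<Lambda> (\<lambda>\<beta>. g \<beta> \<otimes> d \<beta>) A) = (\<Sum>\<beta>\<in>A. dl \<alpha> (g \<beta> \<otimes> d \<beta>))"
    if "finite A" "A \<subseteq> out_arcs Q i" for A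
    using that
  proof (induction A rule: finite_induct)
    case (insert \<beta> A)
    then have "finsum \<Lambda> (\<lambda>\<beta>. g \<beta> \<otimes> d \<beta>) (insert \<beta> A) = g \<beta> \<otimes> d \<beta> \<oplus> finsum \<Lambda> (\<lambda>\<beta>. g \<beta> \<otimes> d \<beta>) A"
      using d by (intro finsum_insert) (auto simp: Dm_mem subset_iff)
    moreover have "finsum \<Lambda> (\<lambda>\<beta>. g \<beta> \<otimes> d \<beta>) A \<in> carrier \<Lambda>"
      using insert d by (intro finsum_closed) (auto simp: Dm_mem subset_iff)
    ultimately show ?case
      using insert d \<alpha> Dm_mem[OF d(1), of \<beta>] by (simp add: dl_add)
  qed (simp add: \<alpha>)
  from this[of "out_arcs Q i"] have "0 = (\<Sum>\<beta>\<in>out_arcs Q i. dl \<alpha> (g \<beta> \<otimes> d \<beta>))"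
    using d(2) \<alpha> by (simp add: pi_def)
  \<comment> \<open>By \<open>dl_mult\<close> the value at
    \<open>g \<beta> \<otimes> d \<beta>\<close> is
    \<open>dl \<alpha> (g \<beta>) * eps (head Q \<alpha>) (d \<beta>)\<close>, since
    \<open>eps\<close> vanishes on arrows; only \<open>\<beta> = \<alpha>\<close> survives.\<close>
  also have "\<dots> = (\<Sum>\<beta>\<in>out_arcs Q i. if \<beta> = \<alpha> then eps (head Q \<alpha>) (d \<alpha>) else 0)"
    using \<alpha> Dm_mem[OF d(1)] by (intro sum.cong) (auto simp: dl_mult dl_g eps_g)
  also have "\<dots> = eps (head Q \<alpha>) (d \<alpha>)" using \<alpha> by simp
  finally show ?thesis using Dm_mem[OF d(1) \<alpha>] \<alpha> by (simp add: Rad_mem)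
qed

text \<open>Two elements of \<open>Dm i\<close> with the same image differ by an element of the
  kernel, whose components are radical by \<open>pi_kernel_Rad\<close>; so Nakayama's lemma gives
  minimality.\<close>

lemma Rad_cover:
  assumes i: "i \<in> verts Q"
  shows "projective_cover \<Lambda> (Dm i) (pi i) (RadM i)"
proof (rule projective_coverI[OF Dm_projective RadM_right_module[OF i] pi_hom[OF i]])
  show "pi i ` carrier (Dm i) = carrier (RadM i)" using pi_surj[OF i] by simp
  fix N assume N: "rsubmodule \<Lambda> N (Dm i)" "pi i ` N = carrier (RadM i)"
  interpret D: right_module \<Lambda> "Dm i" by (rule Dm_right_module)
  have ND: "N \<subseteq> carrier (Dm i)" using N(1) unfolding D.rsubmodule_iff by blast
  show "N = carrier (Dm i)"
  proof (rule nakayama[OF D.right_module_axioms N(1)])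
    fix x assume x: "x \<in> carrier (Dm i)"
    have "pi i x \<in> pi i ` N" using N(2) rmodule_homD(1)[OF pi_hom[OF i] x] by simp
    then obtain n where n: "n \<in> N" "pi i x = pi i n" by (rule imageE)
    have nD: "n \<in> carrier (Dm i)" using n ND by auto
    define d where "d = (\<ominus>\<^bsub>Dm i\<^esub> n) \<oplus>\<^bsub>Dm i\<^esub> x"
    have d: "d \<in> carrier (Dm i)" unfolding d_def using nD x D.M_add D.M_neg by blast
    have "pi i d = \<ominus>\<^bsub>RadM i\<^esub> pi i n \<oplus>\<^bsub>RadM i\<^esub> pi i x"
      unfolding d_def using rmodule_homD(2)[OF pi_hom[OF i] D.M_neg[OF nD] x]
        rmodule_hom_minus[OF D.right_module_axioms RadM_right_module[OF i] pi_hom[OF i] nD] by simp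
    also have "\<dots> = \<zero>"
      using abelian_group.l_neg[OF right_module_group[OF RadM_right_module[OF i]], of "pi i n"]
        rmodule_homD(1)[OF pi_hom[OF i] nD] n(2) by simp
    finally have "pi i d = \<zero>" .
    have "\<forall>\<alpha>\<in>out_arcs Q i. \<exists>y. (\<forall>\<gamma>\<in>arcs Q. y \<gamma> \<in> carrier (Pm (head Q \<alpha>))) \<and>
        d \<alpha> = (\<Oplus>\<gamma>\<in>arcs Q. y \<gamma> \<otimes> g \<gamma>)"
    proof
      fix \<alpha> assume "\<alpha> \<in> out_arcs Q i"
      then have \<alpha>: "\<alpha> \<in> arcs Q" "tail Q \<alpha> = i" by auto
      obtain y where "\<And>\<gamma>. \<gamma> \<in> arcs Q \<Longrightarrow> y \<gamma> \<in> carrier (Pm (head Q \<alpha>))" "d \<alpha> = (\<Oplus>\<gamma>\<in>arcs Q. y \<gamma> \<otimes> g \<gamma>)"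
        by (rule Rad_generated[OF ends_Q(2)[OF \<alpha>(1)] pi_kernel_Rad[OF d \<open>pi i d = \<zero>\<close> \<alpha>]]) (rule that, auto)
      then show "\<exists>y. (\<forall>\<gamma>\<in>arcs Q. y \<gamma> \<in> carrier (Pm (head Q \<alpha>))) \<and> d \<alpha> = (\<Oplus>\<gamma>\<in>arcs Q. y \<gamma> \<otimes> g \<gamma>)"
        by blast
    qed
    from bchoice[OF this] obtain y where y0: "\<forall>\<alpha>\<in>out_arcs Q i. (\<forall>\<gamma>\<in>arcs Q. y \<alpha> \<gamma> \<in> carrier (Pm (head Q \<alpha>))) \<and>
        d \<alpha> = (\<Oplus>\<gamma>\<in>arcs Q. y \<alpha> \<gamma> \<otimes> g \<gamma>)"
      by (elim exE) (rule that)
    have y: "\<And>\<alpha> \<gamma>. \<lbrakk>\<alpha> \<in> out_arcs Q i; \<gamma> \<in> arcs Q\<rbrakk> \<Longrightarrow> y \<alpha> \<gamma> \<in> carrier (Pm (head Q \<alpha>))"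
      "\<And>\<alpha>. \<alpha> \<in> out_arcs Q i \<Longrightarrow> d \<alpha> = (\<Oplus>\<gamma>\<in>arcs Q. y \<alpha> \<gamma> \<otimes> g \<gamma>)"
      using y0 by blast+
    \<comment> \<open>Regrouping: the radical expressions of the components are collected, arrow by
      arrow, into vectors of \<open>Dm i\<close>.\<close>
    define z where "z \<gamma> = (\<lambda>\<alpha>\<in>out_arcs Q i. y \<alpha> \<gamma>)" for \<gamma>
    have z: "z \<gamma> \<in> carrier (Dm i)" if "\<gamma> \<in> arcs Q" for \<gamma>
      using y(1) that by (auto simp: z_def Dm_carrier)
    have zg: "z \<gamma> \<lhd>\<^bsub>Dm i\<^esub> g \<gamma> \<in> carrier (Dm i)" if "\<gamma> \<in> arcs Q" for \<gamma>
      using z[OF that] that by (intro D.act_closed) auto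
    have "d = finsum (Dm i) (\<lambda>\<gamma>. z \<gamma> \<lhd>\<^bsub>Dm i\<^esub> g \<gamma>) (arcs Q)"
    proof (rule PiE_eqI)
      show "d \<in> (\<Pi>\<^sub>E \<alpha>\<in>out_arcs Q i. carrier (Pm (head Q \<alpha>)))" using d by (simp add: Dm_carrier)
      show "finsum (Dm i) (\<lambda>\<gamma>. z \<gamma> \<lhd>\<^bsub>Dm i\<^esub> g \<gamma>) (arcs Q) \<in> (\<Pi>\<^sub>E \<alpha>\<in>out_arcs Q i. carrier (Pm (head Q \<alpha>)))"
        unfolding Dm_carrier[symmetric] using zg by (intro D.module.M.finsum_closed) auto
      fix \<alpha> assume \<alpha>: "\<alpha> \<in> out_arcs Q i"
      then have P: "right_module \<Lambda> (Pm (head Q \<alpha>))" by (intro Pm_right_module) auto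
      have "finsum (Dm i) (\<lambda>\<gamma>. z \<gamma> \<lhd>\<^bsub>Dm i\<^esub> g \<gamma>) (arcs Q) \<alpha> =
        finsum (Pm (head Q \<alpha>)) (\<lambda>\<gamma>. (z \<gamma> \<lhd>\<^bsub>Dm i\<^esub> g \<gamma>) \<alpha>) (arcs Q)"
        unfolding Dm_def
        by (rule finsum_direct_sum[of "out_arcs Q i" \<Lambda> "\<lambda>\<alpha>. Pm (head Q \<alpha>)"])
          (use zg \<alpha> in \<open>auto intro!: Pm_right_module simp: Dm_def\<close>)
      also have "\<dots> = (\<Oplus>\<gamma>\<in>arcs Q. (z \<gamma> \<lhd>\<^bsub>Dm i\<^esub> g \<gamma>) \<alpha>)"
        using \<alpha> y(1) by (intro finsum_additive[where f = "\<lambda>x. x"])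
          (auto simp: right_module_monoid[OF P] abelian_monoid_axioms Pm_carrier z_def m_assoc[symmetric])
      also have "\<dots> = (\<Oplus>\<gamma>\<in>arcs Q. y \<alpha> \<gamma> \<otimes> g \<gamma>)"
        using \<alpha> y(1)[OF \<alpha>] by (intro finsum_cong') (auto simp: z_def Pm_carrier)
      finally show "d \<alpha> = finsum (Dm i) (\<lambda>\<gamma>. z \<gamma> \<lhd>\<^bsub>Dm i\<^esub> g \<gamma>) (arcs Q) \<alpha>" using y(2)[OF \<alpha>] by simp
    qed
    moreover have "x = n \<oplus>\<^bsub>Dm i\<^esub> d"
      unfolding d_def by (rule D.module.M.r_neg2[OF nD x, symmetric])
    ultimately show "\<exists>n\<in>N. \<exists>y. (\<forall>\<gamma>\<in>arcs Q. y \<gamma> \<in> carrier (Dm i)) \<and>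
          x = n \<oplus>\<^bsub>Dm i\<^esub> finsum (Dm i) (\<lambda>\<gamma>. y \<gamma> \<lhd>\<^bsub>Dm i\<^esub> g \<gamma>) (arcs Q)"
      using n(1) z by (intro bexI[of _ n] exI[of _ z]) simp_all
  qed
qed

definition KM :: "'v \<Rightarrow> ('k, 'e \<Rightarrow> 'a, 'a) right_module" where
  "KM i = (Dm i)\<lparr>carrier := {x \<in> carrier (Dm i). pi i x = \<zero>}\<rparr>"

lemma KM_kernel: "(Dm i)\<lparr>carrier := hom_kernel (Dm i) (RadM i) (pi i)\<rparr> = KM i"
  by (simp add: KM_def hom_kernel_def)

lemma KM_fd: "i \<in> verts Q \<Longrightarrow> fd_right_module \<Lambda> (KM i)"
  unfolding KM_kernel[symmetric]
  by (intro fd_right_module.submodule_fd Dm_fd hom_kernel_rsubmodule Dm_right_module RadM_right_module pi_hom)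

text \<open>The first syzygy is only isomorphic to \<open>RadM i\<close>, so the cover of
  \<open>RadM i\<close> is carried along that isomorphism before its kernel is taken.\<close>

lemma syzygy_simple:
  fixes S :: "('k, 'a) fdmod"
  assumes S: "fd_right_module \<Lambda> S" and i: "i \<in> verts Q" and x: "x \<in> carrier S" "x \<noteq> \<zero>\<^bsub>S\<^esub>"
    and gen: "carrier S = range (\<lambda>c. c \<odot>\<^bsub>S\<^esub> x)"
    and act: "\<And>b. b \<in> carrier \<Lambda> \<Longrightarrow> x \<lhd>\<^bsub>S\<^esub> b = eps i b \<odot>\<^bsub>S\<^esub> x"
  shows "rmodule_iso \<Lambda> (RadM i) (syzygy \<Lambda> S)" "rmodule_iso \<Lambda> (KM i) (syzygy \<Lambda> (syzygy \<Lambda> S))"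
    "fd_right_module \<Lambda> (syzygy \<Lambda> (syzygy \<Lambda> S))"
proof -
  have c: "projective_cover \<Lambda> (Pm i) (\<lambda>a. x \<lhd>\<^bsub>S\<^esub> a) S" "hom_kernel (Pm i) S (\<lambda>a. x \<lhd>\<^bsub>S\<^esub> a) = Rad i"
    using simple_cover[OF fd_right_module_imp[OF S] i x(1) gen x(2)] act by auto
  show 1: "rmodule_iso \<Lambda> (RadM i) (syzygy \<Lambda> S)"
    using syzygy_iso(1)[OF S c(1)] unfolding c(2) RadM_def .
  have S1: "fd_right_module \<Lambda> (syzygy \<Lambda> S)" by (rule syzygy_iso(2)[OF S c(1)])
  obtain \<theta> where \<theta>: "\<theta> \<in> rmodule_hom \<Lambda> (RadM i) (syzygy \<Lambda> S)"
    "bij_betw \<theta> (carrier (RadM i)) (carrier (syzygy \<Lambda> S))"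
    using 1 unfolding rmodule_iso_def by blast
  note c2 = projective_cover_iso_target[OF Rad_cover[OF i] RadM_right_module[OF i] fd_right_module_imp[OF S1] \<theta>]
  show "rmodule_iso \<Lambda> (KM i) (syzygy \<Lambda> (syzygy \<Lambda> S))"
    using syzygy_iso(1)[OF S1 c2(1)] unfolding c2(2) KM_kernel .
  show "fd_right_module \<Lambda> (syzygy \<Lambda> (syzygy \<Lambda> S))" by (rule syzygy_iso(2)[OF S1 c2(1)])
qed

end

section \<open>The symmetric form\<close>

context bound_quiver
begin

text \<open>Mirror image of \<open>socle_act\<close>: by the right decomposition, only the vertex
  part of \<open>z\<close> at \<open>j\<close> acts on \<open>x\<close>.\<close>

lemma kill_left:
  assumes x: "x \<in> carrier \<Lambda>" "\<And>\<gamma>. \<gamma> \<in> arcs Q \<Longrightarrow> g \<gamma> \<otimes> x = \<zero>" "j \<in> verts Q" "e j \<otimes> x = x"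
    and z: "z \<in> carrier \<Lambda>"
  shows "z \<otimes> x = eps j z \<odot> x"
proof -
  obtain r where r: "\<And>\<gamma>. \<gamma> \<in> arcs Q \<Longrightarrow> r \<gamma> \<in> carrier \<Lambda>" "z = vpart z \<oplus> (\<Oplus>\<gamma>\<in>arcs Q. r \<gamma> \<otimes> g \<gamma>)"
    using right_decomposition[OF z] by blast
  let ?R = "\<Oplus>\<gamma>\<in>arcs Q. r \<gamma> \<otimes> g \<gamma>"
  have R: "?R \<in> carrier \<Lambda>" using r(1) by (intro finsum_closed) auto
  have "?R \<otimes> x = (\<Oplus>\<gamma>\<in>arcs Q. r \<gamma> \<otimes> g \<gamma> \<otimes> x)"
    using x r(1) by (intro finsum_ldistr) auto
  also have "\<dots> = (\<Oplus>\<gamma>\<in>arcs Q. \<zero>)" using x r(1) by (intro finsum_cong') (auto simp: m_assoc)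
  finally have R0: "?R \<otimes> x = \<zero>" by simp
  have ex: "e u \<otimes> x = (if u = j then x else \<zero>)" if u: "u \<in> verts Q" for u
  proof -
    have "e u \<otimes> x = e u \<otimes> (e j \<otimes> x)" using x by simp
    also have "\<dots> = (e u \<otimes> e j) \<otimes> x" using x u by (intro m_assoc[symmetric]) auto
    finally show ?thesis using x u by (simp add: e_e)
  qed
  have "vpart z \<otimes> x = (\<Oplus>u\<in>verts Q. eps u z \<odot> e u \<otimes> x)"
    unfolding vpart_def using x by (intro finsum_ldistr) auto
  also have "\<dots> = eps j z \<odot> x"
    using x(1,3) by (intro finsum_single[where i = j]) (auto simp: smult_mult_left ex)
  finally have V: "vpart z \<otimes> x = eps j z \<odot> x" .
  have "z \<otimes> x = (vpart z \<oplus> ?R) \<otimes> x" using r(2) by simp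
  also have "\<dots> = vpart z \<otimes> x \<oplus> ?R \<otimes> x" using x R by (intro l_distr) auto
  finally show ?thesis using x by (simp add: V R0)
qed

text \<open>\<open>y\<close> lies in the radical, hence is a sum of elements that start with an
  arrow.\<close>

lemma kill_right:
  assumes x: "x \<in> carrier \<Lambda>" "\<And>\<gamma>. \<gamma> \<in> arcs Q \<Longrightarrow> x \<otimes> g \<gamma> = \<zero>"
    and y: "y \<in> carrier \<Lambda>" "\<And>u. u \<in> verts Q \<Longrightarrow> eps u y = 0"
  shows "x \<otimes> y = \<zero>"
proof -
  obtain l where l: "\<And>\<gamma>. \<gamma> \<in> arcs Q \<Longrightarrow> l \<gamma> \<in> carrier \<Lambda>" "y = vpart y \<oplus> (\<Oplus>\<gamma>\<in>arcs Q. g \<gamma> \<otimes> l \<gamma>)"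
    using left_decomposition[OF y(1)] by blast
  have "(\<Oplus>\<gamma>\<in>arcs Q. g \<gamma> \<otimes> l \<gamma>) \<in> carrier \<Lambda>" using l(1) by (intro finsum_closed) auto
  then have "y = (\<Oplus>\<gamma>\<in>arcs Q. g \<gamma> \<otimes> l \<gamma>)" using l(2) vpart_eq_zero[of y] y(2) by simp
  then have "x \<otimes> y = (\<Oplus>\<gamma>\<in>arcs Q. x \<otimes> (g \<gamma> \<otimes> l \<gamma>))"
    using x(1) l(1) by (simp only:) (intro mult_finsum_right, auto)
  also have "\<dots> = (\<Oplus>\<gamma>\<in>arcs Q. \<zero>)"
    using x l(1) by (intro finsum_cong') (auto simp: m_assoc[symmetric])
  finally show ?thesis by simp
qed

end

locale symmetric_bound_quiver = bound_quiver \<Lambda> Q e g eps dl m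
  for \<Lambda> :: "('k::field, 'a) module" (structure) and Q :: "('v, 'e) pre_digraph" and e g eps dl m +
  fixes B :: "'a \<Rightarrow> 'a \<Rightarrow> 'k"
  assumes B_add: "\<lbrakk>x \<in> carrier \<Lambda>; y \<in> carrier \<Lambda>; z \<in> carrier \<Lambda>\<rbrakk> \<Longrightarrow> B (x \<oplus> y) z = B x z + B y z"
    and B_smult: "\<lbrakk>x \<in> carrier \<Lambda>; y \<in> carrier \<Lambda>\<rbrakk> \<Longrightarrow> B (c \<odot> x) y = c * B x y"
    and B_assoc: "\<lbrakk>x \<in> carrier \<Lambda>; y \<in> carrier \<Lambda>; z \<in> carrier \<Lambda>\<rbrakk> \<Longrightarrow> B (x \<otimes> y) z = B x (y \<otimes> z)"
    and B_sym: "\<lbrakk>x \<in> carrier \<Lambda>; y \<in> carrier \<Lambda>\<rbrakk> \<Longrightarrow> B x y = B y x"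
    and B_nondeg: "\<lbrakk>x \<in> carrier \<Lambda>; \<And>y. y \<in> carrier \<Lambda> \<Longrightarrow> B x y = 0\<rbrakk> \<Longrightarrow> x = \<zero>"
begin

text \<open>\<open>B x \<one>\<close> is the symmetrizing linear form; through it, questions about
  \<open>B\<close> become questions about products.\<close>

lemma B_one: "\<lbrakk>x \<in> carrier \<Lambda>; y \<in> carrier \<Lambda>\<rbrakk> \<Longrightarrow> B (x \<otimes> y) \<one> = B x y"
  using B_assoc[of x y \<one>] by simp

lemma B_zero: "y \<in> carrier \<Lambda> \<Longrightarrow> B \<zero> y = 0"
  using B_smult[of \<zero> y 0] by simp

text \<open>For every \<open>z\<close>, invariance of the form turns
  \<open>B (x \<otimes> g \<gamma>) z\<close> into the value of the symmetrizing form at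
  \<open>g \<gamma> \<otimes> z \<otimes> x\<close>, and this product is zero because
  \<open>g \<gamma> \<otimes> z\<close> is in the radical. Together with the converse below, left
  and right socle agree.\<close>

lemma left_killed_imp_right_killed:
  assumes x: "x \<in> carrier \<Lambda>" "\<And>\<gamma>. \<gamma> \<in> arcs Q \<Longrightarrow> g \<gamma> \<otimes> x = \<zero>" "j \<in> verts Q" "e j \<otimes> x = x"
    and \<gamma>: "\<gamma> \<in> arcs Q"
  shows "x \<otimes> g \<gamma> = \<zero>"
proof (rule B_nondeg)
  show "x \<otimes> g \<gamma> \<in> carrier \<Lambda>" using x \<gamma> by simp
  fix z assume z: "z \<in> carrier \<Lambda>"
  have "B (x \<otimes> g \<gamma>) z = B x (g \<gamma> \<otimes> z)" using x \<gamma> z by (simp add: B_assoc)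
  also have "\<dots> = B (g \<gamma> \<otimes> z) x" using x \<gamma> z by (intro B_sym) auto
  also have "\<dots> = B (g \<gamma> \<otimes> z \<otimes> x) \<one>" using x \<gamma> z by (intro B_one[symmetric]) auto
  also have "g \<gamma> \<otimes> z \<otimes> x = \<zero>"
    using kill_left[OF x, of "g \<gamma> \<otimes> z"] x \<gamma> z by (simp add: eps_mult eps_g)
  finally show "B (x \<otimes> g \<gamma>) z = 0" by (simp add: B_zero)
qed

lemma right_killed_imp_left_killed:
  assumes x: "x \<in> carrier \<Lambda>" "\<And>\<gamma>. \<gamma> \<in> arcs Q \<Longrightarrow> x \<otimes> g \<gamma> = \<zero>" and \<gamma>: "\<gamma> \<in> arcs Q"
  shows "g \<gamma> \<otimes> x = \<zero>"
proof (rule B_nondeg)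
  show "g \<gamma> \<otimes> x \<in> carrier \<Lambda>" using x \<gamma> by simp
  fix z assume z: "z \<in> carrier \<Lambda>"
  have "B (g \<gamma> \<otimes> x) z = B z (g \<gamma> \<otimes> x)" using x \<gamma> z by (intro B_sym) auto
  also have "\<dots> = B (z \<otimes> g \<gamma>) x" using x \<gamma> z by (intro B_assoc[symmetric]) auto
  also have "\<dots> = B x (z \<otimes> g \<gamma>)" using x \<gamma> z by (intro B_sym) auto
  also have "\<dots> = B (x \<otimes> (z \<otimes> g \<gamma>)) \<one>" using x \<gamma> z by (intro B_one[symmetric]) auto
  also have "x \<otimes> (z \<otimes> g \<gamma>) = \<zero>" 
    by (rule kill_right[OF x]) (use \<gamma> z in \<open>auto simp: eps_mult eps_g\<close>)
  finally show "B (g \<gamma> \<otimes> x) z = 0" by (simp add: B_zero)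
qed

text \<open>\<^term>\<open>soc j\<close> is the part at \<^term>\<open>j\<close> of the two-sided socle.\<close>

definition soc :: "'v \<Rightarrow> 'a set" where
  "soc j = {x \<in> carrier \<Lambda>. e j \<otimes> x = x \<and> (\<forall>\<gamma>\<in>arcs Q. g \<gamma> \<otimes> x = \<zero>) \<and> (\<forall>\<gamma>\<in>arcs Q. x \<otimes> g \<gamma> = \<zero>)}"

text \<open>For a vertex \<open>k\<close> other than \<open>j\<close>,
  \<open>x \<otimes> e k\<close> is orthogonal to every \<open>z\<close>, since
  \<open>e k \<otimes> z\<close> acts on \<open>x\<close> from the left by
  \<open>eps j (e k \<otimes> z) = 0\<close>. So socle elements that start at \<open>j\<close> also
  end at \<open>j\<close>, which makes the socle of P_j the simple module at
  \<open>j\<close>.\<close>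

lemma soc_mult_e:
  assumes j: "j \<in> verts Q" and x: "x \<in> soc j"
  shows "x \<otimes> e j = x"
proof -
  have x': "x \<in> carrier \<Lambda>" "e j \<otimes> x = x" "\<And>\<gamma>. \<gamma> \<in> arcs Q \<Longrightarrow> g \<gamma> \<otimes> x = \<zero>" using x unfolding soc_def by simp_all
  have off: "x \<otimes> e k = \<zero>" if k: "k \<in> verts Q" "k \<noteq> j" for k
  proof (rule B_nondeg)
    show "x \<otimes> e k \<in> carrier \<Lambda>" using x'(1) k by simp
    fix z assume z: "z \<in> carrier \<Lambda>"
    have "e k \<otimes> z \<otimes> x = eps j (e k \<otimes> z) \<odot> x"
      using j k z by (intro kill_left[OF x'(1,3) j x'(2)]) auto
    also have "\<dots> = \<zero>" using x'(1) j k z by (simp add: eps_mult eps_e)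
    finally have 0: "e k \<otimes> z \<otimes> x = \<zero>" .
    have "B (x \<otimes> e k) z = B x (e k \<otimes> z)" using x'(1) k z by (simp add: B_assoc)
    also have "\<dots> = B (e k \<otimes> z) x" using x'(1) k z by (intro B_sym) auto
    also have "\<dots> = B (e k \<otimes> z \<otimes> x) \<one>" using x'(1) k z by (intro B_one[symmetric]) auto
    finally show "B (x \<otimes> e k) z = 0" using 0 by (simp add: B_zero)
  qed
  have "x \<otimes> \<one> = (\<Oplus>k\<in>verts Q. x \<otimes> e k)"
    unfolding one_e using x'(1) by (intro mult_finsum_right) auto
  also have "\<dots> = x \<otimes> e j" using j x'(1) off by (intro finsum_single[where i = j]) auto
  finally show ?thesis using x'(1) by simp
qed

lemma socD:
  assumes "x \<in> soc j"
  shows "x \<in> carrier \<Lambda>" "e j \<otimes> x = x" "\<gamma> \<in> arcs Q \<Longrightarrow> g \<gamma> \<otimes> x = \<zero>" "\<gamma> \<in> arcs Q \<Longrightarrow> x \<otimes> g \<gamma> = \<zero>"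
  using assms unfolding soc_def by simp_all

lemma soc_act:
  assumes j: "j \<in> verts Q" and z: "z \<in> soc j" and a: "a \<in> carrier \<Lambda>"
  shows "z \<otimes> a = eps j a \<odot> z"
proof -
  have "z \<lhd>\<^bsub>regular_module \<Lambda>\<^esub> a = eps j a \<odot>\<^bsub>regular_module \<Lambda>\<^esub> z"
  proof (rule socle_act[OF regular])
    show "z \<in> carrier (regular_module \<Lambda>)" using socD(1)[OF z] by simp
    show "z \<lhd>\<^bsub>regular_module \<Lambda>\<^esub> e j = z" using soc_mult_e[OF j z] by simp
    show "z \<lhd>\<^bsub>regular_module \<Lambda>\<^esub> g \<gamma> = \<zero>\<^bsub>regular_module \<Lambda>\<^esub>" if "\<gamma> \<in> arcs Q" for \<gamma>
      using socD(4)[OF z that] by simp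
  qed (fact j a)+
  then show ?thesis by simp
qed

lemma soc_lin:
  assumes j: "j \<in> verts Q" and x: "x \<in> soc j" and y: "y \<in> soc j"
  shows "y \<oplus> c \<odot> x \<in> soc j"
  unfolding soc_def
proof (rule CollectI, intro conjI ballI)
  note xD = socD[OF x] and yD = socD[OF y]
  show "y \<oplus> c \<odot> x \<in> carrier \<Lambda>" using xD(1) yD(1) by simp
  show "e j \<otimes> (y \<oplus> c \<odot> x) = y \<oplus> c \<odot> x"
    using xD(1,2) yD(1,2) j by (simp add: r_distr smult_mult_right)
  fix \<gamma> assume \<gamma>: "\<gamma> \<in> arcs Q"
  show "g \<gamma> \<otimes> (y \<oplus> c \<odot> x) = \<zero>"
    using xD(1) yD(1) xD(3)[OF \<gamma>] yD(3)[OF \<gamma>] \<gamma> by (simp add: r_distr smult_mult_right)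
  show "(y \<oplus> c \<odot> x) \<otimes> g \<gamma> = \<zero>"
    using xD(1) yD(1) xD(4)[OF \<gamma>] yD(4)[OF \<gamma>] \<gamma> by (simp add: l_distr smult_mult_left)
qed

text \<open>The symmetrizing form is injective on \<open>soc j\<close>: the algebra acts there by
  scalars, so \<open>B z a = eps j a * B z \<one>\<close>.\<close>

lemma soc_one_dim:
  assumes j: "j \<in> verts Q" and x: "x \<in> soc j" "x \<noteq> \<zero>" and y: "y \<in> soc j"
  shows "\<exists>c. y = c \<odot> x"
proof -
  have zero: "z = \<zero>" if z: "z \<in> soc j" "B z \<one> = 0" for z
  proof (rule B_nondeg)
    show zc: "z \<in> carrier \<Lambda>" by (rule socD(1)[OF z(1)])
    fix a assume a: "a \<in> carrier \<Lambda>"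
    have "B z a = B (z \<otimes> a) \<one>" using B_one[OF zc a] by simp
    also have "\<dots> = eps j a * B z \<one>" unfolding soc_act[OF j z(1) a] by (rule B_smult[OF zc one_closed])
    finally show "B z a = 0" using z(2) by simp
  qed
  note c = socD(1)[OF x(1)] socD(1)[OF y]
  have t: "B x \<one> \<noteq> 0" using zero[OF x(1)] x(2) by (intro notI) simp
  \<comment> \<open>Chosen so that \<open>y - s x\<close> has value 0 under the symmetrizing
    form.\<close>
  define s where "s = B y \<one> / B x \<one>"
  have "B (y \<oplus> (- s) \<odot> x) \<one> = B y \<one> - s * B x \<one>" using c by (simp add: B_add B_smult)
  also have "\<dots> = 0" using t by (simp add: s_def)
  finally have z: "y \<oplus> (- s) \<odot> x = \<zero>" by (rule zero[OF soc_lin[OF j x(1) y]])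
  have "(- s) \<odot> x \<oplus> s \<odot> x = (- s + s) \<odot> x" using c(1) by (intro add_smult[symmetric])
  also have "\<dots> = \<zero>" using c(1) by simp
  finally have n: "(- s) \<odot> x \<oplus> s \<odot> x = \<zero>" .
  have "y \<oplus> ((- s) \<odot> x \<oplus> s \<odot> x) = (y \<oplus> (- s) \<odot> x) \<oplus> s \<odot> x" using c by (simp add: a_assoc)
  then have "y = s \<odot> x" unfolding z n using c by simp
  then show ?thesis by (rule exI)
qed

text \<open>A socle vector of P_j, obtained as a multiple of \<open>e j\<close>, is killed by the
  arrows on the right, hence by the form also on the left.\<close>

lemma soc_exists:
  assumes j: "j \<in> verts Q"
  obtains y where "y \<in> soc j" "y \<noteq> \<zero>"
proof -
  have ej: "e j \<in> carrier (regular_module \<Lambda>)" "e j \<noteq> \<zero>\<^bsub>regular_module \<Lambda>\<^esub>"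
    using j e_nonzero[OF j] by auto
  have "\<exists>a. a \<in> carrier \<Lambda> \<and> e j \<otimes> a \<noteq> \<zero> \<and> (\<forall>\<gamma>\<in>arcs Q. e j \<otimes> a \<otimes> g \<gamma> = \<zero>)"
  proof (rule socle_vector[OF regular ej])
    fix a i
    assume "a \<in> carrier \<Lambda>" "e j \<lhd>\<^bsub>regular_module \<Lambda>\<^esub> a \<noteq> \<zero>\<^bsub>regular_module \<Lambda>\<^esub>"
      "\<And>\<gamma>. \<gamma> \<in> arcs Q \<Longrightarrow> e j \<lhd>\<^bsub>regular_module \<Lambda>\<^esub> a \<lhd>\<^bsub>regular_module \<Lambda>\<^esub> g \<gamma> = \<zero>\<^bsub>regular_module \<Lambda>\<^esub>"
    then show ?thesis by (intro exI[of _ a]) simp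
  qed
  then obtain a where a': "a \<in> carrier \<Lambda> \<and> e j \<otimes> a \<noteq> \<zero> \<and> (\<forall>\<gamma>\<in>arcs Q. e j \<otimes> a \<otimes> g \<gamma> = \<zero>)"
    by (elim exE) (rule that)
  note a = a'[THEN conjunct1] a'[THEN conjunct2, THEN conjunct1] a'[THEN conjunct2, THEN conjunct2, THEN bspec]
  let ?y = "e j \<otimes> a"
  have y: "?y \<in> carrier \<Lambda>" "e j \<otimes> ?y = ?y" using a(1) j by (auto simp: m_assoc[symmetric] e_e)
  have "g \<gamma> \<otimes> ?y = \<zero>" if "\<gamma> \<in> arcs Q" for \<gamma>
    by (rule right_killed_imp_left_killed[OF y(1) a(3) that])
  then have "?y \<in> soc j" using y a(3) by (simp add: soc_def)
  then show ?thesis using a(2) by (rule that)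
qed

text \<open>
  Duality without dimension counting: a functional vanishing on a finite set \<^term>\<open>F\<close> vanishes on everything orthogonal to the orthogonal complement of \<^term>\<open>F\<close>.
\<close>

lemma double_orthogonal:
  assumes h: "\<And>x y. \<lbrakk>x \<in> carrier \<Lambda>; y \<in> carrier \<Lambda>\<rbrakk> \<Longrightarrow> h (x \<oplus> y) = h x + h y"
    "\<And>c x. x \<in> carrier \<Lambda> \<Longrightarrow> h (c \<odot> x) = c * h x"
    and F: "finite F" "F \<subseteq> carrier \<Lambda>" "\<And>x. x \<in> F \<Longrightarrow> h x = (0::'k)"
    and b: "b \<in> carrier \<Lambda>" "\<And>y. \<lbrakk>y \<in> carrier \<Lambda>; \<And>x. x \<in> F \<Longrightarrow> B x y = 0\<rbrakk> \<Longrightarrow> B b y = 0"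
  shows "h b = 0"
  using F b
proof (induction F arbitrary: b rule: finite_induct)
  case empty
  then have "b = \<zero>" by (intro B_nondeg) auto
  then show ?case using h(2)[of \<zero> 0] by simp
next
  case (insert c F)
  have c: "c \<in> carrier \<Lambda>" "h c = 0" using insert by auto
  have IH: "h b = 0" if "b \<in> carrier \<Lambda>" "\<And>y. \<lbrakk>y \<in> carrier \<Lambda>; \<And>x. x \<in> F \<Longrightarrow> B x y = 0\<rbrakk> \<Longrightarrow> B b y = 0" for b
    using insert.IH[of b] insert.prems(1,2) that by auto
  show ?case
  proof (cases "\<exists>y0\<in>carrier \<Lambda>. (\<forall>x\<in>F. B x y0 = 0) \<and> B c y0 \<noteq> 0")
    case True
    then obtain y0 where y0: "y0 \<in> carrier \<Lambda>" "\<forall>x\<in>F. B x y0 = 0" "B c y0 \<noteq> 0" by blast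
    \<comment> \<open>Makes \<open>b + s c\<close> orthogonal to \<open>y0\<close>.\<close>
    let ?s = "- (B b y0 / B c y0)"
    have b': "b \<oplus> ?s \<odot> c \<in> carrier \<Lambda>" using insert.prems c by simp
    have "h (b \<oplus> ?s \<odot> c) = 0"
    proof (rule IH[OF b'])
      fix y assume y: "y \<in> carrier \<Lambda>" "\<And>x. x \<in> F \<Longrightarrow> B x y = 0"
      \<comment> \<open>Makes \<open>y + t y0\<close> orthogonal to \<open>c\<close>, hence to the
        whole of \<open>insert c F\<close>.\<close>
      let ?t = "- (B c y / B c y0)"
      let ?y = "y \<oplus> ?t \<odot> y0"
      have By: "B x ?y = B x y + ?t * B x y0" if "x \<in> carrier \<Lambda>" for x
      proof -
        have "B x ?y = B ?y x" using that y y0 by (intro B_sym) auto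
        also have "\<dots> = B y x + ?t * B y0 x" using that y y0 by (simp add: B_add B_smult)
        finally show ?thesis using B_sym[of x y] B_sym[of x y0] that y y0 by simp
      qed
      have "B x ?y = 0" if "x \<in> insert c F" for x
        using that By[of x] c y y0 insert.prems(1) by auto
      then have "B b ?y = 0" using insert.prems(4)[of ?y] y y0 by simp
      then have "B b y = B c y / B c y0 * B b y0" using By[OF insert.prems(3)] by simp
      then show "B (b \<oplus> ?s \<odot> c) y = 0" using insert.prems(3) c y y0 by (simp add: B_add B_smult)
    qed
    then show ?thesis using h c insert.prems(3) by simp
  next
    case False
    then show ?thesis using insert.prems by (intro IH) auto
  qed
qed

section \<open>The second syzygy over a symmetric algebra\<close>

lemma KM_simps [simp]:
  "zero (KM i) = zero (Dm i)" "add (KM i) = add (Dm i)" "smult (KM i) = smult (Dm i)" "act (KM i) = act (Dm i)"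
  by (simp_all add: KM_def)

lemma KM_carrier: "carrier (KM i) = {x \<in> carrier (Dm i). pi i x = \<zero>}"
  by (simp add: KM_def)

text \<open>Arrows kill socle elements from the left, so a socle element placed in a single
  component is in the kernel of \<open>pi\<close>.\<close>

lemma inc_KM:
  assumes \<alpha>: "\<alpha> \<in> arcs Q" "tail Q \<alpha> = i" and y: "y \<in> soc (head Q \<alpha>)"
  shows "(\<lambda>\<beta>\<in>out_arcs Q i. if \<beta> = \<alpha> then y else \<zero>) \<in> carrier (KM i)"
proof -
  let ?x = "\<lambda>\<beta>\<in>out_arcs Q i. if \<beta> = \<alpha> then y else \<zero>"
  have "?x \<in> carrier (Dm i)"
    using \<alpha> y by (auto simp: Dm_carrier Pm_carrier soc_def)
  moreover have "pi i ?x = \<zero>"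
    unfolding pi_def using \<alpha> y by (intro finsum_single[where i = \<alpha>]) (auto simp: soc_def)
  ultimately show ?thesis by (simp add: KM_carrier)
qed

lemma KM_basis:
  assumes S: "simple_module \<Lambda> (KM i)"
  shows "\<exists>i' x. i' \<in> verts Q \<and> x \<in> carrier (KM i) \<and> carrier (KM i) = range (\<lambda>c. c \<odot>\<^bsub>KM i\<^esub> x) \<and>
    (\<forall>b\<in>carrier \<Lambda>. x \<lhd>\<^bsub>KM i\<^esub> b = eps i' b \<odot>\<^bsub>KM i\<^esub> x)"
proof (rule simple_structure[OF S])
  fix i' x
  assume "i' \<in> verts Q" "x \<in> carrier (KM i)" "carrier (KM i) = range (\<lambda>c. c \<odot>\<^bsub>KM i\<^esub> x)"
    and "\<And>b. b \<in> carrier \<Lambda> \<Longrightarrow> x \<lhd>\<^bsub>KM i\<^esub> b = eps i' b \<odot>\<^bsub>KM i\<^esub> x"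
  then show ?thesis by (intro exI[of _ i'] exI[of _ x] conjI ballI)
qed

text \<open>Two arrows would give nonzero socle vectors in two different components of a
  one-dimensional module; without any arrow, \<open>Dm i\<close> and its submodule would be
  zero.\<close>

lemma KM_unique_out:
  assumes i: "i \<in> verts Q" and S: "simple_module \<Lambda> (KM i)"
  obtains \<alpha> where "out_arcs Q i = {\<alpha>}"
proof -
  obtain i' x where KB: "i' \<in> verts Q \<and> x \<in> carrier (KM i) \<and> carrier (KM i) = range (\<lambda>c. c \<odot>\<^bsub>KM i\<^esub> x) \<and>
    (\<forall>b\<in>carrier \<Lambda>. x \<lhd>\<^bsub>KM i\<^esub> b = eps i' b \<odot>\<^bsub>KM i\<^esub> x)"
    using KM_basis[OF S] by (elim exE) (rule that)
  note x = KB[THEN conjunct2, THEN conjunct1] KB[THEN conjunct2, THEN conjunct2, THEN conjunct1]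
  have "carrier (KM i) \<noteq> {\<zero>\<^bsub>KM i\<^esub>}" using S by (simp add: simple_module_def)
  have ne: "out_arcs Q i \<noteq> {}"
  proof
    assume "out_arcs Q i = {}"
    then have "carrier (KM i) = {\<zero>\<^bsub>KM i\<^esub>}"
      by (simp add: KM_carrier Dm_carrier pi_def) (auto simp: fun_eq_iff)
    then show False using \<open>carrier (KM i) \<noteq> {\<zero>\<^bsub>KM i\<^esub>}\<close> by simp
  qed
  have "\<alpha> = \<beta>" if ab: "\<alpha> \<in> out_arcs Q i" "\<beta> \<in> out_arcs Q i" for \<alpha> \<beta>
  proof (rule ccontr)
    assume "\<alpha> \<noteq> \<beta>"
    have a: "\<alpha> \<in> arcs Q" "tail Q \<alpha> = i" "\<beta> \<in> arcs Q" "tail Q \<beta> = i" using ab by auto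
    obtain y where y: "y \<in> soc (head Q \<alpha>)" "y \<noteq> \<zero>"
      by (rule soc_exists[OF ends_Q(2)[OF a(1)]])
    obtain z where z: "z \<in> soc (head Q \<beta>)" "z \<noteq> \<zero>"
      by (rule soc_exists[OF ends_Q(2)[OF a(3)]])
    have xD: "x \<in> carrier (Dm i)" using x(1) by (simp add: KM_carrier)
    have xc: "x \<alpha> \<in> carrier \<Lambda>" "x \<beta> \<in> carrier \<Lambda>" using Dm_mem[OF xD] a by auto
    obtain c where c: "(\<lambda>\<gamma>\<in>out_arcs Q i. if \<gamma> = \<alpha> then y else \<zero>) = c \<odot>\<^bsub>KM i\<^esub> x"
      using inc_KM[OF a(1,2) y(1)] unfolding x(2) by (rule rangeE)
    obtain d where d: "(\<lambda>\<gamma>\<in>out_arcs Q i. if \<gamma> = \<beta> then z else \<zero>) = d \<odot>\<^bsub>KM i\<^esub> x"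
      using inc_KM[OF a(3,4) z(1)] unfolding x(2) by (rule rangeE)
    have "c \<odot> x \<alpha> = y" using fun_cong[OF c, of \<alpha>] a by (simp add: eq_commute)
    have cb: "c \<odot> x \<beta> = \<zero>" using fun_cong[OF c, of \<beta>] a \<open>\<alpha> \<noteq> \<beta>\<close> by (simp add: eq_commute)
    have dz: "d \<odot> x \<beta> = z" using fun_cong[OF d, of \<beta>] a by (simp add: eq_commute)
    have "c \<noteq> 0" using \<open>c \<odot> x \<alpha> = y\<close> y(2) xc(1) by (intro notI) simp
    then have "inverse c \<odot> (c \<odot> x \<beta>) = x \<beta>" using xc(2) by (simp add: smult_smult[symmetric])
    then have "x \<beta> = \<zero>" unfolding cb by simp
    then show False using dz z(2) by simp
  qed
  then have "is_singleton (out_arcs Q i)" using ne by (intro is_singletonI') auto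
  then show ?thesis using that by (rule is_singletonE)
qed

text \<open>Arrows kill a simple module because \<open>eps\<close> vanishes on them; so they kill
  the components on the right, and by the form on the left.\<close>

lemma KM_elem_soc:
  assumes i: "i \<in> verts Q" and S: "simple_module \<Lambda> (KM i)" and x: "x \<in> carrier (KM i)"
    and \<alpha>: "\<alpha> \<in> arcs Q" "tail Q \<alpha> = i"
  shows "x \<alpha> \<in> soc (head Q \<alpha>)"
proof -
  obtain i' x0 where KB: "i' \<in> verts Q \<and> x0 \<in> carrier (KM i) \<and> carrier (KM i) = range (\<lambda>c. c \<odot>\<^bsub>KM i\<^esub> x0) \<and>
    (\<forall>b\<in>carrier \<Lambda>. x0 \<lhd>\<^bsub>KM i\<^esub> b = eps i' b \<odot>\<^bsub>KM i\<^esub> x0)"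
    using KM_basis[OF S] by (elim exE) (rule that)
  note x0 = KB[THEN conjunct1] KB[THEN conjunct2, THEN conjunct1]
    KB[THEN conjunct2, THEN conjunct2, THEN conjunct1] KB[THEN conjunct2, THEN conjunct2, THEN conjunct2]
  have D: "x0 \<in> carrier (Dm i)" "x \<in> carrier (Dm i)" using x0(2) x by (auto simp: KM_carrier)
  have "x \<in> range (\<lambda>c. c \<odot>\<^bsub>KM i\<^esub> x0)" using x unfolding x0(3) .
  then obtain c where c: "x = c \<odot>\<^bsub>KM i\<^esub> x0" by (rule rangeE)
  have k: "x \<alpha> \<otimes> g \<gamma> = \<zero>" if \<gamma>: "\<gamma> \<in> arcs Q" for \<gamma>
  proof -
    have "x0 \<alpha> \<otimes> g \<gamma> = eps i' (g \<gamma>) \<odot> x0 \<alpha>"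
      using fun_cong[OF bspec[OF x0(4) g_closed[OF \<gamma>]], of \<alpha>] \<gamma> \<alpha> by simp
    then have "x0 \<alpha> \<otimes> g \<gamma> = \<zero>" using \<gamma> x0(1) Dm_mem[OF D(1) \<alpha>] by (simp add: eps_g)
    moreover have "x \<alpha> = c \<odot> x0 \<alpha>" using fun_cong[OF c, of \<alpha>] \<alpha> by simp
    ultimately show ?thesis using Dm_mem[OF D(1) \<alpha>] \<gamma> by (simp add: smult_mult_left)
  qed
  show ?thesis
    using Dm_mem[OF D(2) \<alpha>] k right_killed_imp_left_killed[OF _ k] by (simp add: soc_def)
qed

lemma KM_unique_in:
  assumes i: "i \<in> verts Q" and S: "simple_module \<Lambda> (KM i)" and \<alpha>: "out_arcs Q i = {\<alpha>}"
  shows "in_arcs Q (head Q \<alpha>) = {\<alpha>}"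
proof -
  have a: "\<alpha> \<in> arcs Q" "tail Q \<alpha> = i" using \<alpha> by auto
  let ?j = "head Q \<alpha>"
  have "\<gamma> = \<alpha>" if \<gamma>: "\<gamma> \<in> arcs Q" "head Q \<gamma> = ?j" for \<gamma>
  proof (rule ccontr)
    assume ne: "\<gamma> \<noteq> \<alpha>"
    \<comment> \<open>A finite set spanning the left ideal generated by \<open>g \<alpha>\<close>,
      since \<open>double_orthogonal\<close> asks for finiteness; longer words contribute
      nothing.\<close>
    let ?F = "(\<lambda>(u, p). e u \<otimes> w p \<otimes> g \<alpha>) ` (verts Q \<times> {p. set p \<subseteq> arcs Q \<and> length p \<le> m})"
    have fin: "finite ?F"
      using finite_lists_length_le[of "arcs Q" m] by (intro finite_imageI finite_cartesian_product) auto
    have F: "?F \<subseteq> carrier \<Lambda>" using a by auto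
    have dl0: "dl \<gamma> (z \<otimes> g \<alpha>) = 0" if "z \<in> carrier \<Lambda>" for z
      using that a \<gamma> ne by (simp add: dl_mult dl_g eps_g)
    \<comment> \<open>\<open>dl \<gamma>\<close> vanishes on this left ideal, but
      \<open>dl \<gamma> (g \<gamma>) = 1\<close>. By \<open>double_orthogonal\<close>,
      \<open>g \<gamma>\<close> therefore cannot be orthogonal to everything that is orthogonal to
      the left ideal.\<close>
    have "\<exists>y. y \<in> carrier \<Lambda> \<and> (\<forall>x\<in>?F. B x y = 0) \<and> B (g \<gamma>) y \<noteq> 0"
    proof (rule ccontr)
      assume no: "\<not> ?thesis"
      have "dl \<gamma> (g \<gamma>) = 0"
      proof (rule double_orthogonal[of "dl \<gamma>" ?F])
        show "dl \<gamma> x = 0" if "x \<in> ?F" for x using that a \<gamma> by (auto simp: dl0)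
        show "B (g \<gamma>) y = 0" if "y \<in> carrier \<Lambda>" "\<And>x. x \<in> ?F \<Longrightarrow> B x y = 0" for y
        proof (rule ccontr)
          assume "B (g \<gamma>) y \<noteq> 0"
          then have "y \<in> carrier \<Lambda> \<and> (\<forall>x\<in>?F. B x y = 0) \<and> B (g \<gamma>) y \<noteq> 0"
            using that by (intro conjI ballI)
          with no show False by (elim notE) (rule exI)
        qed
      qed (use fin F \<gamma> in \<open>auto simp: dl_add dl_smult\<close>)
      then show False using \<gamma> by (simp add: dl_g)
    qed
    then obtain y where y': "y \<in> carrier \<Lambda> \<and> (\<forall>x\<in>?F. B x y = 0) \<and> B (g \<gamma>) y \<noteq> 0" by (elim exE) (rule that)
    note y = y'[THEN conjunct1] y'[THEN conjunct2, THEN conjunct1] y'[THEN conjunct2, THEN conjunct2]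
    have perp: "B (z \<otimes> g \<alpha>) y = 0" if "z \<in> carrier \<Lambda>" for z
      using that
    proof (induction rule: path_induct')
      case zero
      then show ?case using a y by (simp add: B_zero)
    next
      case (add z z')
      then show ?case using a y by (simp add: l_distr B_add)
    next
      case (path c u p)
      show ?case
      proof (cases "length p \<le> m")
        case True
        have "e u \<otimes> w p \<otimes> g \<alpha> \<in> ?F"
          using path True by (intro image_eqI[of _ _ "(u, p)"]) auto
        then have "B (e u \<otimes> w p \<otimes> g \<alpha>) y = 0" by (rule bspec[OF y(2)])
        then show ?thesis using path a y by (simp add: smult_mult_left B_smult)
      next
        case False
        then show ?thesis using path a y w_long[of p] by (simp add: B_zero)
      qed
    qed
    \<comment> \<open>The part of \<open>y\<close> in P_j; products with arrows that end at
      \<open>j\<close> do not see the difference.\<close>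
    let ?y = "e ?j \<otimes> y"
    have yc: "?y \<in> carrier \<Lambda>" using y a by simp
    have gy: "g \<delta> \<otimes> ?y = g \<delta> \<otimes> y" if "\<delta> \<in> arcs Q" "head Q \<delta> = ?j" for \<delta>
      using that y a g_e[of ?j \<delta>] by (simp add: m_assoc[symmetric])
    \<comment> \<open>Orthogonality of \<open>y\<close> to the left ideal means, by associativity of
      the form, that \<open>g \<alpha> \<otimes> y\<close> is orthogonal to everything.\<close>
    have "g \<alpha> \<otimes> y = \<zero>"
    proof (rule B_nondeg)
      show "g \<alpha> \<otimes> y \<in> carrier \<Lambda>" using a y by simp
      fix z assume z: "z \<in> carrier \<Lambda>"
      have "B (g \<alpha> \<otimes> y) z = B z (g \<alpha> \<otimes> y)" using a y z by (intro B_sym) auto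
      also have "\<dots> = B (z \<otimes> g \<alpha>) y" using a y z by (intro B_assoc[symmetric]) auto
      finally show "B (g \<alpha> \<otimes> y) z = 0" using perp[OF z] by simp
    qed
    then have 0: "g \<alpha> \<otimes> ?y = \<zero>" using gy[OF a(1)] by simp
    have "(\<lambda>\<beta>\<in>out_arcs Q i. ?y) \<in> carrier (KM i)"
    proof -
      have "(\<lambda>\<beta>\<in>out_arcs Q i. ?y) \<in> carrier (Dm i)"
        using a \<alpha> y by (auto simp: Dm_carrier intro!: Pm_mult_e)
      moreover have "pi i (\<lambda>\<beta>\<in>out_arcs Q i. ?y) = \<zero>"
        unfolding pi_def using a 0 \<alpha> by (intro finsum_single[where i = \<alpha>]) auto
      ultimately show ?thesis by (simp add: KM_carrier)
    qed
    from KM_elem_soc[OF i S this a] have "?y \<in> soc ?j" using a by simp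
    then have "g \<gamma> \<otimes> y = \<zero>" using gy[OF \<gamma>] \<gamma> by (simp add: soc_def)
    then have "B (g \<gamma>) y = 0" using B_one[of "g \<gamma>" y] \<gamma> y by (simp add: B_zero)
    then show False using y(3) by simp
  qed
  then show ?thesis using a by (auto simp: in_arcs_def)
qed

text \<open>The only component of \<open>x\<close> is a socle element at the head of the arrow, and
  \<open>soc_mult_e\<close> fixes its end there.\<close>

lemma KM_act_head:
  assumes i: "i \<in> verts Q" and S: "simple_module \<Lambda> (KM i)" and \<alpha>: "out_arcs Q i = {\<alpha>}"
    and x: "x \<in> carrier (KM i)"
  shows "x \<lhd>\<^bsub>KM i\<^esub> e (head Q \<alpha>) = x"
proof -
  have a: "\<alpha> \<in> arcs Q" "tail Q \<alpha> = i" using \<alpha> by auto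
  have "x \<alpha> \<otimes> e (head Q \<alpha>) = x \<alpha>"
    using soc_mult_e[OF _ KM_elem_soc[OF i S x a]] a by simp
  moreover have "x \<in> extensional {\<alpha>}" using x \<alpha> by (simp add: KM_carrier Dm_carrier PiE_def)
  ultimately show ?thesis using a \<alpha> by (auto simp: fun_eq_iff extensional_def restrict_def)
qed

text \<open>A kernel element amounts to one \<open>z \<alpha>\<close> with
  \<open>g \<alpha> \<otimes> z \<alpha> = \<zero>\<close>. The other arrows do not end where
  \<open>z \<alpha>\<close> starts, so all arrows kill it on the left and it lies in
  \<open>soc\<close>, which has dimension one.\<close>

lemma KM_simple:
  assumes \<alpha>: "\<alpha> \<in> arcs Q" and out: "out_arcs Q (tail Q \<alpha>) = {\<alpha>}" and inn: "in_arcs Q (head Q \<alpha>) = {\<alpha>}"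
  shows "simple_module \<Lambda> (KM (tail Q \<alpha>))"
proof -
  let ?i = "tail Q \<alpha>" and ?j = "head Q \<alpha>"
  obtain y where y: "y \<in> soc ?j" "y \<noteq> \<zero>" using soc_exists[of ?j] \<alpha> by auto
  let ?x = "\<lambda>\<beta>\<in>out_arcs Q ?i. if \<beta> = \<alpha> then y else \<zero>"
  show ?thesis
  proof (rule simple_moduleI[OF KM_fd, of _ ?x])
    show "?x \<in> carrier (KM ?i)" by (rule inc_KM[OF \<alpha> refl y(1)])
    show "?x \<noteq> \<zero>\<^bsub>KM ?i\<^esub>"
    proof
      assume "?x = \<zero>\<^bsub>KM ?i\<^esub>"
      from fun_cong[OF this, of \<alpha>] show False using y(2) \<alpha> by simp
    qed
    fix z assume "z \<in> carrier (KM ?i)"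
    then have z: "z \<in> carrier (Dm ?i)" "pi ?i z = \<zero>" by (auto simp: KM_carrier)
    note za = Dm_mem[OF z(1) \<alpha> refl]
    have "pi ?i z = g \<alpha> \<otimes> z \<alpha>" unfolding pi_def out using \<alpha> za by (simp add: finsum_insert)
    then have "g \<alpha> \<otimes> z \<alpha> = \<zero>" using z(2) by simp
    then have L: "g \<gamma> \<otimes> z \<alpha> = \<zero>" if \<gamma>: "\<gamma> \<in> arcs Q" for \<gamma>
    proof (cases "\<gamma> = \<alpha>")
      case False
      then have "head Q \<gamma> \<noteq> ?j" using inn \<gamma> by (auto simp: in_arcs_def)
      have "g \<gamma> \<otimes> z \<alpha> = g \<gamma> \<otimes> (e ?j \<otimes> z \<alpha>)" using za by simp
      also have "\<dots> = (g \<gamma> \<otimes> e ?j) \<otimes> z \<alpha>" using za(1) \<gamma> \<alpha> by (intro m_assoc[symmetric]) auto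
      finally show ?thesis using g_e[of ?j \<gamma>] \<gamma> \<alpha> \<open>head Q \<gamma> \<noteq> ?j\<close> za(1) by simp
    qed simp
    have "z \<alpha> \<in> soc ?j"
      using za L left_killed_imp_right_killed[OF za(1) L _ za(2)] \<alpha> by (simp add: soc_def)
    then obtain c where c: "z \<alpha> = c \<odot> y" using soc_one_dim[OF _ y] \<alpha> by auto
    have "z = c \<odot>\<^bsub>KM ?i\<^esub> ?x"
    proof (rule PiE_eqI)
      show "z \<in> (\<Pi>\<^sub>E \<gamma>\<in>out_arcs Q ?i. UNIV)" using z(1) by (auto simp: Dm_carrier PiE_iff)
      show "c \<odot>\<^bsub>KM ?i\<^esub> ?x \<in> (\<Pi>\<^sub>E \<gamma>\<in>out_arcs Q ?i. UNIV)" by auto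
      show "z \<gamma> = (c \<odot>\<^bsub>KM ?i\<^esub> ?x) \<gamma>" if "\<gamma> \<in> out_arcs Q ?i" for \<gamma> using that c \<alpha> unfolding out by simp
    qed
    then show "\<exists>c. z = c \<odot>\<^bsub>KM ?i\<^esub> ?x" by (rule exI)
  qed (use \<alpha> in simp)
qed

end

section \<open>Dimensions and periodicity\<close>

lemma mdim_hom:
  fixes M :: "('k::field, 'm, 'a) right_module"
  assumes M: "fd_right_module \<Lambda> M" and N: "right_module \<Lambda> N" and f: "f \<in> rmodule_hom \<Lambda> M N"
    and surj: "f ` carrier M = carrier N"
  shows "mdim M = mdim N + mdim (M\<lparr>carrier := hom_kernel M N f\<rparr>)"
proof -
  have lm: "linear_map (class_ring :: 'k ring) M N f"
    using M by (intro hom_linear_map[OF _ N f]) auto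
  then have mh: "mod_hom (class_ring :: 'k ring) M N f" by (simp add: linear_map_def)
  have "vectorspace.fin_dim (class_ring :: 'k ring) M"
    using M by (simp add: fd_right_module_def fd_right_module_axioms_def)
  then show ?thesis
    using linear_map.rank_nullity[OF lm] mod_hom.im_def[OF mh] mod_hom.ker_def[OF mh] surj
    by (simp add: hom_kernel_def)
qed

lemma mdim_iso:
  fixes M :: "('k::field, 'm, 'a) right_module"
  assumes M: "fd_right_module \<Lambda> M" and N: "right_module \<Lambda> N" and iso: "rmodule_iso \<Lambda> M N"
  shows "mdim M = mdim N"
proof -
  obtain f where f: "f \<in> rmodule_hom \<Lambda> M N" "bij_betw f (carrier M) (carrier N)"
    using iso unfolding rmodule_iso_def by auto
  have lm: "linear_map (class_ring :: 'k ring) M N f"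
    using M by (intro hom_linear_map[OF _ N f(1)]) auto
  then show ?thesis
    using linear_map.dim_eq[OF lm] f(2) M
    by (simp add: fd_right_module_def fd_right_module_axioms_def bij_betw_def)
qed

lemma (in right_module) dim_one:
  assumes x: "x \<in> carrier M" "x \<noteq> \<zero>\<^bsub>M\<^esub>" and gen: "\<And>y. y \<in> carrier M \<Longrightarrow> \<exists>c. y = c \<odot>\<^bsub>M\<^esub> x"
  shows "dim = 1"
proof (rule dim1I[OF _ x(2,1)])
  have sub: "LinearCombinations.submodule class_ring (span {x}) M"
    using x(1) by (intro span_is_submodule) simp
  have "x \<in> span {x}" using in_own_span[of "{x}"] x(1) by simp
  have "y \<in> span {x}" if yM: "y \<in> carrier M" for y
  proof -
    obtain c where c: "y = c \<odot>\<^bsub>M\<^esub> x" using gen[OF yM] by (elim exE) (rule that)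
    show ?thesis unfolding c using sub \<open>x \<in> span {x}\<close> by (simp add: LinearCombinations.submodule_def)
  qed
  then show "span {x} = carrier M"
    using sub by (auto simp: LinearCombinations.submodule_def)
qed

lemma (in fd_right_module) dim_one_generator:
  assumes "dim = 1"
  shows "\<exists>x. x \<in> carrier M \<and> x \<noteq> \<zero>\<^bsub>M\<^esub> \<and> (\<forall>y\<in>carrier M. \<exists>c. y = c \<odot>\<^bsub>M\<^esub> x)"
proof -
  obtain \<beta> where \<beta>: "finite \<beta>" "basis \<beta>" using finite_basis_exists[OF finite_dimensional] by auto
  then have "card \<beta> = 1" using dim_basis assms by simp
  then obtain v where v: "\<beta> = {v}" by (rule card_1_singletonE)
  have vM: "v \<in> carrier M" and sp: "span {v} = carrier M" and li: "lin_indpt {v}"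
    using \<beta>(2) unfolding v basis_def by auto
  have "v \<noteq> \<zero>\<^bsub>M\<^esub>" using vs_zero_lin_dep[of "{v}"] li vM by auto
  have "carrier M \<subseteq> range (\<lambda>c. c \<odot>\<^bsub>M\<^esub> v)"
  proof (rule span_carrier_subset[OF sp])
    show "range (\<lambda>c. c \<odot>\<^bsub>M\<^esub> v) \<subseteq> carrier M" using vM by auto
    show "\<zero>\<^bsub>M\<^esub> \<in> range (\<lambda>c. c \<odot>\<^bsub>M\<^esub> v)" using vM by (intro image_eqI[of _ _ 0]) auto
    show "{v} \<subseteq> range (\<lambda>c. c \<odot>\<^bsub>M\<^esub> v)" using vM by (auto intro!: image_eqI[of _ _ 1])
  next
    fix x y assume "x \<in> range (\<lambda>c. c \<odot>\<^bsub>M\<^esub> v)" "y \<in> range (\<lambda>c. c \<odot>\<^bsub>M\<^esub> v)"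
    then obtain c d where "x = c \<odot>\<^bsub>M\<^esub> v" "y = d \<odot>\<^bsub>M\<^esub> v" by auto
    then show "x \<oplus>\<^bsub>M\<^esub> y \<in> range (\<lambda>c. c \<odot>\<^bsub>M\<^esub> v)" using vM by (simp add: M_smult_l[symmetric])
  next
    fix c x assume "x \<in> range (\<lambda>c. c \<odot>\<^bsub>M\<^esub> v)"
    then obtain d where "x = d \<odot>\<^bsub>M\<^esub> v" by auto
    then show "c \<odot>\<^bsub>M\<^esub> x \<in> range (\<lambda>c. c \<odot>\<^bsub>M\<^esub> v)" using vM by (simp add: M_smult_assoc[symmetric])
  qed
  then have "\<forall>y\<in>carrier M. \<exists>c. y = c \<odot>\<^bsub>M\<^esub> v" by auto
  with vM \<open>v \<noteq> \<zero>\<^bsub>M\<^esub>\<close> show ?thesis by (intro exI conjI)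
qed

lemma simple_imp_indecomposable:
  assumes "simple_module \<Lambda> S"
  shows "indecomposable_module \<Lambda> S"
  unfolding indecomposable_module_def
proof (intro conjI allI impI)
  show "fd_right_module \<Lambda> S" "carrier S \<noteq> {\<zero>\<^bsub>S\<^esub>}" using assms by (simp_all add: simple_module_def)
  fix N L assume *: "rsubmodule \<Lambda> N S \<and> rsubmodule \<Lambda> L S \<and> N <+>\<^bsub>S\<^esub> L = carrier S \<and> N \<inter> L = {\<zero>\<^bsub>S\<^esub>}"
  then have "N = {\<zero>\<^bsub>S\<^esub>} \<or> N = carrier S" "L = {\<zero>\<^bsub>S\<^esub>} \<or> L = carrier S"
    using assms by (simp_all add: simple_module_def)
  with * \<open>carrier S \<noteq> {\<zero>\<^bsub>S\<^esub>}\<close> show "N = {\<zero>\<^bsub>S\<^esub>} \<or> L = {\<zero>\<^bsub>S\<^esub>}" by auto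
qed

context bound_quiver
begin

text \<open>\<^term>\<open>simple_vec S i x\<close> says that \<^term>\<open>S\<close> is the simple module at the vertex \<^term>\<open>i\<close>.\<close>

definition simple_vec :: "('k, 'm, 'a) right_module \<Rightarrow> 'v \<Rightarrow> 'm \<Rightarrow> bool" where
  "simple_vec S i x \<longleftrightarrow> fd_right_module \<Lambda> S \<and> i \<in> verts Q \<and> x \<in> carrier S \<and> x \<noteq> \<zero>\<^bsub>S\<^esub> \<and>
    carrier S = range (\<lambda>c. c \<odot>\<^bsub>S\<^esub> x) \<and> (\<forall>b\<in>carrier \<Lambda>. x \<lhd>\<^bsub>S\<^esub> b = eps i b \<odot>\<^bsub>S\<^esub> x)"

lemma simple_vecD:
  assumes "simple_vec S i x"
  shows "fd_right_module \<Lambda> S" "i \<in> verts Q" "x \<in> carrier S" "x \<noteq> \<zero>\<^bsub>S\<^esub>"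
    "carrier S = range (\<lambda>c. c \<odot>\<^bsub>S\<^esub> x)" "b \<in> carrier \<Lambda> \<Longrightarrow> x \<lhd>\<^bsub>S\<^esub> b = eps i b \<odot>\<^bsub>S\<^esub> x"
proof -
  note * = assms[unfolded simple_vec_def]
  show "fd_right_module \<Lambda> S" by (rule *[THEN conjunct1])
  show "i \<in> verts Q" by (rule *[THEN conjunct2, THEN conjunct1])
  show "x \<in> carrier S" by (rule *[THEN conjunct2, THEN conjunct2, THEN conjunct1])
  show "x \<noteq> \<zero>\<^bsub>S\<^esub>" by (rule *[THEN conjunct2, THEN conjunct2, THEN conjunct2, THEN conjunct1])
  note ** = *[THEN conjunct2, THEN conjunct2, THEN conjunct2, THEN conjunct2]
  show "carrier S = range (\<lambda>c. c \<odot>\<^bsub>S\<^esub> x)" by (rule **[THEN conjunct1])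
  show "b \<in> carrier \<Lambda> \<Longrightarrow> x \<lhd>\<^bsub>S\<^esub> b = eps i b \<odot>\<^bsub>S\<^esub> x" by (rule **[THEN conjunct2, THEN bspec])
qed

lemma simple_vecI:
  assumes "fd_right_module \<Lambda> S" "i \<in> verts Q" "x \<in> carrier S" "x \<noteq> \<zero>\<^bsub>S\<^esub>"
    "carrier S = range (\<lambda>c. c \<odot>\<^bsub>S\<^esub> x)" "\<And>b. b \<in> carrier \<Lambda> \<Longrightarrow> x \<lhd>\<^bsub>S\<^esub> b = eps i b \<odot>\<^bsub>S\<^esub> x"
  shows "simple_vec S i x"
  unfolding simple_vec_def by (intro conjI ballI assms)

lemma simple_vec_gen:
  assumes "simple_vec S i x" "y \<in> carrier S"
  shows "\<exists>c. y = c \<odot>\<^bsub>S\<^esub> x"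
  using assms(2) unfolding simple_vecD(5)[OF assms(1)] by (rule rangeE) (rule exI)

lemma simple_vec_simple: "simple_vec S i x \<Longrightarrow> simple_module \<Lambda> S"
  by (rule simple_moduleI[OF simple_vecD(1,3,4) simple_vec_gen])

lemma simple_vec_exists:
  assumes S: "simple_module \<Lambda> S"
  shows "\<exists>i x. simple_vec S i x"
proof (rule simple_structure[OF S])
  fix i x
  assume "i \<in> verts Q" "x \<in> carrier S" "x \<noteq> \<zero>\<^bsub>S\<^esub>" "carrier S = range (\<lambda>c. c \<odot>\<^bsub>S\<^esub> x)"
    and "\<And>b. b \<in> carrier \<Lambda> \<Longrightarrow> x \<lhd>\<^bsub>S\<^esub> b = eps i b \<odot>\<^bsub>S\<^esub> x"
  moreover have "fd_right_module \<Lambda> S" using S by (simp add: simple_module_def)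
  ultimately have "simple_vec S i x" by (intro simple_vecI)
  then show ?thesis by (intro exI[of _ i] exI[of _ x])
qed

lemma simple_vec_iso:
  assumes S: "simple_vec S i x" and N: "right_module \<Lambda> N" and iso: "rmodule_iso \<Lambda> S N"
  shows "\<exists>y. simple_vec N i y"
proof -
  note D = simple_vecD[OF S]
  have rS: "right_module \<Lambda> S" using D(1) by auto
  obtain f where f: "f \<in> rmodule_hom \<Lambda> S N" "bij_betw f (carrier S) (carrier N)"
    using iso unfolding rmodule_iso_def by auto
  note fD = rmodule_homD[OF f(1) D(3)]
  have im: "f ` carrier S = carrier N" and inj: "inj_on f (carrier S)"
    using f(2) by (simp_all add: bij_betw_def)
  have f0: "f \<zero>\<^bsub>S\<^esub> = \<zero>\<^bsub>N\<^esub>" by (rule rmodule_hom_zero[OF rS N f(1)])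
  have "simple_vec N i (f x)"
    unfolding simple_vec_def
  proof (intro conjI ballI)
    show "fd_right_module \<Lambda> N" by (rule transport_fd_right_module[OF D(1) N f(1) im])
    show "i \<in> verts Q" "f x \<in> carrier N" by (fact D(2), fact fD(1))
    show "f x \<noteq> \<zero>\<^bsub>N\<^esub>"
      using inj_onD[OF inj, of x "\<zero>\<^bsub>S\<^esub>"] f0 D(3,4) right_module.M_zero[OF rS] by (intro notI) simp
    have "f ` range (\<lambda>c. c \<odot>\<^bsub>S\<^esub> x) = range (\<lambda>c. c \<odot>\<^bsub>N\<^esub> f x)" by (simp add: image_image fD(3))
    then show "carrier N = range (\<lambda>c. c \<odot>\<^bsub>N\<^esub> f x)" using im unfolding D(5) by simp
    show "f x \<lhd>\<^bsub>N\<^esub> b = eps i b \<odot>\<^bsub>N\<^esub> f x" if "b \<in> carrier \<Lambda>" for b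
      using fD(4)[OF that] D(6)[OF that] fD(3) by simp
  qed
  then show ?thesis by (rule exI)
qed

text \<open>Otherwise \<open>eps i (e j) = 0\<close>, and \<open>e j\<close> would kill the whole of
  \<open>S\<close>.\<close>

lemma simple_vec_vertex:
  assumes S: "simple_vec S i x" and j: "j \<in> verts Q" and y: "y \<in> carrier S" "y \<noteq> \<zero>\<^bsub>S\<^esub>" "y \<lhd>\<^bsub>S\<^esub> e j = y"
  shows "i = j"
proof (rule ccontr)
  assume "i \<noteq> j"
  note D = simple_vecD[OF S]
  interpret S: right_module \<Lambda> S using D(1) by auto
  obtain c where c: "y = c \<odot>\<^bsub>S\<^esub> x" using simple_vec_gen[OF S y(1)] by (elim exE) (rule that)
  have "y \<lhd>\<^bsub>S\<^esub> e j = c \<odot>\<^bsub>S\<^esub> (x \<lhd>\<^bsub>S\<^esub> e j)" unfolding c using D(3) j by (intro S.act_smult_left) auto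
  also have "x \<lhd>\<^bsub>S\<^esub> e j = \<zero>\<^bsub>S\<^esub>" using D(2,3) j \<open>i \<noteq> j\<close> D(6)[OF e_closed[OF j]] by (simp add: eps_e)
  finally show False using y(2,3) by simp
qed

lemma simple_vec_same_vertex:
  assumes S: "simple_vec S i x" and T: "simple_vec S j y"
  shows "i = j"
proof (rule simple_vec_vertex[OF S simple_vecD(2,3,4)[OF T]])
  interpret S: right_module \<Lambda> S using simple_vecD(1)[OF S] by auto
  show "y \<lhd>\<^bsub>S\<^esub> e j = y"
    using simple_vecD(6)[OF T e_closed] simple_vecD(2,3)[OF T] by (simp add: eps_e)
qed

lemma mdim_simple_vec:
  assumes S: "simple_vec S i x"
  shows "mdim S = 1"
proof -
  interpret S: right_module \<Lambda> S using simple_vecD(1)[OF S] by auto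
  show ?thesis by (rule S.dim_one[OF simple_vecD(3,4)[OF S] simple_vec_gen[OF S]])
qed

text \<open>The simple module at \<open>i\<close>, built on the field so that no choice enters; it
  is copied to the type \<open>fdmod\<close> when a syzygy is to be taken.\<close>

definition SM :: "'v \<Rightarrow> ('k, 'k, 'a) right_module" where
  "SM i = \<lparr>carrier = UNIV, mult = undefined, one = undefined, zero = 0, add = (+), smult = (*),
    act = (\<lambda>x a. x * eps i a)\<rparr>"

lemma SM_simple_vec:
  assumes i: "i \<in> verts Q"
  shows "simple_vec (SM i) i 1"
proof -
  have rm: "right_module \<Lambda> (SM i)"
  proof (rule right_moduleI)
    show "\<exists>y\<in>carrier (SM i). x \<oplus>\<^bsub>SM i\<^esub> y = \<zero>\<^bsub>SM i\<^esub>" for x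
      by (intro bexI[of _ "- x"]) (simp_all add: SM_def)
  qed (use i in \<open>simp_all add: SM_def algebra_simps eps_add eps_smult eps_mult eps_one\<close>)
  interpret S: right_module \<Lambda> "SM i" by (rule rm)
  have "vectorspace.fin_dim class_ring (SM i)"
  proof (rule S.fin_dimI[of "{1}"])
    fix A assume A: "\<And>c x. x \<in> A \<Longrightarrow> c \<odot>\<^bsub>SM i\<^esub> x \<in> A" "{1} \<subseteq> A"
    have "c \<in> A" for c using A(1)[of 1 c] A(2) by (simp add: SM_def)
    then show "carrier (SM i) \<subseteq> A" by auto
  qed (simp_all add: SM_def)
  then have "fd_right_module \<Lambda> (SM i)" using rm by (simp add: fd_right_module_def fd_right_module_axioms_def)
  then show ?thesis using i by (simp add: simple_vec_def SM_def)
qed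

lemma simple_fdmod_at:
  assumes i: "i \<in> verts Q"
  shows "\<exists>(S :: ('k, 'a) fdmod) x. simple_vec S i x"
proof -
  obtain S :: "('k, 'a) fdmod" and f where S: "fd_right_module \<Lambda> S" "f \<in> rmodule_hom \<Lambda> (SM i) S"
    "bij_betw f (carrier (SM i)) (carrier S)"
    using fdmod_copy[OF simple_vecD(1)[OF SM_simple_vec[OF i]]] by auto
  have "rmodule_iso \<Lambda> (SM i) S" unfolding rmodule_iso_def using S(2,3) by (intro bexI[of _ f])
  from simple_vec_iso[OF SM_simple_vec[OF i] fd_right_module_imp[OF S(1)] this]
  show ?thesis by (rule exI)
qed

lemma syzygy_simple_vec:
  fixes S :: "('k, 'a) fdmod"
  assumes S: "simple_vec S i x"
  shows "rmodule_iso \<Lambda> (RadM i) (syzygy \<Lambda> S)" "rmodule_iso \<Lambda> (KM i) (syzygy \<Lambda> (syzygy \<Lambda> S))"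
    "fd_right_module \<Lambda> (syzygy \<Lambda> (syzygy \<Lambda> S))"
  using syzygy_simple[OF simple_vecD(1,2,3,4,5)[OF S]] simple_vecD(6)[OF S] by simp_all

lemma mdim_Pm:
  assumes i: "i \<in> verts Q"
  shows "mdim (Pm i) = mdim (RadM i) + 1"
proof -
  note D = simple_vecD[OF SM_simple_vec[OF i]]
  have r: "right_module \<Lambda> (SM i)" using D(1) by auto
  have c: "projective_cover \<Lambda> (Pm i) (\<lambda>a. 1 \<lhd>\<^bsub>SM i\<^esub> a) (SM i)" "hom_kernel (Pm i) (SM i) (\<lambda>a. 1 \<lhd>\<^bsub>SM i\<^esub> a) = Rad i"
    using simple_cover[OF r i D(3) D(5) D(4)] D(6) by simp_all
  have "mdim (Pm i) = mdim (SM i) + mdim (RadM i)"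
    using mdim_hom[OF Pm_fd[OF i] r projective_cover_hom(1,2)[OF c(1)]] unfolding c(2) RadM_def .
  then show ?thesis using mdim_simple_vec[OF SM_simple_vec[OF i]] by simp
qed

lemma mdim_Dm:
  assumes i: "i \<in> verts Q"
  shows "mdim (Dm i) = mdim (RadM i) + mdim (KM i)"
  using mdim_hom[OF Dm_fd RadM_right_module[OF i] pi_hom[OF i]] pi_surj[OF i] KM_kernel[of i] by simp

lemma mdim_KM_simple:
  assumes i: "i \<in> verts Q"
  shows "simple_module \<Lambda> (KM i) \<longleftrightarrow> mdim (Pm i) = mdim (Dm i)"
proof
  assume S: "simple_module \<Lambda> (KM i)"
  obtain j x where v: "simple_vec (KM i) j x"
    using simple_vec_exists[OF S] by (elim exE) (rule that)
  show "mdim (Pm i) = mdim (Dm i)" using mdim_simple_vec[OF v] mdim_Pm[OF i] mdim_Dm[OF i] by simp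
next
  assume "mdim (Pm i) = mdim (Dm i)"
  then have 1: "mdim (KM i) = 1" using mdim_Pm[OF i] mdim_Dm[OF i] by simp
  interpret K: fd_right_module \<Lambda> "KM i" by (rule KM_fd[OF i])
  obtain x where x: "x \<in> carrier (KM i) \<and> x \<noteq> \<zero>\<^bsub>KM i\<^esub> \<and> (\<forall>y\<in>carrier (KM i). \<exists>c. y = c \<odot>\<^bsub>KM i\<^esub> x)"
    using K.dim_one_generator[OF 1] by (elim exE) (rule that)
  show "simple_module \<Lambda> (KM i)"
    by (rule simple_moduleI[OF KM_fd[OF i] x[THEN conjunct1] x[THEN conjunct2, THEN conjunct1]])
      (rule bspec[OF x[THEN conjunct2, THEN conjunct2]])
qed

text \<open>Every simple module belongs to a vertex, every vertex has a simple module of type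
  \<open>fdmod\<close>, and its second syzygy is \<open>KM i\<close> up to isomorphism.\<close>

lemma simple_second_syzygy:
  "(\<exists>S :: ('k, 'a) fdmod. simple_module \<Lambda> S \<and> simple_module \<Lambda> ((syzygy \<Lambda> ^^ 2) S)) \<longleftrightarrow>
    (\<exists>i\<in>verts Q. simple_module \<Lambda> (KM i))" (is "?L \<longleftrightarrow> ?R")
proof
  assume ?L
  then obtain S :: "('k, 'a) fdmod" where S: "simple_module \<Lambda> S" "simple_module \<Lambda> (syzygy \<Lambda> (syzygy \<Lambda> S))"
    by (auto simp: numeral_2_eq_2)
  obtain i x where v: "simple_vec S i x" using simple_vec_exists[OF S(1)] by (elim exE) (rule that)
  have i: "i \<in> verts Q" by (rule simple_vecD(2)[OF v])
  have K: "right_module \<Lambda> (KM i)" using KM_fd[OF i] by auto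
  have "simple_module \<Lambda> (KM i)"
    by (rule iso_simple_module[OF S(2) K rmodule_iso_sym[OF K syzygy_simple_vec(2)[OF v]]])
  with i show ?R by (rule bexI[rotated])
next
  assume ?R
  then obtain i where i: "i \<in> verts Q" "simple_module \<Lambda> (KM i)" by (elim bexE) (rule that)
  obtain S :: "('k, 'a) fdmod" and x where v: "simple_vec S i x"
    using simple_fdmod_at[OF i(1)] by (elim exE) (rule that)
  have "simple_module \<Lambda> (syzygy \<Lambda> (syzygy \<Lambda> S))"
    by (rule iso_simple_module[OF i(2) fd_right_module_imp[OF syzygy_simple_vec(3)[OF v]] syzygy_simple_vec(2)[OF v]])
  with simple_vec_simple[OF v] show ?L by (intro exI[of _ S]) (simp add: numeral_2_eq_2)
qed

text \<open>If \<open>S\<close> were projective, the identity would be a cover with kernel zero, so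
  by uniqueness of the syzygy the radical of P_i would be zero, although it contains
  \<open>g \<alpha>\<close>. Periodicity is assumed for non-projective modules only, hence the need
  for this.\<close>

lemma simple_not_projective:
  fixes S :: "('k, 'a) fdmod"
  assumes S: "simple_vec S i x" and \<alpha>: "\<alpha> \<in> arcs Q" "tail Q \<alpha> = i"
  shows "\<not> projective_module \<Lambda> S"
proof
  assume P: "projective_module \<Lambda> S"
  note D = simple_vecD[OF S]
  have rS: "right_module \<Lambda> S" using D(1) by auto
  have "projective_cover \<Lambda> S (\<lambda>x. x) S"
    by (rule projective_coverI[OF P rS rmodule_hom_id]) simp_all
  from syzygy_iso(1)[OF D(1) this] obtain f where
    f: "bij_betw f (hom_kernel S S (\<lambda>x. x)) (carrier (syzygy \<Lambda> S))"
    unfolding rmodule_iso_def by auto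
  obtain h where h: "bij_betw h (Rad i) (carrier (syzygy \<Lambda> S))"
    using syzygy_simple_vec(1)[OF S] unfolding rmodule_iso_def by auto
  have "hom_kernel S S (\<lambda>x. x) = {\<zero>\<^bsub>S\<^esub>}" using right_module.M_zero[OF rS] by (auto simp: hom_kernel_def)
  \<comment> \<open>The two bijections onto the chosen syzygy are compared through cardinality, so
    no isomorphism has to be composed.\<close>
  then have "card (Rad i) = 1" using bij_betw_same_card[OF f] bij_betw_same_card[OF h] by simp
  then obtain a where a: "Rad i = {a}" by (rule card_1_singletonE)
  have "g \<alpha> \<in> Rad i" "\<zero> \<in> Rad i" using \<alpha> D(2) by (simp_all add: Rad_mem e_g eps_g)
  then show False using g_nonzero[OF \<alpha>(1)] unfolding a by simp
qed

end

section \<open>The shape of the quiver under periodicity\<close>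

context symmetric_bound_quiver
begin

lemma simple_KM_iff:
  "(\<exists>i\<in>verts Q. simple_module \<Lambda> (KM i)) \<longleftrightarrow>
    (\<exists>\<alpha>\<in>arcs Q. out_arcs Q (tail Q \<alpha>) = {\<alpha>} \<and> in_arcs Q (head Q \<alpha>) = {\<alpha>})"
proof
  assume "\<exists>i\<in>verts Q. simple_module \<Lambda> (KM i)"
  then obtain i where i: "i \<in> verts Q" "simple_module \<Lambda> (KM i)" by (elim bexE) (rule that)
  obtain \<alpha> where \<alpha>: "out_arcs Q i = {\<alpha>}" by (rule KM_unique_out[OF i])
  then have "\<alpha> \<in> arcs Q" "tail Q \<alpha> = i" by auto
  then show "\<exists>\<alpha>\<in>arcs Q. out_arcs Q (tail Q \<alpha>) = {\<alpha>} \<and> in_arcs Q (head Q \<alpha>) = {\<alpha>}"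
    using \<alpha> KM_unique_in[OF i \<alpha>] by (intro bexI[of _ \<alpha>]) simp_all
next
  assume "\<exists>\<alpha>\<in>arcs Q. out_arcs Q (tail Q \<alpha>) = {\<alpha>} \<and> in_arcs Q (head Q \<alpha>) = {\<alpha>}"
  then obtain \<alpha> where "\<alpha> \<in> arcs Q" "out_arcs Q (tail Q \<alpha>) = {\<alpha>}" "in_arcs Q (head Q \<alpha>) = {\<alpha>}" by auto
  then show "\<exists>i\<in>verts Q. simple_module \<Lambda> (KM i)"
    by (intro bexI[of _ "tail Q \<alpha>"] KM_simple) simp_all
qed

lemma KM_simple_vec:
  assumes i: "i \<in> verts Q" and S: "simple_module \<Lambda> (KM i)" and \<alpha>: "out_arcs Q i = {\<alpha>}"
  shows "\<exists>x. simple_vec (KM i) (head Q \<alpha>) x"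
proof -
  obtain k x where v: "simple_vec (KM i) k x" using simple_vec_exists[OF S] by (elim exE) (rule that)
  have "\<alpha> \<in> arcs Q" using \<alpha> by auto
  then have "k = head Q \<alpha>"
    using simple_vec_vertex[OF v _ simple_vecD(3,4)[OF v] KM_act_head[OF i S \<alpha> simple_vecD(3)[OF v]]]
    by simp
  then show ?thesis using v by auto
qed

text \<open>The ends of \<alpha> may coincide, in which case \<beta> is \<alpha> as well; so the
  loop and the two-cycle are treated at once.\<close>

lemma periodic_quiver_shape:
  assumes periodic: "\<forall>M :: ('k, 'a) fdmod.
      indecomposable_module \<Lambda> M \<and> \<not> projective_module \<Lambda> M \<longrightarrow> rmodule_iso \<Lambda> ((syzygy \<Lambda> ^^ 4) M) M"
    and ind: "indecomposable_algebra \<Lambda>"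
    and \<alpha>: "\<alpha> \<in> arcs Q" and out: "out_arcs Q (tail Q \<alpha>) = {\<alpha>}" and inn: "in_arcs Q (head Q \<alpha>) = {\<alpha>}"
  obtains \<beta> where "verts Q = {tail Q \<alpha>, head Q \<alpha>}" "arcs Q = {\<alpha>, \<beta>}" "tail Q \<beta> = head Q \<alpha>"
    "head Q \<beta> = tail Q \<alpha>"
proof -
  define i j where "i = tail Q \<alpha>" and "j = head Q \<alpha>"
  have ij: "i \<in> verts Q" "j \<in> verts Q" using \<alpha> by (simp_all add: i_def j_def)
  have Ki: "simple_module \<Lambda> (KM i)" using KM_simple[OF \<alpha> out inn] by (simp add: i_def)
  have outi: "out_arcs Q i = {\<alpha>}" using out by (simp add: i_def)
  obtain S :: "('k, 'a) fdmod" and x where S: "simple_vec S i x"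
    using simple_fdmod_at[OF ij(1)] by (elim exE) (rule that)
  have rS: "right_module \<Lambda> S" using simple_vecD(1)[OF S] by auto
  let ?T = "syzygy \<Lambda> (syzygy \<Lambda> S)"
  have rT: "right_module \<Lambda> ?T" using syzygy_simple_vec(3)[OF S] by auto
  obtain y where y: "simple_vec (KM i) j y"
    using KM_simple_vec[OF ij(1) Ki outi, folded j_def] by (elim exE) (rule that)
  obtain z where T: "simple_vec ?T j z"
    using simple_vec_iso[OF y rT syzygy_simple_vec(2)[OF S]] by (elim exE) (rule that)
  have "\<not> projective_module \<Lambda> S" using simple_not_projective[OF S \<alpha>] by (simp add: i_def)
  then have "rmodule_iso \<Lambda> ((syzygy \<Lambda> ^^ 4) S) S"
    using periodic simple_imp_indecomposable[OF simple_vec_simple[OF S]] by simp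
  then have "rmodule_iso \<Lambda> (syzygy \<Lambda> (syzygy \<Lambda> ?T)) S" by (simp add: numeral_eq_Suc)
  \<comment> \<open>The fourth syzygy of \<open>S\<close> is the second syzygy of \<open>T\<close>,
    a simple module at \<open>j\<close>, hence isomorphic to \<open>KM j\<close>; periodicity
    identifies it with \<open>S\<close>.\<close>
  then have iso: "rmodule_iso \<Lambda> (KM j) S"
    by (rule rmodule_iso_trans[OF syzygy_simple_vec(2)[OF T]])
  have rK: "right_module \<Lambda> (KM j)" using KM_fd[OF ij(2)] by auto
  obtain u where u: "simple_vec (KM j) i u"
    using simple_vec_iso[OF S rK rmodule_iso_sym[OF rK iso]] by (elim exE) (rule that)
  have Kj: "simple_module \<Lambda> (KM j)" by (rule simple_vec_simple[OF u])
  obtain \<beta> where \<beta>: "out_arcs Q j = {\<beta>}" by (rule KM_unique_out[OF ij(2) Kj])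
  have in\<beta>: "in_arcs Q (head Q \<beta>) = {\<beta>}" by (rule KM_unique_in[OF ij(2) Kj \<beta>])
  obtain u' where u': "simple_vec (KM j) (head Q \<beta>) u'"
    using KM_simple_vec[OF ij(2) Kj \<beta>] by (elim exE) (rule that)
  \<comment> \<open>\<open>KM j\<close> is simple at the head of \<beta> by its description and at
    \<open>i\<close> by periodicity.\<close>
  have h\<beta>: "head Q \<beta> = i" by (rule simple_vec_same_vertex[OF u' u])
  have "\<beta> \<in> out_arcs Q j" unfolding \<beta> by simp
  then have b: "\<beta> \<in> arcs Q" "tail Q \<beta> = j" by simp_all
  have o1: "\<gamma> = \<alpha>" if "\<gamma> \<in> arcs Q" "tail Q \<gamma> = i" for \<gamma>
  proof -
    have "\<gamma> \<in> out_arcs Q i" using that by simp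
    then show ?thesis unfolding outi by simp
  qed
  have o2: "\<gamma> = \<beta>" if "\<gamma> \<in> arcs Q" "tail Q \<gamma> = j" for \<gamma>
  proof -
    have "\<gamma> \<in> out_arcs Q j" using that by simp
    then show ?thesis unfolding \<beta> by simp
  qed
  have i1: "\<gamma> = \<alpha>" if "\<gamma> \<in> arcs Q" "head Q \<gamma> = j" for \<gamma>
  proof -
    have "\<gamma> \<in> in_arcs Q (head Q \<alpha>)" using that by (simp add: j_def in_arcs_def)
    then show ?thesis unfolding inn by simp
  qed
  have i2: "\<gamma> = \<beta>" if "\<gamma> \<in> arcs Q" "head Q \<gamma> = i" for \<gamma>
  proof -
    have "\<gamma> \<in> in_arcs Q (head Q \<beta>)" using that by (simp add: h\<beta> in_arcs_def)
    then show ?thesis unfolding in\<beta> by simp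
  qed
  have V: "{i, j} = verts Q"
  proof (rule full_vertex_set[OF ind])
    show "{i, j} \<subseteq> verts Q" using ij by simp
    show "{i, j} \<noteq> {}" by simp
    fix \<gamma> assume \<gamma>: "\<gamma> \<in> arcs Q"
    show "tail Q \<gamma> \<in> {i, j} \<longleftrightarrow> head Q \<gamma> \<in> {i, j}"
    proof
      assume "tail Q \<gamma> \<in> {i, j}"
      then consider "tail Q \<gamma> = i" | "tail Q \<gamma> = j" by blast
      then show "head Q \<gamma> \<in> {i, j}"
      proof cases
        case 1 show ?thesis unfolding o1[OF \<gamma> 1] j_def by simp
      next
        case 2 show ?thesis unfolding o2[OF \<gamma> 2] h\<beta> by simp
      qed
    next
      assume "head Q \<gamma> \<in> {i, j}"
      then consider "head Q \<gamma> = i" | "head Q \<gamma> = j" by blast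
      then show "tail Q \<gamma> \<in> {i, j}"
      proof cases
        case 1 show ?thesis unfolding i2[OF \<gamma> 1] b(2) by simp
      next
        case 2 show ?thesis unfolding i1[OF \<gamma> 2] i_def by simp
      qed
    qed
  qed
  have "\<gamma> \<in> {\<alpha>, \<beta>}" if \<gamma>: "\<gamma> \<in> arcs Q" for \<gamma>
  proof -
    have "tail Q \<gamma> \<in> {i, j}" unfolding V using \<gamma> by simp
    then consider "tail Q \<gamma> = i" | "tail Q \<gamma> = j" by blast
    then show ?thesis
    proof cases
      case 1 show ?thesis unfolding o1[OF \<gamma> 1] by simp
    next
      case 2 show ?thesis unfolding o2[OF \<gamma> 2] by simp
    qed
  qed
  then have "arcs Q \<subseteq> {\<alpha>, \<beta>}" by (rule subsetI)
  moreover have "{\<alpha>, \<beta>} \<subseteq> arcs Q" using \<alpha> b(1) by simp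
  ultimately have A: "arcs Q = {\<alpha>, \<beta>}" by (rule equalityI)
  show ?thesis
    by (rule that[OF V[symmetric, unfolded i_def j_def] A b(2)[unfolded j_def] h\<beta>[unfolded i_def]])
qed

end

section \<open>Finite representation type\<close>

text \<open>Quivers that are disjoint unions of oriented cycles, covering the loop and the
  two-cycle; \<open>nx\<close> is the arrow leaving a vertex and \<open>pv\<close> the arrow
  entering it.\<close>

locale nakayama_quiver = bound_quiver \<Lambda> Q e g eps dl m
  for \<Lambda> :: "('k::field, 'a) module" (structure) and Q :: "('v, 'e) pre_digraph" and e g eps dl m +
  fixes nx pv :: "'v \<Rightarrow> 'e"
  assumes out_nx: "u \<in> verts Q \<Longrightarrow> out_arcs Q u = {nx u}"
    and in_pv: "u \<in> verts Q \<Longrightarrow> in_arcs Q u = {pv u}"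
begin

definition sg :: "'v \<Rightarrow> 'v" where
  "sg u = head Q (nx u)"

text \<open>One element for all paths: as every vertex has a single successor,
  \<open>e u \<otimes> N [^] k\<close> is the class of the unique path of length \<open>k\<close>
  from \<open>u\<close>. The algebra then behaves like a truncated polynomial ring in
  \<open>N\<close>, twisted by the permutation \<open>sg\<close> of the vertices.\<close>

definition N :: 'a where
  "N = (\<Oplus>\<gamma>\<in>arcs Q. g \<gamma>)"

lemma nx_arc: "u \<in> verts Q \<Longrightarrow> nx u \<in> arcs Q \<and> tail Q (nx u) = u"
proof -
  assume u: "u \<in> verts Q"
  have "nx u \<in> out_arcs Q u" unfolding out_nx[OF u] by simp
  then show ?thesis by simp
qed

lemma pv_arc: "u \<in> verts Q \<Longrightarrow> pv u \<in> arcs Q \<and> head Q (pv u) = u"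
proof -
  assume u: "u \<in> verts Q"
  have "pv u \<in> in_arcs Q u" unfolding in_pv[OF u] by simp
  then show ?thesis by (simp add: in_arcs_def)
qed

lemma nx_tail: "\<gamma> \<in> arcs Q \<Longrightarrow> nx (tail Q \<gamma>) = \<gamma>"
proof -
  assume "\<gamma> \<in> arcs Q"
  then have "\<gamma> \<in> out_arcs Q (tail Q \<gamma>)" "tail Q \<gamma> \<in> verts Q" by simp_all
  then show ?thesis using out_nx[of "tail Q \<gamma>"] by simp
qed

lemma pv_head: "\<gamma> \<in> arcs Q \<Longrightarrow> pv (head Q \<gamma>) = \<gamma>"
proof -
  assume "\<gamma> \<in> arcs Q"
  then have "\<gamma> \<in> in_arcs Q (head Q \<gamma>)" "head Q \<gamma> \<in> verts Q" by (simp_all add: in_arcs_def)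
  then show ?thesis using in_pv[of "head Q \<gamma>"] by simp
qed

lemma sg_verts [simp]: "u \<in> verts Q \<Longrightarrow> sg u \<in> verts Q"
  using nx_arc[of u] by (simp add: sg_def)

lemma sg_pow [simp]: "u \<in> verts Q \<Longrightarrow> (sg ^^ k) u \<in> verts Q"
  by (induction k) simp_all

lemma N_closed [simp]: "N \<in> carrier \<Lambda>"
  unfolding N_def by (intro finsum_closed) auto

lemma e_N: "u \<in> verts Q \<Longrightarrow> e u \<otimes> N = g (nx u)"
proof -
  assume u: "u \<in> verts Q"
  have "e u \<otimes> N = (\<Oplus>\<gamma>\<in>arcs Q. e u \<otimes> g \<gamma>)"
    unfolding N_def using u by (intro mult_finsum_right) auto
  also have "\<dots> = g (nx u)"
  proof (rule finsum_single[of _ "nx u"])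
    fix \<gamma> assume \<gamma>: "\<gamma> \<in> arcs Q" "\<gamma> \<noteq> nx u"
    then have "tail Q \<gamma> \<noteq> u" using nx_tail[of \<gamma>] by auto
    then show "e u \<otimes> g \<gamma> = \<zero>" using e_g[OF u \<gamma>(1)] by simp
  qed (use u nx_arc[OF u] e_g[of u "nx u"] in simp_all)
  finally show ?thesis .
qed

lemma N_e: "u \<in> verts Q \<Longrightarrow> N \<otimes> e u = g (pv u)"
proof -
  assume u: "u \<in> verts Q"
  have "N \<otimes> e u = (\<Oplus>\<gamma>\<in>arcs Q. g \<gamma> \<otimes> e u)"
    unfolding N_def using u by (intro finsum_ldistr) auto
  also have "\<dots> = g (pv u)"
  proof (rule finsum_single[of _ "pv u"])
    fix \<gamma> assume \<gamma>: "\<gamma> \<in> arcs Q" "\<gamma> \<noteq> pv u"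
    then have "head Q \<gamma> \<noteq> u" using pv_head[of \<gamma>] by auto
    then show "g \<gamma> \<otimes> e u = \<zero>" using g_e[OF u \<gamma>(1)] by simp
  qed (use u pv_arc[OF u] g_e[of u "pv u"] in simp_all)
  finally show ?thesis .
qed

lemma g_eq_e_N: "\<gamma> \<in> arcs Q \<Longrightarrow> g \<gamma> = e (tail Q \<gamma>) \<otimes> N"
  by (simp add: e_N nx_tail)

lemma e_N_swap: "u \<in> verts Q \<Longrightarrow> e u \<otimes> N = N \<otimes> e (sg u)"
  using nx_arc[of u] pv_head[of "nx u"] by (simp add: e_N N_e sg_def)

lemma N_e_swap: "u \<in> verts Q \<Longrightarrow> N \<otimes> e u = e (tail Q (pv u)) \<otimes> N"
  using pv_arc[of u] nx_tail[of "pv u"] by (simp add: e_N N_e)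

lemma e_pow_swap: "u \<in> verts Q \<Longrightarrow> e u \<otimes> N [^] k = N [^] k \<otimes> e ((sg ^^ k) u)" for k :: nat
proof (induction k)
  case (Suc k)
  then have IH: "e u \<otimes> N [^] k = N [^] k \<otimes> e ((sg ^^ k) u)" by simp
  have "e u \<otimes> N [^] Suc k = (e u \<otimes> N [^] k) \<otimes> N" using Suc.prems by (simp add: m_assoc)
  also have "\<dots> = N [^] k \<otimes> (e ((sg ^^ k) u) \<otimes> N)" unfolding IH using Suc.prems by (intro m_assoc) simp_all
  also have "\<dots> = N [^] Suc k \<otimes> e ((sg ^^ Suc k) u)" using Suc.prems by (simp add: e_N_swap m_assoc)
  finally show ?case .
qed simp

text \<open>Read the list from \<open>u\<close>: an arrow that does not start at the current vertex
  makes the product zero; otherwise it is the only arrow there and acts as a factor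
  \<open>N\<close>.\<close>

lemma path_eq_pow:
  assumes "set p \<subseteq> arcs Q" "u \<in> verts Q"
  shows "e u \<otimes> w p = \<zero> \<or> e u \<otimes> w p = e u \<otimes> N [^] length p"
  using assms
proof (induction p arbitrary: u)
  case (Cons \<gamma> p)
  then have \<gamma>: "\<gamma> \<in> arcs Q" "set p \<subseteq> arcs Q" by auto
  show ?case
  proof (cases "u = tail Q \<gamma>")
    case True
    let ?v = "sg u"
    have v: "?v \<in> verts Q" using Cons.prems by simp
    have "e u \<otimes> w (\<gamma> # p) = (e u \<otimes> g \<gamma>) \<otimes> w p" using \<gamma> Cons.prems by (simp add: w_Cons m_assoc)
    also have "e u \<otimes> g \<gamma> = g \<gamma>" using e_g[OF Cons.prems(2) \<gamma>(1)] True by simp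
    also have "g \<gamma> = e u \<otimes> N" unfolding True by (rule g_eq_e_N[OF \<gamma>(1)])
    also have "e u \<otimes> N = N \<otimes> e ?v" by (rule e_N_swap[OF Cons.prems(2)])
    also have "N \<otimes> e ?v \<otimes> w p = N \<otimes> (e ?v \<otimes> w p)" using \<gamma> v by (simp add: m_assoc)
    finally have 1: "e u \<otimes> w (\<gamma> # p) = N \<otimes> (e ?v \<otimes> w p)" .
    have "N \<otimes> (e ?v \<otimes> N [^] length p) = e u \<otimes> N [^] length (\<gamma> # p)"
      using v Cons.prems nat_pow_Suc2[of N "length p"] by (simp add: m_assoc[symmetric] e_N_swap del: nat_pow_Suc)
    then show ?thesis using Cons.IH[OF \<gamma>(2) v] 1 by auto
  next
    case False
    have "e u \<otimes> w (\<gamma> # p) = (e u \<otimes> g \<gamma>) \<otimes> w p" using \<gamma> Cons.prems by (simp add: w_Cons m_assoc)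
    then show ?thesis using e_g[OF Cons.prems(2) \<gamma>(1)] False \<gamma> by simp
  qed
qed simp

lemma pow_induct [consumes 1, case_names zero add pow]:
  assumes "a \<in> carrier \<Lambda>" and zero: "R \<zero>"
    and add: "\<And>x y. \<lbrakk>x \<in> carrier \<Lambda>; y \<in> carrier \<Lambda>; R x; R y\<rbrakk> \<Longrightarrow> R (x \<oplus> y)"
    and pow: "\<And>c u k. u \<in> verts Q \<Longrightarrow> R (c \<odot> (e u \<otimes> N [^] (k::nat)))"
  shows "R a"
  using assms(1)
proof (induction rule: path_induct')
  case (path c u p)
  then show ?case using path_eq_pow[OF path(2,1)] pow[of u c "length p"] zero by auto
qed (use zero add in auto)

text \<open>Each summand \<open>e u \<otimes> N [^] m\<close> of \<open>N [^] m\<close> is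
  \<open>e u\<close> times a product of \<open>m\<close> arrows, so the vanishing of long words
  applies.\<close>

lemma pow_nilpotent: "N [^] m = \<zero>"
proof -
  have p: "\<exists>p. set p \<subseteq> arcs Q \<and> length p = k \<and> e u \<otimes> N [^] k = e u \<otimes> w p" if "u \<in> verts Q" for u k
    using that
  proof (induction k arbitrary: u)
    case 0
    show ?case by (rule exI[of _ "[]"]) simp
  next
    case (Suc k)
    let ?\<gamma> = "nx u"
    have \<gamma>: "?\<gamma> \<in> arcs Q" "tail Q ?\<gamma> = u" "head Q ?\<gamma> = sg u" using nx_arc[OF Suc.prems] by (simp_all add: sg_def)
    obtain p where p: "set p \<subseteq> arcs Q" "length p = k" "e (sg u) \<otimes> N [^] k = e (sg u) \<otimes> w p"
      using Suc.IH[of "sg u"] Suc.prems by auto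
    have "e u \<otimes> N [^] Suc k = N \<otimes> (e (sg u) \<otimes> N [^] k)"
      using Suc.prems nat_pow_Suc2[of N k] by (simp add: m_assoc[symmetric] e_N_swap del: nat_pow_Suc)
    also have "\<dots> = (N \<otimes> e (sg u)) \<otimes> w p" using Suc.prems p(1) by (simp add: p(3) m_assoc)
    also have "N \<otimes> e (sg u) = e u \<otimes> N" by (rule e_N_swap[OF Suc.prems, symmetric])
    also have "e u \<otimes> N = g ?\<gamma>" by (rule e_N[OF Suc.prems])
    also have "g ?\<gamma> = e u \<otimes> g ?\<gamma>" using e_g[OF Suc.prems \<gamma>(1)] \<gamma>(2) by simp
    also have "(e u \<otimes> g ?\<gamma>) \<otimes> w p = e u \<otimes> w (?\<gamma> # p)" using Suc.prems \<gamma> p(1) by (simp add: w_Cons m_assoc)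
    finally show ?case using p \<gamma> by (intro exI[of _ "?\<gamma> # p"]) simp
  qed
  have z: "e u \<otimes> N [^] m = \<zero>" if u: "u \<in> verts Q" for u
  proof -
    obtain q where q: "set q \<subseteq> arcs Q" "length q = m" "e u \<otimes> N [^] m = e u \<otimes> w q"
      using p[OF u, of m] by auto
    then show ?thesis using u w_long[OF q(1)] by simp
  qed
  have "N [^] m = \<one> \<otimes> N [^] m" by simp
  also have "\<dots> = (\<Oplus>u\<in>verts Q. e u \<otimes> N [^] m)"
    unfolding one_e by (intro finsum_ldistr) auto
  also have "\<dots> = (\<Oplus>u\<in>verts Q. \<zero>)" by (intro finsum_cong') (auto simp: z)
  finally show ?thesis by simp
qed

lemma pow_ge: "m \<le> k \<Longrightarrow> N [^] k = \<zero>"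
  using nat_pow_mult[of N m "k - m"] by (simp add: pow_nilpotent)

text \<open>\<open>N\<close> passes an idempotent by shifting its vertex:
  \<open>N \<otimes> e u = e v \<otimes> N\<close> with \<open>v\<close> the predecessor of
  \<open>u\<close>. So powers of \<open>N\<close> can be moved to the far right, where they act last
  on a module.\<close>

lemma N_right_commute:
  assumes "b \<in> carrier \<Lambda>"
  shows "\<exists>b'\<in>carrier \<Lambda>. N [^] (j::nat) \<otimes> b = b' \<otimes> N [^] j"
proof -
  have one: "\<exists>b'\<in>carrier \<Lambda>. N \<otimes> b = b' \<otimes> N" if "b \<in> carrier \<Lambda>" for b
    using that
  proof (induction rule: pow_induct)
    case zero
    show ?case by (rule bexI[of _ \<zero>]) simp_all
  next
    case (add x y)
    then obtain x' y' where "x' \<in> carrier \<Lambda>" "N \<otimes> x = x' \<otimes> N" "y' \<in> carrier \<Lambda>" "N \<otimes> y = y' \<otimes> N" by auto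
    then show ?case using add(1,2) by (intro bexI[of _ "x' \<oplus> y'"]) (simp_all add: l_distr r_distr)
  next
    case (pow c u k)
    let ?v = "tail Q (pv u)"
    have v: "?v \<in> verts Q" using pv_arc[OF pow] by simp
    have "N \<otimes> (e u \<otimes> N [^] k) = (N \<otimes> e u) \<otimes> N [^] k" using pow by (simp add: m_assoc)
    also have "\<dots> = e ?v \<otimes> (N \<otimes> N [^] k)" using pow v by (simp add: N_e_swap m_assoc)
    also have "N \<otimes> N [^] k = N [^] k \<otimes> N" using nat_pow_Suc2[of N k] by simp
    finally have "N \<otimes> (e u \<otimes> N [^] k) = e ?v \<otimes> N [^] k \<otimes> N" using v by (simp add: m_assoc)
    then show ?case using pow v
      by (intro bexI[of _ "c \<odot> (e ?v \<otimes> N [^] k)"]) (simp_all add: smult_mult_left smult_mult_right)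
  qed
  show ?thesis
  proof (induction j)
    case 0
    show ?case using assms by (intro bexI[of _ b]) simp_all
  next
    case (Suc j)
    then obtain b' where b': "b' \<in> carrier \<Lambda>" "N [^] j \<otimes> b = b' \<otimes> N [^] j" by auto
    obtain b'' where b'': "b'' \<in> carrier \<Lambda>" "N \<otimes> b' = b'' \<otimes> N" using one[OF b'(1)] by auto
    have "N [^] Suc j \<otimes> b = N \<otimes> (N [^] j \<otimes> b)" using assms nat_pow_Suc2[of N j] by (simp add: m_assoc)
    also have "\<dots> = (N \<otimes> b') \<otimes> N [^] j" using b' by (simp add: m_assoc)
    also have "\<dots> = b'' \<otimes> (N \<otimes> N [^] j)" using b'' b'(1) by (simp add: m_assoc)
    also have "N \<otimes> N [^] j = N [^] Suc j" using nat_pow_Suc2[of N j] by simp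
    finally show ?case using b''(1) by (intro bexI[of _ b''])
  qed
qed

text \<open>A spanning element \<open>e u \<otimes> N [^] k\<close> with positive \<open>k\<close>
  starts with \<open>N\<close> once the idempotent has passed one factor; its vertex part is zero
  because \<open>eps\<close> vanishes on \<open>N\<close>.\<close>

lemma N_left_decomp:
  assumes "b \<in> carrier \<Lambda>"
  shows "\<exists>b'\<in>carrier \<Lambda>. b = vpart b \<oplus> N \<otimes> b'"
  using assms
proof (induction rule: pow_induct)
  case zero
  show ?case by (rule bexI[of _ \<zero>]) (simp_all add: vpart_eq_zero)
next
  case (add x y)
  then obtain x' y' where x': "x' \<in> carrier \<Lambda>" "x = vpart x \<oplus> N \<otimes> x'" and y': "y' \<in> carrier \<Lambda>" "y = vpart y \<oplus> N \<otimes> y'"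
    by (elim bexE) (rule that)
  have "vpart x \<oplus> N \<otimes> x' \<oplus> (vpart y \<oplus> N \<otimes> y') = vpart (x \<oplus> y) \<oplus> N \<otimes> (x' \<oplus> y')"
    using x'(1) y'(1) add(1,2) by (simp add: vpart_add r_distr a_ac)
  then have "x \<oplus> y = vpart (x \<oplus> y) \<oplus> N \<otimes> (x' \<oplus> y')" using x'(2) y'(2) by (simp only:)
  then show ?case using x'(1) y'(1) by (intro bexI[of _ "x' \<oplus> y'"]) simp_all
next
  case (pow c u k)
  show ?case
  proof (cases k)
    case 0
    then show ?thesis using pow by (intro bexI[of _ \<zero>]) (simp_all add: vpart_e)
  next
    case (Suc l)
    let ?a = "c \<odot> (e u \<otimes> N [^] k)"
    let ?b = "c \<odot> (e (sg u) \<otimes> N [^] l)"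
    have "e u \<otimes> N [^] k = N \<otimes> (e (sg u) \<otimes> N [^] l)"
      using pow nat_pow_Suc2[of N l] by (simp add: Suc m_assoc[symmetric] e_N_swap del: nat_pow_Suc)
    then have a: "?a = N \<otimes> ?b" using pow by (simp add: smult_mult_right)
    have "eps v N = 0" if "v \<in> verts Q" for v
    proof -
      have "eps v N = eps v (e v \<otimes> N)" using that by (simp add: eps_mult eps_e)
      then show ?thesis using that nx_arc[OF that] by (simp add: e_N eps_g)
    qed
    then have "vpart ?a = \<zero>" unfolding a using pow by (intro vpart_eq_zero) (simp add: eps_mult)
    then show ?thesis using a pow by (intro bexI[of _ ?b]) simp_all
  qed
qed

text \<open>
  The annihilator is the one of the class of \<open>e v\<close> in \<open>e v \<Lambda> / e v N\<^sup>p\<^sup>+\<^sup>1 \<Lambda>\<close>, so \<open>v\<close> and \<open>p\<close> determine \<open>M\<close>.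
\<close>

definition generator :: "('k, 'm, 'a) right_module \<Rightarrow> 'v \<Rightarrow> nat \<Rightarrow> 'm \<Rightarrow> bool" where
  "generator M v p x \<longleftrightarrow> x \<in> carrier M \<and> (\<forall>y\<in>carrier M. \<exists>a\<in>carrier \<Lambda>. y = x \<lhd>\<^bsub>M\<^esub> a) \<and>
    (\<forall>a\<in>carrier \<Lambda>. x \<lhd>\<^bsub>M\<^esub> a = \<zero>\<^bsub>M\<^esub> \<longleftrightarrow> (\<exists>b\<in>carrier \<Lambda>. e v \<otimes> a = e v \<otimes> N [^] Suc p \<otimes> b))"

section \<open>Indecomposable modules over these algebras are cyclic\<close>

lemma regular_act_hom:
  assumes M: "right_module \<Lambda> M" and x: "x \<in> carrier M"
  shows "(\<lambda>a. x \<lhd>\<^bsub>M\<^esub> a) \<in> rmodule_hom \<Lambda> (regular_module \<Lambda>) M"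
proof -
  interpret M: right_module \<Lambda> M by (rule M)
  show ?thesis
    using x by (simp add: rmodule_hom_iff M.act_add_right M.act_smult_right M.act_assoc)
qed

text \<open>Let \<open>p\<close> be the largest exponent for which \<open>N [^] p\<close> acts
  nontrivially, and \<open>x\<close> a vector at a vertex with \<open>x N^p\<close> nonzero. The
  cyclic submodule \<open>U\<close> of \<open>x\<close> splits off: a linear functional \<phi> with
  value 1 at \<open>x N^p\<close> defines a complement \<open>W\<close>, the vectors
  \<open>y\<close> such that \<phi> vanishes at all \<open>y N^k\<close>. Indecomposability then
  leaves \<open>M = U\<close>.\<close>

lemma indecomposable_generator:
  fixes M :: "('k, 'm, 'a) right_module"
  assumes M: "indecomposable_module \<Lambda> M"
  shows "\<exists>v\<in>verts Q. \<exists>p<m. \<exists>x. generator M v p x"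
proof -
  have fM: "fd_right_module \<Lambda> M" and ne: "carrier M \<noteq> {\<zero>\<^bsub>M\<^esub>}"
    and ind: "\<And>A B. \<lbrakk>rsubmodule \<Lambda> A M; rsubmodule \<Lambda> B M; A <+>\<^bsub>M\<^esub> B = carrier M; A \<inter> B = {\<zero>\<^bsub>M\<^esub>}\<rbrakk>
      \<Longrightarrow> A = {\<zero>\<^bsub>M\<^esub>} \<or> B = {\<zero>\<^bsub>M\<^esub>}"
    using M by (simp_all add: indecomposable_module_def)
  interpret M: fd_right_module \<Lambda> M by (rule fM)
  have rM: "right_module \<Lambda> M" by (rule M.right_module_axioms)
  define T where "T y k = y \<lhd>\<^bsub>M\<^esub> (N [^] k)" for y and k :: nat
  have T_closed [simp]: "T y k \<in> carrier M" if "y \<in> carrier M" for y k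
    using that by (simp add: T_def)
  have T_T: "T (T y k) l = T y (k + l)" if "y \<in> carrier M" for y k l
    using that by (simp add: T_def M.act_assoc nat_pow_mult)
  have T_ge: "T y k = \<zero>\<^bsub>M\<^esub>" if "y \<in> carrier M" "m \<le> k" for y k
    using that by (simp add: T_def pow_ge act_zero_right[OF rM])
  define P where "P k \<longleftrightarrow> (\<exists>y\<in>carrier M. T y k \<noteq> \<zero>\<^bsub>M\<^esub>)" for k
  obtain y1 where y1: "y1 \<in> carrier M" "y1 \<noteq> \<zero>\<^bsub>M\<^esub>" using ne M.M_zero by auto
  have "P 0" unfolding P_def using y1 by (intro bexI[of _ y1]) (simp_all add: T_def M.act_one)
  moreover have bound: "k < m" if "P k" for k
    using that T_ge unfolding P_def by (meson not_le)
  ultimately obtain p where p: "P p" and max: "\<And>k. P k \<Longrightarrow> k \<le> p"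
    using ex_has_greatest_nat[of P 0 id m] by auto
  have T_max: "T y k = \<zero>\<^bsub>M\<^esub>" if "y \<in> carrier M" "p < k" for y k
    using max[of k] that unfolding P_def by auto
  obtain y0 where y0: "y0 \<in> carrier M" "T y0 p \<noteq> \<zero>\<^bsub>M\<^esub>" using p unfolding P_def by auto
  have "\<exists>v\<in>verts Q. T (y0 \<lhd>\<^bsub>M\<^esub> e v) p \<noteq> \<zero>\<^bsub>M\<^esub>"
  proof (rule ccontr)
    assume no: "\<not> ?thesis"
    have "T y0 p = y0 \<lhd>\<^bsub>M\<^esub> (\<one> \<otimes> N [^] p)" by (simp add: T_def)
    also have "\<one> \<otimes> N [^] p = (\<Oplus>v\<in>verts Q. e v \<otimes> N [^] p)"
      unfolding one_e by (intro finsum_ldistr) auto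
    also have "y0 \<lhd>\<^bsub>M\<^esub> \<dots> = finsum M (\<lambda>v. y0 \<lhd>\<^bsub>M\<^esub> (e v \<otimes> N [^] p)) (verts Q)"
      using y0 by (intro act_finsum_right[OF rM]) auto
    also have "\<dots> = finsum M (\<lambda>v. \<zero>\<^bsub>M\<^esub>) (verts Q)"
      using no y0 by (intro M.module.M.finsum_cong') (auto simp: T_def M.act_assoc)
    finally show False using y0(2) by (simp add: M.module.M.finsum_zero)
  qed
  then obtain v where v: "v \<in> verts Q" "T (y0 \<lhd>\<^bsub>M\<^esub> e v) p \<noteq> \<zero>\<^bsub>M\<^esub>" by auto
  define x where "x = y0 \<lhd>\<^bsub>M\<^esub> e v"
  have x: "x \<in> carrier M" using y0 v by (simp add: x_def)
  have xe: "x \<lhd>\<^bsub>M\<^esub> e v = x" using y0 v by (simp add: x_def M.act_assoc e_e)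
  have Tx: "T x p \<noteq> \<zero>\<^bsub>M\<^esub>" using v by (simp add: x_def)
  \<comment> \<open>The vertex at which the path of length \<open>k\<close> from \<open>v\<close>
    ends; \<open>x N^k\<close> lives there.\<close>
  define wv where "wv k = (sg ^^ k) v" for k
  have wv: "wv k \<in> verts Q" for k using v by (simp add: wv_def)
  have Txe: "T x k \<lhd>\<^bsub>M\<^esub> e (wv k) = T x k" for k
  proof -
    have "T x k = x \<lhd>\<^bsub>M\<^esub> (e v \<otimes> N [^] k)" using x v M.act_assoc[of x "e v" "N [^] k"] by (simp add: T_def xe)
    also have "\<dots> = T x k \<lhd>\<^bsub>M\<^esub> e (wv k)" using x v wv[of k] by (simp add: T_def M.act_assoc e_pow_swap wv_def)
    finally show ?thesis by (rule sym)
  qed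
  have Txu: "T x k \<lhd>\<^bsub>M\<^esub> e u = \<zero>\<^bsub>M\<^esub>" if "u \<in> verts Q" "u \<noteq> wv k" for k u
  proof -
    have "T x k \<lhd>\<^bsub>M\<^esub> e (wv k) \<lhd>\<^bsub>M\<^esub> e u = T x k \<lhd>\<^bsub>M\<^esub> (e (wv k) \<otimes> e u)"
      using x wv that by (intro M.act_assoc) auto
    then show ?thesis using Txe[of k] that x wv[of k] by (simp add: e_e act_zero_right[OF rM])
  qed
  have "\<exists>\<psi> :: 'm \<Rightarrow> nat \<Rightarrow> 'k. inj_on \<psi> (carrier M) \<and>
    (\<forall>x\<in>carrier M. \<forall>y\<in>carrier M. \<forall>k. \<psi> (x \<oplus>\<^bsub>M\<^esub> y) k = \<psi> x k + \<psi> y k) \<and>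
    (\<forall>c. \<forall>x\<in>carrier M. \<forall>k. \<psi> (c \<odot>\<^bsub>M\<^esub> x) k = c * \<psi> x k)"
  proof (rule coordinates_exist[OF fM])
    fix \<psi> :: "'m \<Rightarrow> nat \<Rightarrow> 'k"
    assume "inj_on \<psi> (carrier M)"
      "\<And>x y k. \<lbrakk>x \<in> carrier M; y \<in> carrier M\<rbrakk> \<Longrightarrow> \<psi> (x \<oplus>\<^bsub>M\<^esub> y) k = \<psi> x k + \<psi> y k"
      "\<And>c x k. x \<in> carrier M \<Longrightarrow> \<psi> (c \<odot>\<^bsub>M\<^esub> x) k = c * \<psi> x k"
    then show ?thesis by (intro exI[of _ \<psi>]) simp
  qed
  then obtain \<psi> :: "'m \<Rightarrow> nat \<Rightarrow> 'k" where \<psi>': "inj_on \<psi> (carrier M) \<and>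
    (\<forall>x\<in>carrier M. \<forall>y\<in>carrier M. \<forall>k. \<psi> (x \<oplus>\<^bsub>M\<^esub> y) k = \<psi> x k + \<psi> y k) \<and>
    (\<forall>c. \<forall>x\<in>carrier M. \<forall>k. \<psi> (c \<odot>\<^bsub>M\<^esub> x) k = c * \<psi> x k)"
    by (elim exE) (rule that)
  then have \<psi>: "inj_on \<psi> (carrier M)"
    "\<And>x y k. \<lbrakk>x \<in> carrier M; y \<in> carrier M\<rbrakk> \<Longrightarrow> \<psi> (x \<oplus>\<^bsub>M\<^esub> y) k = \<psi> x k + \<psi> y k"
    "\<And>c x k. x \<in> carrier M \<Longrightarrow> \<psi> (c \<odot>\<^bsub>M\<^esub> x) k = c * \<psi> x k"
    by simp_all
  have \<psi>0: "\<psi> \<zero>\<^bsub>M\<^esub> k = 0" for k using \<psi>(3)[of "\<zero>\<^bsub>M\<^esub>" 0 k] by simp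
  have "\<exists>k. \<psi> (T x p) k \<noteq> 0"
  proof (rule ccontr)
    assume "\<not> ?thesis"
    then have "\<psi> (T x p) = \<psi> \<zero>\<^bsub>M\<^esub>" by (simp add: fun_eq_iff \<psi>0)
    then show False using inj_onD[OF \<psi>(1)] Tx x by (metis T_closed M.M_zero)
  qed
  then obtain k0 where k0: "\<psi> (T x p) k0 \<noteq> 0" by auto
  \<comment> \<open>Passing to the component at \<open>wv p\<close> makes \<phi> compatible with the
    idempotents, which \<open>W\<close> needs to be a submodule; the denominator normalizes the
    value at \<open>x N^p\<close>.\<close>
  define \<phi> where "\<phi> y = \<psi> (y \<lhd>\<^bsub>M\<^esub> e (wv p)) k0 / \<psi> (T x p) k0" for y
  have \<phi>_add: "\<phi> (y \<oplus>\<^bsub>M\<^esub> y') = \<phi> y + \<phi> y'" if "y \<in> carrier M" "y' \<in> carrier M" for y y'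
    using that wv[of p] by (simp add: \<phi>_def M.act_add_left \<psi>(2) add_divide_distrib)
  have \<phi>_smult: "\<phi> (c \<odot>\<^bsub>M\<^esub> y) = c * \<phi> y" if "y \<in> carrier M" for c y
    using that wv[of p] by (simp add: \<phi>_def M.act_smult_left \<psi>(3))
  have \<phi>0: "\<phi> \<zero>\<^bsub>M\<^esub> = 0" using \<phi>_smult[of "\<zero>\<^bsub>M\<^esub>" 0] by simp
  have \<phi>1: "\<phi> (T x p) = 1" using k0 by (simp add: \<phi>_def Txe)
  have \<phi>_e: "\<phi> (y \<lhd>\<^bsub>M\<^esub> e u) = (if u = wv p then \<phi> y else 0)" if "y \<in> carrier M" "u \<in> verts Q" for y u
    using that wv[of p] by (simp add: \<phi>_def M.act_assoc e_e act_zero_right[OF rM] \<psi>0)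
  have T_add: "T (y \<oplus>\<^bsub>M\<^esub> y') k = T y k \<oplus>\<^bsub>M\<^esub> T y' k" if "y \<in> carrier M" "y' \<in> carrier M" for y y' k
    using that by (simp add: T_def M.act_add_left)
  have T_smult: "T (c \<odot>\<^bsub>M\<^esub> y) k = c \<odot>\<^bsub>M\<^esub> T y k" if "y \<in> carrier M" for c y k
    using that by (simp add: T_def M.act_smult_left)
  have T_zero: "T \<zero>\<^bsub>M\<^esub> k = \<zero>\<^bsub>M\<^esub>" for k by (simp add: T_def)
  \<comment> \<open>If \<phi> vanishes at all \<open>x a N^j\<close>, then
    \<open>e v \<otimes> a\<close> lies ever deeper in the filtration by powers of \<open>N\<close>:
    its leading coefficient at depth \<open>t\<close> is the value of \<phi> at
    \<open>x a N^(p - t)\<close>.\<close>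
  have key: "\<exists>b\<in>carrier \<Lambda>. e v \<otimes> a = e v \<otimes> N [^] t \<otimes> b"
    if a: "a \<in> carrier \<Lambda>" and perp: "\<And>j. \<phi> (T (x \<lhd>\<^bsub>M\<^esub> a) j) = 0" and t: "t \<le> Suc p" for a t
    using t
  proof (induction t)
    case 0
    show ?case using a v by (intro bexI[of _ a]) simp_all
  next
    case (Suc t)
    then obtain b where b: "b \<in> carrier \<Lambda>" "e v \<otimes> a = e v \<otimes> N [^] t \<otimes> b" by auto
    obtain b' where b': "b' \<in> carrier \<Lambda>" "b = vpart b \<oplus> N \<otimes> b'"
      using N_left_decomp[OF b(1)] by (elim bexE) (rule that)
    have tp: "t \<le> p" using Suc.prems by simp
    have V: "e v \<otimes> N [^] t \<otimes> vpart b = eps (wv t) b \<odot> (e v \<otimes> N [^] t)"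
    proof -
      have s: "e v \<otimes> N [^] t \<otimes> e u = (if u = wv t then e v \<otimes> N [^] t else \<zero>)" if "u \<in> verts Q" for u
        using that v wv[of t] by (simp add: e_pow_swap m_assoc e_e wv_def)
      have "e v \<otimes> N [^] t \<otimes> vpart b = (\<Oplus>u\<in>verts Q. e v \<otimes> N [^] t \<otimes> (eps u b \<odot> e u))"
        unfolding vpart_def using v by (intro mult_finsum_right) auto
      also have "\<dots> = eps (wv t) b \<odot> (e v \<otimes> N [^] t)"
        using v wv[of t] by (intro finsum_single[where i = "wv t"]) (auto simp: smult_mult_right s)
      finally show ?thesis .
    qed
    have "e v \<otimes> a = e v \<otimes> N [^] t \<otimes> (vpart b \<oplus> N \<otimes> b')" using b(2) b'(2) by simp
    also have "\<dots> = e v \<otimes> N [^] t \<otimes> vpart b \<oplus> e v \<otimes> N [^] t \<otimes> (N \<otimes> b')"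
      using v b'(1) by (intro r_distr) auto
    also have "e v \<otimes> N [^] t \<otimes> (N \<otimes> b') = e v \<otimes> N [^] Suc t \<otimes> b'"
      using v b'(1) by (simp add: m_assoc)
    finally have E: "e v \<otimes> a = eps (wv t) b \<odot> (e v \<otimes> N [^] t) \<oplus> e v \<otimes> N [^] Suc t \<otimes> b'"
      unfolding V .
    have "x \<lhd>\<^bsub>M\<^esub> a = x \<lhd>\<^bsub>M\<^esub> (e v \<otimes> a)" using x v a M.act_assoc[of x "e v" a] xe by simp
    also have "\<dots> = eps (wv t) b \<odot>\<^bsub>M\<^esub> T x t \<oplus>\<^bsub>M\<^esub> T x (Suc t) \<lhd>\<^bsub>M\<^esub> b'"
    proof -
      have xt: "x \<lhd>\<^bsub>M\<^esub> (e v \<otimes> N [^] l) = T x l" for l :: nat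
        using x v M.act_assoc[of x "e v" "N [^] l"] xe by (simp add: T_def)
      have 3: "x \<lhd>\<^bsub>M\<^esub> (e v \<otimes> N [^] Suc t \<otimes> b') = x \<lhd>\<^bsub>M\<^esub> (e v \<otimes> N [^] Suc t) \<lhd>\<^bsub>M\<^esub> b'"
        using x v b'(1) by (intro M.act_assoc[symmetric]) auto
      have 1: "x \<lhd>\<^bsub>M\<^esub> (eps (wv t) b \<odot> (e v \<otimes> N [^] t) \<oplus> e v \<otimes> N [^] Suc t \<otimes> b') =
        x \<lhd>\<^bsub>M\<^esub> (eps (wv t) b \<odot> (e v \<otimes> N [^] t)) \<oplus>\<^bsub>M\<^esub> x \<lhd>\<^bsub>M\<^esub> (e v \<otimes> N [^] Suc t \<otimes> b')"
        using x v b'(1) by (intro M.act_add_right) auto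
      have 2: "x \<lhd>\<^bsub>M\<^esub> (eps (wv t) b \<odot> (e v \<otimes> N [^] t)) = eps (wv t) b \<odot>\<^bsub>M\<^esub> (x \<lhd>\<^bsub>M\<^esub> (e v \<otimes> N [^] t))"
        using x v by (intro M.act_smult_right) auto
      show ?thesis unfolding E 1 2 3 xt by (rule refl)
    qed
    finally have xa: "x \<lhd>\<^bsub>M\<^esub> a = eps (wv t) b \<odot>\<^bsub>M\<^esub> T x t \<oplus>\<^bsub>M\<^esub> T x (Suc t) \<lhd>\<^bsub>M\<^esub> b'" .
    \<comment> \<open>The higher term carries \<open>N^(t + 1)\<close> in front of
      \<open>b'\<close>. Moved to the end, it combines with \<open>N^(p - t)\<close> to
      \<open>N^(p + 1)\<close>, which acts as zero.\<close>
    obtain b'' where b'': "b'' \<in> carrier \<Lambda>" "N [^] Suc t \<otimes> b' = b'' \<otimes> N [^] Suc t"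
      using N_right_commute[OF b'(1), of "Suc t"] by (elim bexE) (rule that)
    have "T x (Suc t) \<lhd>\<^bsub>M\<^esub> b' = x \<lhd>\<^bsub>M\<^esub> (N [^] Suc t \<otimes> b')"
      unfolding T_def using x b'(1) by (intro M.act_assoc) auto
    also have "\<dots> = T (x \<lhd>\<^bsub>M\<^esub> b'') (Suc t)"
      unfolding b''(2) T_def using x b''(1) by (intro M.act_assoc[symmetric]) auto
    finally have "T (T x (Suc t) \<lhd>\<^bsub>M\<^esub> b') (p - t) = T (x \<lhd>\<^bsub>M\<^esub> b'') (Suc t + (p - t))"
      using x b''(1) by (simp add: T_T)
    also have "\<dots> = \<zero>\<^bsub>M\<^esub>" using x b''(1) tp by (intro T_max) auto
    finally have Z: "T (T x (Suc t) \<lhd>\<^bsub>M\<^esub> b') (p - t) = \<zero>\<^bsub>M\<^esub>" .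
    have "\<phi> (T (x \<lhd>\<^bsub>M\<^esub> a) (p - t)) = eps (wv t) b * \<phi> (T (T x t) (p - t))"
      unfolding xa using x b'(1) by (simp add: T_add T_smult Z \<phi>_smult M.module.M.r_zero)
    also have "\<dots> = eps (wv t) b" using x tp by (simp add: T_T \<phi>1)
    finally have "eps (wv t) b = 0" using perp by simp
    then have "e v \<otimes> a = e v \<otimes> N [^] Suc t \<otimes> b'" using E v b'(1) by simp
    then show ?case using b'(1) by (intro bexI[of _ b'])
  qed
  have xN0: "x \<lhd>\<^bsub>M\<^esub> a = \<zero>\<^bsub>M\<^esub>" if "a \<in> carrier \<Lambda>" "b \<in> carrier \<Lambda>" "e v \<otimes> a = e v \<otimes> N [^] Suc p \<otimes> b" for a b
  proof -
    have "x \<lhd>\<^bsub>M\<^esub> a = x \<lhd>\<^bsub>M\<^esub> (e v \<otimes> a)" using x v that M.act_assoc[of x "e v" a] xe by simp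
    also have "\<dots> = x \<lhd>\<^bsub>M\<^esub> e v \<lhd>\<^bsub>M\<^esub> N [^] Suc p \<lhd>\<^bsub>M\<^esub> b"
      unfolding that(3) using x v that by (simp add: M.act_assoc del: nat_pow_Suc)
    also have "x \<lhd>\<^bsub>M\<^esub> e v \<lhd>\<^bsub>M\<^esub> N [^] Suc p = \<zero>\<^bsub>M\<^esub>"
      unfolding xe using T_max[OF x, of "Suc p"] by (simp add: T_def)
    finally show ?thesis using that by simp
  qed
  \<comment> \<open>The largest submodule inside the kernel of \<phi>.\<close>
  define W where "W = {y \<in> carrier M. \<forall>k. \<phi> (T y k) = 0}"
  define U where "U = (\<lambda>a. x \<lhd>\<^bsub>M\<^esub> a) ` carrier (regular_module \<Lambda>)"
  have U: "rsubmodule \<Lambda> U M"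
    unfolding U_def
    by (rule image_rsubmodule[OF regular rM regular_act_hom[OF rM x] reg.rsubmodule_carrier])
  have We: "y \<lhd>\<^bsub>M\<^esub> e u \<in> W" if "y \<in> W" "u \<in> verts Q" for y u
  proof -
    have y: "y \<in> carrier M" "\<And>k. \<phi> (T y k) = 0" using that by (simp_all add: W_def)
    have "T (y \<lhd>\<^bsub>M\<^esub> e u) k = T y k \<lhd>\<^bsub>M\<^esub> e ((sg ^^ k) u)" for k
      using y(1) that(2) by (simp add: T_def M.act_assoc e_pow_swap)
    then have "\<phi> (T (y \<lhd>\<^bsub>M\<^esub> e u) k) = 0" for k using y that(2) by (simp add: \<phi>_e)
    then show ?thesis using y(1) that(2) by (simp add: W_def)
  qed
  have WT: "T y l \<in> W" if "y \<in> W" for y l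
    using that by (simp add: W_def T_T)
  have Wact: "y \<lhd>\<^bsub>M\<^esub> a \<in> W" if a: "a \<in> carrier \<Lambda>" and y: "y \<in> W" for y a
    using a
  proof (induction rule: pow_induct)
    case zero
    then show ?case using y by (simp add: W_def act_zero_right[OF rM] T_zero \<phi>0)
  next
    case (add a b)
    then show ?case using y by (simp add: W_def M.act_add_right T_add \<phi>_add)
  next
    case (pow c u k)
    have yM: "y \<in> carrier M" using y by (simp add: W_def)
    have "y \<lhd>\<^bsub>M\<^esub> (c \<odot> (e u \<otimes> N [^] k)) = c \<odot>\<^bsub>M\<^esub> T (y \<lhd>\<^bsub>M\<^esub> e u) k"
      using yM pow by (simp add: T_def M.act_smult_right M.act_assoc)
    moreover have "T (y \<lhd>\<^bsub>M\<^esub> e u) k \<in> W" by (rule WT[OF We[OF y pow]])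
    ultimately show ?case by (simp add: W_def T_smult \<phi>_smult)
  qed
  have W: "rsubmodule \<Lambda> W M"
  proof (rule M.rsubmoduleI)
    show "W \<subseteq> carrier M" by (auto simp: W_def)
    show "\<zero>\<^bsub>M\<^esub> \<in> W" by (simp add: W_def T_zero \<phi>0)
    show "y \<oplus>\<^bsub>M\<^esub> y' \<in> W" if "y \<in> W" "y' \<in> W" for y y' using that by (simp add: W_def T_add \<phi>_add)
    show "c \<odot>\<^bsub>M\<^esub> y \<in> W" if "y \<in> W" for c y using that by (simp add: W_def T_smult \<phi>_smult)
    show "y \<lhd>\<^bsub>M\<^esub> a \<in> W" if "y \<in> W" "a \<in> carrier \<Lambda>" for y a by (rule Wact[OF that(2,1)])
  qed
  have UW: "U \<inter> W = {\<zero>\<^bsub>M\<^esub>}"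
  proof
    show "{\<zero>\<^bsub>M\<^esub>} \<subseteq> U \<inter> W" using U W by (simp add: M.rsubmodule_iff)
    show "U \<inter> W \<subseteq> {\<zero>\<^bsub>M\<^esub>}"
    proof
      fix y assume y: "y \<in> U \<inter> W"
      then obtain a where a: "a \<in> carrier \<Lambda>" "y = x \<lhd>\<^bsub>M\<^esub> a" by (auto simp: U_def)
      have "\<phi> (T (x \<lhd>\<^bsub>M\<^esub> a) j) = 0" for j using y a(2) by (simp add: W_def)
      from key[OF a(1) this order_refl] obtain b where "b \<in> carrier \<Lambda>" "e v \<otimes> a = e v \<otimes> N [^] Suc p \<otimes> b"
        by (elim bexE) (rule that)
      then show "y \<in> {\<zero>\<^bsub>M\<^esub>}" using xN0[OF a(1)] a(2) by simp
    qed
  qed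
  \<comment> \<open>Adding multiples of \<open>x\<close>, \<open>x N\<close>, \<open>x N^2\<close>
    and so on to \<open>y\<close> clears the values of \<phi> at \<open>y N^j\<close> one by one,
    from \<open>j = p\<close> downwards, until the sum lies in \<open>W\<close>.\<close>
  have approx: "\<exists>a\<in>carrier \<Lambda>. \<forall>j. Suc p \<le> j + t \<longrightarrow> \<phi> (T (y \<oplus>\<^bsub>M\<^esub> x \<lhd>\<^bsub>M\<^esub> a) j) = 0"
    if y: "y \<in> carrier M" and t: "t \<le> Suc p" for y t
    using t
  proof (induction t)
    case 0
    show ?case
      using y x T_max[OF y] by (intro bexI[of _ \<zero>]) (simp_all add: act_zero_right[OF rM] M.module.M.r_zero \<phi>0)
  next
    case (Suc t)
    then obtain a where a: "a \<in> carrier \<Lambda>" "\<And>j. Suc p \<le> j + t \<Longrightarrow> \<phi> (T (y \<oplus>\<^bsub>M\<^esub> x \<lhd>\<^bsub>M\<^esub> a) j) = 0" by auto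
    \<comment> \<open>Cancels the value at \<open>j = p - t\<close>, where \<open>x N^t\<close>
      contributes \<open>\<phi> (x N^p) = 1\<close>; at larger \<open>j\<close> its contribution is
      zero by the choice of \<open>p\<close>.\<close>
    define c where "c = - \<phi> (T (y \<oplus>\<^bsub>M\<^esub> x \<lhd>\<^bsub>M\<^esub> a) (p - t))"
    let ?a = "a \<oplus> c \<odot> N [^] t"
    have yx: "y \<oplus>\<^bsub>M\<^esub> x \<lhd>\<^bsub>M\<^esub> a \<in> carrier M" using y x a(1) by simp
    have "y \<oplus>\<^bsub>M\<^esub> x \<lhd>\<^bsub>M\<^esub> ?a = (y \<oplus>\<^bsub>M\<^esub> x \<lhd>\<^bsub>M\<^esub> a) \<oplus>\<^bsub>M\<^esub> c \<odot>\<^bsub>M\<^esub> T x t"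
      using y x a(1) by (simp add: T_def M.act_add_right M.act_smult_right M.module.M.a_assoc)
    then have f: "\<phi> (T (y \<oplus>\<^bsub>M\<^esub> x \<lhd>\<^bsub>M\<^esub> ?a) j) = \<phi> (T (y \<oplus>\<^bsub>M\<^esub> x \<lhd>\<^bsub>M\<^esub> a) j) + c * \<phi> (T x (t + j))" for j
      using yx x by (simp add: T_add T_smult \<phi>_add \<phi>_smult T_T)
    have "\<phi> (T (y \<oplus>\<^bsub>M\<^esub> x \<lhd>\<^bsub>M\<^esub> ?a) j) = 0" if j: "Suc p \<le> j + Suc t" for j
    proof (cases "j = p - t")
      case True
      then show ?thesis unfolding f using Suc.prems by (simp add: c_def \<phi>1)
    next
      case False
      then have "Suc p \<le> j + t" using j by simp
      then show ?thesis unfolding f using a(2) T_max[OF x, of "t + j"] by (simp add: \<phi>0)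
    qed
    then show ?case using a(1) by (intro bexI[of _ ?a]) simp_all
  qed
  have sum: "U <+>\<^bsub>M\<^esub> W = carrier M"
  proof
    show "U <+>\<^bsub>M\<^esub> W \<subseteq> carrier M"
    proof
      fix y assume "y \<in> U <+>\<^bsub>M\<^esub> W"
      then obtain s t where "s \<in> U" "t \<in> W" "y = s \<oplus>\<^bsub>M\<^esub> t" unfolding mem_set_add by auto
      moreover have "U \<subseteq> carrier M" "W \<subseteq> carrier M" using U W by (simp_all add: M.rsubmodule_iff)
      ultimately show "y \<in> carrier M" by auto
    qed
    show "carrier M \<subseteq> U <+>\<^bsub>M\<^esub> W"
    proof
      fix y assume y: "y \<in> carrier M"
      obtain a where a: "a \<in> carrier \<Lambda>" "\<And>j. \<phi> (T (y \<oplus>\<^bsub>M\<^esub> x \<lhd>\<^bsub>M\<^esub> a) j) = 0"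
        using approx[OF y order_refl] by auto
      have "y \<oplus>\<^bsub>M\<^esub> x \<lhd>\<^bsub>M\<^esub> a \<in> W" using y x a by (simp add: W_def)
      moreover have "x \<lhd>\<^bsub>M\<^esub> ((- 1) \<odot> a) \<in> U" using a(1) by (auto simp: U_def)
      moreover have "y = x \<lhd>\<^bsub>M\<^esub> ((- 1) \<odot> a) \<oplus>\<^bsub>M\<^esub> (y \<oplus>\<^bsub>M\<^esub> x \<lhd>\<^bsub>M\<^esub> a)"
      proof -
        have s: "x \<lhd>\<^bsub>M\<^esub> a \<in> carrier M" using x a(1) by simp
        have "\<ominus>\<^bsub>M\<^esub> (x \<lhd>\<^bsub>M\<^esub> a) \<oplus>\<^bsub>M\<^esub> (y \<oplus>\<^bsub>M\<^esub> x \<lhd>\<^bsub>M\<^esub> a) = y \<oplus>\<^bsub>M\<^esub> (\<ominus>\<^bsub>M\<^esub> (x \<lhd>\<^bsub>M\<^esub> a) \<oplus>\<^bsub>M\<^esub> x \<lhd>\<^bsub>M\<^esub> a)"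
          using y s by (intro M.module.M.a_lcomm) auto
        also have "\<dots> = y" using y s by (simp add: M.module.M.l_neg M.module.M.r_zero)
        finally show ?thesis using x a(1) by (simp add: M.act_smult_right M.M_smult_minus)
      qed
      ultimately show "y \<in> U <+>\<^bsub>M\<^esub> W" unfolding mem_set_add by (intro bexI)
    qed
  qed
  have "x \<in> U" unfolding U_def using M.act_one[OF x] by (intro image_eqI[of _ _ \<one>]) simp_all
  moreover have "x \<noteq> \<zero>\<^bsub>M\<^esub>" using Tx by (auto simp: T_zero)
  ultimately have "W = {\<zero>\<^bsub>M\<^esub>}" using ind[OF U W sum UW] by auto
  then have all: "\<exists>a\<in>carrier \<Lambda>. y = x \<lhd>\<^bsub>M\<^esub> a" if "y \<in> carrier M" for y
    using approx[OF that order_refl] sum that unfolding mem_set_add[symmetric]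
  proof -
    have "y \<in> U <+>\<^bsub>M\<^esub> {\<zero>\<^bsub>M\<^esub>}" using that sum \<open>W = {\<zero>\<^bsub>M\<^esub>}\<close> by simp
    then obtain s where s: "s \<in> U" "y = s \<oplus>\<^bsub>M\<^esub> \<zero>\<^bsub>M\<^esub>" unfolding mem_set_add by auto
    moreover have "s \<in> carrier M" using s(1) U by (auto simp: M.rsubmodule_iff)
    ultimately have "y \<in> U" by (simp add: M.module.M.r_zero)
    then show ?thesis by (auto simp: U_def)
  qed
  have "generator M v p x"
    unfolding generator_def
  proof (intro conjI ballI x)
    show "\<exists>a\<in>carrier \<Lambda>. y = x \<lhd>\<^bsub>M\<^esub> a" if "y \<in> carrier M" for y by (rule all[OF that])
    fix a assume a: "a \<in> carrier \<Lambda>"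
    show "x \<lhd>\<^bsub>M\<^esub> a = \<zero>\<^bsub>M\<^esub> \<longleftrightarrow> (\<exists>b\<in>carrier \<Lambda>. e v \<otimes> a = e v \<otimes> N [^] Suc p \<otimes> b)"
    proof
      assume "x \<lhd>\<^bsub>M\<^esub> a = \<zero>\<^bsub>M\<^esub>"
      then have "\<phi> (T (x \<lhd>\<^bsub>M\<^esub> a) j) = 0" for j by (simp add: T_zero \<phi>0)
      from key[OF a this order_refl] show "\<exists>b\<in>carrier \<Lambda>. e v \<otimes> a = e v \<otimes> N [^] Suc p \<otimes> b" .
    next
      assume "\<exists>b\<in>carrier \<Lambda>. e v \<otimes> a = e v \<otimes> N [^] Suc p \<otimes> b"
      then show "x \<lhd>\<^bsub>M\<^esub> a = \<zero>\<^bsub>M\<^esub>" using xN0[OF a] by (elim bexE)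
    qed
  qed
  then show ?thesis using v(1) bound[OF p] by (intro bexI[of _ v] exI[of _ p] exI[of _ x] conjI)
qed

text \<open>The generators of the two cyclic modules have the same annihilator, so sending
  \<open>x a\<close> to \<open>y a\<close> is well defined and injective.\<close>

lemma generator_iso:
  assumes M: "right_module \<Lambda> M" and M': "right_module \<Lambda> M'"
    and x: "generator M v p x" and y: "generator M' v p y"
  shows "rmodule_iso \<Lambda> M M'"
proof -
  interpret M: right_module \<Lambda> M by (rule M)
  interpret M': right_module \<Lambda> M' by (rule M')
  have xM: "x \<in> carrier M" and yM: "y \<in> carrier M'" using x y by (simp_all add: generator_def)
  have gx: "\<exists>a. a \<in> carrier \<Lambda> \<and> z = x \<lhd>\<^bsub>M\<^esub> a" if "z \<in> carrier M" for z
    using x that by (auto simp: generator_def)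
  have gy: "\<exists>a. a \<in> carrier \<Lambda> \<and> z = y \<lhd>\<^bsub>M'\<^esub> a" if "z \<in> carrier M'" for z
    using y that by (auto simp: generator_def)
  have ann: "x \<lhd>\<^bsub>M\<^esub> a = \<zero>\<^bsub>M\<^esub> \<longleftrightarrow> y \<lhd>\<^bsub>M'\<^esub> a = \<zero>\<^bsub>M'\<^esub>" if "a \<in> carrier \<Lambda>" for a
    using x y that by (simp add: generator_def del: nat_pow_Suc)
  have eq: "x \<lhd>\<^bsub>M\<^esub> a = x \<lhd>\<^bsub>M\<^esub> b \<longleftrightarrow> y \<lhd>\<^bsub>M'\<^esub> a = y \<lhd>\<^bsub>M'\<^esub> b" if ab: "a \<in> carrier \<Lambda>" "b \<in> carrier \<Lambda>" for a b
  proof -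
    have d: "a \<oplus> (- 1) \<odot> b \<in> carrier \<Lambda>" using ab by simp
    have "x \<lhd>\<^bsub>M\<^esub> (a \<oplus> (- 1) \<odot> b) = x \<lhd>\<^bsub>M\<^esub> a \<oplus>\<^bsub>M\<^esub> \<ominus>\<^bsub>M\<^esub> (x \<lhd>\<^bsub>M\<^esub> b)"
      using xM ab by (simp add: M.act_add_right M.act_smult_right M.M_smult_minus)
    then have 1: "x \<lhd>\<^bsub>M\<^esub> a = x \<lhd>\<^bsub>M\<^esub> b \<longleftrightarrow> x \<lhd>\<^bsub>M\<^esub> (a \<oplus> (- 1) \<odot> b) = \<zero>\<^bsub>M\<^esub>"
      using M.M_diff_zero[of "x \<lhd>\<^bsub>M\<^esub> a" "x \<lhd>\<^bsub>M\<^esub> b"] xM ab by (auto simp: M.module.M.r_neg)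
    have "y \<lhd>\<^bsub>M'\<^esub> (a \<oplus> (- 1) \<odot> b) = y \<lhd>\<^bsub>M'\<^esub> a \<oplus>\<^bsub>M'\<^esub> \<ominus>\<^bsub>M'\<^esub> (y \<lhd>\<^bsub>M'\<^esub> b)"
      using yM ab by (simp add: M'.act_add_right M'.act_smult_right M'.M_smult_minus)
    then have 2: "y \<lhd>\<^bsub>M'\<^esub> a = y \<lhd>\<^bsub>M'\<^esub> b \<longleftrightarrow> y \<lhd>\<^bsub>M'\<^esub> (a \<oplus> (- 1) \<odot> b) = \<zero>\<^bsub>M'\<^esub>"
      using M'.M_diff_zero[of "y \<lhd>\<^bsub>M'\<^esub> a" "y \<lhd>\<^bsub>M'\<^esub> b"] yM ab by (auto simp: M'.module.M.r_neg)
    show ?thesis unfolding 1 2 by (rule ann[OF d])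
  qed
  define co where "co z = (SOME a. a \<in> carrier \<Lambda> \<and> z = x \<lhd>\<^bsub>M\<^esub> a)" for z
  have co: "co z \<in> carrier \<Lambda>" "x \<lhd>\<^bsub>M\<^esub> co z = z" if "z \<in> carrier M" for z
    using someI_ex[OF gx[OF that]] by (simp_all add: co_def)
  define f where "f z = y \<lhd>\<^bsub>M'\<^esub> co z" for z
  have f: "f (x \<lhd>\<^bsub>M\<^esub> a) = y \<lhd>\<^bsub>M'\<^esub> a" if a: "a \<in> carrier \<Lambda>" for a
  proof -
    have "x \<lhd>\<^bsub>M\<^esub> a \<in> carrier M" using xM a by simp
    from co[OF this] show ?thesis using eq[of "co (x \<lhd>\<^bsub>M\<^esub> a)" a] a by (simp add: f_def)
  qed
  have hom: "f \<in> rmodule_hom \<Lambda> M M'"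
    unfolding rmodule_hom_iff
  proof (intro conjI ballI allI)
    fix z assume z: "z \<in> carrier M"
    note c = co[OF z]
    show "f z \<in> carrier M'" using c(1) yM by (simp add: f_def)
    show "f (z \<oplus>\<^bsub>M\<^esub> z') = f z \<oplus>\<^bsub>M'\<^esub> f z'" if z': "z' \<in> carrier M" for z'
    proof -
      note c' = co[OF z']
      have "z \<oplus>\<^bsub>M\<^esub> z' = x \<lhd>\<^bsub>M\<^esub> (co z \<oplus> co z')" using c c' xM by (simp add: M.act_add_right)
      then show ?thesis using f[of "co z \<oplus> co z'"] c(1) c'(1) yM by (simp add: M'.act_add_right f_def)
    qed
    show "f (k \<odot>\<^bsub>M\<^esub> z) = k \<odot>\<^bsub>M'\<^esub> f z" for k
    proof -
      have "k \<odot>\<^bsub>M\<^esub> z = x \<lhd>\<^bsub>M\<^esub> (k \<odot> co z)" using c xM by (simp add: M.act_smult_right)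
      then show ?thesis using f[of "k \<odot> co z"] c(1) yM by (simp add: M'.act_smult_right f_def)
    qed
    show "f (z \<lhd>\<^bsub>M\<^esub> a) = f z \<lhd>\<^bsub>M'\<^esub> a" if a: "a \<in> carrier \<Lambda>" for a
    proof -
      have "z \<lhd>\<^bsub>M\<^esub> a = x \<lhd>\<^bsub>M\<^esub> (co z \<otimes> a)" using c xM a M.act_assoc[of x "co z" a] by simp
      then show ?thesis using f[of "co z \<otimes> a"] c(1) yM a by (simp add: M'.act_assoc f_def)
    qed
  qed
  have "inj_on f (carrier M)"
  proof (rule inj_onI)
    fix z z' assume z: "z \<in> carrier M" "z' \<in> carrier M" "f z = f z'"
    then have "x \<lhd>\<^bsub>M\<^esub> co z = x \<lhd>\<^bsub>M\<^esub> co z'" using eq[OF co(1)[OF z(1)] co(1)[OF z(2)]] by (simp add: f_def)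
    then show "z = z'" using co(2)[OF z(1)] co(2)[OF z(2)] by simp
  qed
  moreover have "f ` carrier M = carrier M'"
  proof
    show "f ` carrier M \<subseteq> carrier M'" using rmodule_homD(1)[OF hom] by auto
    show "carrier M' \<subseteq> f ` carrier M"
    proof
      fix z assume z: "z \<in> carrier M'"
      obtain a where a: "a \<in> carrier \<Lambda> \<and> z = y \<lhd>\<^bsub>M'\<^esub> a" using gy[OF z] by (elim exE) (rule that)
      then show "z \<in> f ` carrier M" using f[of a] xM by (intro image_eqI[of _ _ "x \<lhd>\<^bsub>M\<^esub> a"]) simp_all
    qed
  qed
  ultimately have "bij_betw f (carrier M) (carrier M')" by (simp add: bij_betw_def)
  then show ?thesis unfolding rmodule_iso_def using hom by (intro bexI[of _ f])
qed

lemma nakayama_finite_type: "finite_representation_type \<Lambda>"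
proof -
  define G where "G vp (M :: ('k, 'a) fdmod) \<longleftrightarrow>
    indecomposable_module \<Lambda> M \<and> (\<exists>x. generator M (fst vp) (snd vp) x)" for vp M
  \<comment> \<open>One representative for each pair of a vertex and a length below \<open>m\<close>
    that occurs; the filter ensures that each choice has a witness.\<close>
  define R where "R = (\<lambda>vp. SOME M. G vp M) ` {vp \<in> verts Q \<times> {..<m}. \<exists>M. G vp M}"
  have G: "G vp (SOME M. G vp M)" if "\<exists>M. G vp M" for vp using that by (rule someI_ex)
  show ?thesis
    unfolding finite_representation_type_def
  proof (intro exI[of _ R] conjI ballI allI impI)
    have "finite (verts Q \<times> {..<m})" by (intro finite_cartesian_product) simp_all
    then show "finite R" unfolding R_def by (intro finite_imageI) simp
    show "indecomposable_module \<Lambda> L" if LR: "L \<in> R" for L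
    proof -
      obtain vp where "L = (SOME M. G vp M)" "\<exists>M. G vp M" using LR unfolding R_def by blast
      then have "G vp L" using G[of vp] by simp
      then show ?thesis by (simp add: G_def)
    qed
    fix M :: "('k, 'a) fdmod" assume M: "indecomposable_module \<Lambda> M"
    obtain v p x where v: "v \<in> verts Q" "p < m" "generator M v p x"
      using indecomposable_generator[OF M] by auto
    have GM: "G (v, p) M" using M v(3) by (auto simp: G_def)
    then have ex: "\<exists>M. G (v, p) M" by (rule exI)
    let ?L = "SOME M. G (v, p) M"
    have GL: "G (v, p) ?L" by (rule G[OF ex])
    then obtain y where y: "generator ?L v p y" by (auto simp: G_def)
    have "right_module \<Lambda> M" "right_module \<Lambda> ?L"
      using M GL by (auto simp: G_def indecomposable_module_def)
    then have "rmodule_iso \<Lambda> M ?L" using v(3) y by (rule generator_iso)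
    moreover have "?L \<in> R" unfolding R_def using v ex by (intro imageI) simp
    ultimately show "\<exists>L\<in>R. rmodule_iso \<Lambda> M L" by (rule bexI)
  qed
qed

end

section \<open>Path algebras modulo admissible ideals\<close>

lemma path_algebra_simps [simp]:
  "carrier (path_algebra Q) = {f. finite {p. f p \<noteq> 0} \<and> {p. f p \<noteq> 0} \<subseteq> paths Q}"
  "zero (path_algebra Q) = (\<lambda>p. 0)" "add (path_algebra Q) = (\<lambda>f g p. f p + g p)"
  "smult (path_algebra Q) = (\<lambda>c f p. c * f p)"
  "one (path_algebra Q) = (\<lambda>(u, p). if u \<in> verts Q \<and> p = [] then 1 else 0)"
  by (simp_all add: path_algebra_def)

lemma path_algebra_mult:
  "(f \<otimes>\<^bsub>path_algebra Q\<^esub> h) (u, p) = (\<Sum>n\<le>length p. f (u, take n p) * h (path_end Q u (take n p), drop n p))"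
  by (simp add: path_algebra_def)

lemma path_end_simps [simp]: "path_end Q u [] = u" "path_end Q u (\<gamma> # p) = path_end Q (head Q \<gamma>) p"
  by (simp_all add: path_end_def pre_digraph.awalk_verts.simps pre_digraph.awalk_verts_non_Nil)

lemma paths_simps:
  assumes "fin_digraph Q"
  shows "(u, []) \<in> paths Q \<longleftrightarrow> u \<in> verts Q"
    "(u, \<gamma> # p) \<in> paths Q \<longleftrightarrow> \<gamma> \<in> arcs Q \<and> u = tail Q \<gamma> \<and> (head Q \<gamma>, p) \<in> paths Q"
proof -
  interpret fin_digraph Q by fact
  show "(u, []) \<in> paths Q \<longleftrightarrow> u \<in> verts Q" by (auto simp: paths_def awalk_Nil_iff)
  show "(u, \<gamma> # p) \<in> paths Q \<longleftrightarrow> \<gamma> \<in> arcs Q \<and> u = tail Q \<gamma> \<and> (head Q \<gamma>, p) \<in> paths Q"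
    by (auto simp: paths_def awalk_Cons_iff)
qed

locale admissible_quotient =
  fixes Q :: "('v, 'e) pre_digraph" and I :: "(('v, 'e) path \<Rightarrow> 'k::field) set"
  assumes quiver: "fin_digraph Q" and admissible: "admissible_ideal Q I"
begin

abbreviation A :: "('k, ('v, 'e) path \<Rightarrow> 'k) module" where
  "A \<equiv> path_algebra Q"

abbreviation Lam :: "('k, (('v, 'e) path \<Rightarrow> 'k) set) module" where
  "Lam \<equiv> bound_quiver_algebra Q I"

definition cls :: "(('v, 'e) path \<Rightarrow> 'k) \<Rightarrow> (('v, 'e) path \<Rightarrow> 'k) set" where
  "cls f = I +>\<^bsub>A\<^esub> f"

abbreviation ve :: "'v \<Rightarrow> ('v, 'e) path \<Rightarrow> 'k" where
  "ve u \<equiv> path_elem (u, [])"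

abbreviation ar :: "'e \<Rightarrow> ('v, 'e) path \<Rightarrow> 'k" where
  "ar \<gamma> \<equiv> path_elem (tail Q \<gamma>, [\<gamma>])"

lemma ideal_I: "ideal I A"
  using admissible by (simp add: admissible_ideal_def)

sublocale IA: ideal I A by (rule ideal_I)

lemma fin [simp]: "finite (verts Q)" "finite (arcs Q)"
  and ends [simp]: "\<gamma> \<in> arcs Q \<Longrightarrow> tail Q \<gamma> \<in> verts Q" "\<gamma> \<in> arcs Q \<Longrightarrow> head Q \<gamma> \<in> verts Q"
  using quiver by (auto simp: fin_digraph_def fin_digraph_axioms_def wf_digraph_def)

lemma path_elem_closed: "q \<in> paths Q \<Longrightarrow> path_elem q \<in> carrier A"
  by (simp add: path_elem_def)

lemma ve_closed: "u \<in> verts Q \<Longrightarrow> ve u \<in> carrier A"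
  by (rule path_elem_closed) (simp add: paths_simps[OF quiver])

lemma ar_closed: "\<gamma> \<in> arcs Q \<Longrightarrow> ar \<gamma> \<in> carrier A"
  by (rule path_elem_closed) (simp add: paths_simps[OF quiver])

lemma smult_closed_A: "f \<in> carrier A \<Longrightarrow> (\<lambda>p. c * f p) \<in> carrier A"
  by (auto elim: finite_subset[rotated])

section \<open>Products with trivial paths and with arrows\<close>

lemma ve_mult: "(ve v \<otimes>\<^bsub>A\<^esub> h) (u, p) = (if u = v then h (u, p) else 0)"
proof -
  \<comment> \<open>Only the cut before the first arrow contributes, as the left factor must be a
    trivial path.\<close>
  have "(ve v \<otimes>\<^bsub>A\<^esub> h) (u, p) = (\<Sum>n\<le>length p. if n = 0 then (if u = v then h (u, p) else 0) else 0)"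
    unfolding path_algebra_mult by (intro sum.cong) (auto simp: path_elem_def)
  then show ?thesis by simp
qed

lemma mult_ve: "(h \<otimes>\<^bsub>A\<^esub> ve v) (u, p) = (if path_end Q u p = v then h (u, p) else 0)"
proof -
  \<comment> \<open>Only the cut after the last arrow contributes, as the right factor must be a
    trivial path.\<close>
  have "(h \<otimes>\<^bsub>A\<^esub> ve v) (u, p) =
    (\<Sum>n\<le>length p. if n = length p then (if path_end Q u p = v then h (u, p) else 0) else 0)"
    unfolding path_algebra_mult by (intro sum.cong) (auto simp: path_elem_def)
  then show ?thesis by simp
qed

lemma ar_mult_Nil: "(ar \<gamma> \<otimes>\<^bsub>A\<^esub> h) (u, []) = 0"
  by (simp add: path_algebra_mult path_elem_def)

lemma ar_mult_Cons:
  "(ar \<gamma> \<otimes>\<^bsub>A\<^esub> h) (u, \<delta> # p) = (if \<delta> = \<gamma> \<and> u = tail Q \<gamma> then h (head Q \<gamma>, p) else 0)"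
proof -
  \<comment> \<open>Only the cut after exactly one arrow, \<open>n = 1\<close>, contributes.\<close>
  have "(ar \<gamma> \<otimes>\<^bsub>A\<^esub> h) (u, \<delta> # p) =
    (\<Sum>n\<le>Suc (length p). if n = 1 then (if \<delta> = \<gamma> \<and> u = tail Q \<gamma> then h (head Q \<gamma>, p) else 0) else 0)"
    unfolding path_algebra_mult
  proof (intro sum.cong, goal_cases)
    case (2 n)
    show ?case
    proof (cases n)
      case (Suc l)
      then show ?thesis using 2 by (cases l) (auto simp: path_elem_def)
    qed (simp add: path_elem_def)
  qed simp
  then show ?thesis by (simp add: sum.delta del: sum.atMost_Suc)
qed

lemma path_elem_Cons: "ar \<gamma> \<otimes>\<^bsub>A\<^esub> path_elem (head Q \<gamma>, p) = path_elem (tail Q \<gamma>, \<gamma> # p)"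
proof
  fix x :: "('v, 'e) path"
  obtain u q where x: "x = (u, q)" by (cases x)
  show "(ar \<gamma> \<otimes>\<^bsub>A\<^esub> path_elem (head Q \<gamma>, p)) x = path_elem (tail Q \<gamma>, \<gamma> # p) x"
    unfolding x
  proof (cases q)
    case Nil
    show "(ar \<gamma> \<otimes>\<^bsub>A\<^esub> path_elem (head Q \<gamma>, p)) (u, q) = path_elem (tail Q \<gamma>, \<gamma> # p) (u, q)"
      unfolding Nil ar_mult_Nil by (simp add: path_elem_def)
  next
    case (Cons \<delta> r)
    show "(ar \<gamma> \<otimes>\<^bsub>A\<^esub> path_elem (head Q \<gamma>, p)) (u, q) = path_elem (tail Q \<gamma>, \<gamma> # p) (u, q)"
      unfolding Cons ar_mult_Cons by (simp add: path_elem_def)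
  qed
qed

lemma ve_ve: "ve u \<otimes>\<^bsub>A\<^esub> ve v = (if u = v then ve u else \<zero>\<^bsub>A\<^esub>)"
proof
  fix x :: "('v, 'e) path"
  obtain t q where x: "x = (t, q)" by (cases x)
  show "(ve u \<otimes>\<^bsub>A\<^esub> ve v) x = (if u = v then ve u else \<zero>\<^bsub>A\<^esub>) x"
    unfolding x ve_mult by (auto simp: path_elem_def)
qed

lemma ve_ar: "ve u \<otimes>\<^bsub>A\<^esub> ar \<gamma> = (if u = tail Q \<gamma> then ar \<gamma> else \<zero>\<^bsub>A\<^esub>)"
proof
  fix x :: "('v, 'e) path"
  obtain t q where x: "x = (t, q)" by (cases x)
  show "(ve u \<otimes>\<^bsub>A\<^esub> ar \<gamma>) x = (if u = tail Q \<gamma> then ar \<gamma> else \<zero>\<^bsub>A\<^esub>) x"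
    unfolding x ve_mult by (auto simp: path_elem_def)
qed

lemma ar_ve: "ar \<gamma> \<otimes>\<^bsub>A\<^esub> ve u = (if u = head Q \<gamma> then ar \<gamma> else \<zero>\<^bsub>A\<^esub>)"
proof
  fix x :: "('v, 'e) path"
  obtain t q where x: "x = (t, q)" by (cases x)
  show "(ar \<gamma> \<otimes>\<^bsub>A\<^esub> ve u) x = (if u = head Q \<gamma> then ar \<gamma> else \<zero>\<^bsub>A\<^esub>) x"
    unfolding x mult_ve by (auto simp: path_elem_def)
qed

lemma mult_smult_left: "(\<lambda>p. c * f p) \<otimes>\<^bsub>A\<^esub> h = (\<lambda>p. c * (f \<otimes>\<^bsub>A\<^esub> h) p)"
proof
  fix x :: "('v, 'e) path"
  obtain t q where x: "x = (t, q)" by (cases x)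
  show "((\<lambda>p. c * f p) \<otimes>\<^bsub>A\<^esub> h) x = c * (f \<otimes>\<^bsub>A\<^esub> h) x"
    unfolding x path_algebra_mult by (simp add: sum_distrib_left mult.assoc)
qed

lemma mult_smult_right: "f \<otimes>\<^bsub>A\<^esub> (\<lambda>p. c * h p) = (\<lambda>p. c * (f \<otimes>\<^bsub>A\<^esub> h) p)"
proof
  fix x :: "('v, 'e) path"
  obtain t q where x: "x = (t, q)" by (cases x)
  show "(f \<otimes>\<^bsub>A\<^esub> (\<lambda>p. c * h p)) x = c * (f \<otimes>\<^bsub>A\<^esub> h) x"
    unfolding x path_algebra_mult by (simp add: sum_distrib_left mult.left_commute)
qed

text \<open>An ideal of a ring is closed under ring multiplication; scalars enter as multiplication
  by \<open>c\<close> times the unit.\<close>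

lemma smult_I: "f \<in> I \<Longrightarrow> (\<lambda>p. c * f p) \<in> I"
proof -
  assume f: "f \<in> I"
  have "(\<lambda>p. c * \<one>\<^bsub>A\<^esub> p) \<otimes>\<^bsub>A\<^esub> f \<in> I"
    by (rule IA.I_l_closed[OF f smult_closed_A[OF IA.one_closed]])
  then show ?thesis unfolding mult_smult_left using IA.l_one[OF IA.a_Hcarr[OF f]] by (simp only:)
qed

text \<open>Bounds the powers of the arrow ideal from above by a condition on coefficients, which
  can be tested directly; it is used for \<open>k = 1\<close> and \<open>k = 2\<close>.\<close>

definition low :: "nat \<Rightarrow> (('v, 'e) path \<Rightarrow> 'k) set" where
  "low k = {f \<in> carrier A. \<forall>u p. length p < k \<longrightarrow> f (u, p) = 0}"

lemma lowI: "\<lbrakk>f \<in> carrier A; \<And>u p. length p < k \<Longrightarrow> f (u, p) = 0\<rbrakk> \<Longrightarrow> f \<in> low k"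
  unfolding low_def by blast

lemma lowD: "f \<in> low k \<Longrightarrow> length p < k \<Longrightarrow> f (u, p) = 0" "f \<in> low k \<Longrightarrow> f \<in> carrier A"
  unfolding low_def by blast+

lemma low_add: "\<lbrakk>f \<in> low k; h \<in> low k\<rbrakk> \<Longrightarrow> f \<oplus>\<^bsub>A\<^esub> h \<in> low k"
  using lowD(1)[of f k] lowD(1)[of h k] IA.a_closed[OF lowD(2) lowD(2), of f k h k]
  by (intro lowI) auto

lemma ideal_low: "ideal (low 1) A"
proof (rule idealI)
  show "ring A" by (rule IA.ring_axioms)
  show "subgroup (low 1) (add_monoid A)"
  proof (rule IA.add.subgroupI)
    show "low 1 \<subseteq> carrier A" using lowD(2) by blast
    have "\<zero>\<^bsub>A\<^esub> \<in> low 1" by (rule lowI[OF IA.zero_closed]) simp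
    then show "low 1 \<noteq> {}" by blast
    fix f :: "('v, 'e) path \<Rightarrow> 'k" assume f: "f \<in> low 1"
    have m: "(\<lambda>p. (-1) * f p) \<in> carrier A" by (rule smult_closed_A[OF lowD(2)[OF f]])
    have s: "(\<lambda>p. (-1) * f p) \<oplus>\<^bsub>A\<^esub> f = \<zero>\<^bsub>A\<^esub>" by simp
    have e: "\<ominus>\<^bsub>A\<^esub> f = (\<lambda>p. (-1) * f p)"
      by (rule IA.minus_equality[OF s lowD(2)[OF f] m])
    show "\<ominus>\<^bsub>A\<^esub> f \<in> low 1" unfolding e by (rule lowI[OF m]) (simp add: lowD(1)[OF f])
  next
    fix f h :: "('v, 'e) path \<Rightarrow> 'k" assume "f \<in> low 1" "h \<in> low 1"
    then show "f \<oplus>\<^bsub>A\<^esub> h \<in> low 1" by (rule low_add)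
  qed
next
  fix f h :: "('v, 'e) path \<Rightarrow> 'k" assume f: "f \<in> low 1" and h: "h \<in> carrier A"
  have fc: "f \<in> carrier A" by (rule lowD(2)[OF f])
  show "h \<otimes>\<^bsub>A\<^esub> f \<in> low 1"
    by (rule lowI[OF IA.m_closed[OF h fc]]) (use lowD(1)[OF f, of "[]"] in \<open>simp add: path_algebra_mult\<close>)
  show "f \<otimes>\<^bsub>A\<^esub> h \<in> low 1"
    by (rule lowI[OF IA.m_closed[OF fc h]]) (use lowD(1)[OF f, of "[]"] in \<open>simp add: path_algebra_mult\<close>)
qed

lemma ar_image_closed: "ar ` arcs Q \<subseteq> (carrier A :: (_ \<Rightarrow> 'k) set)"
  using ar_closed by blast

lemma arrow_ideal_low: "arrow_ideal Q \<subseteq> low 1"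
  unfolding arrow_ideal_def
proof (rule IA.genideal_minimal[OF ideal_low])
  show "ar ` arcs Q \<subseteq> (low 1 :: (_ \<Rightarrow> 'k) set)"
  proof
    fix f :: "('v, 'e) path \<Rightarrow> 'k" assume "f \<in> ar ` arcs Q"
    then obtain \<gamma> where \<gamma>: "\<gamma> \<in> arcs Q" "f = ar \<gamma>" by blast
    show "f \<in> low 1" unfolding \<gamma>(2) by (rule lowI[OF ar_closed[OF \<gamma>(1)]]) (auto simp: path_elem_def)
  qed
qed

lemma low_mult: "\<lbrakk>f \<in> low 1; h \<in> low 1\<rbrakk> \<Longrightarrow> f \<otimes>\<^bsub>A\<^esub> h \<in> low 2"
proof (rule lowI)
  assume f: "f \<in> low 1" and h: "h \<in> low 1"
  show "f \<otimes>\<^bsub>A\<^esub> h \<in> carrier A" by (rule IA.m_closed[OF lowD(2)[OF f] lowD(2)[OF h]])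
  fix u and p :: "'e list" assume p: "length p < 2"
  have f0: "f (t, []) = 0" and h0: "h (t, []) = 0" for t
    using lowD(1)[OF f, of "[]" t] lowD(1)[OF h, of "[]" t] by simp_all
  show "(f \<otimes>\<^bsub>A\<^esub> h) (u, p) = 0"
  proof (cases p)
    case (Cons \<gamma> q)
    then have "q = []" using p by simp
    then show ?thesis using Cons f0 h0 by (simp add: path_algebra_mult)
  qed (simp add: path_algebra_mult f0)
qed

text \<open>Elements of the arrow ideal have no coefficients at trivial paths, so a product of two
  of them has none at arrows either.\<close>

lemma I_low: "I \<subseteq> low 2"
proof -
  \<comment> \<open>By the recursion, the first power is the product of the whole algebra with the
    arrow ideal, not literally the arrow ideal.\<close>
  have 1: "arrow_ideal_power Q 1 \<subseteq> low 1"
  proof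
    fix f :: "('v, 'e) path \<Rightarrow> 'k" assume "f \<in> arrow_ideal_power Q 1"
    then have "f \<in> ideal_prod A (carrier A) (arrow_ideal Q)" by (simp only: One_nat_def arrow_ideal_power.simps)
    then show "f \<in> low 1"
    proof (induction rule: ideal_prod.induct)
      case (prod i j)
      then show ?case using ideal.I_l_closed[OF ideal_low, of j i] arrow_ideal_low by blast
    qed (rule low_add)
  qed
  have "arrow_ideal_power Q 2 \<subseteq> low 2"
  proof
    fix f :: "('v, 'e) path \<Rightarrow> 'k" assume "f \<in> arrow_ideal_power Q 2"
    then have "f \<in> ideal_prod A (arrow_ideal_power Q 1) (arrow_ideal Q)"
      by (simp only: numeral_2_eq_2 One_nat_def arrow_ideal_power.simps)
    then show "f \<in> low 2"
    proof (induction rule: ideal_prod.induct)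
      case (prod i j)
      then show ?case using low_mult[of i j] 1 arrow_ideal_low by blast
    qed (rule low_add)
  qed
  then show ?thesis using admissible unfolding admissible_ideal_def by blast
qed

section \<open>The quotient algebra in terms of residue classes\<close>

lemma carrier_Lam: "carrier Lam = cls ` carrier A"
  by (auto simp: bound_quiver_algebra_def quotient_algebra_def FactRing_def A_RCOSETS_def'
      cls_def simp del: path_algebra_simps)

lemma cls_closed: "f \<in> carrier A \<Longrightarrow> cls f \<in> carrier Lam"
  unfolding carrier_Lam by (rule imageI)

lemma cls_mult: "\<lbrakk>f \<in> carrier A; h \<in> carrier A\<rbrakk> \<Longrightarrow> cls f \<otimes>\<^bsub>Lam\<^esub> cls h = cls (f \<otimes>\<^bsub>A\<^esub> h)"
  using IA.rcoset_mult_add[of f h]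
  by (simp add: bound_quiver_algebra_def quotient_algebra_def FactRing_def cls_def del: path_algebra_simps)

lemma cls_add: "\<lbrakk>f \<in> carrier A; h \<in> carrier A\<rbrakk> \<Longrightarrow> cls f \<oplus>\<^bsub>Lam\<^esub> cls h = cls (f \<oplus>\<^bsub>A\<^esub> h)"
  using IA.a_rcos_sum[of f h]
  by (simp add: bound_quiver_algebra_def quotient_algebra_def FactRing_def cls_def del: path_algebra_simps)

lemma cls_one: "\<one>\<^bsub>Lam\<^esub> = cls \<one>\<^bsub>A\<^esub>"
  by (simp add: bound_quiver_algebra_def quotient_algebra_def FactRing_def cls_def del: path_algebra_simps)

lemma cls_eq: "cls f = cls h" if "f \<in> carrier A" "i \<in> I" "h = i \<oplus>\<^bsub>A\<^esub> f" for f h i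
proof -
  have "h \<in> I +>\<^bsub>A\<^esub> f" using that by (auto simp: a_r_coset_def r_coset_def simp del: path_algebra_simps)
  then show ?thesis
    unfolding cls_def using that(1) by (rule IA.a_repr_independence')
qed

lemma cls_mem:
  assumes "f \<in> carrier A" "h \<in> cls f"
  obtains i where "i \<in> I" "h = i \<oplus>\<^bsub>A\<^esub> f"
  using assms unfolding cls_def by (auto simp: a_r_coset_def r_coset_def simp del: path_algebra_simps)

lemma cls_self: "f \<in> carrier A \<Longrightarrow> f \<in> cls f"
  unfolding cls_def by (rule IA.a_rcos_self)

lemma cls_zero: "\<zero>\<^bsub>Lam\<^esub> = cls \<zero>\<^bsub>A\<^esub>"
proof -
  have "\<zero>\<^bsub>A\<^esub> \<in> I" by (rule additive_subgroup.zero_closed[OF IA.is_additive_subgroup])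
  then have "I +>\<^bsub>A\<^esub> \<zero>\<^bsub>A\<^esub> = I" by (rule IA.a_coset_join2[OF IA.zero_closed IA.a_subgroup])
  then show ?thesis
    by (simp add: bound_quiver_algebra_def quotient_algebra_def FactRing_def cls_def del: path_algebra_simps)
qed

text \<open>The definition takes a union over all representatives. They differ by elements of
  \<open>I\<close>, which scalars preserve, so all members of the union are the same class.\<close>

lemma cls_smult: "c \<odot>\<^bsub>Lam\<^esub> cls f = cls (\<lambda>p. c * f p)" if f: "f \<in> carrier A" for f c
proof -
  have "cls (\<lambda>p. c * h p) = cls (\<lambda>p. c * f p)" if h: "h \<in> cls f" for h
  proof -
    obtain i where i: "i \<in> I" "h = i \<oplus>\<^bsub>A\<^esub> f" by (rule cls_mem[OF f h])
    have "(\<lambda>p. c * h p) = (\<lambda>p. c * i p) \<oplus>\<^bsub>A\<^esub> (\<lambda>p. c * f p)" unfolding i(2) by (simp add: distrib_left)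
    from cls_eq[OF smult_closed_A[OF f] smult_I[OF i(1)] this] show ?thesis by (rule sym)
  qed
  then have "(\<Union>h\<in>cls f. cls (\<lambda>p. c * h p)) = cls (\<lambda>p. c * f p)" using cls_self[OF f] by blast
  then show ?thesis by (simp add: bound_quiver_algebra_def quotient_algebra_def cls_def)
qed

text \<open>The ring operations are those of \<open>A Quot I\<close>, copied into a larger record;
  the axioms are unfolded until only these operations occur.\<close>

lemma ring_Lam: "ring Lam"
proof -
  have q: "ring (A Quot I)" by (rule IA.quotient_is_ring)
  have 1: "carrier Lam = carrier (A Quot I)" "mult Lam = mult (A Quot I)" "one Lam = one (A Quot I)"
    "zero Lam = zero (A Quot I)" "add Lam = add (A Quot I)"
    by (simp_all add: bound_quiver_algebra_def quotient_algebra_def)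
  show ?thesis
    using q unfolding ring_def abelian_group_def abelian_monoid_def abelian_group_axioms_def
      ring_axioms_def comm_group_def group_def group_axioms_def comm_monoid_def comm_monoid_axioms_def
      Group.monoid_def Units_def partial_object.simps monoid.simps 1 .
qed

lemma k_algebra_Lam: "k_algebra Lam"
proof -
  have r: "carrier (regular_module Lam) = carrier Lam" "zero (regular_module Lam) = \<zero>\<^bsub>Lam\<^esub>"
    "add (regular_module Lam) = add Lam" "smult (regular_module Lam) = smult Lam"
    "act (regular_module Lam) = mult Lam" by (simp_all add: regular_module_def)
  interpret R: ring Lam by (rule ring_Lam)
  have s: "smult Lam c x \<in> carrier Lam" if x: "x \<in> carrier Lam" for c x
  proof -
    obtain f where f: "f \<in> carrier A" "x = cls f" using x unfolding carrier_Lam by blast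
    show ?thesis unfolding f(2) cls_smult[OF f(1)] by (rule cls_closed[OF smult_closed_A[OF f(1)]])
  qed
  have "right_module Lam (regular_module Lam)"
  proof (rule right_moduleI, unfold r)
    fix x assume x: "x \<in> carrier Lam"
    then obtain f where f: "f \<in> carrier A" "x = cls f" unfolding carrier_Lam by blast
    note sf = smult_closed_A[OF f(1)]
    show "\<exists>y\<in>carrier Lam. x \<oplus>\<^bsub>Lam\<^esub> y = \<zero>\<^bsub>Lam\<^esub>" using x R.r_neg[OF x] by (intro bexI[of _ "\<ominus>\<^bsub>Lam\<^esub> x"]) simp_all
    show "c \<odot>\<^bsub>Lam\<^esub> x \<in> carrier Lam" for c by (rule s[OF x])
    show "(a * b) \<odot>\<^bsub>Lam\<^esub> x = a \<odot>\<^bsub>Lam\<^esub> (b \<odot>\<^bsub>Lam\<^esub> x)" for a b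
      unfolding f(2) cls_smult[OF f(1)] cls_smult[OF sf] by (simp add: mult.assoc)
    show "1 \<odot>\<^bsub>Lam\<^esub> x = x" unfolding f(2) cls_smult[OF f(1)] by simp
    show "(a + b) \<odot>\<^bsub>Lam\<^esub> x = a \<odot>\<^bsub>Lam\<^esub> x \<oplus>\<^bsub>Lam\<^esub> b \<odot>\<^bsub>Lam\<^esub> x" for a b
      unfolding f(2) cls_smult[OF f(1)] cls_add[OF sf sf] by (simp add: distrib_right)
    fix y assume y: "y \<in> carrier Lam"
    then obtain h where h: "h \<in> carrier A" "y = cls h" unfolding carrier_Lam by blast
    note sh = smult_closed_A[OF h(1)]
    show "a \<odot>\<^bsub>Lam\<^esub> (x \<oplus>\<^bsub>Lam\<^esub> y) = a \<odot>\<^bsub>Lam\<^esub> x \<oplus>\<^bsub>Lam\<^esub> a \<odot>\<^bsub>Lam\<^esub> y" for a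
      unfolding f(2) h(2) cls_smult[OF f(1)] cls_smult[OF h(1)] cls_add[OF f(1) h(1)] cls_add[OF sf sh]
        cls_smult[OF IA.a_closed[OF f(1) h(1)]] by (simp add: distrib_left)
    show "(c \<odot>\<^bsub>Lam\<^esub> x) \<otimes>\<^bsub>Lam\<^esub> y = c \<odot>\<^bsub>Lam\<^esub> (x \<otimes>\<^bsub>Lam\<^esub> y)" for c
      unfolding f(2) h(2) cls_smult[OF f(1)] cls_mult[OF f(1) h(1)] cls_mult[OF sf h(1)]
        cls_smult[OF IA.m_closed[OF f(1) h(1)]] mult_smult_left by (rule refl)
    show "x \<otimes>\<^bsub>Lam\<^esub> (c \<odot>\<^bsub>Lam\<^esub> y) = c \<odot>\<^bsub>Lam\<^esub> (x \<otimes>\<^bsub>Lam\<^esub> y)" for c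
      unfolding f(2) h(2) cls_smult[OF h(1)] cls_mult[OF f(1) h(1)] cls_mult[OF f(1) sh]
        cls_smult[OF IA.m_closed[OF f(1) h(1)]] mult_smult_right by (rule refl)
  qed (simp_all add: R.a_ac R.l_distr R.r_distr R.m_assoc)
  then show ?thesis using ring_Lam by (simp add: k_algebra_def k_algebra_axioms_def)
qed

text \<open>Reads the coefficient off an arbitrary representative; by \<open>rep_cls\<close> the
  choice does not matter. The same holds for \<open>da\<close> at arrows.\<close>

definition ev :: "'v \<Rightarrow> (('v, 'e) path \<Rightarrow> 'k) set \<Rightarrow> 'k" where
  "ev u X = (SOME f. f \<in> X) (u, [])"

definition da :: "'e \<Rightarrow> (('v, 'e) path \<Rightarrow> 'k) set \<Rightarrow> 'k" where
  "da \<gamma> X = (SOME f. f \<in> X) (tail Q \<gamma>, [\<gamma>])"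

text \<open>Representatives differ by an element of \<open>I\<close>, which has no coefficients at
  paths of length below 2.\<close>

lemma rep_cls:
  assumes f: "f \<in> carrier A" and p: "length p < 2"
  shows "(SOME h. h \<in> cls f) (u, p) = f (u, p)"
proof -
  have "(SOME h. h \<in> cls f) \<in> cls f" using cls_self[OF f] by (rule someI[of "\<lambda>h. h \<in> cls f"])
  then obtain i where i: "i \<in> I" "(SOME h. h \<in> cls f) = i \<oplus>\<^bsub>A\<^esub> f" by (rule cls_mem[OF f])
  have "i \<in> low 2" using i(1) I_low by blast
  then have "i (u, p) = 0" using p by (rule lowD(1))
  then show ?thesis unfolding i(2) by simp
qed

lemma ev_cls: "f \<in> carrier A \<Longrightarrow> ev u (cls f) = f (u, [])"
  unfolding ev_def by (rule rep_cls) simp_all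

lemma da_cls: "f \<in> carrier A \<Longrightarrow> da \<gamma> (cls f) = f (tail Q \<gamma>, [\<gamma>])"
  unfolding da_def by (rule rep_cls) simp_all

lemma finsum_cls:
  assumes "finite J" "\<And>j. j \<in> J \<Longrightarrow> f j \<in> carrier A"
  shows "finsum Lam (\<lambda>j. cls (f j)) J = cls (\<lambda>p. \<Sum>j\<in>J. f j p) \<and> (\<lambda>p. \<Sum>j\<in>J. f j p) \<in> carrier A"
  using assms
proof (induction J rule: finite_induct)
  case empty
  interpret R: ring Lam by (rule ring_Lam)
  show ?case using cls_zero IA.zero_closed by simp
next
  case (insert j J)
  interpret R: ring Lam by (rule ring_Lam)
  have fj: "f j \<in> carrier A" and fJ: "\<And>j. j \<in> J \<Longrightarrow> f j \<in> carrier A" using insert.prems by blast+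
  have IH: "finsum Lam (\<lambda>j. cls (f j)) J = cls (\<lambda>p. \<Sum>j\<in>J. f j p)" "(\<lambda>p. \<Sum>j\<in>J. f j p) \<in> carrier A"
    using insert.IH[OF fJ] by simp_all
  have "finsum Lam (\<lambda>j. cls (f j)) (insert j J) = cls (f j) \<oplus>\<^bsub>Lam\<^esub> finsum Lam (\<lambda>j. cls (f j)) J"
    using insert.hyps fj fJ cls_closed by (intro R.finsum_insert) auto
  also have "\<dots> = cls (f j \<oplus>\<^bsub>A\<^esub> (\<lambda>p. \<Sum>j\<in>J. f j p))" unfolding IH(1) by (rule cls_add[OF fj IH(2)])
  also have s: "f j \<oplus>\<^bsub>A\<^esub> (\<lambda>p. \<Sum>j\<in>J. f j p) = (\<lambda>p. \<Sum>j\<in>insert j J. f j p)" using insert.hyps by simp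
  finally show ?case using IA.a_closed[OF fj IH(2)] unfolding s by (intro conjI)
qed

lemma cls_one_sum: "\<one>\<^bsub>Lam\<^esub> = finsum Lam (\<lambda>u. cls (ve u)) (verts Q)"
proof -
  have "(\<lambda>p. \<Sum>u\<in>verts Q. ve u p) = \<one>\<^bsub>A\<^esub>"
  proof
    fix x :: "('v, 'e) path"
    obtain t q where x: "x = (t, q)" by (cases x)
    have "(\<Sum>u\<in>verts Q. ve u x) = (\<Sum>u\<in>verts Q. if u = t then (if q = [] then 1 else 0) else 0)"
      unfolding x by (intro sum.cong) (auto simp: path_elem_def)
    then show "(\<Sum>u\<in>verts Q. ve u x) = \<one>\<^bsub>A\<^esub> x" by (simp add: x)
  qed
  then show ?thesis using finsum_cls[OF fin(1) ve_closed] cls_one by simp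
qed

lemma foldr_cls:
  assumes "set p \<subseteq> arcs Q"
  shows "foldr (\<lambda>\<gamma> b. cls (ar \<gamma>) \<otimes>\<^bsub>Lam\<^esub> b) p \<one>\<^bsub>Lam\<^esub> = cls (foldr (\<lambda>\<gamma> b. ar \<gamma> \<otimes>\<^bsub>A\<^esub> b) p \<one>\<^bsub>A\<^esub>) \<and>
    foldr (\<lambda>\<gamma> b. ar \<gamma> \<otimes>\<^bsub>A\<^esub> b) p \<one>\<^bsub>A\<^esub> \<in> carrier A"
  using assms
proof (induction p)
  case Nil
  show ?case using cls_one IA.one_closed by simp
next
  case (Cons \<gamma> p)
  have \<gamma>: "ar \<gamma> \<in> carrier A" using Cons.prems by (intro ar_closed) simp
  have IH: "foldr (\<lambda>\<gamma> b. cls (ar \<gamma>) \<otimes>\<^bsub>Lam\<^esub> b) p \<one>\<^bsub>Lam\<^esub> = cls (foldr (\<lambda>\<gamma> b. ar \<gamma> \<otimes>\<^bsub>A\<^esub> b) p \<one>\<^bsub>A\<^esub>)"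
    "foldr (\<lambda>\<gamma> b. ar \<gamma> \<otimes>\<^bsub>A\<^esub> b) p \<one>\<^bsub>A\<^esub> \<in> carrier A" using Cons by simp_all
  show ?case
    unfolding foldr.simps comp_def IH(1) cls_mult[OF \<gamma> IH(2)] using IA.m_closed[OF \<gamma> IH(2)]
    by (intro conjI refl)
qed

text \<open>The powers of the arrow ideal grow by factors on the right, while \<open>foldr\<close>
  adds factors on the left; hence the reverse induction, in which \<open>s\<close> pulls out the
  last factor.\<close>

lemma foldr_power:
  assumes "set p \<subseteq> arcs Q"
  shows "foldr (\<lambda>\<gamma> b. ar \<gamma> \<otimes>\<^bsub>A\<^esub> b) p \<one>\<^bsub>A\<^esub> \<in> arrow_ideal_power Q (length p)"
  using assms
proof (induction p rule: rev_induct)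
  case Nil
  show ?case using IA.one_closed by simp
next
  case (snoc \<gamma> p)
  have \<gamma>: "\<gamma> \<in> arcs Q" and p: "set p \<subseteq> arcs Q" using snoc.prems by simp_all
  have s: "foldr (\<lambda>\<gamma> b. ar \<gamma> \<otimes>\<^bsub>A\<^esub> b) q x = foldr (\<lambda>\<gamma> b. ar \<gamma> \<otimes>\<^bsub>A\<^esub> b) q \<one>\<^bsub>A\<^esub> \<otimes>\<^bsub>A\<^esub> x"
    if "set q \<subseteq> arcs Q" "x \<in> carrier A" for q x
    using that
  proof (induction q)
    case Nil
    show ?case using IA.l_one[OF Nil(2)] by simp
  next
    case (Cons \<delta> q)
    have \<delta>: "ar \<delta> \<in> carrier A" and q: "set q \<subseteq> arcs Q" using Cons.prems by (simp_all add: ar_closed del: path_algebra_simps)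
    have "foldr (\<lambda>\<gamma> b. ar \<gamma> \<otimes>\<^bsub>A\<^esub> b) q \<one>\<^bsub>A\<^esub> \<in> carrier A" using foldr_cls[OF q] by (rule conjunct2)
    then show ?case
      unfolding foldr.simps comp_def Cons.IH[OF q Cons.prems(2)] by (rule IA.m_assoc[OF \<delta> _ Cons.prems(2), symmetric])
  qed
  have "ar \<gamma> \<in> arrow_ideal Q"
    unfolding arrow_ideal_def using IA.genideal_self[OF ar_image_closed] \<gamma> by blast
  then have "foldr (\<lambda>\<gamma> b. ar \<gamma> \<otimes>\<^bsub>A\<^esub> b) p \<one>\<^bsub>A\<^esub> \<otimes>\<^bsub>A\<^esub> ar \<gamma> \<in> arrow_ideal_power Q (Suc (length p))"
    unfolding arrow_ideal_power.simps by (intro ideal_prod.prod snoc.IH p)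
  then show ?case
    using s[OF p ar_closed[OF \<gamma>]] IA.r_one[OF ar_closed[OF \<gamma>]] by (simp del: path_algebra_simps)
qed

lemma path_elem_foldr:
  assumes "(u, p) \<in> paths Q"
  shows "path_elem (u, p) = ve u \<otimes>\<^bsub>A\<^esub> foldr (\<lambda>\<gamma> b. ar \<gamma> \<otimes>\<^bsub>A\<^esub> b) p \<one>\<^bsub>A\<^esub> \<and> set p \<subseteq> arcs Q \<and> u \<in> verts Q"
  using assms
proof (induction p arbitrary: u)
  case Nil
  then have "u \<in> verts Q" by (simp add: paths_simps[OF quiver])
  then show ?case
    unfolding foldr_Nil id_apply by (intro conjI IA.r_one[OF ve_closed, symmetric]) simp_all
next
  case (Cons \<gamma> p)
  have \<gamma>: "\<gamma> \<in> arcs Q" "u = tail Q \<gamma>" "(head Q \<gamma>, p) \<in> paths Q"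
    using Cons.prems unfolding paths_simps(2)[OF quiver] by blast+
  note IH = Cons.IH[OF \<gamma>(3)]
  let ?W = "foldr (\<lambda>\<gamma> b. ar \<gamma> \<otimes>\<^bsub>A\<^esub> b) p \<one>\<^bsub>A\<^esub>"
  have W: "?W \<in> carrier A" using foldr_cls[of p] IH by blast
  note a = ar_closed[OF \<gamma>(1)] and h = ve_closed[OF ends(2)[OF \<gamma>(1)]] and t = ve_closed[OF ends(1)[OF \<gamma>(1)]]
  have "path_elem (u, \<gamma> # p) = ar \<gamma> \<otimes>\<^bsub>A\<^esub> path_elem (head Q \<gamma>, p)"
    unfolding \<gamma>(2) by (rule path_elem_Cons[symmetric])
  also have "\<dots> = ar \<gamma> \<otimes>\<^bsub>A\<^esub> (ve (head Q \<gamma>) \<otimes>\<^bsub>A\<^esub> ?W)"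
    by (rule arg_cong[OF IH[THEN conjunct1], where f = "\<lambda>x. ar \<gamma> \<otimes>\<^bsub>A\<^esub> x"])
  also have "\<dots> = (ar \<gamma> \<otimes>\<^bsub>A\<^esub> ve (head Q \<gamma>)) \<otimes>\<^bsub>A\<^esub> ?W" by (rule IA.m_assoc[OF a h W, symmetric])
  also have "ar \<gamma> \<otimes>\<^bsub>A\<^esub> ve (head Q \<gamma>) = ar \<gamma>" unfolding ar_ve if_P[OF refl] ..
  also have "ar \<gamma> \<otimes>\<^bsub>A\<^esub> ?W = (ve u \<otimes>\<^bsub>A\<^esub> ar \<gamma>) \<otimes>\<^bsub>A\<^esub> ?W" unfolding ve_ar \<gamma>(2) if_P[OF refl] ..
  also have "\<dots> = ve u \<otimes>\<^bsub>A\<^esub> (ar \<gamma> \<otimes>\<^bsub>A\<^esub> ?W)" unfolding \<gamma>(2) by (rule IA.m_assoc[OF t a W])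
  finally show ?case unfolding foldr_Cons comp_apply
    using IH \<gamma>(1) ends(1)[OF \<gamma>(1)] by (intro conjI) (assumption | simp add: \<gamma>(2))+
qed

text \<open>Induction over a finite set containing the support; each step splits off the coefficient
  at one path.\<close>

lemma A_induct:
  assumes f: "f \<in> carrier A" and zero: "R \<zero>\<^bsub>A\<^esub>"
    and add: "\<And>f h. \<lbrakk>f \<in> carrier A; h \<in> carrier A; R f; R h\<rbrakk> \<Longrightarrow> R (f \<oplus>\<^bsub>A\<^esub> h)"
    and path: "\<And>c q. q \<in> paths Q \<Longrightarrow> R (\<lambda>p. c * path_elem q p)"
  shows "R f"
proof -
  have "\<lbrakk>finite S; {p. f p \<noteq> 0} \<subseteq> S; f \<in> carrier A\<rbrakk> \<Longrightarrow> R f" for S f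
  proof (induction S arbitrary: f rule: finite_induct)
    case empty
    then have "f = \<zero>\<^bsub>A\<^esub>" by (auto simp: fun_eq_iff)
    then show ?case using zero by simp
  next
    case (insert q S)
    show ?case
    proof (cases "f q = 0")
      case True
      then have "{p. f p \<noteq> 0} \<subseteq> S" using insert.prems(1) by auto
      then show ?thesis using insert.IH insert.prems(2) by blast
    next
      case False
      then have q: "q \<in> paths Q" using insert.prems(2) by auto
      let ?f = "f(q := 0)"
      have "{p. ?f p \<noteq> 0} \<subseteq> {p. f p \<noteq> 0}" by auto
      then have fc: "?f \<in> carrier A" using insert.prems(2) by (auto intro: finite_subset)
      have "{p. ?f p \<noteq> 0} \<subseteq> S" using insert.prems(1) by auto
      then have R: "R ?f" using fc by (rule insert.IH)
      have s: "f = ?f \<oplus>\<^bsub>A\<^esub> (\<lambda>p. f q * path_elem q p)" by (auto simp: fun_eq_iff path_elem_def)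
      show ?thesis
        by (subst s) (rule add[OF fc smult_closed_A[OF path_elem_closed[OF q]] R path[OF q]])
    qed
  qed
  from this[of "{p. f p \<noteq> 0}" f] f show ?thesis by simp
qed

text \<open>Identities between classes are checked on representatives, functionals on coefficients.
  The constant \<open>m\<close> is an exponent for which the power of the arrow ideal lies in
  \<open>I\<close>.\<close>

lemma bound_quiver_Lam:
  "\<exists>m. bound_quiver Lam Q (vertex_idempotent Q I) (\<lambda>\<gamma>. cls (ar \<gamma>)) ev da m"
proof -
  obtain m where m: "arrow_ideal_power Q m \<subseteq> I" using admissible unfolding admissible_ideal_def by blast
  have vi: "vertex_idempotent Q I = (\<lambda>u. cls (ve u))" by (simp add: vertex_idempotent_def cls_def fun_eq_iff)
  have "bound_quiver Lam Q (\<lambda>u. cls (ve u)) (\<lambda>\<gamma>. cls (ar \<gamma>)) ev da m"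
    unfolding bound_quiver_def bound_quiver_axioms_def
  proof (intro conjI allI impI k_algebra_Lam quiver)
    fix u v assume u: "u \<in> verts Q" and v: "v \<in> verts Q"
    show "cls (ve u) \<otimes>\<^bsub>Lam\<^esub> cls (ve v) = (if u = v then cls (ve u) else \<zero>\<^bsub>Lam\<^esub>)"
      unfolding cls_mult[OF ve_closed[OF u] ve_closed[OF v]] ve_ve cls_zero by simp
    show "ev u (cls (ve v)) = (if u = v then 1 else 0)"
      unfolding ev_cls[OF ve_closed[OF v]] by (simp add: path_elem_def)
  next
    show "\<one>\<^bsub>Lam\<^esub> = finsum Lam (\<lambda>u. cls (ve u)) (verts Q)" by (rule cls_one_sum)
  next
    fix u \<gamma> assume u: "u \<in> verts Q" and \<gamma>: "\<gamma> \<in> arcs Q"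
    show "cls (ve u) \<otimes>\<^bsub>Lam\<^esub> cls (ar \<gamma>) = (if u = tail Q \<gamma> then cls (ar \<gamma>) else \<zero>\<^bsub>Lam\<^esub>)"
      unfolding cls_mult[OF ve_closed[OF u] ar_closed[OF \<gamma>]] ve_ar cls_zero by simp
    show "cls (ar \<gamma>) \<otimes>\<^bsub>Lam\<^esub> cls (ve u) = (if u = head Q \<gamma> then cls (ar \<gamma>) else \<zero>\<^bsub>Lam\<^esub>)"
      unfolding cls_mult[OF ar_closed[OF \<gamma>] ve_closed[OF u]] ar_ve cls_zero by simp
    show "ev u (cls (ar \<gamma>)) = 0"
      unfolding ev_cls[OF ar_closed[OF \<gamma>]] by (simp add: path_elem_def)
  next
    fix u a b assume "a \<in> carrier Lam" "b \<in> carrier Lam"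
    then obtain f h where f: "f \<in> carrier A" "a = cls f" and h: "h \<in> carrier A" "b = cls h"
      unfolding carrier_Lam by blast
    show "ev u (a \<oplus>\<^bsub>Lam\<^esub> b) = ev u a + ev u b"
      unfolding f(2) h(2) cls_add[OF f(1) h(1)] ev_cls[OF f(1)] ev_cls[OF h(1)] ev_cls[OF IA.a_closed[OF f(1) h(1)]]
      by simp
    show "ev u (a \<otimes>\<^bsub>Lam\<^esub> b) = ev u a * ev u b"
      unfolding f(2) h(2) cls_mult[OF f(1) h(1)] ev_cls[OF f(1)] ev_cls[OF h(1)] ev_cls[OF IA.m_closed[OF f(1) h(1)]]
      by (simp add: path_algebra_mult)
  next
    fix \<gamma> a b assume "a \<in> carrier Lam" "b \<in> carrier Lam"
    then obtain f h where f: "f \<in> carrier A" "a = cls f" and h: "h \<in> carrier A" "b = cls h"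
      unfolding carrier_Lam by blast
    show "da \<gamma> (a \<oplus>\<^bsub>Lam\<^esub> b) = da \<gamma> a + da \<gamma> b"
      unfolding f(2) h(2) cls_add[OF f(1) h(1)] da_cls[OF f(1)] da_cls[OF h(1)] da_cls[OF IA.a_closed[OF f(1) h(1)]]
      by simp
    \<comment> \<open>A path of length one has two cuts, before and after its arrow; they give the
      two terms of the product rule.\<close>
    show "da \<gamma> (a \<otimes>\<^bsub>Lam\<^esub> b) = ev (tail Q \<gamma>) a * da \<gamma> b + da \<gamma> a * ev (head Q \<gamma>) b"
      unfolding f(2) h(2) cls_mult[OF f(1) h(1)] da_cls[OF f(1)] da_cls[OF h(1)] ev_cls[OF f(1)] ev_cls[OF h(1)]
        da_cls[OF IA.m_closed[OF f(1) h(1)]]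
      by (simp add: path_algebra_mult)
  next
    fix u c a assume "a \<in> carrier Lam"
    then obtain f where f: "f \<in> carrier A" "a = cls f" unfolding carrier_Lam by blast
    show "ev u (c \<odot>\<^bsub>Lam\<^esub> a) = c * ev u a"
      unfolding f(2) cls_smult[OF f(1)] ev_cls[OF f(1)] ev_cls[OF smult_closed_A[OF f(1)]] by (rule refl)
  next
    fix \<gamma> c a assume "a \<in> carrier Lam"
    then obtain f where f: "f \<in> carrier A" "a = cls f" unfolding carrier_Lam by blast
    show "da \<gamma> (c \<odot>\<^bsub>Lam\<^esub> a) = c * da \<gamma> a"
      unfolding f(2) cls_smult[OF f(1)] da_cls[OF f(1)] da_cls[OF smult_closed_A[OF f(1)]] by (rule refl)
  next
    fix \<gamma> \<delta> assume \<gamma>: "\<gamma> \<in> arcs Q" and \<delta>: "\<delta> \<in> arcs Q"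
    show "da \<gamma> (cls (ar \<delta>)) = (if \<gamma> = \<delta> then 1 else 0)"
      unfolding da_cls[OF ar_closed[OF \<delta>]] by (simp add: path_elem_def)
  next
    fix a R assume a: "a \<in> carrier Lam" and zero: "R \<zero>\<^bsub>Lam\<^esub>"
      and add: "\<forall>x y. x \<in> carrier Lam \<longrightarrow> y \<in> carrier Lam \<longrightarrow> R x \<longrightarrow> R y \<longrightarrow> R (x \<oplus>\<^bsub>Lam\<^esub> y)"
      and path: "\<forall>c u p. u \<in> verts Q \<longrightarrow> set p \<subseteq> arcs Q \<longrightarrow>
        R (c \<odot>\<^bsub>Lam\<^esub> (cls (ve u) \<otimes>\<^bsub>Lam\<^esub> foldr (\<lambda>\<gamma> b. cls (ar \<gamma>) \<otimes>\<^bsub>Lam\<^esub> b) p \<one>\<^bsub>Lam\<^esub>))"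
    obtain f where f: "f \<in> carrier A" "a = cls f" using a unfolding carrier_Lam by blast
    have "R (cls f)"
    proof (rule A_induct[OF f(1), of "\<lambda>f. R (cls f)"])
      show "R (cls \<zero>\<^bsub>A\<^esub>)" using zero unfolding cls_zero .
      show "R (cls (f \<oplus>\<^bsub>A\<^esub> h))" if "f \<in> carrier A" "h \<in> carrier A" "R (cls f)" "R (cls h)" for f h
        using add[rule_format, OF cls_closed[OF that(1)] cls_closed[OF that(2)] that(3,4)]
        unfolding cls_add[OF that(1,2)] .
      fix c q assume q: "q \<in> paths Q"
      obtain u p where up: "q = (u, p)" by (cases q)
      note pe = path_elem_foldr[OF q[unfolded up]]
      have p: "set p \<subseteq> arcs Q" and u: "u \<in> verts Q" using pe by blast+
      note fc = foldr_cls[OF p]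
      have "cls (path_elem q) = cls (ve u) \<otimes>\<^bsub>Lam\<^esub> foldr (\<lambda>\<gamma> b. cls (ar \<gamma>) \<otimes>\<^bsub>Lam\<^esub> b) p \<one>\<^bsub>Lam\<^esub>"
        unfolding up fc[THEN conjunct1] cls_mult[OF ve_closed[OF u] fc[THEN conjunct2]]
        using pe by (simp only:)
      then show "R (cls (\<lambda>p. c * path_elem q p))"
        using path[rule_format, OF u p, of c] unfolding cls_smult[OF path_elem_closed[OF q], symmetric] by (simp only:)
    qed
    then show "R a" unfolding f(2) .
  next
    fix p assume p: "set p \<subseteq> arcs Q" "length p = m"
    have "foldr (\<lambda>\<gamma> b. ar \<gamma> \<otimes>\<^bsub>A\<^esub> b) p \<one>\<^bsub>A\<^esub> \<in> I" using foldr_power[OF p(1)] m unfolding p(2) by blast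
    then have "cls \<zero>\<^bsub>A\<^esub> = cls (foldr (\<lambda>\<gamma> b. ar \<gamma> \<otimes>\<^bsub>A\<^esub> b) p \<one>\<^bsub>A\<^esub>)"
      by (rule cls_eq[OF IA.zero_closed]) (rule IA.r_zero[symmetric], rule foldr_cls[OF p(1), THEN conjunct2])
    then show "foldr (\<lambda>\<gamma> b. cls (ar \<gamma>) \<otimes>\<^bsub>Lam\<^esub> b) p \<one>\<^bsub>Lam\<^esub> = \<zero>\<^bsub>Lam\<^esub>"
      unfolding foldr_cls[OF p(1), THEN conjunct1] cls_zero by (rule sym)
  qed (rule cls_closed, erule ve_closed ar_closed)+
  then show ?thesis unfolding vi by (rule exI)
qed

end

section \<open>The equivalences for the bound quiver algebra\<close>

lemma mdim_direct_sum_singleton: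
  fixes M :: "'i \<Rightarrow> ('k::field, 'm, 'a) right_module"
  assumes M: "fd_right_module \<Lambda> (M i)"
  shows "mdim (direct_sum_module {i} M) = mdim (M i)"
proof -
  have rm: "right_module \<Lambda> (M j)" if "j \<in> {i}" for j
    using M that by (auto simp: fd_right_module_def)
  have rs: "right_module \<Lambda> (direct_sum_module {i} M)" by (rule direct_sum_right_module[OF rm])
  have "bij_betw (inc {i} M i) (carrier (M i)) (carrier (direct_sum_module {i} M))"
    unfolding bij_betw_def
  proof
    show "inj_on (inc {i} M i) (carrier (M i))"
    proof (rule inj_onI)
      fix x y assume "inc {i} M i x = inc {i} M i y"
      then have "inc {i} M i x i = inc {i} M i y i" by (rule arg_cong)
      then show "x = y" by (simp add: inc_def)
    qed
    show "inc {i} M i ` carrier (M i) = carrier (direct_sum_module {i} M)"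
    proof
      show "inc {i} M i ` carrier (M i) \<subseteq> carrier (direct_sum_module {i} M)"
        by (auto simp: inc_def direct_sum_module_def split: if_splits)
      show "carrier (direct_sum_module {i} M) \<subseteq> inc {i} M i ` carrier (M i)"
      proof
        fix x assume x: "x \<in> carrier (direct_sum_module {i} M)"
        then have "x = inc {i} M i (x i)" "x i \<in> carrier (M i)"
          by (auto simp: inc_def direct_sum_module_def fun_eq_iff PiE_def extensional_def)
        then show "x \<in> inc {i} M i ` carrier (M i)" by (rule image_eqI)
      qed
    qed
  qed
  then have "rmodule_iso \<Lambda> (M i) (direct_sum_module {i} M)"
    unfolding rmodule_iso_def by (rule bexI[OF _ inc_hom[OF rm]]) simp_all
  from mdim_iso[OF M rs this] show ?thesis by (rule sym)
qed

theorem lemma2p1: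
  fixes Q :: "('v, 'e) pre_digraph"
    and I :: "(('v, 'e) path \<Rightarrow> 'k::alg_closed_field) set"
    and \<Lambda> :: "('k, (('v, 'e) path \<Rightarrow> 'k) set) module"
  assumes quiver: "fin_digraph Q"
    and admissible: "admissible_ideal Q I"
    and Lambda: "\<Lambda> = bound_quiver_algebra Q I"
    and indecomposable: "indecomposable_algebra \<Lambda>"
    and symmetric: "symmetric_algebra \<Lambda>"
    and periodic: "\<forall>M :: ('k, (('v, 'e) path \<Rightarrow> 'k) set) fdmod.
      indecomposable_module \<Lambda> M \<and> \<not> projective_module \<Lambda> M \<longrightarrow>
        rmodule_iso \<Lambda> ((syzygy \<Lambda> ^^ 4) M) M"
  defines "a \<equiv> \<exists>S :: ('k, (('v, 'e) path \<Rightarrow> 'k) set) fdmod.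
      simple_module \<Lambda> S \<and> simple_module \<Lambda> ((syzygy \<Lambda> ^^ 2) S)"
    and "b \<equiv> \<exists>i\<in>verts Q. mdim (proj_at Q I i) = mdim (proj_plus Q I i) \<and>
      mdim (proj_at Q I i) = mdim (proj_minus Q I i)"
    and "c \<equiv> (\<exists>v \<alpha>. verts Q = {v} \<and> arcs Q = {\<alpha>} \<and> tail Q \<alpha> = v \<and> head Q \<alpha> = v) \<or>
      (\<exists>v w \<alpha> \<beta>. v \<noteq> w \<and> verts Q = {v, w} \<and> \<alpha> \<noteq> \<beta> \<and> arcs Q = {\<alpha>, \<beta>} \<and>
        tail Q \<alpha> = v \<and> head Q \<alpha> = w \<and> tail Q \<beta> = w \<and> head Q \<beta> = v)"
    and "d \<equiv> \<exists>\<alpha>\<in>arcs Q. out_arcs Q (tail Q \<alpha>) = {\<alpha>} \<and> in_arcs Q (head Q \<alpha>) = {\<alpha>}"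
  shows "(a \<longleftrightarrow> b) \<and> (b \<longleftrightarrow> c) \<and> (c \<longleftrightarrow> d) \<and> (a \<longrightarrow> finite_representation_type \<Lambda>)"
proof -
  interpret admissible_quotient Q I by (rule admissible_quotient.intro[OF quiver admissible])
  obtain m where "bound_quiver \<Lambda> Q (vertex_idempotent Q I) (\<lambda>\<gamma>. cls (ar \<gamma>)) ev da m"
    using bound_quiver_Lam unfolding Lambda[symmetric] by (elim exE) (rule that)
  then interpret L: bound_quiver \<Lambda> Q "vertex_idempotent Q I" "\<lambda>\<gamma>. cls (ar \<gamma>)" ev da m .
  obtain B where B: "\<forall>x\<in>carrier \<Lambda>. \<forall>y\<in>carrier \<Lambda>. \<forall>z\<in>carrier \<Lambda>. B (x \<oplus>\<^bsub>\<Lambda>\<^esub> y) z = B x z + B y z"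
    "\<forall>c. \<forall>x\<in>carrier \<Lambda>. \<forall>y\<in>carrier \<Lambda>. B (c \<odot>\<^bsub>\<Lambda>\<^esub> x) y = c * B x y"
    "\<forall>x\<in>carrier \<Lambda>. \<forall>y\<in>carrier \<Lambda>. \<forall>z\<in>carrier \<Lambda>. B (x \<otimes>\<^bsub>\<Lambda>\<^esub> y) z = B x (y \<otimes>\<^bsub>\<Lambda>\<^esub> z)"
    "\<forall>x\<in>carrier \<Lambda>. \<forall>y\<in>carrier \<Lambda>. B x y = B y x"
    "\<forall>x\<in>carrier \<Lambda>. (\<forall>y\<in>carrier \<Lambda>. B x y = 0) \<longrightarrow> x = \<zero>\<^bsub>\<Lambda>\<^esub>"
    using symmetric unfolding symmetric_algebra_def by (elim exE conjE) (rule that)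
  have "symmetric_bound_quiver_axioms \<Lambda> B"
  proof (rule symmetric_bound_quiver_axioms.intro, goal_cases)
    case (5 x)
    then have "\<forall>y\<in>carrier \<Lambda>. B x y = 0" by (intro ballI)
    then show ?case by (rule B(5)[THEN bspec, OF 5(1), THEN mp])
  qed (rule B(1-4)[rule_format]; assumption)+
  then interpret L: symmetric_bound_quiver \<Lambda> Q "vertex_idempotent Q I" "\<lambda>\<gamma>. cls (ar \<gamma>)" ev da m B
    by (intro symmetric_bound_quiver.intro L.bound_quiver_axioms)
  have at: "proj_at Q I i = L.Pm i" for i
    unfolding proj_at_def L.Pm_def Lambda[symmetric] ..
  have plus: "proj_plus Q I i = L.Dm i" for i
    unfolding proj_plus_def L.Dm_def at ..

  \<comment> \<open>Both alternatives of (c) in one: the loop is the case \<open>v = w\<close> and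
    \<open>\<alpha> = \<beta>\<close>, so that a single argument treats both below.\<close>
  have shape: "\<exists>v w \<alpha> \<beta>. verts Q = {v, w} \<and> arcs Q = {\<alpha>, \<beta>} \<and> tail Q \<alpha> = v \<and> head Q \<alpha> = w \<and>
      tail Q \<beta> = w \<and> head Q \<beta> = v \<and> (v = w \<longleftrightarrow> \<alpha> = \<beta>)" if hc: c
    using hc unfolding c_def by fastforce
  have ad: "a \<longleftrightarrow> d"
    unfolding a_def d_def L.simple_second_syzygy L.simple_KM_iff ..
  have dc: c if hd: d
  proof -
    obtain \<alpha> where \<alpha>: "\<alpha> \<in> arcs Q" and o: "out_arcs Q (tail Q \<alpha>) = {\<alpha>}" and i: "in_arcs Q (head Q \<alpha>) = {\<alpha>}"
      using hd unfolding d_def by (elim bexE conjE) (rule that)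
    obtain \<beta> where \<beta>: "verts Q = {tail Q \<alpha>, head Q \<alpha>}" "arcs Q = {\<alpha>, \<beta>}" "tail Q \<beta> = head Q \<alpha>" "head Q \<beta> = tail Q \<alpha>"
      by (rule L.periodic_quiver_shape[OF periodic indecomposable \<alpha> o i])
    show c
    proof (cases "tail Q \<alpha> = head Q \<alpha>")
      case True
      then have "\<beta> \<in> out_arcs Q (tail Q \<alpha>)" using \<beta> by auto
      then have "\<beta> = \<alpha>" unfolding o by simp
      then have "verts Q = {tail Q \<alpha>} \<and> arcs Q = {\<alpha>} \<and> tail Q \<alpha> = tail Q \<alpha> \<and> head Q \<alpha> = tail Q \<alpha>"
        using True \<beta>(1,2) by simp
      then show c unfolding c_def by (intro disjI1 exI)
    next
      case False
      then have "\<alpha> \<noteq> \<beta>" using \<beta>(3) by auto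
      then have "tail Q \<alpha> \<noteq> head Q \<alpha> \<and> verts Q = {tail Q \<alpha>, head Q \<alpha>} \<and> \<alpha> \<noteq> \<beta> \<and> arcs Q = {\<alpha>, \<beta>} \<and>
          tail Q \<alpha> = tail Q \<alpha> \<and> head Q \<alpha> = head Q \<alpha> \<and> tail Q \<beta> = head Q \<alpha> \<and> head Q \<beta> = tail Q \<alpha>"
        using False \<beta> by simp
      then show c unfolding c_def by (intro disjI2 exI)
    qed
  qed
  have cb: "d \<and> b \<and> finite_representation_type \<Lambda>" if hc: c
  proof -
    obtain v w \<alpha> \<beta> where vw: "verts Q = {v, w}" and ab: "arcs Q = {\<alpha>, \<beta>}"
      and ends: "tail Q \<alpha> = v" "head Q \<alpha> = w" "tail Q \<beta> = w" "head Q \<beta> = v" and eq: "v = w \<longleftrightarrow> \<alpha> = \<beta>"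
      using shape[OF hc] by (elim exE conjE) (rule that)
    have out: "out_arcs Q v = {\<alpha>}" "out_arcs Q w = {\<beta>}" and inn: "in_arcs Q w = {\<alpha>}" "in_arcs Q v = {\<beta>}"
      using ab ends eq by (auto simp: out_arcs_def in_arcs_def)
    have \<alpha>: "\<alpha> \<in> arcs Q" and v: "v \<in> verts Q" and w: "w \<in> verts Q" using vw ab by simp_all
    \<comment> \<open>Here \<alpha> is the only arrow leaving \<open>v\<close> and the only one
      entering \<open>w\<close>, so the kernel is simple and P_v has the dimension of P_v^+.\<close>
    have "simple_module \<Lambda> (L.KM v)"
      using L.KM_simple[of \<alpha>] \<alpha> out(1) inn(1) unfolding ends by simp
    then have PD: "mdim (L.Pm v) = mdim (L.Dm v)" using L.mdim_KM_simple[OF v] by simp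
    \<comment> \<open>For a quiver of this shape both P_v^+ and P_v^- have the single summand
      P_w.\<close>
    have "mdim (L.Dm v) = mdim (L.Pm w)"
      unfolding L.Dm_def out(1) using mdim_direct_sum_singleton[where M = "\<lambda>\<alpha>. L.Pm (head Q \<alpha>)" and i = \<alpha> and \<Lambda> = \<Lambda>] L.Pm_fd[OF w]
      by (simp add: ends)
    moreover have "mdim (proj_minus Q I v) = mdim (L.Pm w)"
      unfolding proj_minus_def inn(2) at
      using mdim_direct_sum_singleton[where M = "\<lambda>\<alpha>. L.Pm (tail Q \<alpha>)" and i = \<beta> and \<Lambda> = \<Lambda>] L.Pm_fd[OF w]
      by (simp add: ends)
    ultimately have b unfolding b_def at plus using PD by (intro bexI[OF _ v]) simp
    moreover have d unfolding d_def by (rule bexI[OF _ \<alpha>]) (simp add: ends out inn)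
    moreover have "finite_representation_type \<Lambda>"
    proof (rule nakayama_quiver.nakayama_finite_type)
      show "nakayama_quiver \<Lambda> Q (vertex_idempotent Q I) (\<lambda>\<gamma>. cls (ar \<gamma>)) ev da m
        (\<lambda>u. if u = v then \<alpha> else \<beta>) (\<lambda>u. if u = v then \<beta> else \<alpha>)"
        by (rule nakayama_quiver.intro[OF L.bound_quiver_axioms], rule nakayama_quiver_axioms.intro)
          (use vw out inn eq in auto)
    qed
    ultimately show ?thesis by (intro conjI)
  qed
  have ba: a if hb: b
  proof -
    obtain i where i: "i \<in> verts Q" "mdim (L.Pm i) = mdim (L.Dm i)"
      using hb unfolding b_def at plus by (elim bexE conjE) (rule that)
    have "simple_module \<Lambda> (L.KM i)" using L.mdim_KM_simple[OF i(1)] i(2) by simp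
    then show a unfolding a_def L.simple_second_syzygy by (rule bexI[OF _ i(1)])
  qed
  \<comment> \<open>The facts at hand are the equivalence of (a) and (d), the step from (d) to (c),
    the step from (c) to (d), (b) and finite type, and the step from (b) to (a).\<close>
  show ?thesis using ad dc cb ba by argo
qed

end
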